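(* Tightness of $\sigma$-confoliations is an invariant of $\sigma$-deformation: if $M$ is a closed oriented 3-manifold and $\xi_t$, $t\in[a,b]$, is a $\sigma$-deformation on $M$, then $\xi_a$ is tight if and only if $\xi_b$ is tight.
   Context: A positive contact structure (positive confoliation) on an oriented 3-manifold is a smooth plane field $\xi$ locally of the form $\ker\alpha$ with $\alpha\wedge d\alpha>0$ ($\alpha\wedge d\alpha\ge 0$); it is contact at a point if $\alpha\wedge d\alpha>0$ there. All contact structures and confoliations are positive. A $\sigma$-confoliation on $M$ is a confoliation $\xi$ for which there is a smooth compact surface $F\subset M$ (possibly empty), called the maximal integral surface of $\xi$, such that (1) $F$ is everywhere tangent to $\xi$; (2) $\xi$ is contact on $M-F$; (3) each connected component of $F$ has nonempty boundary. A $\sigma$-deformation is a smooth 1-parameter family $\xi_t$, $t\in[a,b]$, of plane fields on $M$ such that each $\xi_t$ is a $\sigma$-confoliation, with maximal integral surface $F_t$, and there exist a 1-parameter family $h_t$, $t\in[a,b]$, of diffeomorphisms of $M$, a partition of $[a,b]$ into finitely many nontrivial disjoint consecutive subintervals $I_1,\dots,I_k$, and compact smooth surfaces $\Sigma_1,\dots,\Sigma_k$ in $M$ such that: (1) $h_t(F_t)=\Sigma_j$ for each $t\in\mathrm{int}(I_j)$; (2) for $1\le j\le k-1$ the surfaces $\Sigma_j,\Sigma_{j+1}$ are distinct and one is contained in the other; (3) the closure of the difference (larger minus smaller) of $\Sigma_j,\Sigma_{j+1}$ is a compact surface with piecewise smooth boundary; (4) each component of the larger of $\Sigma_j,\Sigma_{j+1}$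 is obtained from the smaller by attaching 1-handles and adding 0-handles. A $\sigma$-confoliation $\xi$ with maximal integral surface $F$ is tight if there is no 2-dimensional disc $D$ smoothly embedded in $M$ such that $\partial D$ is tangent to $\xi$ and disjoint from $F$, and $D$ is transverse to $\xi$ at $\partial D$. *)

theory Defs
  imports "HOL-Analysis.Analysis"
begin

section \<open>Smooth maps between subsets of Euclidean spaces\<close>

primrec Ck_on :: "nat \<Rightarrow> 'e::euclidean_space set \<Rightarrow> ('e \<Rightarrow> 'f::euclidean_space) \<Rightarrow> bool" where
  "Ck_on 0 T f \<longleftrightarrow> continuous_on T f"
| "Ck_on (Suc k) T f \<longleftrightarrow>
     (\<forall>x\<in>T. f differentiable (at x)) \<and>
     (\<forall>v. Ck_on k T (\<lambda>x. frechet_derivative f (at x) v))"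

text \<open>\<open>Ck_on\<close> is meant for open sets only. On an arbitrary set, such as a closed interval or a closed
  disc, a map is smooth if near each point of the set it has a smooth extension to an open set.\<close>

definition smooth_on :: "'e::euclidean_space set \<Rightarrow> ('e \<Rightarrow> 'f::euclidean_space) \<Rightarrow> bool" where
  "smooth_on S f \<longleftrightarrow>
     (\<forall>x\<in>S. \<exists>T g. open T \<and> x \<in> T \<and> (\<forall>k. Ck_on k T g) \<and> (\<forall>y\<in>S \<inter> T. g y = f y))"

section \<open>Oriented 3-manifolds\<close>

text \<open>A chart is a domain together with a coordinate map. Only the values of the map on the domain
  matter.\<close>

type_synonym 'a chart = "'a set \<times> ('a \<Rightarrow> real^3)"

abbreviation cdom :: "'a chart \<Rightarrow> 'a set" where "cdom \<equiv> fst"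
abbreviation cmap :: "'a chart \<Rightarrow> 'a \<Rightarrow> real^3" where "cmap \<equiv> snd"
abbreviation cinv :: "'a chart \<Rightarrow> real^3 \<Rightarrow> 'a" where "cinv c \<equiv> inv_into (cdom c) (cmap c)"
abbreviation cimage :: "'a chart \<Rightarrow> (real^3) set" where "cimage c \<equiv> cmap c ` cdom c"

definition is_chart :: "'a topology \<Rightarrow> 'a chart \<Rightarrow> bool" where
  "is_chart X c \<longleftrightarrow> openin X (cdom c) \<and> open (cimage c) \<and>
     homeomorphic_map (subtopology X (cdom c)) (top_of_set (cimage c)) (cmap c)"

abbreviation transition :: "'a chart \<Rightarrow> 'a chart \<Rightarrow> real^3 \<Rightarrow> real^3" where
  "transition c d \<equiv> cmap d \<circ> cinv c"

definition oriented_compatible :: "'a chart \<Rightarrow> 'a chart \<Rightarrow> bool" where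
  "oriented_compatible c d \<longleftrightarrow>
     smooth_on (cmap c ` (cdom c \<inter> cdom d)) (transition c d) \<and>
     smooth_on (cmap d ` (cdom c \<inter> cdom d)) (transition d c) \<and>
     (\<forall>p\<in>cdom c \<inter> cdom d.
        det (matrix (frechet_derivative (transition c d) (at (cmap c p)))) > 0)"

record 'a manifold3 =
  mtop :: "'a topology"
  atlas :: "'a chart set"

abbreviation points :: "'a manifold3 \<Rightarrow> 'a set" where "points M \<equiv> topspace (mtop M)"

text \<open>The atlas is the maximal oriented one, so it contains every positively oriented smooth
  chart.\<close>

definition oriented_3manifold :: "'a manifold3 \<Rightarrow> bool" where
  "oriented_3manifold M \<longleftrightarrow>
     Hausdorff_space (mtop M) \<and> second_countable (mtop M) \<and>
     (\<forall>c\<in>atlas M. is_chart (mtop M) c) \<and>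
     (\<Union>c\<in>atlas M. cdom c) = points M \<and>
     (\<forall>c\<in>atlas M. \<forall>d\<in>atlas M. oriented_compatible c d) \<and>
     (\<forall>c. is_chart (mtop M) c \<and> (\<forall>d\<in>atlas M. oriented_compatible c d) \<longrightarrow> c \<in> atlas M)"

definition closed_oriented_3manifold :: "'a manifold3 \<Rightarrow> bool" where
  "closed_oriented_3manifold M \<longleftrightarrow> oriented_3manifold M \<and> compact_space (mtop M)"

definition charts_at :: "'a manifold3 \<Rightarrow> 'a \<Rightarrow> 'a chart set" where
  "charts_at M p = {c\<in>atlas M. p \<in> cdom c}"

section \<open>Tangent vectors and smooth maps\<close>

text \<open>A tangent vector at \<open>p\<close> is the family of its coordinate vectors in all charts at \<open>p\<close>, related by
  the derivatives of the transition maps (and set to zero in all other charts).\<close>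

type_synonym 'a tvec = "'a chart \<Rightarrow> real^3"

definition tangent_space :: "'a manifold3 \<Rightarrow> 'a \<Rightarrow> 'a tvec set" where
  "tangent_space M p =
     {v. (\<forall>c\<in>charts_at M p. \<forall>d\<in>charts_at M p.
            v d = frechet_derivative (transition c d) (at (cmap c p)) (v c)) \<and>
         (\<forall>c. c \<notin> charts_at M p \<longrightarrow> v c = 0)}"

definition smooth_into ::
  "'a manifold3 \<Rightarrow> 'e::euclidean_space set \<Rightarrow> ('e \<Rightarrow> 'a) \<Rightarrow> bool" where
  "smooth_into M S f \<longleftrightarrow> f ` S \<subseteq> points M \<and>
     (\<forall>x\<in>S. \<exists>d\<in>charts_at M (f x). \<exists>T. open T \<and> x \<in> T \<and> f ` (S \<inter> T) \<subseteq> cdom d \<and>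
        smooth_on (S \<inter> T) (cmap d \<circ> f))"

text \<open>The differential at \<open>x\<close> of a smooth map \<open>f\<close> from \<open>S\<close> into \<open>M\<close>; it is used only for \<open>S\<close> convex with
  nonempty interior, where the derivative within \<open>S\<close> is unique, also at boundary points.\<close>

definition differential_within ::
  "'a manifold3 \<Rightarrow> 'e::euclidean_space set \<Rightarrow> ('e \<Rightarrow> 'a) \<Rightarrow> 'e \<Rightarrow> 'e \<Rightarrow> 'a tvec" where
  "differential_within M S f x u =
     (\<lambda>d. if d \<in> charts_at M (f x) then frechet_derivative (cmap d \<circ> f) (at x within S) u else 0)"

definition smooth_self_map :: "'a manifold3 \<Rightarrow> ('a \<Rightarrow> 'a) \<Rightarrow> bool" where
  "smooth_self_map M h \<longleftrightarrow> (\<forall>c\<in>atlas M. smooth_into M (cimage c) (h \<circ> cinv c))"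

definition diffeomorphism :: "'a manifold3 \<Rightarrow> ('a \<Rightarrow> 'a) \<Rightarrow> bool" where
  "diffeomorphism M h \<longleftrightarrow> bij_betw h (points M) (points M) \<and>
     smooth_self_map M h \<and> smooth_self_map M (inv_into (points M) h)"

definition diffeomorphism_family ::
  "'a manifold3 \<Rightarrow> real \<Rightarrow> real \<Rightarrow> (real \<Rightarrow> 'a \<Rightarrow> 'a) \<Rightarrow> bool" where
  "diffeomorphism_family M a b h \<longleftrightarrow> (\<forall>t\<in>{a..b}. diffeomorphism M (h t)) \<and>
     (\<forall>c\<in>atlas M. smooth_into M ({a..b} \<times> cimage c) (\<lambda>(t, x). h t (cinv c x)))"

section \<open>Differential forms, plane fields and confoliations\<close>

text \<open>A 1-form in coordinates is a map \<open>\<alpha> x v\<close>, linear in the vector \<open>v\<close>. The exterior derivative and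
  the wedge product are normalised without factorials.\<close>

type_synonym form1 = "real^3 \<Rightarrow> real^3 \<Rightarrow> real"

definition ext_deriv :: "form1 \<Rightarrow> real^3 \<Rightarrow> real^3 \<Rightarrow> real^3 \<Rightarrow> real" where
  "ext_deriv \<alpha> x u v =
     frechet_derivative (\<lambda>y. \<alpha> y v) (at x) u - frechet_derivative (\<lambda>y. \<alpha> y u) (at x) v"

definition wedge12 ::
  "(real^3 \<Rightarrow> real) \<Rightarrow> (real^3 \<Rightarrow> real^3 \<Rightarrow> real) \<Rightarrow> real^3 \<Rightarrow> real^3 \<Rightarrow> real^3 \<Rightarrow> real" where
  "wedge12 \<theta> \<omega> u v w = \<theta> u * \<omega> v w - \<theta> v * \<omega> u w + \<theta> w * \<omega> u v"

text \<open>The coefficient of \<open>\<alpha> \<and> d\<alpha>\<close> with respect to \<open>dx\<^sub>1 \<and> dx\<^sub>2 \<and> dx\<^sub>3\<close>. As all charts are positively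
  oriented, its sign is that of \<open>\<alpha> \<and> d\<alpha>\<close> for the orientation of the manifold.\<close>

definition contact_coeff :: "form1 \<Rightarrow> real^3 \<Rightarrow> real" where
  "contact_coeff \<alpha> x = wedge12 (\<alpha> x) (ext_deriv \<alpha> x) (axis 1 1) (axis 2 1) (axis 3 1)"

text \<open>A field of subsets of the tangent spaces; that each of them is a plane is expressed by its
  being the kernel of a nonzero linear functional.\<close>

type_synonym 'a plane_field = "'a \<Rightarrow> 'a tvec set"

definition kernel_at :: "'a manifold3 \<Rightarrow> 'a chart \<Rightarrow> form1 \<Rightarrow> 'a \<Rightarrow> 'a tvec set" where
  "kernel_at M c \<alpha> q = {v\<in>tangent_space M q. \<alpha> (cmap c q) (v c) = 0}"

definition local_form ::
  "'a manifold3 \<Rightarrow> 'a plane_field \<Rightarrow> 'a chart \<Rightarrow> 'a set \<Rightarrow> form1 \<Rightarrow> bool" where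
  "local_form M \<xi> c W \<alpha> \<longleftrightarrow> c \<in> atlas M \<and> openin (mtop M) W \<and> W \<subseteq> cdom c \<and>
     (\<forall>v. smooth_on (cmap c ` W) (\<lambda>x. \<alpha> x v)) \<and>
     (\<forall>q\<in>W. linear (\<alpha> (cmap c q)) \<and> (\<exists>v. \<alpha> (cmap c q) v \<noteq> 0) \<and> \<xi> q = kernel_at M c \<alpha> q)"

definition smooth_plane_field :: "'a manifold3 \<Rightarrow> 'a plane_field \<Rightarrow> bool" where
  "smooth_plane_field M \<xi> \<longleftrightarrow> (\<forall>p\<in>points M. \<exists>c W \<alpha>. p \<in> W \<and> local_form M \<xi> c W \<alpha>)"

definition confoliation :: "'a manifold3 \<Rightarrow> 'a plane_field \<Rightarrow> bool" where
  "confoliation M \<xi> \<longleftrightarrow> smooth_plane_field M \<xi> \<and>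
     (\<forall>p\<in>points M. \<exists>c W \<alpha>. p \<in> W \<and> local_form M \<xi> c W \<alpha> \<and>
        (\<forall>q\<in>W. contact_coeff \<alpha> (cmap c q) \<ge> 0))"

definition contact_at :: "'a manifold3 \<Rightarrow> 'a plane_field \<Rightarrow> 'a \<Rightarrow> bool" where
  "contact_at M \<xi> p \<longleftrightarrow>
     (\<exists>c W \<alpha>. p \<in> W \<and> local_form M \<xi> c W \<alpha> \<and> contact_coeff \<alpha> (cmap c p) > 0)"

text \<open>A family is smooth if it has local defining forms depending smoothly on parameter and point
  together.\<close>

definition smooth_plane_field_family ::
  "'a manifold3 \<Rightarrow> real \<Rightarrow> real \<Rightarrow> (real \<Rightarrow> 'a plane_field) \<Rightarrow> bool" where
  "smooth_plane_field_family M a b \<xi> \<longleftrightarrow>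
     (\<forall>s\<in>{a..b}. \<forall>p\<in>points M. \<exists>c W \<alpha> \<delta>. p \<in> W \<and> \<delta> > 0 \<and>
        (\<forall>t\<in>{a..b} \<inter> ball s \<delta>. local_form M (\<xi> t) c W (\<alpha> t)) \<and>
        (\<forall>v. smooth_on (({a..b} \<inter> ball s \<delta>) \<times> cmap c ` W) (\<lambda>(t, x). \<alpha> t x v)))"

section \<open>Surfaces\<close>

text \<open>Boundary of a topological surface, viewed as a subspace.\<close>

definition surface_boundary :: "'a topology \<Rightarrow> 'a set \<Rightarrow> 'a set" where
  "surface_boundary X S = S - {p. \<exists>V. p \<in> V \<and> openin (subtopology X S) V \<and>
     subtopology X V homeomorphic_space (euclidean :: (real^2) topology)}"

definition topological_surface :: "'a topology \<Rightarrow> 'a set \<Rightarrow> bool" where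
  "topological_surface X S \<longleftrightarrow> S \<subseteq> topspace X \<and>
     (\<forall>p\<in>S. \<exists>V. p \<in> V \<and> openin (subtopology X S) V \<and>
        (subtopology X V homeomorphic_space (euclidean :: (real^2) topology) \<or>
         subtopology X V homeomorphic_space top_of_set {x :: real^2. x $ 1 \<ge> 0}))"

text \<open>Charts in which the surface is a piece of a coordinate plane or half-plane. Since a
  flattening chart can be made positively oriented by changing the sign of its second coordinate,
  it is no restriction to take it from the oriented atlas.\<close>

definition flattens :: "'a chart \<Rightarrow> 'a set \<Rightarrow> bool" where
  "flattens c F \<longleftrightarrow>
     cmap c ` (F \<inter> cdom c) = cimage c \<inter> {x. x $ 3 = 0} \<or>
     cmap c ` (F \<inter> cdom c) = cimage c \<inter> {x. x $ 3 = 0 \<and> x $ 1 \<ge> 0}"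

definition compact_smooth_surface :: "'a manifold3 \<Rightarrow> 'a set \<Rightarrow> bool" where
  "compact_smooth_surface M F \<longleftrightarrow> compactin (mtop M) F \<and>
     (\<forall>p\<in>F. \<exists>c\<in>charts_at M p. flattens c F)"

definition surface_tangent_plane :: "'a manifold3 \<Rightarrow> 'a set \<Rightarrow> 'a \<Rightarrow> 'a tvec set" where
  "surface_tangent_plane M F p =
     {v\<in>tangent_space M p. \<exists>c\<in>charts_at M p. flattens c F \<and> v c $ 3 = 0}"

definition smooth_arc :: "'a manifold3 \<Rightarrow> (real \<Rightarrow> 'a) \<Rightarrow> bool" where
  "smooth_arc M \<gamma> \<longleftrightarrow> smooth_into M {0..1} \<gamma> \<and> inj_on \<gamma> {0..1} \<and>
     (\<forall>s\<in>{0..1}. inj (differential_within M {0..1} \<gamma> s))"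

text \<open>A compact topological surface lying locally in smooth surfaces, whose boundary is made of
  finitely many smooth arcs. Corners of any angle are allowed, including cusps: these do occur in
  the difference of two nested smooth surfaces whose boundary curves coincide along an arc and then
  separate.\<close>

definition compact_surface_pw_smooth_boundary :: "'a manifold3 \<Rightarrow> 'a set \<Rightarrow> bool" where
  "compact_surface_pw_smooth_boundary M S \<longleftrightarrow>
     compactin (mtop M) S \<and> topological_surface (mtop M) S \<and>
     (\<forall>p\<in>S. \<exists>c\<in>charts_at M p. \<forall>q\<in>S \<inter> cdom c. cmap c q $ 3 = 0) \<and>
     (\<exists>\<Gamma>. finite \<Gamma> \<and> (\<forall>\<gamma>\<in>\<Gamma>. smooth_arc M \<gamma>) \<and>
        surface_boundary (mtop M) S = (\<Union>\<gamma>\<in>\<Gamma>. \<gamma> ` {0..1}))"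

section \<open>Handles\<close>

definition adds_0_handle :: "'a topology \<Rightarrow> 'a set \<Rightarrow> 'a set \<Rightarrow> bool" where
  "adds_0_handle X S S' \<longleftrightarrow>
     (\<exists>D. D \<subseteq> topspace X \<and> subtopology X D homeomorphic_space top_of_set (cball (0 :: real^2) 1) \<and>
        S \<inter> D = {} \<and> S' = S \<union> D)"

text \<open>A 1-handle is an embedded square meeting the surface exactly in two opposite sides, which lie
  in the boundary. It is only required to be topologically embedded: a handle fitting between two
  smooth nested surfaces cannot be a smooth square at the ends of the attaching arcs.\<close>

definition attaches_1_handle :: "'a topology \<Rightarrow> 'a set \<Rightarrow> 'a set \<Rightarrow> bool" where
  "attaches_1_handle X S S' \<longleftrightarrow>
     (\<exists>e :: real \<times> real \<Rightarrow> 'a. embedding_map (top_of_set ({0..1} \<times> {0..1})) X e \<and>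
        (\<forall>x\<in>{0..1}. \<forall>y\<in>{0..1}. e (x, y) \<in> S \<longleftrightarrow> x = 0 \<or> x = 1) \<and>
        e ` ({0, 1} \<times> {0..1}) \<subseteq> surface_boundary X S \<and>
        S' = S \<union> e ` ({0..1} \<times> {0..1}))"

definition isotopic_within :: "'a topology \<Rightarrow> 'a set \<Rightarrow> 'a set \<Rightarrow> 'a set \<Rightarrow> bool" where
  "isotopic_within X L S S' \<longleftrightarrow>
     (\<exists>g :: real \<Rightarrow> 'a \<Rightarrow> 'a.
        continuous_map (prod_topology (top_of_set {0..1}) (subtopology X S)) (subtopology X L)
          (\<lambda>(s, p). g s p) \<and>
        (\<forall>s\<in>{0..1}. embedding_map (subtopology X S) (subtopology X L) (g s)) \<and>
        (\<forall>p\<in>S. g 0 p = p) \<and> g 1 ` S = S')"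

text \<open>As usual, attaching handles is understood up to isotopy: the smaller surface may first be
  moved inside the larger one. This covers the case of a smaller surface contained in the interior
  of the larger one, where a collar separates the handles from it.\<close>

definition obtained_by_01_handles :: "'a topology \<Rightarrow> 'a set \<Rightarrow> 'a set \<Rightarrow> bool" where
  "obtained_by_01_handles X S L \<longleftrightarrow>
     (\<exists>S'. isotopic_within X L S S' \<and>
        (\<lambda>A B. adds_0_handle X A B \<or> attaches_1_handle X A B)\<^sup>*\<^sup>* S' L)"

definition elementary_enlargement :: "'a manifold3 \<Rightarrow> 'a set \<Rightarrow> 'a set \<Rightarrow> bool" where
  "elementary_enlargement M S L \<longleftrightarrow> S \<subset> L \<and>
     compact_surface_pw_smooth_boundary M (mtop M closure_of (L - S)) \<and>
     (\<forall>C\<in>connected_components_of (subtopology (mtop M) L).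
        obtained_by_01_handles (mtop M) (S \<inter> C) C)"

section \<open>Sigma-confoliations, sigma-deformations and tightness\<close>

definition maximal_integral_surface :: "'a manifold3 \<Rightarrow> 'a plane_field \<Rightarrow> 'a set \<Rightarrow> bool" where
  "maximal_integral_surface M \<xi> F \<longleftrightarrow> compact_smooth_surface M F \<and>
     (\<forall>p\<in>F. surface_tangent_plane M F p = \<xi> p) \<and>
     (\<forall>p\<in>points M - F. contact_at M \<xi> p) \<and>
     (\<forall>C\<in>connected_components_of (subtopology (mtop M) F).
        surface_boundary (mtop M) C \<noteq> {})"

definition sigma_confoliation :: "'a manifold3 \<Rightarrow> 'a plane_field \<Rightarrow> bool" where
  "sigma_confoliation M \<xi> \<longleftrightarrow> confoliation M \<xi> \<and> (\<exists>F. maximal_integral_surface M \<xi> F)"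

text \<open>The intervals \<open>I 1, \<dots>, I k\<close> may be open, closed or half-open. They are disjoint since they are
  consecutive.\<close>

definition interval_partition :: "real \<Rightarrow> real \<Rightarrow> nat \<Rightarrow> (nat \<Rightarrow> real set) \<Rightarrow> bool" where
  "interval_partition a b k I \<longleftrightarrow>
     (\<forall>j\<in>{1..k}. is_interval (I j) \<and> interior (I j) \<noteq> {}) \<and>
     (\<Union>j\<in>{1..k}. I j) = {a..b} \<and>
     (\<forall>i\<in>{1..k}. \<forall>j\<in>{1..k}. i < j \<longrightarrow> (\<forall>s\<in>I i. \<forall>t\<in>I j. s < t))"

definition sigma_deformation ::
  "'a manifold3 \<Rightarrow> real \<Rightarrow> real \<Rightarrow> (real \<Rightarrow> 'a plane_field) \<Rightarrow> bool" where
  "sigma_deformation M a b \<xi> \<longleftrightarrow>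
     smooth_plane_field_family M a b \<xi> \<and>
     (\<forall>t\<in>{a..b}. sigma_confoliation M (\<xi> t)) \<and>
     (\<exists>F. (\<forall>t\<in>{a..b}. maximal_integral_surface M (\<xi> t) (F t)) \<and>
       (\<exists>h k I \<Sigma>. diffeomorphism_family M a b h \<and> interval_partition a b k I \<and>
          (\<forall>j\<in>{1..k}. compact_smooth_surface M (\<Sigma> j)) \<and>
          (\<forall>j\<in>{1..k}. \<forall>t\<in>interior (I j). h t ` F t = \<Sigma> j) \<and>
          (\<forall>j\<in>{1..<k}. elementary_enlargement M (\<Sigma> j) (\<Sigma> (Suc j)) \<or>
                        elementary_enlargement M (\<Sigma> (Suc j)) (\<Sigma> j))))"

text \<open>An embedded disc tangent to \<open>\<xi>\<close> along its boundary curve, transverse to \<open>\<xi>\<close> at its boundary and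
  with boundary disjoint from \<open>F\<close>. The tangent line of the unit circle at \<open>x\<close> is the orthogonal
  complement of \<open>x\<close>.\<close>

definition overtwisted_disc ::
  "'a manifold3 \<Rightarrow> 'a plane_field \<Rightarrow> 'a set \<Rightarrow> (real^2 \<Rightarrow> 'a) \<Rightarrow> bool" where
  "overtwisted_disc M \<xi> F f \<longleftrightarrow>
     smooth_into M (cball 0 1) f \<and> inj_on f (cball 0 1) \<and>
     (\<forall>x\<in>cball 0 1. inj (differential_within M (cball 0 1) f x)) \<and>
     (\<forall>x\<in>sphere 0 1.
        f x \<notin> F \<and>
        (\<forall>u. u \<bullet> x = 0 \<longrightarrow> differential_within M (cball 0 1) f x u \<in> \<xi> (f x)) \<and>
        (\<forall>w\<in>tangent_space M (f x). \<exists>u. \<exists>v\<in>\<xi> (f x).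
           w = (\<lambda>c. differential_within M (cball 0 1) f x u c + v c)))"

text \<open>The maximal integral surface is unique, being the set of points where \<open>\<xi>\<close> is not contact, so
  the quantifier over \<open>F\<close> only names it.\<close>

definition tight :: "'a manifold3 \<Rightarrow> 'a plane_field \<Rightarrow> bool" where
  "tight M \<xi> \<longleftrightarrow> sigma_confoliation M \<xi> \<and>
     (\<forall>F. maximal_integral_surface M \<xi> F \<longrightarrow> (\<nexists>f. overtwisted_disc M \<xi> F f))"

end

(* A confoliation is overtwisted if it is not tight. Overtwistedness turns out to be locally constant
 in the deformation parameter, so the connectedness of [a, b] gives the theorem.

 Near any point there are charts in which a plane field is ker (dz + H dy); it is a confoliation iff
 the x-derivative of H is nonnegative and contact where that derivative is positive. Two such functions
 that agree outside a compact set of the box are intertwined by a map moving points along the x-lines;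
 it carries an overtwisted disc for one plane field to an overtwisted disc for the other, once the
 boundary of the disc has been moved, by a contact isotopy and Sard's theorem, off the points whose
 image is degenerate for the second plane field. Thus a confoliation may be changed inside one chart.

 Every component of the maximal integral surface has nonempty boundary. From a boundary point one
 pushes contactness into the surface along thin "noses", chart by chart, in all plane fields of the
 family close to the given one at once; this turns a whole neighbourhood of the parameter into a family
 of contact structures without affecting overtwistedness. A family of contact structures is locally
 constant up to finitely many changes in single charts, so there overtwistedness does not vary. *)

theory Submission
 imports Defs
begin

text \<open>Discs see the planes along their boundary curve only, so two plane fields have to be
  matched along that curve alone; maps along x-lines achieve this. The difficulty is asymmetric. In
  a more contact field a degenerate target would be degenerate for the old field too, with the same
  value of H, which strict monotonicity on the line excludes. In the other direction the targets
  must avoid the degenerate points. These lie on a surface tangent to the planes; in the coordinates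
  (H, y, z), where the form is dz + x dy, their image comes from maps of rank at most one, and a
  small contact translation frees a curve from it. A compactly supported change of H cannot increase
  along a whole x-line. Its decrease must fall where the planes are already contact: that is the
  exit of a nose, and why noses start from points already reached, ultimately next to the boundary
  of the surface. A change in one chart alters only h in dz + h dy + k dx, so a contact family is
  made constant by freezing its two coefficients in turn, which takes the place of Gray stability.
  At the ends of [a, b] a substitution by squares makes the parameter two-sided.\<close>

abbreviation fd :: "('v::real_normed_vector => 'w::real_normed_vector) => 'v => 'v => 'w" where
 "fd f x == frechet_derivative f (at x)"

section \<open>Calculus of smooth maps on open sets\<close>

lemma Ck_on_congD:
 assumes "open T" "!!x. x : T ==> f x = g x" "Ck_on k T f"
 shows "Ck_on k T g"
 using assms(2,3)
proof (induction k arbitrary: f g)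
 case 0
 then show ?case using continuous_on_eq by auto
next
 case (Suc k)
 have d: "f differentiable (at x)" "fd g x = fd f x"
  "g differentiable (at x)" if "x : T" for x
 proof -
  show "f differentiable (at x)" using Suc.prems(2) that by simp
  then obtain f' where f': "(f has_derivative f') (at x)" by (auto simp: differentiable_def)
  then have "(g has_derivative f') (at x)"
   using has_derivative_transform_within_open[OF f' \<open>open T\<close> that] Suc.prems(1) by blast
  then show "fd g x = fd f x" "g differentiable (at x)"
   using f' frechet_derivative_at[of f f'] frechet_derivative_at[of g f'] by (auto simp: differentiable_def)
 qed
 have "Ck_on k T (%x. fd g x v)" for v
  by (rule Suc.IH[of "%x. fd f x v"]) (use Suc.prems(2) d in auto)
 then show ?case using d by auto
qed

lemma Ck_on_SucI:
 assumes "open T" "!!x. x : T ==> (f has_derivative f' x) (at x)" "!!v. Ck_on k T (%x. f' x v)"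
 shows "Ck_on (Suc k) T f"
proof -
 have "fd f x = f' x" if "x : T" for x
  using frechet_derivative_at[OF assms(2)[OF that]] by simp
 then have "Ck_on k T (%x. fd f x v)" for v
  using Ck_on_congD[OF assms(1) _ assms(3)[of v]] by auto
 then show ?thesis using assms(2) by (auto simp: differentiable_def)
qed

lemma Ck_on_Suc_derivative:
 "Ck_on (Suc k) T f ==> x : T ==> (f has_derivative fd f x) (at x)"
 using frechet_derivative_works by auto

lemma Ck_on_Suc_imp: "Ck_on (Suc k) T f ==> Ck_on k T f"
proof (induction k arbitrary: f)
 case 0
 then show ?case
  by (simp add: continuous_at_imp_continuous_on differentiable_imp_continuous_within)
next
 case (Suc k)
 then show ?case by (auto simp del: Ck_on.simps(1))
qed

lemma Ck_on_le: "m <= k ==> Ck_on k T f ==> Ck_on m T f"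
 by (induction k rule: dec_induct) (auto dest: Ck_on_Suc_imp simp del: Ck_on.simps)

lemma Ck_on_subset: "Ck_on k T f ==> S <= T ==> Ck_on k S f"
 by (induction k arbitrary: f) (auto intro: continuous_on_subset)

lemma Ck_on_local:
 assumes "!!x. x : T ==> \<exists>U. open U & x : U & Ck_on k U f"
 shows "Ck_on k T f"
 using assms
proof (induction k arbitrary: f)
 case 0
 then show ?case
  by simp (metis continuous_at_imp_continuous_on continuous_on_eq_continuous_at)
next
 case (Suc k)
 have "f differentiable (at x)" if "x : T" for x
  using Suc.prems[OF that] by auto
 moreover have "Ck_on k T (%x. fd f x v)" for v
  by (rule Suc.IH) (use Suc.prems in force)
 ultimately show ?case by simp
qed

lemma Ck_on_const: "open T ==> Ck_on k T (%x. c)"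
proof (induction k arbitrary: c)
 case (Suc k)
 show ?case by (rule Ck_on_SucI[where f' = "%x v. 0"]) (use Suc in auto)
qed simp

lemma Ck_on_bounded_linear:
 assumes "open T" "bounded_linear f"
 shows "Ck_on k T f"
proof (cases k)
 case 0
 then show ?thesis using assms by (simp add: linear_continuous_on)
next
 case (Suc m)
 have "Ck_on (Suc m) T f"
  by (rule Ck_on_SucI[where f' = "%x. f"])
   (auto intro: assms Ck_on_const bounded_linear_imp_has_derivative)
 then show ?thesis using Suc by simp
qed

lemma Ck_on_linear_comp:
 assumes "open T" "bounded_linear h" "Ck_on k T f"
 shows "Ck_on k T (%x. h (f x))"
 using assms(3)
proof (induction k arbitrary: f)
 case 0
 then show ?case using assms by (simp add: bounded_linear.continuous_on)
next
 case (Suc k)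
 show ?case
 proof (rule Ck_on_SucI[where f' = "%x v. h (fd f x v)"])
  show "((%x. h (f x)) has_derivative (%v. h (fd f x v))) (at x)"
   if "x : T" for x
   using bounded_linear.has_derivative[OF assms(2) Ck_on_Suc_derivative[OF Suc.prems that]] .
  show "Ck_on k T (%x. h (fd f x v))" for v
   by (rule Suc.IH) (use Suc.prems in simp)
 qed (rule assms)
qed

lemma Ck_on_add:
 assumes "open T" "Ck_on k T f" "Ck_on k T g"
 shows "Ck_on k T (%x. f x + g x)"
 using assms(2,3)
proof (induction k arbitrary: f g)
 case 0
 then show ?case by (simp add: continuous_on_add)
next
 case (Suc k)
 show ?case
 proof (rule Ck_on_SucI[where f' = "%x v. fd f x v + fd g x v"])
  show "((%x. f x + g x) has_derivative
    (%v. fd f x v + fd g x v)) (at x)" if "x : T" for x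
   using has_derivative_add[OF Ck_on_Suc_derivative[OF Suc.prems(1) that] Ck_on_Suc_derivative[OF Suc.prems(2) that]] .
  show "Ck_on k T (%x. fd f x v + fd g x v)" for v
   by (rule Suc.IH) (use Suc.prems in simp_all)
 qed (rule assms)
qed

lemma Ck_on_bilinear:
 assumes "open T" "bounded_bilinear h" "Ck_on k T f" "Ck_on k T g"
 shows "Ck_on k T (%x. h (f x) (g x))"
 using assms(3,4)
proof (induction k arbitrary: f g)
 case 0
 then show ?case using assms by (simp add: bounded_bilinear.continuous_on)
next
 case (Suc k)
 show ?case
 proof (rule Ck_on_SucI[where f' = "%x v. h (f x) (fd g x v)
    + h (fd f x v) (g x)"])
  show "((%x. h (f x) (g x)) has_derivative (%v. h (f x) (fd g x v)
    + h (fd f x v) (g x))) (at x)" if "x : T" for x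
   using bounded_bilinear.FDERIV[OF assms(2) Ck_on_Suc_derivative[OF Suc.prems(1) that] Ck_on_Suc_derivative[OF Suc.prems(2) that]] .
  show "Ck_on k T (%x. h (f x) (fd g x v)
    + h (fd f x v) (g x))" for v
   using Suc.prems Ck_on_Suc_imp[OF Suc.prems(1)] Ck_on_Suc_imp[OF Suc.prems(2)]
   by (intro Ck_on_add Suc.IH assms) simp_all
 qed (rule assms)
qed

lemma Ck_on_sum:
 assumes "open T" "!!i. i : I ==> Ck_on k T (f i)"
 shows "Ck_on k T (%x. \<Sum>i\<in>I. f i x)"
 using assms(2)
proof (induction I rule: infinite_finite_induct)
 case (insert i I)
 then show ?case using Ck_on_add[OF assms(1), of k "f i"] by simp
qed (auto intro: Ck_on_const assms)

text \<open>The chain rule is expanded over a basis: \<open>Ck_on\<close> differentiates in constant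
  directions, while in the chain rule the direction \<open>?f' x v\<close> varies with the point.
  The sum turns it into scalar coefficients times derivatives in fixed directions, to which the
  induction hypothesis applies.\<close>

lemma Ck_on_compose:
 assumes "open T" "open U" "Ck_on k T f" "Ck_on k U g" "f ` T <= U"
 shows "Ck_on k T (%x. g (f x))"
 using assms(3,4,5)
proof (induction k arbitrary: g)
 case 0
 then show ?case by (auto intro: continuous_on_compose2)
next
 case (Suc k)
 let ?g' = "%y. fd g y" and ?f' = "%x. fd f x"
 show ?case
 proof (rule Ck_on_SucI[where f' = "%x v. \<Sum>b\<in>Basis. (?f' x v \<bullet> b) *\<^sub>R ?g' (f x) b"])
  fix x assume x: "x : T"
  then have g: "(g has_derivative ?g' (f x)) (at (f x))"
   using Ck_on_Suc_derivative[OF Suc.prems(2)] Suc.prems(3) by blast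
  interpret L: linear "?g' (f x)" using g has_derivative_linear by blast
  have "((%x. g (f x)) has_derivative (%v. ?g' (f x) (?f' x v))) (at x)"
   using has_derivative_compose[OF Ck_on_Suc_derivative[OF Suc.prems(1) x] g] .
  moreover have "?g' (f x) w = (\<Sum>b\<in>Basis. (w \<bullet> b) *\<^sub>R ?g' (f x) b)" for w
   by (subst euclidean_representation[symmetric, of w]) (simp only: L.sum L.scaleR)
  then have "(%v. ?g' (f x) (?f' x v)) = (%v. \<Sum>b\<in>Basis. (?f' x v \<bullet> b) *\<^sub>R ?g' (f x) b)" by blast
  ultimately show "((%x. g (f x)) has_derivative (%v. \<Sum>b\<in>Basis. (?f' x v \<bullet> b) *\<^sub>R ?g' (f x) b)) (at x)"
   by metis
 next
  fix v
  have "Ck_on k T (%x. ?f' x v \<bullet> b)" for b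
   by (rule Ck_on_linear_comp[OF assms(1) bounded_linear_inner_left]) (use Suc.prems in simp)
  moreover have "Ck_on k T (%x. ?g' (f x) b)" for b
   by (rule Suc.IH) (use Suc.prems Ck_on_Suc_imp[OF Suc.prems(1)] in simp_all)
  ultimately show "Ck_on k T (%x. \<Sum>b\<in>Basis. (?f' x v \<bullet> b) *\<^sub>R ?g' (f x) b)"
   by (intro Ck_on_sum Ck_on_bilinear[OF _ bounded_bilinear_scaleR] assms)
 qed (rule assms)
qed

lemma Ck_on_inverse: "Ck_on k {x. x ~= 0} (inverse :: real => real)"
proof (induction k)
 case 0
 then show ?case by (auto intro: continuous_intros)
next
 case (Suc k)
 have o: "open {x::real. x ~= 0}" by (rule open_Collect_neq) auto
 show ?case
 proof (rule Ck_on_SucI[where f' = "%x v. - (inverse x * v * inverse x)"])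
  show "(inverse has_derivative (%v. - (inverse x * v * inverse x))) (at x)"
   if "x : {x. x ~= 0}" for x :: real
   using has_derivative_inverse'[of x] that by simp
  have "Ck_on k {x. x ~= 0} (%x::real. (- v) * (inverse x * inverse x))" for v
   by (intro Ck_on_bilinear[OF o bounded_bilinear_mult] Ck_on_const Suc o)
  then show "Ck_on k {x. x ~= 0} (%x::real. - (inverse x * v * inverse x))" for v
   by (simp add: algebra_simps)
 qed (rule o)
qed

lemma Ck_on_exp: "Ck_on k UNIV (exp :: real => real)"
proof (induction k)
 case (Suc k)
 show ?case
 proof (rule Ck_on_SucI[where f' = "%x v. v * exp x"])
  show "Ck_on k UNIV (%x::real. v * exp x)" for v
   by (intro Ck_on_bilinear[OF _ bounded_bilinear_mult] Ck_on_const Suc) auto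
 qed (auto intro!: derivative_eq_intros)
qed (simp add: continuous_on_exp)

definition Cinf_on :: "'e::euclidean_space set => ('e => 'f::euclidean_space) => bool" where
 "Cinf_on T f \<longleftrightarrow> open T & (\<forall>k. Ck_on k T f)"

lemma Cinf_on_open: "Cinf_on T f ==> open T"
 by (simp add: Cinf_on_def)

lemma Cinf_on_has_derivative:
 "Cinf_on T f ==> x : T ==> (f has_derivative fd f x) (at x)"
 using Ck_on_Suc_derivative[of 0] by (auto simp: Cinf_on_def simp del: Ck_on.simps)

lemma Cinf_on_differentiable: "Cinf_on T f ==> x : T ==> f differentiable (at x)"
 using Cinf_on_has_derivative by (auto simp: differentiable_def)

lemma Cinf_on_derivative: "Cinf_on T f ==> Cinf_on T (%x. fd f x v)"
 unfolding Cinf_on_def using Ck_on.simps(2) by blast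

lemma Cinf_on_continuous: "Cinf_on T f ==> continuous_on T f"
 unfolding Cinf_on_def using Ck_on.simps(1) by blast

lemma Cinf_on_cong:
 assumes "Cinf_on T f" "!!x. x : T ==> f x = g x"
 shows "Cinf_on T g"
 using assms Ck_on_congD[of T f g] by (auto simp: Cinf_on_def)

lemma Cinf_on_subset: "Cinf_on T f ==> open S ==> S <= T ==> Cinf_on S f"
 by (auto simp: Cinf_on_def intro: Ck_on_subset)

lemma Cinf_on_local:
 assumes "open T" "!!x. x : T ==> \<exists>U. x : U & Cinf_on U f"
 shows "Cinf_on T f"
 unfolding Cinf_on_def
 by (intro conjI allI Ck_on_local assms) (use assms(2) in \<open>fastforce simp: Cinf_on_def\<close>)

named_theorems smooth_intros

lemma Cinf_on_const [smooth_intros]: "open T ==> Cinf_on T (%x. c)"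
 by (simp add: Cinf_on_def Ck_on_const)

lemma Cinf_on_bounded_linear: "open T ==> bounded_linear f ==> Cinf_on T f"
 by (simp add: Cinf_on_def Ck_on_bounded_linear)

lemma Cinf_on_ident [smooth_intros]: "open T ==> Cinf_on T (%x. x)"
 by (simp add: Cinf_on_bounded_linear bounded_linear_ident)

lemma Cinf_on_linear_comp: "bounded_linear h ==> Cinf_on T f ==> Cinf_on T (%x. h (f x))"
 by (simp add: Cinf_on_def Ck_on_linear_comp)

lemma Cinf_on_add [smooth_intros]:
 "Cinf_on T f ==> Cinf_on T g ==> Cinf_on T (%x. f x + g x)"
 by (simp add: Cinf_on_def Ck_on_add)

lemma Cinf_on_bilinear:
 "bounded_bilinear h ==> Cinf_on T f ==> Cinf_on T g ==> Cinf_on T (%x. h (f x) (g x))"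
 by (simp add: Cinf_on_def Ck_on_bilinear)

lemma Cinf_on_minus [smooth_intros]: "Cinf_on T f ==> Cinf_on T (%x. - f x)"
 by (rule Cinf_on_linear_comp[OF bounded_linear_minus[OF bounded_linear_ident]])

lemma Cinf_on_diff [smooth_intros]:
 "Cinf_on T f ==> Cinf_on T g ==> Cinf_on T (%x. f x - g x)"
 using Cinf_on_add[OF _ Cinf_on_minus] by fastforce

lemma Cinf_on_mult [smooth_intros]:
 fixes f g :: "_ => real"
 shows "Cinf_on T f ==> Cinf_on T g ==> Cinf_on T (%x. f x * g x)"
 by (rule Cinf_on_bilinear[OF bounded_bilinear_mult])

lemma Cinf_on_scaleR [smooth_intros]:
 "Cinf_on T f ==> Cinf_on T g ==> Cinf_on T (%x. f x *\<^sub>R g x)"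
 by (rule Cinf_on_bilinear[OF bounded_bilinear_scaleR])

lemma Cinf_on_inner [smooth_intros]:
 "Cinf_on T f ==> Cinf_on T g ==> Cinf_on T (%x. f x \<bullet> g x)"
 by (rule Cinf_on_bilinear[OF bounded_bilinear_inner])

lemma Cinf_on_sum [smooth_intros]:
 "open T ==> (!!i. i : I ==> Cinf_on T (f i)) ==> Cinf_on T (%x. \<Sum>i\<in>I. f i x)"
 by (simp add: Cinf_on_def Ck_on_sum)

lemma Cinf_on_power [smooth_intros]:
 fixes f :: "_ => real"
 assumes "Cinf_on T f"
 shows "Cinf_on T (%x. f x ^ n)"
 by (induction n) (auto intro: smooth_intros assms Cinf_on_open[OF assms])

lemma Cinf_on_compose:
 "Cinf_on T f ==> Cinf_on U g ==> f ` T <= U ==> Cinf_on T (%x. g (f x))"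
 by (auto simp: Cinf_on_def intro: Ck_on_compose)

lemma Cinf_on_compose_UNIV:
 "Cinf_on UNIV g ==> Cinf_on T f ==> Cinf_on T (%x. g (f x))"
 by (rule Cinf_on_compose[of T f UNIV g]) auto

lemma Cinf_on_vec_nth [smooth_intros]:
 fixes f :: "_ => real ^ 'n"
 shows "Cinf_on T f ==> Cinf_on T (%x. f x $ i)"
 by (rule Cinf_on_linear_comp[OF bounded_linear_vec_nth])

lemma Cinf_on_fst [smooth_intros]: "Cinf_on T f ==> Cinf_on T (%x. fst (f x))"
 by (rule Cinf_on_linear_comp[OF bounded_linear_fst])

lemma Cinf_on_snd [smooth_intros]: "Cinf_on T f ==> Cinf_on T (%x. snd (f x))"
 by (rule Cinf_on_linear_comp[OF bounded_linear_snd])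

lemma Cinf_on_componentwise:
 assumes "open T" "!!b. b : Basis ==> Cinf_on T (%x. f x \<bullet> b)"
 shows "Cinf_on T f"
proof -
 have "Cinf_on T (%x. \<Sum>b\<in>Basis. (f x \<bullet> b) *\<^sub>R b)"
  by (intro smooth_intros assms)
 then show ?thesis by (simp add: euclidean_representation)
qed

lemma Cinf_on_vec:
 fixes f :: "_ => real ^ 'n"
 assumes "open T" "!!i. Cinf_on T (%x. f x $ i)"
 shows "Cinf_on T f"
 by (rule Cinf_on_componentwise[OF assms(1)])
  (auto simp: Basis_vec_def inner_axis intro: assms(2))

lemma Cinf_on_vector3 [smooth_intros]:
 fixes f g h :: "_ => real"
 assumes "Cinf_on T f" "Cinf_on T g" "Cinf_on T h"
 shows "Cinf_on T (%x. vector [f x, g x, h x] :: real^3)"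
proof (rule Cinf_on_vec)
 show "Cinf_on T (%x. (vector [f x, g x, h x] :: real^3) $ i)" for i
  using exhaust_3[of i] assms by auto
qed (rule Cinf_on_open[OF assms(1)])

lemma Cinf_on_Pair [smooth_intros]:
 assumes "Cinf_on T f" "Cinf_on T g"
 shows "Cinf_on T (%x. (f x, g x))"
proof (rule Cinf_on_componentwise)
 show "Cinf_on T (%x. (f x, g x) \<bullet> b)" if "b : Basis" for b
  using that Cinf_on_inner[OF assms(1) Cinf_on_const[OF Cinf_on_open[OF assms(1)]]]
   Cinf_on_inner[OF assms(2) Cinf_on_const[OF Cinf_on_open[OF assms(1)]]]
  by (auto simp: Basis_prod_def)
qed (rule Cinf_on_open[OF assms(1)])

lemma Cinf_on_inverse [smooth_intros]:
 fixes f :: "_ => real"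
 assumes "Cinf_on T f" "!!x. x : T ==> f x ~= 0"
 shows "Cinf_on T (%x. inverse (f x))"
proof (rule Cinf_on_compose[OF assms(1)])
 show "Cinf_on {x. x ~= 0} (inverse :: real => real)"
  unfolding Cinf_on_def by (auto intro!: Ck_on_inverse open_Collect_neq)
qed (use assms in auto)

lemma Cinf_on_divide [smooth_intros]:
 fixes f g :: "_ => real"
 shows "Cinf_on T f ==> Cinf_on T g ==> (!!x. x : T ==> g x ~= 0) ==> Cinf_on T (%x. f x / g x)"
 unfolding divide_inverse by (intro smooth_intros)

text \<open>Caratheodory's criterion: an exact factorisation of the increment, with coefficients
  continuous at \<open>p\<close>, yields the derivative there. It suits flows of differential
  equations, whose increments are available as integrals.\<close>

lemma has_derivative_Caratheodory:
 fixes f :: "'e::euclidean_space => 'f::real_normed_vector"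
 assumes "open T" "p : T"
  and eq: "!!q. q : T ==> f q - f p = (\<Sum>b\<in>Basis. ((q - p) \<bullet> b) *\<^sub>R C b q)"
  and cont: "!!b. b : Basis ==> continuous (at p) (C b)"
 shows "(f has_derivative (%v. \<Sum>b\<in>Basis. (v \<bullet> b) *\<^sub>R C b p)) (at p)"
proof -
 obtain e where e: "e > 0" "ball p e <= T" using assms(1,2) openE by blast
 show ?thesis
proof (rule has_derivativeI_sandwich[OF e(1)])
 show "bounded_linear (%v. \<Sum>b\<in>Basis. (v \<bullet> b) *\<^sub>R C b p)"
  by (intro bounded_linear_intros)
 let ?R = "%q. \<Sum>b\<in>Basis. norm (C b q - C b p)"
 show "((%q. ?R q) \<longlongrightarrow> 0) (at p)"
 proof -
  have "((%q. \<Sum>b\<in>Basis. norm (C b q - C b p)) \<longlongrightarrow> (\<Sum>b\<in>(Basis::'e set). norm (C b p - C b p))) (at p)"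
   using cont by (intro tendsto_intros) (auto simp: continuous_at)
  then show ?thesis by simp
 qed
 show "norm ((f q - f p) - (\<Sum>b\<in>Basis. ((q - p) \<bullet> b) *\<^sub>R C b p)) / norm (q - p) <= ?R q"
  if "q ~= p" "dist q p < e" for q
 proof -
  have "q : T" using e that by (auto simp: dist_commute)
  then have "norm ((f q - f p) - (\<Sum>b\<in>Basis. ((q - p) \<bullet> b) *\<^sub>R C b p))
    = norm (\<Sum>b\<in>Basis. ((q - p) \<bullet> b) *\<^sub>R (C b q - C b p))"
   by (simp add: eq sum_subtractf[symmetric] scaleR_diff_right)
  also have "... <= (\<Sum>b\<in>Basis. norm (q - p) * norm (C b q - C b p))"
   by (intro sum_norm_le) (auto intro!: mult_right_mono Basis_le_norm)
  finally show ?thesis using that by (simp add: sum_distrib_left[symmetric] divide_le_eq mult.commute)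
 qed
qed
qed

text \<open>The family \<open>x\<^sup>-\<^sup>n exp (- 1 / x)\<close> is closed under differentiation, which makes the
 flat function smooth.\<close>

definition flat_aux :: "nat => real => real" where
 "flat_aux n x = (if x > 0 then exp (- (1 / x)) / x ^ n else 0)"

lemma flat_aux_tendsto: "(flat_aux n \<longlongrightarrow> 0) (at 0)"
proof -
 have "((%x::real. x ^ n / exp x) \<longlongrightarrow> 0) at_top" by (rule tendsto_power_div_exp_0)
 then have "((%x::real. inverse x ^ n / exp (inverse x)) \<longlongrightarrow> 0) (at_right 0)"
  by (rule filterlim_compose[OF _ filterlim_inverse_at_top_right])
 then have r: "(flat_aux n \<longlongrightarrow> 0) (at_right 0)"
 proof (rule Lim_transform_eventually)
  show "\<forall>\<^sub>F x in at_right 0. inverse x ^ n / exp (inverse x) = flat_aux n x"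
   unfolding eventually_at_right_field
   by (intro exI[of _ 1]) (auto simp: flat_aux_def exp_minus field_simps)
 qed
 have l: "(flat_aux n \<longlongrightarrow> 0) (at_left 0)"
  by (rule tendsto_eventually) (auto simp: flat_aux_def eventually_at_left_field intro!: exI[of _ "-1"])
 show ?thesis using l r filterlim_split_at by blast
qed

lemma flat_aux_has_derivative:
 "(flat_aux n has_real_derivative flat_aux (n + 2) x - n * flat_aux (n + 1) x) (at x)"
proof (cases x "0::real" rule: linorder_cases)
 case less
 have "((%x. 0) has_real_derivative 0) (at x)" by simp
 then have "(flat_aux n has_real_derivative 0) (at x)"
  by (rule has_field_derivative_transform_within_open[where S = "{..<0}"])
   (use less in \<open>auto simp: flat_aux_def\<close>)
 then show ?thesis using less by (simp add: flat_aux_def)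
next
 case greater
 have "((%x. exp (- (1 / x)) / x ^ n) has_real_derivative
   (exp (- (1 / x)) * (1 / x\<^sup>2) * x ^ n - exp (- (1 / x)) * (n * x ^ (n - 1))) / (x ^ n * x ^ n)) (at x)"
  using greater by (auto intro!: derivative_eq_intros simp: power2_eq_square)
 also have "(exp (- (1 / x)) * (1 / x\<^sup>2) * x ^ n - exp (- (1 / x)) * (n * x ^ (n - 1))) / (x ^ n * x ^ n)
   = flat_aux (n + 2) x - n * flat_aux (n + 1) x"
  using greater by (cases n) (simp_all add: flat_aux_def field_simps power2_eq_square)
 finally show ?thesis
  by (rule has_field_derivative_transform_within_open[where S = "{0<..}"])
   (use greater in \<open>auto simp: flat_aux_def\<close>)
next
 case equal
 have "((%h. (flat_aux n (0 + h) - flat_aux n 0) / h) \<longlongrightarrow> 0) (at 0)"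
  by (rule Lim_transform_eventually[OF flat_aux_tendsto[of "n + 1"]])
   (auto simp: flat_aux_def eventually_at intro!: exI[of _ 1])
 then show ?thesis using equal unfolding DERIV_def by (simp add: flat_aux_def)
qed

lemma Ck_on_flat_aux: "Ck_on k UNIV (flat_aux n)"
proof (induction k arbitrary: n)
 case 0
 show ?case
  using DERIV_isCont[OF flat_aux_has_derivative] by (simp add: continuous_at_imp_continuous_on)
next
 case (Suc k)
 show ?case
 proof (rule Ck_on_SucI)
  show "(flat_aux n has_derivative (*) (flat_aux (n + 2) x - n * flat_aux (n + 1) x)) (at x)" for x
   using flat_aux_has_derivative by (simp add: has_field_derivative_def)
  have "Ck_on k UNIV (%x. (flat_aux (n + 2) x + (- n) * flat_aux (n + 1) x) * v)" for v
   by (intro Ck_on_bilinear[OF _ bounded_bilinear_mult] Ck_on_add Ck_on_const Suc) auto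
  then show "Ck_on k UNIV (%x. (flat_aux (n + 2) x - n * flat_aux (n + 1) x) * v)" for v
   by (simp add: algebra_simps)
 qed simp
qed

section \<open>Smooth cutoff functions\<close>

definition flat :: "real => real" where
 "flat x = (if x > 0 then exp (- (1 / x)) else 0)"

lemma flat_eq_aux: "flat = flat_aux 0"
 by (auto simp: flat_def flat_aux_def)

lemma Cinf_on_flat [smooth_intros]: "Cinf_on T f ==> Cinf_on T (%x. flat (f x))"
 by (rule Cinf_on_compose_UNIV) (simp_all add: flat_eq_aux Cinf_on_def Ck_on_flat_aux)

lemma flat_has_derivative: "(flat has_real_derivative (if x > 0 then flat x / x\<^sup>2 else 0)) (at x)"
 using flat_aux_has_derivative[of 0 x]
 by (cases "x > 0") (simp_all add: flat_eq_aux flat_aux_def power2_eq_square)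

lemma flat_nonneg: "flat x >= 0" and flat_pos: "x > 0 ==> flat x > 0" and flat_0: "x <= 0 ==> flat x = 0"
 by (auto simp: flat_def)

definition smooth_step :: "real => real" where
 "smooth_step x = flat x / (flat x + flat (1 - x))"

lemma smooth_step_denominator: "flat x + flat (1 - x) > 0"
 using flat_nonneg[of x] flat_nonneg[of "1 - x"] flat_pos[of x] flat_pos[of "1 - x"]
 by (cases "x > 0") auto

lemma Cinf_on_smooth_step [smooth_intros]: "Cinf_on T f ==> Cinf_on T (%x. smooth_step (f x))"
 unfolding smooth_step_def
 by (intro smooth_intros) (auto simp: Cinf_on_open smooth_step_denominator less_imp_neq[symmetric])

lemma smooth_step_0: "x <= 0 ==> smooth_step x = 0"
 and smooth_step_1: "x >= 1 ==> smooth_step x = 1"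
 and smooth_step_nonneg: "smooth_step x >= 0"
 and smooth_step_le_1: "smooth_step x <= 1"
 using smooth_step_denominator[of x] flat_nonneg[of x] flat_nonneg[of "1 - x"] flat_pos[of x]
 by (simp_all add: smooth_step_def flat_0)

lemma smooth_bump_ball:
 fixes a :: "'e::euclidean_space"
 assumes "r > 0"
 obtains rho :: "'e => real" where "Cinf_on UNIV rho" "!!x. 0 <= rho x" "!!x. rho x <= 1"
  "!!x. x : ball a (r / 2) ==> rho x = 1" "!!x. x ~: ball a r ==> rho x = 0"
proof
 \<comment> \<open>The quadratic argument equals 1 at distance \<open>r / 2\<close> from
   \<open>a\<close> and 0 at distance \<open>r\<close>.\<close>
 let ?rho = "%x. smooth_step (4 / 3 - 4 / (3 * r\<^sup>2) * ((x - a) \<bullet> (x - a)))"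
 show "Cinf_on UNIV ?rho" by (intro smooth_intros) auto
 show "0 <= ?rho x" "?rho x <= 1" for x by (rule smooth_step_nonneg smooth_step_le_1)+
 show "?rho x = 1" if "x : ball a (r / 2)" for x
 proof (rule smooth_step_1)
  have "norm (x - a) <= r / 2" using that by (simp add: dist_norm norm_minus_commute)
  then have "norm (x - a) ^ 2 <= (r / 2) ^ 2" by (intro power_mono) auto
  then show "1 <= 4 / 3 - 4 / (3 * r\<^sup>2) * ((x - a) \<bullet> (x - a))"
   using assms by (simp add: power2_norm_eq_inner field_simps)
 qed
 show "?rho x = 0" if "x ~: ball a r" for x
 proof (rule smooth_step_0)
  have "r <= norm (x - a)" using that by (simp add: dist_norm norm_minus_commute)
  then have "r ^ 2 <= norm (x - a) ^ 2" using assms by (intro power_mono) auto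
  then show "4 / 3 - 4 / (3 * r\<^sup>2) * ((x - a) \<bullet> (x - a)) <= 0"
   using assms by (simp add: power2_norm_eq_inner field_simps)
 qed
qed

text \<open>Finitely many bumps on balls are combined as one minus the product of the
  \<open>1 - rho a\<close>: this stays between 0 and 1 and equals 1 wherever one of the bumps
  does.\<close>

lemma smooth_bump:
 fixes K :: "'e::euclidean_space set"
 assumes "compact K" "open V" "K <= V"
 obtains rho :: "'e => real" and U C where "Cinf_on UNIV rho" "!!x. 0 <= rho x" "!!x. rho x <= 1"
  "open U" "K <= U" "!!x. x : U ==> rho x = 1" "compact C" "C <= V" "!!x. x ~: C ==> rho x = 0"
proof -
 define P :: "'e => real => ('e => real) => bool" where "P a r rho \<longleftrightarrow> r > 0 & cball a r <= V & Cinf_on UNIV rho &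
  (\<forall>x. 0 <= rho x) & (\<forall>x. rho x <= 1) & (\<forall>x\<in>ball a (r / 2). rho x = 1) &
  (\<forall>x. x ~: ball a r --> rho x = 0)" for a r rho
 have "\<exists>r rho. P a r rho" if "a : K" for a
 proof -
  have "a : V" using assms(3) that by (rule subsetD)
  with assms(2) obtain r where r: "r > 0" "cball a r <= V" unfolding open_contains_cball by (elim ballE exE conjE) auto
  obtain rho :: "'e => real" where "Cinf_on UNIV rho" "!!x. 0 <= rho x" "!!x. rho x <= 1"
   "!!x. x : ball a (r / 2) ==> rho x = 1" "!!x. x ~: ball a r ==> rho x = 0"
   by (rule smooth_bump_ball[OF r(1), where a = a], rule that)
  with r have "P a r rho" by (simp add: P_def)
  then show ?thesis by blast
 qed
 then obtain r rho where P: "!!a. a : K ==> P a (r a) (rho a)" by metis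
 note * = P[unfolded P_def]
 have cov: "K <= (\<Union>a\<in>K. ball a (r a / 2))"
 proof
  fix a assume "a : K"
  then show "a : (\<Union>a\<in>K. ball a (r a / 2))" using *[of a] by (intro UN_I[of a]) auto
 qed
 obtain A where A: "A <= K" "finite A" "K <= (\<Union>a\<in>A. ball a (r a / 2))"
  by (rule compactE_image[OF assms(1) _ cov, rotated]) (rule that, assumption+, simp)
 let ?psi = "%x. 1 - (\<Prod>a\<in>A. 1 - rho a x)"
 have "Cinf_on UNIV (%x. \<Prod>a\<in>A. 1 - rho a x)"
  using A(2,1)
 proof (induction A)
  case (insert a A)
  have "Cinf_on UNIV (%x. (1 - rho a x) * (\<Prod>a\<in>A. 1 - rho a x))"
   by (intro smooth_intros) (use insert * in simp_all)
  then show ?case using insert by simp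
 qed (simp_all add: Cinf_on_const)
 then have 1: "Cinf_on UNIV ?psi" by (intro smooth_intros) auto
 have 2: "0 <= ?psi x" "?psi x <= 1" for x
 proof -
  have "!!a. a : A ==> 0 <= 1 - rho a x" "!!a. a : A ==> 1 - rho a x <= 1"
   using * A(1) by (auto simp: subset_iff)
  then show "0 <= ?psi x" "?psi x <= 1"
   using prod_le_1[of A "%a. 1 - rho a x"] prod_nonneg[of A "%a. 1 - rho a x"] by auto
 qed
 have 3: "?psi x = 1" if x: "x : (\<Union>a\<in>A. ball a (r a / 2))" for x
 proof -
  obtain a where a: "a : A" "x : ball a (r a / 2)" using x by blast
  then have "a : K" using A(1) by blast
  then have "rho a x = 1" using *[of a] a(2) by blast
  with a(1) have "(\<Prod>a\<in>A. 1 - rho a x) = 0" using A(2) by (intro prod_zero bexI[of _ a]) auto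
  then show ?thesis by simp
 qed
 have 4: "?psi x = 0" if "x ~: (\<Union>a\<in>A. cball a (r a))" for x
 proof -
  have "rho a x = 0" if "a : A" for a
  proof -
   have "x ~: ball a (r a)" using \<open>x ~: (\<Union>a\<in>A. cball a (r a))\<close> that by force
   then show ?thesis using * A(1) that by blast
  qed
  then show ?thesis by simp
 qed
 show ?thesis
 proof (rule that[of ?psi "\<Union>a\<in>A. ball a (r a / 2)" "\<Union>a\<in>A. cball a (r a)"])
  show "compact (\<Union>a\<in>A. cball a (r a))" using A(2) by (intro compact_UN) auto
  show "(\<Union>a\<in>A. cball a (r a)) <= V" using * A(1) by blast
  show "open (\<Union>a\<in>A. ball a (r a / 2))" by blast
 qed (fact 1 2 3 4 A(3))+
qed

section \<open>Symmetry of second derivatives\<close>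

text \<open>The second difference of \<open>f\<close> over a small parallelogram, divided by the
  square of the step, is by two mean value steps a value of either mixed derivative at a nearby
  point, depending on the order of the steps. Continuity of both gives equality in the
  limit.\<close>

lemma symmetric_second_derivative_real:
 fixes f :: "'e::euclidean_space => real"
 assumes "Cinf_on T f" "x : T"
 shows "fd (%y. frechet_derivative f (at y) u) x v
  = fd (%y. frechet_derivative f (at y) v) x u"
proof -
 let ?D = "%u y. fd f y u"
 let ?E = "%u v y. fd (?D u) y v"
 obtain e where e: "e > 0" "ball x e <= T" using assms Cinf_on_open openE by blast
 let ?M = "norm u + norm v + 1"
 have M: "?M > 0" by (simp add: add_nonneg_pos)
 have mean: "\<exists>s t. 0 <= s & s <= h & 0 <= t & t <= h &
   f (x + h *\<^sub>R u + h *\<^sub>R v) - f (x + h *\<^sub>R u) - f (x + h *\<^sub>R v) + f x = h * h * ?E u v (x + s *\<^sub>R u + t *\<^sub>R v)"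
  if h: "0 < h" "h * (norm u + norm v + 1) < e" for h u v
 proof -
  have inT: "x + s *\<^sub>R u + t *\<^sub>R v : T" if "0 <= s" "s <= h" "0 <= t" "t <= h" for s t
  proof -
   have "norm (s *\<^sub>R u + t *\<^sub>R v) <= h * norm u + h * norm v"
    using that by (intro order_trans[OF norm_triangle_ineq] add_mono) (auto intro: mult_right_mono)
   also have "... < e" using h by (simp add: algebra_simps)
   finally show ?thesis using e(2) using norm_minus_cancel[of "s *\<^sub>R u + t *\<^sub>R v"]
    by (intro subsetD[OF e(2)]) (simp add: dist_norm del: norm_minus_cancel)
  qed
  have dF: "((%s. f (x + s *\<^sub>R u + t *\<^sub>R v)) has_real_derivative ?D u (x + s *\<^sub>R u + t *\<^sub>R v)) (at s)"
   if "0 <= s" "s <= h" "0 <= t" "t <= h" for s t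
  proof -
   have "((%s. f (x + s *\<^sub>R u + t *\<^sub>R v)) has_derivative (%r. ?D (r *\<^sub>R u) (x + s *\<^sub>R u + t *\<^sub>R v))) (at s)"
   proof -
    have "((%s. x + s *\<^sub>R u + t *\<^sub>R v) has_derivative (%r. r *\<^sub>R u)) (at s)"
     by (auto intro!: derivative_eq_intros)
    from has_derivative_compose[OF this Cinf_on_has_derivative[OF assms(1) inT[OF that]]] show ?thesis .
   qed
   moreover have "?D (r *\<^sub>R u) (x + s *\<^sub>R u + t *\<^sub>R v) = ?D u (x + s *\<^sub>R u + t *\<^sub>R v) * r" for r
    using linear_frechet_derivative[OF Cinf_on_differentiable[OF assms(1) inT[OF that]]]
    by (simp add: linear_cmul)
   ultimately show ?thesis by (simp add: has_field_derivative_def)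
  qed
  have dG: "((%t. ?D u (x + s *\<^sub>R u + t *\<^sub>R v)) has_real_derivative ?E u v (x + s *\<^sub>R u + t *\<^sub>R v)) (at t)"
   if "0 <= s" "s <= h" "0 <= t" "t <= h" for s t
  proof -
   note D = Cinf_on_derivative[OF assms(1), of u]
   have "((%t. ?D u (x + s *\<^sub>R u + t *\<^sub>R v)) has_derivative (%r. ?E u (r *\<^sub>R v) (x + s *\<^sub>R u + t *\<^sub>R v))) (at t)"
   proof -
    have "((%t. x + s *\<^sub>R u + t *\<^sub>R v) has_derivative (%r. r *\<^sub>R v)) (at t)"
     by (auto intro!: derivative_eq_intros)
    from has_derivative_compose[OF this Cinf_on_has_derivative[OF D inT[OF that]]] show ?thesis .
   qed
   moreover have "?E u (r *\<^sub>R v) (x + s *\<^sub>R u + t *\<^sub>R v) = ?E u v (x + s *\<^sub>R u + t *\<^sub>R v) * r" for r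
    using linear_frechet_derivative[OF Cinf_on_differentiable[OF D inT[OF that]]]
    by (simp add: linear_cmul)
   ultimately show ?thesis by (simp add: has_field_derivative_def)
  qed
  let ?F = "%s. f (x + s *\<^sub>R u + h *\<^sub>R v) - f (x + s *\<^sub>R u + 0 *\<^sub>R v)"
  have "\<exists>s. s > 0 & s < h & ?F h - ?F 0 = (h - 0) * (?D u (x + s *\<^sub>R u + h *\<^sub>R v) - ?D u (x + s *\<^sub>R u + 0 *\<^sub>R v))"
   by (rule MVT2, use h in simp, intro DERIV_diff dF) (use h in auto)
  then obtain s where s: "0 < s" "s < h"
   "?F h - ?F 0 = h * (?D u (x + s *\<^sub>R u + h *\<^sub>R v) - ?D u (x + s *\<^sub>R u + 0 *\<^sub>R v))" by auto
  have "\<exists>t. t > 0 & t < h & ?D u (x + s *\<^sub>R u + h *\<^sub>R v) - ?D u (x + s *\<^sub>R u + 0 *\<^sub>R v)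
    = (h - 0) * ?E u v (x + s *\<^sub>R u + t *\<^sub>R v)"
   by (rule MVT2[where f = "%t. ?D u (x + s *\<^sub>R u + t *\<^sub>R v)"]) (use h s in \<open>auto intro: dG\<close>)
  then obtain t where "0 < t" "t < h" "?D u (x + s *\<^sub>R u + h *\<^sub>R v) - ?D u (x + s *\<^sub>R u + 0 *\<^sub>R v)
    = h * ?E u v (x + s *\<^sub>R u + t *\<^sub>R v)" by auto
  with s show ?thesis by (intro exI[of _ s] exI[of _ t]) (auto simp: algebra_simps)
 qed
 \<comment> \<open>The steps tend to 0 and keep the parallelogram inside the ball of radius
   \<open>e\<close>; the summand 1 in \<open>?M\<close> covers \<open>u = v = 0\<close>.\<close>
 define d where "d n = e / (2 * ?M * Suc n)" for n
 have d: "d n > 0" "d n * ?M < e" for n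
 proof -
  show "d n > 0" using e M by (simp add: d_def)
  have *: "e / (2 * m * s) * m = e / (2 * s)" if "m > 0" for m s :: real
   using that by (simp add: field_simps)
  have "d n * ?M = e / (2 * Suc n)" unfolding d_def using *[OF M, of "real (Suc n)"] by (simp only: of_nat_mult of_nat_numeral)
  also have "... < e" using mult_strict_left_mono[of 1 "2 * real (Suc n)" e] e(1) by (simp add: divide_less_eq)
  finally show "d n * ?M < e" .
 qed
 have d0: "d \<longlonglongrightarrow> 0"
 proof -
  have "(%n. e / (2 * ?M) * inverse (Suc n)) \<longlonglongrightarrow> e / (2 * ?M) * 0"
   by (intro tendsto_mult LIMSEQ_inverse_real_of_nat tendsto_const)
  moreover have "d = (%n. e / (2 * ?M) * inverse (Suc n))"
   by (rule ext) (simp only: d_def divide_inverse inverse_mult_distrib mult.assoc)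
  ultimately show ?thesis by simp
 qed
 define \<Delta> where "\<Delta> n = (f (x + d n *\<^sub>R u + d n *\<^sub>R v) - f (x + d n *\<^sub>R u) - f (x + d n *\<^sub>R v) + f x) / (d n * d n)" for n
 have lim: "(%n. dl n) \<longlonglongrightarrow> ?E a b x"
  if *: "!!n. \<exists>s t. 0 <= s & s <= d n & 0 <= t & t <= d n & dl n = ?E a b (x + s *\<^sub>R a + t *\<^sub>R b)" for dl a b
 proof -
  obtain s t where st: "!!n. 0 <= s n" "!!n. s n <= d n" "!!n. 0 <= t n" "!!n. t n <= d n"
   "!!n. dl n = ?E a b (x + s n *\<^sub>R a + t n *\<^sub>R b)"
   using * by metis
  have "s \<longlonglongrightarrow> 0" "t \<longlonglongrightarrow> 0"
   by (rule tendsto_sandwich[OF _ _ tendsto_const d0]; use st in auto)+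
  then have "(%n. x + s n *\<^sub>R a + t n *\<^sub>R b) \<longlonglongrightarrow> x + 0 *\<^sub>R a + 0 *\<^sub>R b"
   by (intro tendsto_intros)
  then have "(%n. x + s n *\<^sub>R a + t n *\<^sub>R b) \<longlonglongrightarrow> x" by simp
  moreover have "isCont (?E a b) x"
   using Cinf_on_continuous[OF Cinf_on_derivative[OF Cinf_on_derivative[OF assms(1)]]]
    assms(2) Cinf_on_open[OF assms(1)] continuous_on_eq_continuous_at by blast
  ultimately show ?thesis using st(5) isCont_tendsto_compose by fastforce
 qed
 have "\<Delta> \<longlonglongrightarrow> ?E u v x"
  using mean[OF d(1), of _ u v] d by (intro lim) (simp add: \<Delta>_def nonzero_divide_eq_eq less_imp_neq[symmetric] mult.commute)
 moreover have "\<Delta> \<longlonglongrightarrow> ?E v u x"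
 proof (rule lim)
  fix n
  have "d n * (norm v + norm u + 1) < e" using d(2)[of n] by (simp add: algebra_simps)
  from mean[OF d(1) this] show "\<exists>s t. 0 <= s & s <= d n & 0 <= t & t <= d n & \<Delta> n = ?E v u (x + s *\<^sub>R v + t *\<^sub>R u)"
   using d(1)[of n] by (simp add: \<Delta>_def nonzero_divide_eq_eq less_imp_neq[symmetric] algebra_simps)
 qed
 ultimately show ?thesis using LIMSEQ_unique by blast
qed

lemma symmetric_second_derivative:
 fixes f :: "'e::euclidean_space => 'f::euclidean_space"
 assumes "Cinf_on T f" "x : T"
 shows "fd (%y. frechet_derivative f (at y) u) x v
  = fd (%y. frechet_derivative f (at y) v) x u"
proof (rule euclidean_eqI)
 fix b :: 'f
 let ?f = "%y. f y \<bullet> b"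
 have f: "Cinf_on T ?f" by (intro smooth_intros assms Cinf_on_open[OF assms(1)])
 have 1: "fd ?f y w = fd f y w \<bullet> b" if "y : T" for y w
  using frechet_derivative_at[OF has_derivative_inner_left[OF Cinf_on_has_derivative[OF assms(1) that]], of b]
  by (rule fun_cong[OF sym])
 have 2: "fd (%y. frechet_derivative f (at y) w) x w' \<bullet> b
   = fd (%y. frechet_derivative ?f (at y) w) x w'" for w w'
 proof -
  have "((%y. fd f y w \<bullet> b) has_derivative
    (%w'. fd (%y. frechet_derivative f (at y) w) x w' \<bullet> b)) (at x)"
   by (rule has_derivative_inner_left[OF Cinf_on_has_derivative[OF Cinf_on_derivative[OF assms(1)] assms(2)]])
  then have "((%y. fd ?f y w) has_derivative
    (%w'. fd (%y. frechet_derivative f (at y) w) x w' \<bullet> b)) (at x)"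
   by (rule has_derivative_transform_within_open[OF _ Cinf_on_open[OF assms(1)] assms(2)]) (simp add: 1)
  then show ?thesis by (rule fun_cong[OF frechet_derivative_at])
 qed
 show "fd (%y. frechet_derivative f (at y) u) x v \<bullet> b
   = fd (%y. frechet_derivative f (at y) v) x u \<bullet> b"
  unfolding 2 by (rule symmetric_second_derivative_real[OF f assms(2)])
qed

section \<open>Coordinates of three-space and smooth inverses\<close>

abbreviation vec3 :: "real => real => real => real^3" where
 "vec3 x y z == vector [x, y, z]"

lemma vec3_eta: "vec3 (p $ 1) (p $ 2) (p $ 3) = p"
 by (simp add: vec_eq_iff forall_3)

lemma vec3_decomp: "vec3 x y z = x *\<^sub>R axis 1 1 + y *\<^sub>R axis 2 1 + z *\<^sub>R axis 3 1"
 by (simp add: vec_eq_iff forall_3 axis_def)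

lemma Basis_real3: "(Basis :: (real^3) set) = {axis 1 1, axis 2 1, axis 3 1}"
 using exhaust_3 by (auto simp: Basis_vec_def) metis

lemma sum_Basis_real3:
 "(\<Sum>b\<in>(Basis :: (real^3) set). f b) = f (axis 1 1) + f (axis 2 1) + f (axis 3 1)"
 unfolding Basis_real3 by (simp add: axis_eq_axis add.assoc)

lemma continuous_on_vec3 [continuous_intros]:
 assumes "continuous_on S f" "continuous_on S g" "continuous_on S h"
 shows "continuous_on S (%x. vec3 (f x) (g x) (h x))"
 unfolding vec3_decomp by (intro continuous_intros assms)

lemma linear_real3:
 fixes L :: "real^3 => 'a::real_vector"
 assumes "linear L"
 shows "L v = (v $ 1) *\<^sub>R L (axis 1 1) + (v $ 2) *\<^sub>R L (axis 2 1) + (v $ 3) *\<^sub>R L (axis 3 1)"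
proof -
 have "L v = L (v $ 1 *\<^sub>R axis 1 1 + v $ 2 *\<^sub>R axis 2 1 + v $ 3 *\<^sub>R axis 3 1)"
  by (simp only: vec3_decomp[symmetric] vec3_eta)
 then show ?thesis by (simp only: linear_add[OF assms] linear_cmul[OF assms])
qed

lemma has_derivative_Caratheodory3:
 fixes f :: "real^3 => real"
 assumes "open T" "p : T"
  and "!!q. q : T ==> f q - f p = (q $ 1 - p $ 1) * C1 q + (q $ 2 - p $ 2) * C2 q + (q $ 3 - p $ 3) * C3 q"
  and "continuous (at p) C1" "continuous (at p) C2" "continuous (at p) C3"
 shows "(f has_derivative (%v. v $ 1 * C1 p + v $ 2 * C2 p + v $ 3 * C3 p)) (at p)"
proof -
 define C where "C b = (if b = axis 1 1 then C1 else if b = axis 2 1 then C2 else C3)" for b :: "real^3"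
 have C: "C (axis 1 1) = C1" "C (axis 2 1) = C2" "C (axis 3 1) = C3"
  by (simp_all add: C_def axis_eq_axis)
 have "(f has_derivative (%v. \<Sum>b\<in>Basis. (v \<bullet> b) *\<^sub>R C b p)) (at p)"
 proof (rule has_derivative_Caratheodory[OF assms(1,2)])
  show "f q - f p = (\<Sum>b\<in>Basis. ((q - p) \<bullet> b) *\<^sub>R C b q)" if "q : T" for q
   using assms(3)[OF that] by (simp add: sum_Basis_real3 C inner_axis)
  show "isCont (C b) p" if "b : Basis" for b
   using that assms(4-6) C by (auto simp: Basis_real3)
 qed
 then show ?thesis by (simp add: sum_Basis_real3 C inner_axis)
qed

text \<open>Cramer's rule in terms of cross products. The solution is written out because its smooth
  dependence on the entries of \<open>L\<close> can then be read off.\<close>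

lemma linear_inverse_real3:
 fixes L :: "real^3 => real^3"
 assumes "linear L"
 defines "a == L (axis 1 1)" and "b == L (axis 2 1)" and "c == L (axis 3 1)"
 shows "det (matrix L) = a \<bullet> cross3 b c"
  and "det (matrix L) ~= 0 ==> L (vec3 (v \<bullet> cross3 b c / (a \<bullet> cross3 b c))
   (v \<bullet> cross3 c a / (a \<bullet> cross3 b c)) (v \<bullet> cross3 a b / (a \<bullet> cross3 b c))) = v"
proof -
 show 1: "det (matrix L) = a \<bullet> cross3 b c"
  by (simp add: det_3 matrix_def a_def b_def c_def cross3_def inner_vec_def sum_3 algebra_simps)
 let ?d = "a \<bullet> cross3 b c"
 assume "det (matrix L) ~= 0"
 then have d: "?d ~= 0" using 1 by simp
 have "L (vec3 (v \<bullet> cross3 b c / ?d) (v \<bullet> cross3 c a / ?d) (v \<bullet> cross3 a b / ?d)) =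
  (v \<bullet> cross3 b c / ?d) *\<^sub>R a + (v \<bullet> cross3 c a / ?d) *\<^sub>R b + (v \<bullet> cross3 a b / ?d) *\<^sub>R c"
  by (subst linear_real3[OF assms(1)]) (simp add: a_def b_def c_def)
 also have "... = (1 / ?d) *\<^sub>R ((v \<bullet> cross3 b c) *\<^sub>R a + (v \<bullet> cross3 c a) *\<^sub>R b + (v \<bullet> cross3 a b) *\<^sub>R c)"
  by (simp add: scaleR_add_right)
 also have "(v \<bullet> cross3 b c) *\<^sub>R a + (v \<bullet> cross3 c a) *\<^sub>R b + (v \<bullet> cross3 a b) *\<^sub>R c = ?d *\<^sub>R v"
  by (simp add: vec_eq_iff forall_3 cross3_def inner_vec_def sum_3 algebra_simps)
 finally show "L (vec3 (v \<bullet> cross3 b c / ?d) (v \<bullet> cross3 c a / ?d) (v \<bullet> cross3 a b / ?d)) = v"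
  using d by simp
qed

lemma Ck_on_inverse_comp:
 fixes f :: "_ => real"
 assumes "Ck_on k T f" "open T" "!!x. x : T ==> f x ~= 0"
 shows "Ck_on k T (%x. inverse (f x))"
 by (rule Ck_on_compose[OF assms(2) _ assms(1) Ck_on_inverse]) (use assms(3) in \<open>auto intro!: open_Collect_neq\<close>)

lemma Ck_on_vec3:
 fixes f g h :: "_ => real"
 assumes "open T" "Ck_on k T f" "Ck_on k T g" "Ck_on k T h"
 shows "Ck_on k T (%x. vec3 (f x) (g x) (h x))"
 unfolding vec3_decomp
 by (intro Ck_on_add Ck_on_bilinear[OF _ bounded_bilinear_scaleR] Ck_on_const assms)

lemma bounded_bilinear_cross3: "bounded_bilinear cross3"
 by (rule bilinear_conv_bounded_bilinear[THEN iffD1])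
  (auto simp: bilinear_def linear_iff cross3_simps)

text \<open>Invariance of domain makes the image open. The derivative of the inverse at
  \<open>y\<close> is \<open>L\<close> at the inverse image of \<open>y\<close>, with
  \<open>L\<close> smooth by Cramer's rule, so each order of smoothness of the inverse yields the
  next one.\<close>

lemma Cinf_on_inverse_real3:
 fixes f :: "real^3 => real^3"
 assumes f: "Cinf_on U f" "inj_on f U"
  and det: "!!x. x : U ==> det (matrix (fd f x)) ~= 0"
 shows "open (f ` U)" "Cinf_on (f ` U) (inv_into U f)"
proof -
 let ?g = "inv_into U f" and ?D = "%x. fd f x"
 note op = Cinf_on_open[OF f(1)]
 show o: "open (f ` U)"
  by (rule invariance_of_domain[OF Cinf_on_continuous[OF f(1)] op f(2)])
 define a b c where "a x = ?D x (axis 1 1)" and "b x = ?D x (axis 2 1)" and "c x = ?D x (axis 3 1)" for x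
 define d where "d x = a x \<bullet> cross3 (b x) (c x)" for x
 define L where "L x v = vec3 (v \<bullet> cross3 (b x) (c x) * inverse (d x)) (v \<bullet> cross3 (c x) (a x) * inverse (d x))
  (v \<bullet> cross3 (a x) (b x) * inverse (d x))" for x v
 have lin: "linear (?D x)" if "x : U" for x
  using linear_frechet_derivative[OF Cinf_on_differentiable[OF f(1) that]] .
 have d0: "d x ~= 0" if "x : U" for x
  using det[OF that] linear_inverse_real3(1)[OF lin[OF that]] by (simp add: d_def a_def b_def c_def)
 have L: "?D x o L x = id" if "x : U" for x
  using linear_inverse_real3(2)[OF lin[OF that] det[OF that]]
  by (auto simp: fun_eq_iff L_def d_def a_def b_def c_def divide_inverse)
 have der: "(?g has_derivative L (?g y)) (at y)" if "y : f ` U" for y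
 proof -
  have gU: "?g y : U" using that by (rule inv_into_into)
  have "(?g has_derivative L (?g y)) (at (f (?g y)))"
   by (rule has_derivative_inverse_strong[OF op gU Cinf_on_continuous[OF f(1)] _
      Cinf_on_has_derivative[OF f(1) gU] L[OF gU]])
    (rule inv_into_f_f[OF f(2)])
  then show ?thesis by (simp add: f_inv_into_f[OF that])
 qed
 have abc: "Cinf_on U a" "Cinf_on U b" "Cinf_on U c"
  unfolding a_def b_def c_def by (rule Cinf_on_derivative[OF f(1)])+
 have Ld: "Ck_on k U (%x. L x v)" for k v
 proof -
  have Ck: "Ck_on k U a" "Ck_on k U b" "Ck_on k U c" using abc by (auto simp: Cinf_on_def)
  have "Ck_on k U d" unfolding d_def
   by (intro Ck_on_bilinear[OF op bounded_bilinear_inner] Ck_on_bilinear[OF op bounded_bilinear_cross3] Ck)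
  then have "Ck_on k U (%x. inverse (d x))" by (rule Ck_on_inverse_comp[OF _ op d0])
  then show ?thesis unfolding L_def
   by (intro Ck_on_vec3 Ck_on_bilinear[OF op bounded_bilinear_mult] Ck_on_bilinear[OF op bounded_bilinear_inner]
     Ck_on_bilinear[OF op bounded_bilinear_cross3] Ck Ck_on_const op)
 qed
 have "Ck_on k (f ` U) ?g" for k
 proof (induction k)
  case 0
  show ?case using der has_derivative_continuous continuous_at_imp_continuous_on by (metis Ck_on.simps(1))
 next
  case (Suc k)
  show ?case
   by (rule Ck_on_SucI[OF o der])
    (auto intro!: Ck_on_compose[OF o op Suc Ld] simp: image_subset_iff inv_into_into)
 qed
 then show "Cinf_on (f ` U) ?g" using o by (simp add: Cinf_on_def)
qed

section \<open>Parameter integrals and the flow of a scalar differential equation\<close>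

lemma continuous_on_integral_01:
 fixes F :: "'e::topological_space \<times> real => real"
 assumes "continuous_on (U \<times> {0..1}) F"
 shows "continuous_on U (%x. integral {0..1} (%t. F (x, t)))"
 using integral_continuous_on_param[of U 0 1 "%x t. F (x, t)"] assms by (simp add: case_prod_beta')

lemma Ck_on_integral:
 fixes F :: "'e::euclidean_space \<times> real => real"
 assumes "Ck_on k UNIV F"
 shows "Ck_on k UNIV (%x. integral {0..1} (%t. F (x, t)))"
 using assms
proof (induction k arbitrary: F)
 case 0
 then show ?case by (auto intro!: continuous_on_integral_01 elim: continuous_on_subset)
next
 case (Suc k)
 define D where "D z v = fd F z (v, 0)" for z v
 have F: "(F has_derivative fd F z) (at z)" for z
  using Ck_on_Suc_derivative[OF Suc.prems] by simp
 have bl: "bounded_linear (D z)" for z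
  unfolding D_def
  by (rule bounded_linear_compose[OF has_derivative_bounded_linear[OF F]])
   (intro bounded_linear_intros)
 have CkD: "Ck_on k UNIV (%z. D z v)" for v unfolding D_def using Suc.prems by simp
 then have contD: "continuous_on UNIV (%z. D z v)" for v using Ck_on_le[of 0 k] by auto
 have contF: "continuous_on UNIV F" using Ck_on_le[OF _ Suc.prems, of 0] by simp
 have derx: "((%x. F (x, t)) has_derivative blinfun_apply (Blinfun (D (x, t)))) (at x within UNIV)" for x t
 proof -
  have "((%x. (x, t)) has_derivative (%v. (v, 0))) (at x)" by (auto intro!: derivative_eq_intros)
  have "D (x, t) = (%v. fd F (x, t) (v, 0))" by (rule ext) (rule D_def)
  with has_derivative_compose[OF \<open>((%x. (x, t)) has_derivative _) _\<close> F] show ?thesis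
   unfolding bounded_linear_Blinfun_apply[OF bl] by simp
 qed
 have contB: "continuous_on (UNIV \<times> cbox 0 1) (%(x, t). Blinfun (D (x, t)))"
  unfolding case_prod_beta'
  by (rule continuous_on_blinfun_componentwise)
   (use contD in \<open>auto simp: bounded_linear_Blinfun_apply[OF bl] intro: continuous_on_subset\<close>)
 have "((%x. integral (cbox 0 1) (%t. F (x, t))) has_derivative
   blinfun_apply (integral (cbox 0 1) (%t. Blinfun (D (x, t))))) (at x within UNIV)" for x
 proof (rule leibniz_rule[OF derx _ contB])
  show "(%t. F (x, t)) integrable_on cbox 0 1" for x
   by (rule integrable_continuous, rule continuous_on_compose2[OF contF], intro continuous_intros) simp
 qed auto
 note calc = this
 have B: "blinfun_apply (integral (cbox 0 1) (%t. Blinfun (D (x, t)))) v = integral {0..1} (%t. D (x, t) v)" for x v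
 proof -
  have "(%t. Blinfun (D (x, t))) integrable_on cbox 0 1"
   by (intro integrable_continuous continuous_on_compose2[OF contB[unfolded case_prod_beta'], of _ "Pair x", simplified] continuous_intros) auto
  from blinfun_apply_integral[OF this, of v] show ?thesis
   by (simp add: bounded_linear_Blinfun_apply[OF bl])
 qed
 have "((%x. integral {0..1} (%t. F (x, t))) has_derivative
   (%v. integral {0..1} (%t. D (x, t) v))) (at x)" for x
 proof -
  have "(%v. integral {0..1} (%t. D (x, t) v)) = blinfun_apply (integral (cbox 0 1) (%t. Blinfun (D (x, t))))"
   by (rule ext) (rule B[symmetric])
  then show ?thesis using calc[of x] by simp
 qed
 then show ?case
  by (rule Ck_on_SucI[OF open_UNIV]) (rule Suc.IH[OF CkD])
qed

lemma ftc_segment: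
 fixes phi :: "real => real"
 assumes "!!s. (phi has_real_derivative h s) (at s)"
 shows "phi b - phi a = (b - a) * integral {0..1} (%t. h (a + t * (b - a)))"
proof -
 have "((%t. (b - a) * h (a + t * (b - a))) has_integral (phi (a + 1 * (b - a)) - phi (a + 0 * (b - a)))) {0..1}"
 proof (rule fundamental_theorem_of_calculus)
  fix t :: real
  have "((%t. phi (a + t * (b - a))) has_real_derivative h (a + t * (b - a)) * (b - a)) (at t)"
   by (rule DERIV_chain2[OF assms]) (auto intro!: derivative_eq_intros)
  then show "((%t. phi (a + t * (b - a))) has_vector_derivative (b - a) * h (a + t * (b - a))) (at t within {0..1})"
   by (simp add: has_real_derivative_iff_has_vector_derivative mult.commute has_vector_derivative_at_within)
 qed simp
 then have "integral {0..1} (%t. (b - a) * h (a + t * (b - a))) = phi b - phi a"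
  by (subst integral_unique[OF \<open>(_ has_integral _) _\<close>]) simp
 then show ?thesis by simp
qed

text \<open>The substitution by \<open>t * x\<close> writes the integral from 0 to \<open>x\<close>
  over a fixed interval, for either sign of \<open>x\<close>, so that the results on parameter
  integrals apply to it.\<close>

lemma has_derivative_integral_01:
 fixes h :: "real => real"
 assumes "continuous_on UNIV h"
 shows "((%x. x * integral {0..1} (%t. h (t * x))) has_real_derivative h x) (at x)"
proof -
 have "\<exists>F. \<forall>x. - \<infinity> < ereal x --> ereal x < \<infinity> --> (F has_vector_derivative h x) (at x)"
  by (rule einterval_antiderivative)
   (use assms in \<open>auto simp: continuous_on_eq_continuous_at\<close>)
 then obtain F where F: "!!x. (F has_real_derivative h x) (at x)"
  by (auto simp: has_real_derivative_iff_has_vector_derivative)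
 have "(%x. x * integral {0..1} (%t. h (t * x))) = (%x. F x - F 0)"
  using ftc_segment[OF F, of _ 0] by auto
 then show ?thesis using F by (auto intro!: derivative_eq_intros)
qed

text \<open>Picard iteration for \<open>dz/dx = g (x, y, z)\<close> with initial value at
  \<open>x = 0\<close>. The unknown is the deviation from the initial value divided by
  \<open>exp (2 * L * |x|)\<close>. In this weighted norm the Picard operator contracts by 1/2 on
  all of space, because the integral of \<open>L * exp (2 * L * s)\<close> over
  \<open>[0, |x|]\<close> is at most half of \<open>exp (2 * L * |x|)\<close>. One fixed point is
  thus a global solution, continuous in all variables together.\<close>

lemma scalar_ode_solution_exists:
 fixes g :: "real^3 => real"
 assumes cont: "continuous_on UNIV g" and L: "L > 0" and B: "!!p. \<bar>g p\<bar> <= B"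
  and lip: "!!x y z z'. \<bar>g (vec3 x y z) - g (vec3 x y z')\<bar> <= L * \<bar>z - z'\<bar>"
 obtains Z where "continuous_on UNIV Z"
  "!!p. Z p = p $ 3 + p $ 1 * integral {0..1} (%t. g (vec3 (t * p $ 1) (p $ 2) (Z (vec3 (t * p $ 1) (p $ 2) (p $ 3)))))"
proof -
 let ?s = "%t p::real^3. vec3 (t * p $ 1) (p $ 2) (p $ 3)"
 define F where "F phi t p = g (vec3 (t * p $ 1) (p $ 2) (p $ 3 + exp (2 * L * (t * \<bar>p $ 1\<bar>)) * phi (?s t p)))"
  for phi :: "real^3 => real" and t p
 define T where "T phi p = exp (- 2 * L * \<bar>p $ 1\<bar>) * (p $ 1 * integral {0..1} (%t. F phi t p))" for phi p
 have contF: "continuous_on UNIV (%(p, t). F phi t p)" if "continuous_on UNIV phi" for phi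
  unfolding F_def case_prod_beta'
  by (intro continuous_on_compose2[OF cont] continuous_intros continuous_on_compose2[OF that]) auto
 have contF2: "continuous_on {0..1} (%t. F phi t p)" if "continuous_on UNIV phi" for phi p
  unfolding F_def
  by (intro continuous_on_compose2[OF cont] continuous_intros continuous_on_compose2[OF that]) auto
 have intF: "(%t. F phi t p) integrable_on {0..1}" if "continuous_on UNIV phi" for phi p
  by (rule integrable_continuous_real[OF contF2[OF that]])
 have contT: "continuous_on UNIV (T phi)" if "continuous_on UNIV phi" for phi
  unfolding T_def
  by (intro continuous_intros continuous_on_integral_01[of _ "%(p, t). F phi t p", simplified]
    continuous_on_subset[OF contF[OF that]]) auto
 have B0: "B >= 0" using B[of 0] by simp
 \<comment> \<open>The weight also keeps the operator inside the bounded functions: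
   \<open>u * exp (- u) <= 1\<close> with \<open>u = 2 * L * |x|\<close>.\<close>
 have boundT: "norm (T phi p) <= B / (2 * L)" if "continuous_on UNIV phi" for phi p
 proof -
  have "norm (integral {0..1} (%t. F phi t p)) <= B * (1 - 0)"
   by (rule integral_bound) (use contF2[OF that] B in \<open>auto simp: F_def\<close>)
  then have "\<bar>p $ 1 * integral {0..1} (%t. F phi t p)\<bar> <= \<bar>p $ 1\<bar> * B"
   by (auto simp: abs_mult intro: mult_left_mono)
  then have "norm (T phi p) <= exp (- 2 * L * \<bar>p $ 1\<bar>) * (\<bar>p $ 1\<bar> * B)"
   by (simp add: T_def abs_mult)
  also have "... = (2 * L * \<bar>p $ 1\<bar>) * exp (- (2 * L * \<bar>p $ 1\<bar>)) * (B / (2 * L))"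
   using L by (simp add: field_simps)
  also have "... <= 1 * (B / (2 * L))"
  proof (rule mult_right_mono)
   have "2 * L * \<bar>p $ 1\<bar> <= exp (2 * L * \<bar>p $ 1\<bar>)"
    using exp_ge_add_one_self[of "2 * L * \<bar>p $ 1\<bar>"] by linarith
   then show "2 * L * \<bar>p $ 1\<bar> * exp (- (2 * L * \<bar>p $ 1\<bar>)) <= 1"
    by (simp add: exp_minus field_simps)
  qed (use L B0 in simp)
  finally show ?thesis by simp
 qed
 have diff: "\<bar>T phi p - T psi p\<bar> <= 1 / 2 * d"
  if c: "continuous_on UNIV phi" "continuous_on UNIV psi" and d: "!!p. \<bar>phi p - psi p\<bar> <= d" for phi psi p d
 proof -
  have d0: "d >= 0" using d[of 0] by simp
  let ?x = "\<bar>p $ 1\<bar>"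
  have E: "((%t. ?x * (L * (exp (2 * L * (t * ?x)) * d))) has_integral
    (exp (2 * L * ?x) - 1) / 2 * d) {0..1}"
  proof -
   have "((%t. ?x * (L * (exp (2 * L * (t * ?x)) * d))) has_integral
    (exp (2 * L * (1 * ?x)) / 2 * d - exp (2 * L * (0 * ?x)) / 2 * d)) {0..1}"
   proof (rule fundamental_theorem_of_calculus)
    fix t :: real
    have "((%t. exp (2 * L * (t * ?x)) / 2 * d) has_real_derivative ?x * (L * (exp (2 * L * (t * ?x)) * d))) (at t within {0..1})"
     by (auto intro!: derivative_eq_intros)
    then show "((%t. exp (2 * L * (t * ?x)) / 2 * d) has_vector_derivative ?x * (L * (exp (2 * L * (t * ?x)) * d))) (at t within {0..1})"
     by (simp add: has_real_derivative_iff_has_vector_derivative)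
   qed simp
   then show ?thesis by (simp add: algebra_simps diff_divide_distrib)
  qed
  have "norm (integral {0..1} (%t. p $ 1 * (F phi t p - F psi t p)))
   <= integral {0..1} (%t. ?x * (L * (exp (2 * L * (t * ?x)) * d)))"
  proof (rule integral_norm_bound_integral)
   show "(%t. p $ 1 * (F phi t p - F psi t p)) integrable_on {0..1}"
    using integrable_on_cmult_left[OF integrable_diff[OF intF[OF c(1)] intF[OF c(2)]], of "p $ 1"] by simp
   show "(%t. ?x * (L * (exp (2 * L * (t * ?x)) * d))) integrable_on {0..1}" using E by blast
   show "norm (p $ 1 * (F phi t p - F psi t p)) <= ?x * (L * (exp (2 * L * (t * ?x)) * d))" for t
   proof -
    let ?e = "exp (2 * L * (t * ?x))"
    have "\<bar>F phi t p - F psi t p\<bar> <= L * \<bar>(p $ 3 + ?e * phi (?s t p)) - (p $ 3 + ?e * psi (?s t p))\<bar>"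
     unfolding F_def by (rule lip)
    also have "\<bar>(p $ 3 + ?e * phi (?s t p)) - (p $ 3 + ?e * psi (?s t p))\<bar> = ?e * \<bar>phi (?s t p) - psi (?s t p)\<bar>"
     by (simp add: abs_mult right_diff_distrib[symmetric])
    also have "L * ... <= L * (?e * d)" using L d by simp
    finally show ?thesis by (simp add: abs_mult mult_left_mono)
   qed
  qed
  also have "... = (exp (2 * L * ?x) - 1) / 2 * d" using E by (rule integral_unique)
  finally have "\<bar>p $ 1 * (integral {0..1} (%t. F phi t p) - integral {0..1} (%t. F psi t p))\<bar> <= (exp (2 * L * ?x) - 1) / 2 * d"
   by (simp add: integral_diff[OF intF[OF c(1)] intF[OF c(2)]])
  then have "exp (- 2 * L * ?x) * \<bar>p $ 1 * (integral {0..1} (%t. F phi t p) - integral {0..1} (%t. F psi t p))\<bar>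
   <= exp (- 2 * L * ?x) * ((exp (2 * L * ?x) - 1) / 2 * d)" by simp
  also have "... = (1 - exp (- 2 * L * ?x)) / 2 * d"
   by (simp add: exp_minus field_simps)
  also have "... <= 1 / 2 * d" using d0 by (intro mult_right_mono) auto
  finally have fin: "exp (- 2 * L * ?x) * \<bar>p $ 1 * (integral {0..1} (%t. F phi t p) - integral {0..1} (%t. F psi t p))\<bar>
   <= 1 / 2 * d" .
  have "T phi p - T psi p = exp (- 2 * L * ?x) * (p $ 1 * (integral {0..1} (%t. F phi t p) - integral {0..1} (%t. F psi t p)))"
   by (simp add: T_def algebra_simps)
  then show ?thesis using fin by (simp only: abs_mult abs_exp_cancel)
 qed
 define TT where "TT phi = Bcontfun (T (apply_bcontfun phi))" for phi :: "(real^3) \<Rightarrow>\<^sub>C real"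
 have TT: "apply_bcontfun (TT phi) = T (apply_bcontfun phi)" for phi
  unfolding TT_def
  by (rule Bcontfun_inverse, rule bcontfun_normI[OF contT boundT]) auto
 have "\<forall>phi psi. dist (TT phi) (TT psi) <= 1 / 2 * dist phi psi"
 proof (intro allI dist_bound)
  fix phi psi p
  show "dist (apply_bcontfun (TT phi) p) (apply_bcontfun (TT psi) p) <= 1 / 2 * dist phi psi"
   unfolding TT dist_real_def
   by (rule diff) (use dist_bounded[of phi _ psi] in \<open>auto simp: dist_real_def\<close>)
 qed
 then have "\<exists>!phi. TT phi = phi" by (intro banach_fix_type[of "1 / 2"]) auto
 then obtain phi0 where phi0: "TT phi0 = phi0" by blast
 define phi where "phi = apply_bcontfun phi0"
 have phi: "T phi = phi" "continuous_on UNIV phi" using TT[of phi0] by (simp_all add: phi0 phi_def)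
 show ?thesis
 proof
  let ?Z = "%p. p $ 3 + exp (2 * L * \<bar>p $ 1\<bar>) * phi p"
  show "continuous_on UNIV ?Z" by (intro continuous_intros phi(2))
  fix p :: "real^3"
  have "integral {0..1} (%t. F phi t p) = integral {0..1} (%t. g (vec3 (t * p $ 1) (p $ 2) (?Z (?s t p))))"
   by (rule integral_cong) (simp add: F_def abs_mult mult.assoc)
  moreover have "exp (2 * L * \<bar>p $ 1\<bar>) * phi p = p $ 1 * integral {0..1} (%t. F phi t p)"
  proof -
   have "phi p = exp (- 2 * L * \<bar>p $ 1\<bar>) * (p $ 1 * integral {0..1} (%t. F phi t p))"
    using fun_cong[OF phi(1), of p] by (simp add: T_def)
   then have "exp (2 * L * \<bar>p $ 1\<bar>) * phi p = exp (2 * L * \<bar>p $ 1\<bar>) * (exp (- 2 * L * \<bar>p $ 1\<bar>) * (p $ 1 * integral {0..1} (%t. F phi t p)))"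
    by (rule arg_cong)
   then show ?thesis by (simp add: exp_minus)
  qed
  ultimately show "?Z p = p $ 3 + p $ 1 * integral {0..1} (%t. g (vec3 (t * p $ 1) (p $ 2) (?Z (?s t p))))"
   by simp
 qed
qed

text \<open>The derivative of the solution with respect to the initial value and the parameter is given by
 integrals along the solution, so that each derivative of the solution is expressed by derivatives
 of lower order.\<close>

lemma scalar_ode_flow:
 fixes g :: "real^3 => real"
 assumes g: "Cinf_on UNIV g" and B: "!!p. \<bar>g p\<bar> <= B"
  and L: "!!p. \<bar>fd g p (axis 3 1)\<bar> <= L"
 obtains Z where "Cinf_on UNIV Z" "!!y z. Z (vec3 0 y z) = z"
  "!!p. fd Z p (axis 1 1) = g (vec3 (p $ 1) (p $ 2) (Z p))"
  "!!p. fd Z p (axis 3 1) > 0"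
  "!!p. \<bar>Z p - p $ 3\<bar> <= B * \<bar>p $ 1\<bar>"
proof -
 let ?D = "%i p. fd g p (axis i 1)"
 have Dg: "(g has_derivative fd g p) (at p)" for p
  using Cinf_on_has_derivative[OF g] by simp
 have lin: "linear (fd g p)" for p
  using Dg has_derivative_linear by blast
 have smD: "Cinf_on UNIV (?D i)" for i by (rule Cinf_on_derivative[OF g])
 have cg: "continuous_on UNIV g" and cD: "continuous_on UNIV (?D i)" for i
  using Cinf_on_continuous g smD by blast+
 have partial: "((%z. g (vec3 x (y + z * a) (c + z * b))) has_real_derivative
   a * ?D 2 (vec3 x (y + z * a) (c + z * b)) + b * ?D 3 (vec3 x (y + z * a) (c + z * b))) (at z)" for x y a b c z
 proof -
  let ?q = "%z. vec3 x (y + z * a) (c + z * b)"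
  have "((%z. vec3 x y c + z *\<^sub>R vec3 0 a b) has_derivative (%r. r *\<^sub>R vec3 0 a b)) (at z)"
   by (auto intro!: derivative_eq_intros)
  moreover have "(%z. vec3 x y c + z *\<^sub>R vec3 0 a b) = ?q"
   by (auto simp: fun_eq_iff vec_eq_iff forall_3)
  ultimately have "(?q has_derivative (%r. r *\<^sub>R vec3 0 a b)) (at z)" by simp
  from has_derivative_compose[OF this Dg]
  have "((%z. g (?q z)) has_derivative (%r. fd g (?q z) (r *\<^sub>R vec3 0 a b))) (at z)" .
  moreover have "fd g (?q z) (r *\<^sub>R vec3 0 a b) = (a * ?D 2 (?q z) + b * ?D 3 (?q z)) * r" for r
   by (subst linear_real3[OF lin]) (simp add: algebra_simps)
  ultimately show ?thesis by (simp add: has_field_derivative_def)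
 qed
 \<comment> \<open>The constant is enlarged to \<open>|L| + 1\<close> because the existence theorem
   asks for a positive one.\<close>
 have lip: "\<bar>g (vec3 x y z) - g (vec3 x y z')\<bar> <= (\<bar>L\<bar> + 1) * \<bar>z - z'\<bar>" for x y z z'
 proof -
  have "norm (g (vec3 x (y + z * 0) (0 + z * 1)) - g (vec3 x (y + z' * 0) (0 + z' * 1))) <= (\<bar>L\<bar> + 1) * norm (z - z')"
  proof (rule field_differentiable_bound[OF convex_UNIV has_field_derivative_at_within[OF partial[of x y 0 0 1]]])
   show "norm (0 * ?D 2 (vec3 x (y + z * 0) (0 + z * 1)) + 1 * ?D 3 (vec3 x (y + z * 0) (0 + z * 1))) <= \<bar>L\<bar> + 1" for z
    using L[of "vec3 x y z"] by simp
  qed auto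
  then show ?thesis by simp
 qed
 obtain Z where contZ: "continuous_on UNIV Z"
  and Z: "!!p. Z p = p $ 3 + p $ 1 * integral {0..1} (%t. g (vec3 (t * p $ 1) (p $ 2) (Z (vec3 (t * p $ 1) (p $ 2) (p $ 3)))))"
 proof (rule scalar_ode_solution_exists[OF cg _ B lip])
  show "\<bar>L\<bar> + 1 > 0" by simp
 qed (rule that)
 have Z0: "Z (vec3 0 y z) = z" for y z
  using trans[OF Z[of "vec3 0 y z"], of z] by simp
 have Zx: "((%x. Z (vec3 x y z)) has_real_derivative g (vec3 x y (Z (vec3 x y z)))) (at x)" for x y z
 proof -
  have "continuous_on UNIV (%x. g (vec3 x y (Z (vec3 x y z))))"
   by (intro continuous_on_compose2[OF cg] continuous_intros continuous_on_compose2[OF contZ]) auto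
  from has_derivative_integral_01[OF this] have
   "((%x. z + x * integral {0..1} (%t. g (vec3 (t * x) y (Z (vec3 (t * x) y z))))) has_real_derivative g (vec3 x y (Z (vec3 x y z)))) (at x)"
   using DERIV_add[OF DERIV_const] by fastforce
  moreover have "z + x * integral {0..1} (%t. g (vec3 (t * x) y (Z (vec3 (t * x) y z)))) = Z (vec3 x y z)" for x
   by (rule sym, rule trans[OF Z]) simp
  ultimately show ?thesis by simp
 qed
 let ?s = "%t p::real^3. vec3 (t * p $ 1) (p $ 2) (p $ 3)"
 \<comment> \<open>Solutions of the linearised equation: \<open>exp M0\<close> is the derivative of
   the flow in the initial value, and \<open>exp M0 * N0\<close> is its derivative in the parameter
   \<open>y\<close>.\<close>
 define M0 where "M0 p = p $ 1 * integral {0..1} (%t. ?D 3 (vec3 (t * p $ 1) (p $ 2) (Z (?s t p))))" for p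
 define N0 where "N0 p = p $ 1 * integral {0..1} (%t. exp (- M0 (?s t p)) * ?D 2 (vec3 (t * p $ 1) (p $ 2) (Z (?s t p))))" for p
 have derZ: "(Z has_derivative (%v. v $ 1 * g (vec3 (p $ 1) (p $ 2) (Z p)) + v $ 2 * (exp (M0 p) * N0 p) + v $ 3 * exp (M0 p))) (at p)" for p
 proof -
  let ?y = "p $ 2" and ?z = "p $ 3"
  \<comment> \<open>At the same \<open>x\<close>, \<open>b\<close> is the solution with the initial
    data of \<open>p\<close>; \<open>r\<close> runs on the segment from it to the solution with the
    data of \<open>q\<close>, and \<open>m\<close> averages a partial derivative of \<open>g\<close>
    over that segment.\<close>
  define b where "b q = Z (vec3 (q $ 1) ?y ?z)" for q :: "real^3"
  define r where "r q t = vec3 (q $ 1) (?y + t * (q $ 2 - ?y)) (b q + t * (Z q - b q))" for q t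
  define m where "m i q = integral {0..1} (%t. ?D i (r q t))" for i q
  define M where "M q = q $ 1 * integral {0..1} (%t. m 3 (?s t q))" for q
  define N where "N q = q $ 1 * integral {0..1} (%t. exp (- M (?s t q)) * m 2 (?s t q))" for q
  define C1 where "C1 q = integral {0..1} (%t. g (vec3 (p $ 1 + t * (q $ 1 - p $ 1)) ?y (Z (vec3 (p $ 1 + t * (q $ 1 - p $ 1)) ?y ?z))))" for q :: "real^3"
  have cb: "continuous_on UNIV b" unfolding b_def
   by (intro continuous_intros continuous_on_compose2[OF contZ]) auto
  have cr: "continuous_on UNIV (%(q, t). r q t)" unfolding r_def case_prod_beta'
   by (intro continuous_intros continuous_on_compose2[OF cb] continuous_on_compose2[OF contZ]) auto
  have cDr: "continuous_on UNIV (%(q, t). ?D i (r q t))" for i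
   using continuous_on_compose2[OF cD[of i] cr] by (simp add: case_prod_beta')
  have cm: "continuous_on UNIV (m i)" for i unfolding m_def
   by (rule continuous_on_integral_01[of _ "%(q, t). ?D i (r q t)", simplified])
    (rule continuous_on_subset[OF cDr], simp)
  have cms: "continuous_on UNIV (%(q, t). m i (?s t q))" for i unfolding case_prod_beta'
   by (intro continuous_intros continuous_on_compose2[OF cm]) auto
  have cM: "continuous_on UNIV M" unfolding M_def
   by (intro continuous_intros continuous_on_integral_01[of _ "%(q, t). m 3 (?s t q)", simplified])
    (rule continuous_on_subset[OF cms], simp)
  have cN: "continuous_on UNIV N" unfolding N_def
  proof (intro continuous_intros continuous_on_integral_01[of _ "%(q, t). exp (- M (?s t q)) * m 2 (?s t q)", simplified])
   show "continuous_on (UNIV \<times> {0..1}) (%(q, t). exp (- M (?s t q)) * m 2 (?s t q))"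
    unfolding case_prod_beta'
    by (intro continuous_intros continuous_on_compose2[OF cM] continuous_on_compose2[OF cm]) auto
  qed
  have cC1: "continuous_on UNIV C1" unfolding C1_def
  proof (rule continuous_on_integral_01[of _ "%(q, t). g (vec3 (p $ 1 + t * (q $ 1 - p $ 1)) ?y (Z (vec3 (p $ 1 + t * (q $ 1 - p $ 1)) ?y ?z)))", simplified])
   show "continuous_on (UNIV \<times> {0..1}) (%(q, t). g (vec3 (p $ 1 + t * (q $ 1 - p $ 1)) ?y (Z (vec3 (p $ 1 + t * (q $ 1 - p $ 1)) ?y ?z))))"
    unfolding case_prod_beta'
    by (intro continuous_on_compose2[OF cg] continuous_intros continuous_on_compose2[OF contZ]) auto
  qed
  \<comment> \<open>The difference of two solutions satisfies a linear equation exactly, with the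
    averages \<open>m\<close> as coefficients, and the integrating factor \<open>exp (- M)\<close>
    solves it. The increment formula obtained has no remainder, as Caratheodory's criterion
    requires.\<close>
  have step: "Z (vec3 x y' z') - Z (vec3 x ?y ?z) = exp (M (vec3 x y' z')) * ((z' - ?z) + (y' - ?y) * N (vec3 x y' z'))" for x y' z'
  proof -
   define d where "d s = Z (vec3 s y' z') - Z (vec3 s ?y ?z)" for s
   let ?M = "%s. M (vec3 s y' z')" and ?N = "%s. N (vec3 s y' z')" and ?m = "%i s. m i (vec3 s y' z')"
   have d': "(d has_real_derivative ?m 3 s * d s + ?m 2 s * (y' - ?y)) (at s)" for s
   proof -
    let ?zb = "Z (vec3 s ?y ?z)" and ?z' = "Z (vec3 s y' z')"
    let ?P = "%t. (y' - ?y) * ?D 2 (r (vec3 s y' z') t) + d s * ?D 3 (r (vec3 s y' z') t)"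
    have "g (vec3 s (?y + 1 * (y' - ?y)) (?zb + 1 * d s)) - g (vec3 s (?y + 0 * (y' - ?y)) (?zb + 0 * d s))
     = (1 - 0) * integral {0..1} (%t. (%t. (y' - ?y) * ?D 2 (vec3 s (?y + t * (y' - ?y)) (?zb + t * d s)) + d s * ?D 3 (vec3 s (?y + t * (y' - ?y)) (?zb + t * d s))) (0 + t * (1 - 0)))"
     by (rule ftc_segment[where phi = "%z. g (vec3 s (?y + z * (y' - ?y)) (?zb + z * d s))"]) (rule partial)
    then have "g (vec3 s y' ?z') - g (vec3 s ?y ?zb) = integral {0..1} ?P"
     by (simp add: d_def r_def b_def)
    also have "... = (y' - ?y) * ?m 2 s + d s * ?m 3 s"
    proof -
     have "(%t. ?D i (r (vec3 s y' z') t)) integrable_on {0..1}" for i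
     proof (rule integrable_continuous_real)
      show "continuous_on {0..1} (%t. ?D i (r (vec3 s y' z') t))" unfolding r_def
       by (intro continuous_on_compose2[OF cD] continuous_intros) auto
     qed
     then have "(%t. c * ?D i (r (vec3 s y' z') t)) integrable_on {0..1}" for i c
      using integrable_cmul[of "%t. ?D i (r (vec3 s y' z') t)" "{0..1}" c] by simp
     then show ?thesis unfolding m_def by (simp add: integral_add)
    qed
    finally show ?thesis unfolding d_def
     by (auto intro!: derivative_eq_intros Zx simp: d_def algebra_simps)
   qed
   have cms': "continuous_on UNIV (?m i)" for i
    by (intro continuous_on_compose2[OF cm] continuous_intros) auto
   have M': "(?M has_real_derivative ?m 3 s) (at s)" for s
    using has_derivative_integral_01[OF cms'[of 3]] by (simp add: M_def)
   have N': "(?N has_real_derivative exp (- ?M s) * ?m 2 s) (at s)" for s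
   proof -
    have "continuous_on UNIV (%s. exp (- ?M s) * ?m 2 s)"
     by (intro continuous_intros cms' continuous_on_compose2[OF cM]) auto
    from has_derivative_integral_01[OF this] show ?thesis by (simp add: N_def)
   qed
   have "((%s. exp (- ?M s) * d s - (y' - ?y) * ?N s) has_real_derivative 0) (at s)" for s
    by (auto intro!: derivative_eq_intros M' N' d' simp: algebra_simps)
   then have "exp (- ?M x) * d x - (y' - ?y) * ?N x = exp (- ?M 0) * d 0 - (y' - ?y) * ?N 0"
    by (intro DERIV_isconst_all) blast
   also have "... = z' - ?z" by (simp add: M_def N_def d_def Z0)
   finally have "exp (- ?M x) * d x = (z' - ?z) + (y' - ?y) * ?N x" by simp
   then have "exp (?M x) * (exp (- ?M x) * d x) = exp (?M x) * ((z' - ?z) + (y' - ?y) * ?N x)" by simp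
   moreover have "exp (?M x) * (exp (- ?M x) * d x) = d x" by (simp add: exp_minus)
   ultimately show ?thesis by (metis d_def)
  qed
  have "(Z has_derivative (%v. v $ 1 * C1 p + v $ 2 * (exp (M p) * N p) + v $ 3 * exp (M p))) (at p)"
  proof (rule has_derivative_Caratheodory3[OF open_UNIV UNIV_I])
   fix q :: "real^3"
   have "Z q - Z p = (Z q - Z (vec3 (q $ 1) ?y ?z)) + (Z (vec3 (q $ 1) ?y ?z) - Z (vec3 (p $ 1) ?y ?z))"
    by (simp add: vec3_eta)
   also have "Z q - Z (vec3 (q $ 1) ?y ?z) = exp (M q) * ((q $ 3 - ?z) + (q $ 2 - ?y) * N q)"
    using step[of "q $ 1" "q $ 2" "q $ 3"] by (simp add: vec3_eta)
   also have "Z (vec3 (q $ 1) ?y ?z) - Z (vec3 (p $ 1) ?y ?z) = (q $ 1 - p $ 1) * C1 q"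
    unfolding C1_def by (rule ftc_segment[OF Zx])
   finally show "Z q - Z p = (q $ 1 - p $ 1) * C1 q + (q $ 2 - ?y) * (exp (M q) * N q) + (q $ 3 - ?z) * exp (M q)"
    by (simp add: algebra_simps)
  next
   show "isCont C1 p" "isCont (%q. exp (M q) * N q) p" "isCont (%q. exp (M q)) p"
    using cM cN cC1 by (auto simp: continuous_on_eq_continuous_at intro!: continuous_intros)
  qed
  moreover have mp: "m i (?s t p) = ?D i (vec3 (t * p $ 1) ?y (Z (?s t p)))" for i t
   by (simp add: m_def r_def b_def)
  then have "M (?s t p) = M0 (?s t p)" for t
   using mp[of 3] by (simp add: M_def M0_def mult.assoc[symmetric])
  moreover have "M p = M0 p" using mp[of 3] by (simp add: M_def M0_def)
  moreover have "N p = N0 p" using mp[of 2] calculation(2) by (simp add: N_def N0_def)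
  moreover have "C1 p = g (vec3 (p $ 1) ?y (Z p))" by (simp add: C1_def vec3_eta)
  ultimately show ?thesis by simp
 qed
 have CkZ: "Ck_on k UNIV Z" for k
 proof (induction k)
  case (Suc k)
  have lf: "Ck_on k UNIV (%pt :: (real^3) \<times> real. fst pt $ i)" for i
   by (intro Ck_on_bounded_linear bounded_linear_compose[OF bounded_linear_vec_nth bounded_linear_fst]) simp
  have ls: "Ck_on k UNIV (%pt :: (real^3) \<times> real. snd pt)"
   by (intro Ck_on_bounded_linear bounded_linear_snd) simp
  have lv: "Ck_on k UNIV (%p :: real^3. p $ i)" for i
   by (intro Ck_on_bounded_linear bounded_linear_vec_nth) simp
  have Cks: "Ck_on k UNIV (%pt :: (real^3) \<times> real. ?s (snd pt) (fst pt))"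
   by (intro Ck_on_vec3 Ck_on_bilinear[OF _ bounded_bilinear_mult] lf ls) auto
  have CkZs: "Ck_on k UNIV (%pt. Z (?s (snd pt) (fst pt)))"
   by (rule Ck_on_compose[OF open_UNIV open_UNIV Cks Suc subset_UNIV])
  have Ckv: "Ck_on k UNIV (%pt. vec3 (snd pt * fst pt $ 1) (fst pt $ 2) (Z (?s (snd pt) (fst pt))))"
   by (intro Ck_on_vec3 CkZs Ck_on_bilinear[OF _ bounded_bilinear_mult] lf ls) auto
  have CkD: "Ck_on k UNIV (%pt. ?D i (vec3 (snd pt * fst pt $ 1) (fst pt $ 2) (Z (?s (snd pt) (fst pt)))))" for i
   by (rule Ck_on_compose[OF _ open_UNIV Ckv]) (use smD in \<open>auto simp: Cinf_on_def\<close>)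
  have CkM: "Ck_on k UNIV M0" unfolding M0_def
   using Ck_on_integral[OF CkD[of 3]]
   by (intro Ck_on_bilinear[OF _ bounded_bilinear_mult] lv) auto
  have CkE: "Ck_on k UNIV (%p. exp (c * M0 p))" for c
   by (rule Ck_on_compose[OF open_UNIV open_UNIV _ Ck_on_exp subset_UNIV])
    (use CkM in \<open>auto intro!: Ck_on_bilinear[OF _ bounded_bilinear_mult] Ck_on_const\<close>)
  have "Ck_on k UNIV (%pt. exp (- 1 * M0 (?s (snd pt) (fst pt))))"
   by (rule Ck_on_compose[OF open_UNIV open_UNIV Cks CkE subset_UNIV])
  then have "Ck_on k UNIV (%pt. exp (- M0 (?s (snd pt) (fst pt))) * ?D 2 (vec3 (snd pt * fst pt $ 1) (fst pt $ 2) (Z (?s (snd pt) (fst pt)))))"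
   by (intro Ck_on_bilinear[OF _ bounded_bilinear_mult] CkD) auto
  from Ck_on_integral[OF this] have CkN: "Ck_on k UNIV N0" unfolding N0_def
   by (intro Ck_on_bilinear[OF _ bounded_bilinear_mult] lv) auto
  have Ckg: "Ck_on k UNIV (%p. g (vec3 (p $ 1) (p $ 2) (Z p)))"
   by (rule Ck_on_compose[OF open_UNIV open_UNIV _ _ subset_UNIV])
    (use g Suc in \<open>auto simp: Cinf_on_def intro!: Ck_on_vec3 lv\<close>)
  show ?case
   by (rule Ck_on_SucI[OF open_UNIV derZ])
    (use CkE[of 1] in \<open>auto intro!: Ck_on_add Ck_on_bilinear[OF _ bounded_bilinear_mult] Ck_on_const CkN Ckg\<close>)
 qed (simp add: contZ)
 have fZ: "fd Z p = (%v. v $ 1 * g (vec3 (p $ 1) (p $ 2) (Z p)) + v $ 2 * (exp (M0 p) * N0 p) + v $ 3 * exp (M0 p))" for p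
  using frechet_derivative_at[OF derZ] by simp
 show ?thesis
 proof (rule that[of Z])
  show "Cinf_on UNIV Z" by (simp add: Cinf_on_def CkZ)
  show "\<bar>Z p - p $ 3\<bar> <= B * \<bar>p $ 1\<bar>" for p
  proof -
   have "norm (integral {0..1} (%t. g (vec3 (t * p $ 1) (p $ 2) (Z (?s t p))))) <= B * (1 - 0)"
   proof (rule integral_bound)
    show "continuous_on {0..1} (%t. g (vec3 (t * p $ 1) (p $ 2) (Z (?s t p))))"
     by (intro continuous_on_compose2[OF cg] continuous_intros continuous_on_compose2[OF contZ]) auto
   qed (use B in auto)
   then have I: "\<bar>integral {0..1} (%t. g (vec3 (t * p $ 1) (p $ 2) (Z (?s t p))))\<bar> <= B" by simp
   have "Z p - p $ 3 = p $ 1 * integral {0..1} (%t. g (vec3 (t * p $ 1) (p $ 2) (Z (?s t p))))"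
    using Z[of p] by linarith
   then show ?thesis using mult_left_mono[OF I abs_ge_zero[of "p $ 1"]] by (simp only: abs_mult mult.commute)
  qed
 qed (simp_all add: Z0 fZ axis_def)
qed

section \<open>Contact coefficients of covector fields\<close>

abbreviation contact_coeff_vec :: "(real^3 => real^3) => real^3 => real" where
 "contact_coeff_vec A == contact_coeff (%x v. A x \<bullet> v)"

lemma contact_coeff_cong:
 assumes "open V" "x : V" "!!y v. y : V ==> al y v = \<beta> y v"
 shows "contact_coeff al x = contact_coeff \<beta> x"
proof -
 have "fd (%y. al y v) x = fd (%y. \<beta> y v) x" for v
 proof -
  have "((%y. al y v) has_derivative D) (at x) \<longleftrightarrow> ((%y. \<beta> y v) has_derivative D) (at x)" for D
   using assms has_derivative_transform_within_open[of "%y. al y v" D x UNIV V "%y. \<beta> y v"]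
    has_derivative_transform_within_open[of "%y. \<beta> y v" D x UNIV V "%y. al y v"] by auto
  then show ?thesis by (simp add: frechet_derivative_def)
 qed
 moreover have "al x v = \<beta> x v" for v using assms by blast
 ultimately show ?thesis by (simp add: contact_coeff_def wedge12_def ext_deriv_def)
qed

lemma ext_deriv_vec:
 assumes "(A has_derivative D) (at x)"
 shows "ext_deriv (%x v. A x \<bullet> v) x u v = D u \<bullet> v - D v \<bullet> u"
proof -
 have "fd (%y. A y \<bullet> w) x = (%h. D h \<bullet> w)" for w
  using frechet_derivative_at[OF has_derivative_inner_left[OF assms]] by simp
 then show ?thesis by (simp add: ext_deriv_def)
qed

text \<open>The vector \<open>c\<close> is the curl of a field with derivative \<open>D\<close>: in
  dimension three the exterior derivative of a 1-form is the triple product with the curl.\<close>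

lemma alternating_form_eq_cross3:
 fixes D :: "real^3 => real^3"
 assumes "linear D"
 defines "c == vec3 (D (axis 2 1) $ 3 - D (axis 3 1) $ 2) (D (axis 3 1) $ 1 - D (axis 1 1) $ 3)
  (D (axis 1 1) $ 2 - D (axis 2 1) $ 1)"
 shows "D u \<bullet> v - D v \<bullet> u = c \<bullet> cross3 u v"
 using linear_real3[OF assms(1), of u] linear_real3[OF assms(1), of v]
 by (simp add: c_def cross3_def inner_vec_def sum_3 algebra_simps)

text \<open>This is the classical expression of \<open>A\<close> dotted with its curl.\<close>

lemma contact_coeff_vec_eq:
 assumes "(A has_derivative D) (at x)"
 shows "contact_coeff_vec A x = A x \<bullet> vec3 (D (axis 2 1) $ 3 - D (axis 3 1) $ 2)
  (D (axis 3 1) $ 1 - D (axis 1 1) $ 3) (D (axis 1 1) $ 2 - D (axis 2 1) $ 1)"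
proof -
 have [simp]: "cross3 (axis 2 1) (axis 3 1) = axis 1 1" "cross3 (axis 1 1) (axis 3 1) = - axis 2 1"
  "cross3 (axis 1 1) (axis 2 1) = (axis 3 1 :: real^3)"
  by (simp_all add: cross3_def vec_eq_iff forall_3 axis_def)
 have a: "w \<bullet> axis i 1 = w $ i" for w :: "real^3" and i by (simp add: inner_axis)
 show ?thesis
  unfolding contact_coeff_def wedge12_def ext_deriv_vec[OF assms]
   alternating_form_eq_cross3[OF has_derivative_linear[OF assms]]
  by (simp add: a inner_minus_right) (simp add: inner_vec_def sum_3 right_diff_distrib)
qed

text \<open>The term containing the derivative of \<open>g\<close> drops out, as it is wedged with
  \<open>A\<close> twice.\<close>

lemma contact_coeff_vec_scale:
 assumes "(A has_derivative D) (at x)" "(g has_derivative G) (at x)"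
 shows "contact_coeff_vec (%y. g y *\<^sub>R A y) x = (g x)\<^sup>2 * contact_coeff_vec A x"
proof -
 have 1: "((%y. g y *\<^sub>R A y) has_derivative (%v. g x *\<^sub>R D v + G v *\<^sub>R A x)) (at x)"
  by (rule has_derivative_scaleR[OF assms(2,1)])
 show ?thesis
  unfolding contact_coeff_vec_eq[OF 1] contact_coeff_vec_eq[OF assms(1)]
  by (simp add: inner_vec_def sum_3 power2_eq_square algebra_simps)
qed

text \<open>Exterior differentiation commutes with pullback: the second derivatives of
  \<open>T\<close> enter symmetrically and cancel. What remains is the pullback of a form of top
  degree, which contributes the determinant.\<close>

lemma contact_coeff_vec_pullback:
 fixes T :: "real^3 => real^3"
 assumes T: "Cinf_on U T" "x : U" and A: "(A has_derivative D) (at (T x))"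
  and B: "!!y v. y : U ==> B y \<bullet> v = A (T y) \<bullet> fd T y v"
 shows "contact_coeff_vec B x = det (matrix (fd T x)) * contact_coeff_vec A (T x)"
proof -
 let ?M = "fd T x"
 let ?E = "%v. fd (%y. frechet_derivative T (at y) v) x"
 have M: "(T has_derivative ?M) (at x)" by (rule Cinf_on_has_derivative[OF T])
 have linM: "linear ?M" using has_derivative_linear[OF M] .
 have linD: "linear D" using has_derivative_linear[OF A] .
 have dB: "((%y. B y \<bullet> v) has_derivative (%h. A (T x) \<bullet> ?E v h + D (?M h) \<bullet> ?M v)) (at x)" for v
 proof -
  have "((%y. fd T y v) has_derivative ?E v) (at x)"
   by (rule Cinf_on_has_derivative[OF Cinf_on_derivative[OF T(1)] T(2)])
  from has_derivative_inner[OF has_derivative_compose[OF M A] this]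
  have "((%y. A (T y) \<bullet> fd T y v) has_derivative
    (%h. A (T x) \<bullet> ?E v h + D (?M h) \<bullet> ?M v)) (at x)" .
  then show ?thesis
   by (rule has_derivative_transform_within_open[OF _ Cinf_on_open[OF T(1)] T(2)]) (simp add: B)
 qed
 have ext: "ext_deriv (%x v. B x \<bullet> v) x u v = D (?M u) \<bullet> ?M v - D (?M v) \<bullet> ?M u" for u v
  using symmetric_second_derivative[OF T, of u v]
  by (simp add: ext_deriv_def frechet_derivative_at[OF dB, symmetric])
 define c where "c = vec3 (D (axis 2 1) $ 3 - D (axis 3 1) $ 2) (D (axis 3 1) $ 1 - D (axis 1 1) $ 3)
  (D (axis 1 1) $ 2 - D (axis 2 1) $ 1)"
 define m1 m2 m3 where "m1 = ?M (axis 1 1)" and "m2 = ?M (axis 2 1)" and "m3 = ?M (axis 3 1)"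
 have "contact_coeff_vec B x = (A (T x) \<bullet> m1) * (c \<bullet> cross3 m2 m3) - (A (T x) \<bullet> m2) * (c \<bullet> cross3 m1 m3)
   + (A (T x) \<bullet> m3) * (c \<bullet> cross3 m1 m2)"
  unfolding contact_coeff_def wedge12_def ext
  by (simp add: B[OF T(2)] alternating_form_eq_cross3[OF linD] c_def m1_def m2_def m3_def)
 also have "... = (m1 \<bullet> cross3 m2 m3) * (A (T x) \<bullet> c)"
  by (simp add: cross3_def inner_vec_def sum_3 algebra_simps)
 finally show ?thesis
  using linear_inverse_real3(1)[OF linM] contact_coeff_vec_eq[OF A] by (simp add: c_def m1_def m2_def m3_def)
qed

lemma covector_proportional:
 fixes a b :: "'v::real_inner"
 assumes "!!v. a \<bullet> v = 0 \<longleftrightarrow> b \<bullet> v = 0" "a ~= 0"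
 shows "b = ((b \<bullet> a) / (a \<bullet> a)) *\<^sub>R a" "b \<bullet> a ~= 0"
proof -
 let ?v = "b - ((b \<bullet> a) / (a \<bullet> a)) *\<^sub>R a"
 have aa: "a \<bullet> a ~= 0" using assms(2) by simp
 have 1: "a \<bullet> ?v = 0" using aa by (simp add: inner_diff_right inner_commute)
 then have "b \<bullet> ?v = 0" using assms(1) by blast
 with 1 have "?v \<bullet> ?v = 0" by (simp add: inner_diff_left)
 then show "b = ((b \<bullet> a) / (a \<bullet> a)) *\<^sub>R a" by simp
 show "b \<bullet> a ~= 0" using assms(1)[of a] aa by simp
qed

section \<open>The normal form k dx + h dy + dz\<close>

definition nf_covector :: "(real^3 => real) => (real^3 => real) => real^3 => real^3" where
 "nf_covector h k x = vec3 (k x) (h x) 1"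

text \<open>The coefficient of \<open>A\<close> wedged with \<open>dA\<close> for
  \<open>A = k dx + h dy + dz\<close>. It is affine in \<open>h\<close> for fixed \<open>k\<close>,
  which makes perturbations of \<open>h\<close> easy to control, and for \<open>k = 0\<close> it
  reduces to the x-derivative of \<open>h\<close>.\<close>

definition nf_contact :: "(real^3 => real) => (real^3 => real) => real^3 => real" where
 "nf_contact h k x = fd h x (axis 1 1) - fd k x (axis 2 1)
  - k x * fd h x (axis 3 1) + h x * fd k x (axis 3 1)"

lemma nf_covector_inner: "nf_covector h k x \<bullet> v = k x * v $ 1 + h x * v $ 2 + v $ 3"
 by (simp add: nf_covector_def inner_vec_def sum_3)

lemma has_derivative_nf_covector:
 assumes "(h has_derivative h') (at x)" "(k has_derivative k') (at x)"
 shows "(nf_covector h k has_derivative (%v. vec3 (k' v) (h' v) 0)) (at x)"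
proof -
 have "((%x. k x *\<^sub>R axis 1 1 + h x *\<^sub>R axis 2 1 + 1 *\<^sub>R axis 3 1 :: real^3) has_derivative
   (%v. k' v *\<^sub>R axis 1 1 + h' v *\<^sub>R axis 2 1 + 0 *\<^sub>R axis 3 1)) (at x)"
  by (auto intro!: derivative_eq_intros assms)
 then show ?thesis unfolding nf_covector_def[abs_def] vec3_decomp .
qed

lemma contact_coeff_nf:
 assumes "h differentiable (at x)" "k differentiable (at x)"
 shows "contact_coeff_vec (nf_covector h k) x = nf_contact h k x"
 using contact_coeff_vec_eq[OF has_derivative_nf_covector[OF assms[unfolded frechet_derivative_works]]]
 by (simp add: nf_contact_def nf_covector_inner algebra_simps)

lemma Cinf_on_nf_covector: "Cinf_on V h ==> Cinf_on V k ==> Cinf_on V (nf_covector h k)"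
 unfolding nf_covector_def[abs_def] by (intro smooth_intros) (auto intro: Cinf_on_open)

lemma smooth_on_open_iff:
 assumes o: "open S"
 shows "smooth_on S f \<longleftrightarrow> Cinf_on S f"
proof
 assume f: "smooth_on S f"
 show "Cinf_on S f"
 proof (rule Cinf_on_local[OF o])
  fix x assume "x : S"
  then have "\<exists>T g. open T & x : T & (\<forall>k. Ck_on k T g) & (\<forall>y\<in>S Int T. g y = f y)"
   using f by (simp add: smooth_on_def)
  then obtain T g where T: "open T" "x : T" "\<forall>k. Ck_on k T g" "\<forall>y\<in>S Int T. g y = f y"
   by (elim exE conjE)
  have "Cinf_on (S Int T) g" using o T Ck_on_subset[of _ T g "S Int T"] by (simp add: Cinf_on_def open_Int)
  then have "Cinf_on (S Int T) f" by (rule Cinf_on_cong) (use T(4) in blast)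
  then show "\<exists>U. x : U & Cinf_on U f" using \<open>x : S\<close> T(2) by blast
 qed
next
 assume "Cinf_on S f"
 then show "smooth_on S f"
  using o unfolding smooth_on_def Cinf_on_def by (intro ballI exI[of _ S] exI[of _ f]) simp
qed

section \<open>Charts and tangent vectors\<close>

lemma matrix_det_compose:
 fixes f g :: "real^'n => real^'n"
 assumes "linear f" "linear g"
 shows "det (matrix (%x. g (f x))) = det (matrix g) * det (matrix f)"
 using matrix_compose[OF assms] by (simp add: o_def det_mul)

locale closed_manifold =
 fixes M :: "'a manifold3"
 assumes closed_manifold: "closed_oriented_3manifold M"
begin

lemma oriented_manifold: "oriented_3manifold M"
 using closed_manifold by (simp add: closed_oriented_3manifold_def)

lemma compact_points: "compact_space (mtop M)"
 using closed_manifold by (simp add: closed_oriented_3manifold_def)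

lemma Hausdorff_points: "Hausdorff_space (mtop M)"
 using oriented_manifold by (simp add: oriented_3manifold_def)

lemma atlas_is_chart: "c : atlas M ==> is_chart (mtop M) c"
 using oriented_manifold by (simp add: oriented_3manifold_def)

lemma atlas_compatible: "c : atlas M ==> d : atlas M ==> oriented_compatible c d"
 using oriented_manifold by (simp add: oriented_3manifold_def)

lemma atlas_maximal:
 "is_chart (mtop M) c ==> (!!d. d : atlas M ==> oriented_compatible c d) ==> c : atlas M"
 using oriented_manifold unfolding oriented_3manifold_def by blast

lemma ex_chart: "p : points M ==> \<exists>c. c : charts_at M p"
proof -
 assume "p : points M"
 moreover have "(\<Union>c\<in>atlas M. cdom c) = points M"
  using oriented_manifold by (simp add: oriented_3manifold_def)
 ultimately obtain c where "c : atlas M" "p : cdom c" by blast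
 then show ?thesis unfolding charts_at_def by blast
qed

lemma charts_atD: "c : charts_at M p ==> c : atlas M & p : cdom c"
 by (simp add: charts_at_def)

lemma openin_cdom: "c : atlas M ==> openin (mtop M) (cdom c)"
 using atlas_is_chart by (simp add: is_chart_def)

lemma cdom_subset: "c : atlas M ==> cdom c <= points M"
 using openin_cdom openin_subset by blast

lemma open_cimage: "c : atlas M ==> open (cimage c)"
 using atlas_is_chart by (simp add: is_chart_def)

lemma chart_homeo: "c : atlas M ==> homeomorphic_map (subtopology (mtop M) (cdom c)) (top_of_set (cimage c)) (cmap c)"
 using atlas_is_chart by (simp add: is_chart_def)

lemma inj_on_cmap: "c : atlas M ==> inj_on (cmap c) (cdom c)"
proof -
 assume c: "c : atlas M"
 have "topspace (subtopology (mtop M) (cdom c)) = cdom c"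
  using cdom_subset[OF c] by (auto simp: topspace_subtopology)
 then show ?thesis using homeomorphic_imp_injective_map[OF chart_homeo[OF c]] by simp
qed

lemma cinv_cmap: "c : atlas M ==> p : cdom c ==> cinv c (cmap c p) = p"
 by (rule inv_into_f_f[OF inj_on_cmap])

lemma cmap_cinv: "x : cimage c ==> cmap c (cinv c x) = x"
 by (rule f_inv_into_f)

lemma cinv_cdom: "x : cimage c ==> cinv c x : cdom c"
 by (rule inv_into_into)

lemma cinv_charts_at: "c : atlas M ==> x : cimage c ==> c : charts_at M (cinv c x)"
 by (simp add: charts_at_def cinv_cdom)

lemma open_cmap_image:
 assumes c: "c : atlas M" and U: "openin (mtop M) U"
 shows "open (cmap c ` (cdom c Int U))"
proof -
 have "openin (subtopology (mtop M) (cdom c)) (cdom c Int U)"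
  using U by (rule openin_subtopology_Int2)
 then have "openin (top_of_set (cimage c)) (cmap c ` (cdom c Int U))"
  using homeomorphic_imp_open_map[OF chart_homeo[OF c]] by (simp add: open_map_def)
 then show ?thesis using open_cimage[OF c] openin_open_trans by blast
qed

lemma openin_chart_preimage:
 assumes c: "c : atlas M" and V: "open V"
 shows "openin (mtop M) {p : cdom c. cmap c p : V}"
proof -
 have "openin (top_of_set (cimage c)) (cimage c Int V)" using V by (simp add: openin_open_Int)
 from openin_continuous_map_preimage[OF homeomorphic_imp_continuous_map[OF chart_homeo[OF c]] this]
 have "openin (subtopology (mtop M) (cdom c)) {p : topspace (subtopology (mtop M) (cdom c)). cmap c p : cimage c Int V}" .
 moreover have "{p : topspace (subtopology (mtop M) (cdom c)). cmap c p : cimage c Int V} = {p : cdom c. cmap c p : V}"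
  using cdom_subset[OF c] by (auto simp: topspace_subtopology)
 ultimately show ?thesis using openin_cdom[OF c] openin_trans_full by metis
qed

lemma chart_preimage_eq: "c : atlas M ==> V <= cimage c ==> {p : cdom c. cmap c p : V} = cinv c ` V"
proof (intro equalityI subsetI)
 fix p assume c: "c : atlas M" and p: "p : {p : cdom c. cmap c p : V}"
 then have "p = cinv c (cmap c p)" by (simp add: cinv_cmap)
 then show "p : cinv c ` V" using p by blast
next
 fix p assume c: "c : atlas M" and V: "V <= cimage c" and "p : cinv c ` V"
 then obtain x where x: "x : V" "p = cinv c x" by blast
 then have "x : cimage c" using V by blast
 then show "p : {p : cdom c. cmap c p : V}" using x by (simp add: cinv_cdom cmap_cinv)
qed

lemma openin_cinv_image: "c : atlas M ==> open V ==> V <= cimage c ==> openin (mtop M) (cinv c ` V)"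
 using openin_chart_preimage[of c V] chart_preimage_eq[of c V] by simp

lemma open_overlap: "c : atlas M ==> d : atlas M ==> open (cmap c ` (cdom c Int cdom d))"
 by (rule open_cmap_image[OF _ openin_cdom])

lemma Cinf_on_transition:
 "c : atlas M ==> d : atlas M ==> Cinf_on (cmap c ` (cdom c Int cdom d)) (transition c d)"
 using atlas_compatible[of c d] smooth_on_open_iff[OF open_overlap[of c d], of "transition c d"]
 by (simp only: oriented_compatible_def)

lemma transition_cmap: "c : atlas M ==> p : cdom c ==> transition c d (cmap c p) = cmap d p"
 by (simp add: cinv_cmap)

lemma transition_det:
 "c : atlas M ==> d : atlas M ==> p : cdom c ==> p : cdom d ==>
 det (matrix (fd (transition c d) (cmap c p))) > 0"
 using atlas_compatible[of c d] by (simp add: oriented_compatible_def)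

lemma transition_has_derivative:
 assumes "c : charts_at M p" "d : charts_at M p"
 shows "(transition c d has_derivative fd (transition c d) (cmap c p)) (at (cmap c p))"
 using assms by (intro Cinf_on_has_derivative[OF Cinf_on_transition]) (auto simp: charts_at_def)

lemma transition_linear:
 "c : charts_at M p ==> d : charts_at M p ==> linear (fd (transition c d) (cmap c p))"
 using transition_has_derivative has_derivative_linear by blast

lemma transition_chain:
 assumes "c : charts_at M p" "d : charts_at M p" "e : charts_at M p"
 shows "fd (transition d e) (cmap d p) (fd (transition c d) (cmap c p) v)
  = fd (transition c e) (cmap c p) v"
proof -
 have c: "c : atlas M" "p : cdom c" "d : atlas M" "p : cdom d" using assms by (auto simp: charts_at_def)
 have eq: "transition c d (cmap c p) = cmap d p" using c by (simp add: cinv_cmap)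
 have "((%x. transition d e (transition c d x)) has_derivative
   (%v. fd (transition d e) (cmap d p) (fd (transition c d) (cmap c p) v)))
   (at (cmap c p))"
  using has_derivative_compose[OF transition_has_derivative[OF assms(1,2)]] transition_has_derivative[OF assms(2,3)]
  unfolding eq by blast
 then have "(transition c e has_derivative
   (%v. fd (transition d e) (cmap d p) (fd (transition c d) (cmap c p) v)))
   (at (cmap c p))"
  by (rule has_derivative_transform_within_open[OF _ open_overlap[OF c(1,3)]])
   (use c in \<open>auto simp: cinv_cmap\<close>)
 from frechet_derivative_at[OF this] show ?thesis by metis
qed

lemma transition_same:
 assumes "c : charts_at M p"
 shows "fd (transition c c) (cmap c p) v = v"
proof -
 have c: "c : atlas M" "p : cdom c" using assms by (auto simp: charts_at_def)
 have "((%x. x) has_derivative (%v. v)) (at (cmap c p))" by simp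
 then have "(transition c c has_derivative (%v. v)) (at (cmap c p))"
  by (rule has_derivative_transform_within_open[OF _ open_cimage[OF c(1)]])
   (use c in \<open>auto simp: cinv_cmap\<close>)
 from frechet_derivative_at[OF this] show ?thesis by metis
qed

text \<open>Maximality of the atlas is what makes this work: after a diffeomorphism with positive
  determinant, defined on a part of the chart image, the new chart is compatible with every chart of
  the atlas in both directions. All special coordinates constructed later enter the atlas through
  this lemma.\<close>

lemma atlas_reparametrize:
 assumes c: "c : atlas M" and V: "V <= cimage c" and T: "Cinf_on V T" "inj_on T V"
  and det: "!!x. x : V ==> det (matrix (fd T x)) > 0"
 defines "d == ({p : cdom c. cmap c p : V}, T o cmap c)"
 shows "d : atlas M" "cimage d = T ` V" "!!x. x : V ==> cinv d (T x) = cinv c x"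
  "!!y. y : T ` V ==> cinv d y = cinv c (inv_into V T y)"
proof -
 let ?S = "inv_into V T"
 have oV: "open V" by (rule Cinf_on_open[OF T(1)])
 have det0: "!!x. x : V ==> det (matrix (fd T x)) ~= 0" using det by force
 note S = Cinf_on_inverse_real3[OF T det0]
 have dd: "cdom d = {p : cdom c. cmap c p : V}" "cmap d = T o cmap c" by (simp_all add: d_def)
 show im: "cimage d = T ` V"
  using V unfolding dd by auto
 have inj: "inj_on (cmap d) (cdom d)"
  using inj_on_cmap[OF c] T(2) unfolding dd by (auto simp: inj_on_def)
 show cd: "cinv d (T x) = cinv c x" if "x : V" for x
 proof -
  have "x : cimage c" using that V by blast
  then have "cinv c x : cdom d" "cmap d (cinv c x) = T x"
   using that by (simp_all add: dd cinv_cdom cmap_cinv)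
  then show ?thesis using inv_into_f_f[OF inj] by metis
 qed
 show cd2: "cinv d y = cinv c (?S y)" if "y : T ` V" for y
  using cd[OF inv_into_into[OF that]] f_inv_into_f[OF that] by simp
 have od: "openin (mtop M) (cdom d)" unfolding dd by (rule openin_chart_preimage[OF c oV])
 have top_d: "topspace (subtopology (mtop M) (cdom d)) = cdom d"
  using openin_subset[OF od] by (auto simp: topspace_subtopology)
 show "d : atlas M"
 proof (rule atlas_maximal)
  have "homeomorphic_map (subtopology (mtop M) (cdom d)) (top_of_set (cimage d)) (cmap d)"
  proof (rule bijective_open_imp_homeomorphic_map)
   show "continuous_map (subtopology (mtop M) (cdom d)) (top_of_set (cimage d)) (cmap d)"
    unfolding continuous_map_def
   proof (intro conjI allI impI)
    fix W assume "openin (top_of_set (cimage d)) W"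
    then have "openin (top_of_set (T ` V)) W" by (simp only: im)
    then have W: "open W" "W <= T ` V" using openin_open_trans[OF _ S(1)] openin_imp_subset by blast+
    have "open (V Int T -` W)"
     using continuous_open_preimage[OF Cinf_on_continuous[OF T(1)] oV W(1)] .
    then have "openin (mtop M) {p : cdom c. cmap c p : V Int T -` W}" by (rule openin_chart_preimage[OF c])
    moreover have "{p : cdom c. cmap c p : V Int T -` W} = {p : topspace (subtopology (mtop M) (cdom d)). cmap d p : W}"
     unfolding top_d by (auto simp: dd)
    ultimately have "openin (mtop M) {p : cdom d. cmap d p : W}" unfolding top_d by (simp only:)
    then show "openin (subtopology (mtop M) (cdom d)) {p : topspace (subtopology (mtop M) (cdom d)). cmap d p : W}"
     unfolding openin_open_subtopology[OF od] top_d by blast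
   qed (use top_d in auto)
   show "open_map (subtopology (mtop M) (cdom d)) (top_of_set (cimage d)) (cmap d)"
    unfolding open_map_def
   proof (intro allI impI)
    fix U assume "openin (subtopology (mtop M) (cdom d)) U"
    then have U: "openin (mtop M) U" "U <= cdom d" using openin_open_subtopology[OF od] by auto
    have "open (cmap c ` (cdom c Int U))" by (rule open_cmap_image[OF c U(1)])
    moreover have "cdom c Int U = U" using U(2) by (auto simp: dd)
    ultimately have "open (cmap c ` U)" by simp
    moreover have sub: "cmap c ` U <= V" using U(2) by (auto simp: dd)
    ultimately have "open (T ` cmap c ` U)"
     by (intro invariance_of_domain continuous_on_subset[OF Cinf_on_continuous[OF T(1)]] inj_on_subset[OF T(2)])
    then have "open (cmap d ` U)" by (simp add: dd image_comp)
    then show "openin (top_of_set (cimage d)) (cmap d ` U)"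
     using U(2) S(1)[folded im] by (meson image_mono open_openin_trans)
   qed
  qed (use inj top_d in auto)
  then show "is_chart (mtop M) d" using od S(1) im by (simp add: is_chart_def)
 next
  fix e assume e: "e : atlas M"
  let ?I = "cdom d Int cdom e" and ?O = "cdom c Int cdom e"
  have "cdom d <= cdom c" by (auto simp: dd)
  have o1: "open (cmap c ` (cdom c Int (cdom d Int cdom e)))"
   by (rule open_cmap_image[OF c openin_Int[OF od openin_cdom[OF e]]])
  have I: "cdom c Int (cdom d Int cdom e) = ?I" by (auto simp: dd)
  note o1 = o1[unfolded I]
  have sub: "cmap c ` ?I <= V" "cmap c ` ?I <= cmap c ` ?O" by (auto simp: dd)
  have imI: "cmap d ` ?I = T ` (cmap c ` ?I)" by (auto simp: dd)
  have oI: "open (cmap d ` ?I)" unfolding imI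
   by (rule invariance_of_domain[OF continuous_on_subset[OF Cinf_on_continuous[OF T(1)] sub(1)] o1 inj_on_subset[OF T(2) sub(1)]])
  have Sm: "?S (cmap d p) = cmap c p" if "p : ?I" for p
   using that by (simp add: dd inv_into_f_f[OF T(2)])
  have imS: "?S ` (cmap d ` ?I) <= cmap c ` ?O" using Sm by (auto simp: dd)
  have smS: "Cinf_on (cmap d ` ?I) ?S"
   by (rule Cinf_on_subset[OF S(2) oI]) (use sub imI in auto)
  have eq: "transition d e y = transition c e (?S y)" if "y : cmap d ` ?I" for y
  proof -
   have "y : T ` V" using that unfolding im[symmetric] by blast
   from cd2[OF this] show ?thesis by (simp only: o_apply)
  qed
  have "Cinf_on (cmap d ` ?I) (%y. transition c e (?S y))"
   by (rule Cinf_on_compose[OF smS Cinf_on_transition[OF c e] imS])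
  then have s1: "Cinf_on (cmap d ` ?I) (transition d e)"
   by (rule Cinf_on_cong) (simp only: eq)
  have oe: "open (cmap e ` ?I)"
   using open_cmap_image[OF e openin_Int[OF od openin_cdom[OF e]]] by (simp add: Int_commute Int_left_commute)
  have "Cinf_on (cmap e ` ?I) (%y. T (transition e c y))"
  proof (rule Cinf_on_compose[OF Cinf_on_subset[OF Cinf_on_transition[OF e c] oe] T(1)])
   show "cmap e ` ?I <= cmap e ` (cdom e Int cdom c)" by (auto simp: dd)
   show "transition e c ` cmap e ` ?I <= V" using e by (auto simp: dd cinv_cmap)
  qed
  then have s2: "Cinf_on (cmap e ` ?I) (transition e d)"
   by (rule Cinf_on_cong) (simp add: dd)
  have "det (matrix (fd (transition d e) (cmap d p))) > 0" if p: "p : ?I" for p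
  proof -
   have pc: "c : charts_at M p" "e : charts_at M p" "cmap c p : V" using p c e by (auto simp: charts_at_def dd)
   let ?y = "cmap d p"
   have y: "?y : cmap d ` ?I" using p by blast
   let ?DS = "fd ?S ?y" and ?DT = "fd T (cmap c p)"
   let ?Dc = "fd (transition c e) (cmap c p)"
   have dS: "(?S has_derivative ?DS) (at ?y)" by (rule Cinf_on_has_derivative[OF smS y])
   have dT: "(T has_derivative ?DT) (at (cmap c p))" by (rule Cinf_on_has_derivative[OF T(1) pc(3)])
   have "((%x. ?S (T x)) has_derivative (%v. ?DS (?DT v))) (at (cmap c p))"
    using has_derivative_compose[OF dT] dS by (simp add: dd)
   moreover have "((%x. ?S (T x)) has_derivative (%v. v)) (at (cmap c p))"
    by (rule has_derivative_transform_within_open[OF has_derivative_ident oV pc(3)])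
     (simp add: inv_into_f_f[OF T(2)])
   ultimately have "(%v. ?DS (?DT v)) = (%v. v)" by (rule has_derivative_unique)
   then have "det (matrix ?DS) * det (matrix ?DT) = 1"
    using matrix_det_compose[OF has_derivative_linear[OF dT] has_derivative_linear[OF dS]]
    by (simp add: matrix_id_mat_1[unfolded id_def])
   then have dS0: "det (matrix ?DS) > 0" using det[OF pc(3)] by (metis zero_less_mult_pos2 zero_less_one)
   have "((%y. transition c e (?S y)) has_derivative (%v. ?Dc (?DS v))) (at ?y)"
    using has_derivative_compose[OF dS] transition_has_derivative[OF pc(1,2)] by (simp only: Sm[OF p])
   then have "(transition d e has_derivative (%v. ?Dc (?DS v))) (at ?y)"
    by (rule has_derivative_transform_within_open[OF _ oI y]) (simp only: eq)
   then have "fd (transition d e) ?y = (%v. ?Dc (?DS v))"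
    by (rule frechet_derivative_at[symmetric])
   moreover have "det (matrix (%v. ?Dc (?DS v))) = det (matrix ?Dc) * det (matrix ?DS)"
    by (rule matrix_det_compose[OF has_derivative_linear[OF dS] transition_linear[OF pc(1,2)]])
   moreover have "det (matrix ?Dc) > 0" using transition_det[of c e p] pc by (simp add: charts_at_def)
   ultimately show ?thesis using dS0 by simp
  qed
  then show "oriented_compatible d e"
   unfolding oriented_compatible_def smooth_on_open_iff[OF oI] smooth_on_open_iff[OF oe]
   using s1 s2 by blast
 qed
qed

end

section \<open>Plane fields as fields of covectors in charts\<close>

definition cov_pull :: "(real^3 => real^3) => (real^3 => real^3) => real^3 => real^3" where
 "cov_pull T A x = vec3 (A (T x) \<bullet> fd T x (axis 1 1))
  (A (T x) \<bullet> fd T x (axis 2 1)) (A (T x) \<bullet> fd T x (axis 3 1))"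

lemma cov_pull_inner:
 assumes "linear (fd T x)"
 shows "cov_pull T A x \<bullet> v = A (T x) \<bullet> fd T x v"
 by (subst linear_real3[OF assms, of v]) (simp add: cov_pull_def inner_vec_def[of "vec3 _ _ _"] sum_3 inner_add_right)

lemma Cinf_on_cov_pull:
 assumes "Cinf_on U T" "Cinf_on V A" "T ` U <= V"
 shows "Cinf_on U (cov_pull T A)"
 unfolding cov_pull_def[abs_def]
 by (intro smooth_intros Cinf_on_compose[OF assms] Cinf_on_derivative assms)

context closed_manifold
begin

lemma cinv_image_subset: "V <= cimage c ==> cinv c ` V <= cdom c"
proof
 fix q assume V: "V <= cimage c" and "q : cinv c ` V"
 from this(2) obtain x where "x : V" "q = cinv c x" by (rule imageE)
 then show "q : cdom c" using cinv_cdom[of x c] V by (simp add: subsetD)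
qed

definition tvec :: "'a => 'a chart => real^3 => 'a tvec" where
 "tvec p c w = (%d. if d : charts_at M p then fd (transition c d) (cmap c p) w else 0)"

lemma tvec_chart: "c : charts_at M p ==> tvec p c w c = w"
 by (simp add: tvec_def transition_same del: o_apply)

lemma tvec_tangent:
 assumes "c : charts_at M p"
 shows "tvec p c w : tangent_space M p"
 unfolding tangent_space_def using transition_chain[OF assms] by (simp add: tvec_def)

lemma tangent_eq_tvec:
 assumes "c : charts_at M p" "v : tangent_space M p"
 shows "v = tvec p c (v c)"
proof
 fix d
 show "v d = tvec p c (v c) d"
 proof (cases "d : charts_at M p")
  case True
  then have "v d = fd (transition c d) (cmap c p) (v c)"
   using assms unfolding tangent_space_def by blast
  then show ?thesis using True by (simp only: tvec_def if_True)
 next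
  case False
  then have "v d = 0" using assms unfolding tangent_space_def by blast
  then show ?thesis using False by (simp only: tvec_def if_False)
 qed
qed

lemma tangent_change:
 assumes "c : charts_at M p" "d : charts_at M p" "v : tangent_space M p"
 shows "v d = fd (transition c d) (cmap c p) (v c)"
 using assms unfolding tangent_space_def by blast

abbreviation ker_at :: "'a => 'a chart => real^3 => 'a tvec set" where
 "ker_at p c a == {v : tangent_space M p. a \<bullet> v c = 0}"

text \<open>The counterpart of \<open>local_form\<close> with the covector \<open>A x\<close> in
  place of a functional and an open set of chart coordinates in place of one in \<open>M\<close>. In
  this form the calculus of \<open>Cinf_on\<close> applies directly.\<close>

definition represents :: "'a plane_field => 'a chart => (real^3) set => (real^3 => real^3) => bool" where
 "represents ksi c V A \<longleftrightarrow> c : atlas M & V <= cimage c & Cinf_on V A &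
  (\<forall>x\<in>V. A x ~= 0 & ksi (cinv c x) = ker_at (cinv c x) c (A x))"

lemma representsD:
 assumes "represents ksi c V A"
 shows "c : atlas M" "V <= cimage c" "Cinf_on V A" "open V"
  "!!x. x : V ==> A x ~= 0" "!!x. x : V ==> ksi (cinv c x) = ker_at (cinv c x) c (A x)"
  "!!x. x : V ==> c : charts_at M (cinv c x)" "!!x. x : V ==> cmap c (cinv c x) = x"
 using assms Cinf_on_open[of V A] cinv_charts_at[of c] cmap_cinv[of _ c]
 unfolding represents_def by blast+

lemma represents_plane:
 assumes "represents ksi c V A" "p : cdom c" "cmap c p : V"
 shows "ksi p = ker_at p c (A (cmap c p))" "c : charts_at M p"
 using representsD(6,7)[OF assms(1,3)] cinv_cmap[OF representsD(1)[OF assms(1)] assms(2)] by simp_all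

lemma represents_tvec:
 assumes "represents ksi c V A" "p : cdom c" "cmap c p : V"
 shows "tvec p c w : ksi p \<longleftrightarrow> A (cmap c p) \<bullet> w = 0"
 using represents_plane[OF assms] tvec_tangent tvec_chart by simp

lemma represents_subset:
 "represents ksi c V A ==> U <= V ==> open U ==> represents ksi c U A"
 unfolding represents_def by (meson Cinf_on_subset order_trans subsetD)

lemma represents_cong:
 assumes "represents ksi c V A" "!!x. x : V ==> ksi' (cinv c x) = ksi (cinv c x)"
 shows "represents ksi' c V A"
 using assms unfolding represents_def by simp

lemma represents_imp_local_form:
 assumes "represents ksi c V A"
 shows "local_form M ksi c (cinv c ` V) (%x v. A x \<bullet> v)"
 unfolding local_form_def
proof (intro conjI allI ballI)
 note R = representsD[OF assms]
 show "c : atlas M" by (rule R)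
 show "openin (mtop M) (cinv c ` V)" by (rule openin_cinv_image[OF R(1,4,2)])
 show "cinv c ` V <= cdom c" by (rule cinv_image_subset[OF R(2)])
 have eq: "cmap c ` cinv c ` V = V"
 proof -
  have "cmap c ` cinv c ` V = (%x. x) ` V" unfolding image_image by (rule image_cong[OF refl R(8)])
  then show ?thesis by simp
 qed
 have "Cinf_on V (%x. A x \<bullet> v)" for v
  by (rule Cinf_on_inner[OF R(3) Cinf_on_const[OF R(4)]])
 then show "smooth_on (cmap c ` cinv c ` V) (%x. A x \<bullet> v)" for v
  unfolding eq smooth_on_open_iff[OF R(4)] .
 fix q assume "q : cinv c ` V"
 then obtain x where x: "x : V" "q = cinv c x" by blast
 show "linear ((\<bullet>) (A (cmap c q)))" by (rule bounded_linear.linear[OF bounded_linear_inner_right])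
 show "\<exists>v. A (cmap c q) \<bullet> v ~= 0"
  using R(5)[OF x(1)] R(8)[OF x(1)] x(2) by (intro exI[of _ "A (cmap c q)"]) simp
 show "ksi q = kernel_at M c (%x v. A x \<bullet> v) q"
  using R(6)[OF x(1)] R(8)[OF x(1)] x(2) by (simp add: kernel_at_def)
qed

lemma local_form_imp_represents:
 assumes "local_form M ksi c W al"
 defines "A == %x. vec3 (al x (axis 1 1)) (al x (axis 2 1)) (al x (axis 3 1))"
 shows "represents ksi c (cmap c ` W) A" "!!x v. x : cmap c ` W ==> al x v = A x \<bullet> v"
proof -
 have c: "c : atlas M" and W: "openin (mtop M) W" "W <= cdom c"
  and sm: "!!v. smooth_on (cmap c ` W) (%x. al x v)"
  and q: "!!q. q : W ==> linear (al (cmap c q))" "!!q. q : W ==> \<exists>v. al (cmap c q) v ~= 0"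
   "!!q. q : W ==> ksi q = kernel_at M c al q"
  using assms(1) by (auto simp: local_form_def)
 have "cdom c Int W = W" using W(2) by blast
 then have o: "open (cmap c ` W)" using open_cmap_image[OF c W(1)] by simp
 show A: "al x v = A x \<bullet> v" if x: "x : cmap c ` W" for x v
 proof -
  obtain q' where "q' : W" "x = cmap c q'" using x by blast
  then show ?thesis using linear_real3[OF q(1), of q' v] by (simp add: A_def inner_vec_def sum_3 algebra_simps)
 qed
 show "represents ksi c (cmap c ` W) A"
  unfolding represents_def
 proof (intro conjI ballI)
  show "cmap c ` W <= cimage c" using W(2) by blast
  show "Cinf_on (cmap c ` W) A" unfolding A_def
   by (intro smooth_intros) (rule sm[unfolded smooth_on_open_iff[OF o]])+
  fix x assume x: "x : cmap c ` W"
  then obtain q' where q': "q' : W" "x = cmap c q'" by blast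
  then have cx: "cinv c x = q'" using cinv_cmap[OF c] W(2) by blast
  show "A x ~= 0" using q(2)[OF q'(1)] A[OF x] q'(2) by force
  show "ksi (cinv c x) = ker_at (cinv c x) c (A x)"
   unfolding cx q(3)[OF q'(1)] kernel_at_def using A[OF x] q'(2) by simp
 qed (rule c)
qed

lemma represents_transport:
 assumes R: "represents ksi c V A" and d: "d : atlas M"
 shows "represents ksi d (cmap d ` (cdom d Int cinv c ` V)) (cov_pull (transition d c) A)"
proof -
 note R' = representsD[OF R]
 let ?U = "cmap d ` (cdom d Int cinv c ` V)" and ?T = "transition d c"
 have oU: "open ?U" by (rule open_cmap_image[OF d openin_cinv_image[OF R'(1,4,2)]])
 have cV: "cinv c ` V <= cdom c" by (rule cinv_image_subset[OF R'(2)])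
 then have sub: "?U <= cmap d ` (cdom d Int cdom c)" by blast
 have smT: "Cinf_on ?U ?T" by (rule Cinf_on_subset[OF Cinf_on_transition[OF d R'(1)] oU sub])
 have TU: "?T ` ?U <= V"
  using R'(8) by (auto simp: cinv_cmap[OF d])
 show ?thesis
  unfolding represents_def
 proof (intro conjI ballI)
  show "?U <= cimage d" by blast
  show "Cinf_on ?U (cov_pull ?T A)" by (rule Cinf_on_cov_pull[OF smT R'(3) TU])
  fix x assume x: "x : ?U"
  then obtain p where p: "p : cdom d" "p : cinv c ` V" "x = cmap d p" by blast
  then have px: "cinv d x = p" "?T x = cmap c p" by (simp_all add: cinv_cmap[OF d])
  have pc: "p : cdom c" "cmap c p : V" using p(2) cV R'(8) by auto
  have ch: "c : charts_at M p" "d : charts_at M p" using pc p d R'(1) by (auto simp: charts_at_def)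
  have lin: "linear (fd ?T x)" using transition_linear[OF ch(2,1)] p(3) by simp
  show eq: "ksi (cinv d x) = ker_at (cinv d x) d (cov_pull ?T A x)"
   unfolding px(1) represents_plane(1)[OF R pc] cov_pull_inner[OF lin] px(2)
   using tangent_change[OF ch(2,1)] p(3) by auto
  \<comment> \<open>A zero covector would make the plane the whole tangent space, but it omits the
    vector whose coordinates in \<open>c\<close> are \<open>A\<close> itself.\<close>
  show "cov_pull ?T A x ~= 0"
  proof
   assume 0: "cov_pull ?T A x = 0"
   have "ksi p = ker_at p d (0 :: real^3)"
    using eq unfolding px(1) 0 .
   then have "tvec p c (A (cmap c p)) : ksi p" using tvec_tangent[OF ch(1)] by simp
   then have "A (cmap c p) \<bullet> A (cmap c p) = 0" using represents_tvec[OF R pc] by blast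
   then show False using R'(5)[OF pc(2)] by simp
  qed
 qed (rule d)
qed

text \<open>The sign of the contact coefficient is intrinsic: two defining forms in the same chart differ by a
 factor \<open>g\<close>, which enters as \<open>g\<^sup>2\<close>, and a change of charts contributes its determinant.\<close>

lemma contact_coeff_sign:
 assumes R: "represents ksi c V A" and R': "represents ksi d V' A'"
  and p: "p : cdom c" "cmap c p : V" "p : cdom d" "cmap d p : V'"
 shows "\<exists>r>0. contact_coeff_vec A (cmap c p) = r * contact_coeff_vec A' (cmap d p)"
proof -
 note D = representsD[OF R] and D' = representsD[OF R']
 let ?T = "transition c d" and ?U = "cmap c ` (cdom c Int cinv d ` V')"
 define B where "B = cov_pull ?T A'"
 have RB: "represents ksi c ?U B" unfolding B_def by (rule represents_transport[OF R' D(1)])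
 let ?x = "cmap c p"
 have pV': "p : cinv d ` V'" using p cinv_cmap[OF D'(1)] by force
 have ch: "c : charts_at M p" "d : charts_at M p" using p D(1) D'(1) by (auto simp: charts_at_def)
 have xU: "?x : ?U" using p(1) pV' by blast
 have Tx: "?T ?x = cmap d p" using p by (simp add: cinv_cmap[OF D(1)])
 let ?W = "?U Int V"
 have W: "open ?W" "?x : ?W" using xU p representsD(4)[OF RB] D(4) by auto
 \<comment> \<open>The factor between the two proportional covectors, written as a quotient of inner
   products so that its smoothness is evident.\<close>
 define g where "g y = (B y \<bullet> A y) / (A y \<bullet> A y)" for y
 have ppn: "B y = g y *\<^sub>R A y" "g y ~= 0" if y: "y : ?W" for y
 proof -
  have y': "y : V" "y : ?U" using y by auto
  have py: "cinv c y : cdom c" "cmap c (cinv c y) = y" using cinv_image_subset[OF D(2)] D(8)[OF y'(1)] y'(1) by auto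
  have "A y \<bullet> w = 0 \<longleftrightarrow> B y \<bullet> w = 0" for w
   using represents_tvec[OF R py(1), of w] represents_tvec[OF RB py(1), of w] y' py(2) by simp
  then show "B y = g y *\<^sub>R A y" "g y ~= 0"
   using covector_proportional[of "A y" "B y"] D(5)[OF y'(1)] by (auto simp: g_def)
 qed
 have smg: "Cinf_on ?W g" unfolding g_def
  by (intro smooth_intros Cinf_on_subset[OF representsD(3)[OF RB] W(1)] Cinf_on_subset[OF D(3) W(1)])
   (use D(5) in auto)
 have "contact_coeff_vec B ?x = contact_coeff_vec (%y. g y *\<^sub>R A y) ?x"
  by (rule contact_coeff_cong[OF W]) (simp add: ppn(1)[symmetric])
 also have "... = (g ?x)\<^sup>2 * contact_coeff_vec A ?x"
  by (rule contact_coeff_vec_scale[OF Cinf_on_has_derivative[OF D(3) p(2)] Cinf_on_has_derivative[OF smg W(2)]])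
 finally have 1: "contact_coeff_vec B ?x = (g ?x)\<^sup>2 * contact_coeff_vec A ?x" .
 have oU: "open ?U" by (rule representsD(4)[OF RB])
 have "Cinf_on ?U ?T"
 proof (rule Cinf_on_subset[OF Cinf_on_transition[OF D(1) D'(1)] oU])
  show "?U <= cmap c ` (cdom c Int cdom d)" using cinv_image_subset[OF D'(2)] by blast
 qed
 note smT = this
 have "contact_coeff_vec B ?x = det (matrix (fd ?T ?x)) * contact_coeff_vec A' (?T ?x)"
 proof (rule contact_coeff_vec_pullback[OF smT xU])
  show "(A' has_derivative fd A' (?T ?x)) (at (?T ?x))"
   unfolding Tx by (rule Cinf_on_has_derivative[OF D'(3) p(4)])
  show "B y \<bullet> v = A' (?T y) \<bullet> fd ?T y v" if "y : ?U" for y v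
   unfolding B_def
   by (rule cov_pull_inner[OF linear_frechet_derivative[OF Cinf_on_differentiable[OF smT that]]])
 qed
 with 1 Tx have 2: "(g ?x)\<^sup>2 * contact_coeff_vec A ?x
   = det (matrix (fd ?T ?x)) * contact_coeff_vec A' (cmap d p)" by (simp only:)
 have dp: "det (matrix (fd ?T ?x)) > 0"
  using transition_det[OF D(1) D'(1) p(1,3)] .
 have gp: "(g ?x)\<^sup>2 > 0" using ppn(2)[OF W(2)] by simp
 show ?thesis
 proof (intro exI conjI)
  show "det (matrix (fd ?T ?x)) / (g ?x)\<^sup>2 > 0" using dp gp by simp
  show "contact_coeff_vec A ?x = det (matrix (fd ?T ?x)) / (g ?x)\<^sup>2 * contact_coeff_vec A' (cmap d p)"
   using 2 gp by (simp add: field_simps)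
 qed
qed

text \<open>The confoliation inequality at a single point. An existential suffices, because by
  \<open>contact_coeff_sign\<close> all defining forms give the same sign.\<close>

definition conf_at :: "'a plane_field => 'a => bool" where
 "conf_at ksi p \<longleftrightarrow> (\<exists>c V A. represents ksi c V A & p : cdom c & cmap c p : V & contact_coeff_vec A (cmap c p) >= 0)"

lemma contact_at_represents:
 assumes R: "represents ksi c V A" and p: "p : cdom c" "cmap c p : V"
 shows "contact_at M ksi p \<longleftrightarrow> contact_coeff_vec A (cmap c p) > 0"
proof
 assume "contact_coeff_vec A (cmap c p) > 0"
 moreover have "p : cinv c ` V" using p cinv_cmap[OF representsD(1)[OF R]] by force
 ultimately show "contact_at M ksi p"
  using represents_imp_local_form[OF R] unfolding contact_at_def by blast
next
 assume "contact_at M ksi p"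
 then obtain d W al where W: "p : W" "local_form M ksi d W al" "contact_coeff al (cmap d p) > 0"
  unfolding contact_at_def by blast
 let ?A = "%x. vec3 (al x (axis 1 1)) (al x (axis 2 1)) (al x (axis 3 1))"
 note R' = local_form_imp_represents[OF W(2)]
 have pd: "p : cdom d" "cmap d p : cmap d ` W" using W(1,2) by (auto simp: local_form_def)
 have "contact_coeff al (cmap d p) = contact_coeff_vec ?A (cmap d p)"
  by (rule contact_coeff_cong[OF representsD(4)[OF R'(1)] pd(2) R'(2)])
 then show "contact_coeff_vec A (cmap c p) > 0"
  using contact_coeff_sign[OF R R'(1) p pd] W(3) by auto
qed

lemma conf_at_represents:
 assumes R: "represents ksi c V A" and p: "p : cdom c" "cmap c p : V"
 shows "conf_at ksi p \<longleftrightarrow> contact_coeff_vec A (cmap c p) >= 0"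
proof
 assume "conf_at ksi p"
 then obtain d V' A' where "represents ksi d V' A'" "p : cdom d" "cmap d p : V'" "contact_coeff_vec A' (cmap d p) >= 0"
  unfolding conf_at_def by blast
 then show "contact_coeff_vec A (cmap c p) >= 0"
  using contact_coeff_sign[OF R _ p] by fastforce
qed (use assms in \<open>unfold conf_at_def, blast\<close>)

lemma confoliation_conf_at:
 assumes "confoliation M ksi" "p : points M"
 shows "conf_at ksi p"
proof -
 obtain c W al where W: "p : W" "local_form M ksi c W al" "contact_coeff al (cmap c p) >= 0"
  using assms unfolding confoliation_def by blast
 let ?A = "%x. vec3 (al x (axis 1 1)) (al x (axis 2 1)) (al x (axis 3 1))"
 note R = local_form_imp_represents[OF W(2)]
 have pc: "p : cdom c" "cmap c p : cmap c ` W" using W(1,2) by (auto simp: local_form_def)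
 have "contact_coeff al (cmap c p) = contact_coeff_vec ?A (cmap c p)"
  by (rule contact_coeff_cong[OF representsD(4)[OF R(1)] pc(2) R(2)])
 then have "contact_coeff_vec ?A (cmap c p) >= 0" using W(3) by simp
 then show ?thesis using R(1) pc unfolding conf_at_def by blast
qed

end

section \<open>Overtwisted discs\<close>

lemma smooth_on_subset: "smooth_on S f ==> R <= S ==> smooth_on R f"
 unfolding smooth_on_def by (meson IntD1 IntD2 IntI subsetD)

lemma smooth_on_compose:
 assumes "smooth_on S g" "Cinf_on V h" "g ` S <= V"
 shows "smooth_on S (h o g)"
 unfolding smooth_on_def
proof
 fix x assume x: "x : S"
 then obtain T g' where T: "open T" "x : T" "\<forall>k. Ck_on k T g'" "\<forall>y\<in>S Int T. g' y = g y"
  using assms(1)[unfolded smooth_on_def, rule_format, OF x] by (elim exE conjE)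
 let ?T = "T Int g' -` V"
 have g': "Cinf_on T g'" using T by (simp add: Cinf_on_def)
 have o: "open ?T"
  by (rule continuous_open_preimage[OF Cinf_on_continuous[OF g'] T(1) Cinf_on_open[OF assms(2)]])
 have "Cinf_on ?T (%y. h (g' y))"
  by (rule Cinf_on_compose[OF Cinf_on_subset[OF g' o] assms(2)]) auto
 then have "\<forall>k. Ck_on k ?T (%y. h (g' y))" by (simp add: Cinf_on_def)
 moreover have "x : ?T" using T(2,4) x assms(3) by auto
 moreover have "\<forall>y\<in>S Int ?T. h (g' y) = (h o g) y" using T(4) by simp
 ultimately show "\<exists>T g'. open T & x : T & (\<forall>k. Ck_on k T g') & (\<forall>y\<in>S Int T. g' y = (h o g) y)"
  using o by blast
qed

lemma smooth_on_extension:
 assumes "smooth_on S f" "x : S"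
 obtains T g where "x : T" "Cinf_on T g" "!!y. y : S Int T ==> g y = f y"
 using assms(1)[unfolded smooth_on_def, rule_format, OF assms(2)] that unfolding Cinf_on_def by blast

lemma smooth_on_continuous: "smooth_on S f ==> continuous_on S f"
 unfolding continuous_on_eq_continuous_within
proof
 fix x assume f: "smooth_on S f" and x: "x : S"
 obtain T g where T: "x : T" "Cinf_on T g" "!!y. y : S Int T ==> g y = f y"
  by (rule smooth_on_extension[OF f x], rule that)
 obtain e where e: "e > 0" "ball x e <= T" using T(1) Cinf_on_open[OF T(2)] openE by blast
 have "continuous (at x) g"
  using Cinf_on_continuous[OF T(2)] T(1) Cinf_on_open[OF T(2)] continuous_on_eq_continuous_at by blast
 then have "continuous (at x within S) g" by (rule continuous_at_imp_continuous_at_within)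
 then show "continuous (at x within S) f"
  by (rule continuous_transform_within[OF _ e(1) x]) (use T(3) e(2) in \<open>auto simp: dist_commute subset_iff\<close>)
qed

lemma smooth_on_has_derivative_within:
 assumes f: "smooth_on (S Int T) f" and x: "x : S" "x : T" "open T"
 shows "\<exists>D. (f has_derivative D) (at x within S)"
proof -
 obtain U g where U: "x : U" "Cinf_on U g" "!!y. y : S Int T Int U ==> g y = f y"
  by (rule smooth_on_extension[OF f]) (use x in blast, rule that)
 have "open (T Int U)" using x(3) Cinf_on_open[OF U(2)] by blast
 then obtain e where e: "e > 0" "ball x e <= T Int U" using x(2) U(1) openE by blast
 have "(g has_derivative fd g x) (at x within S)"
  by (rule has_derivative_at_withinI[OF Cinf_on_has_derivative[OF U(2,1)]])
 then have "(f has_derivative fd g x) (at x within S)"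
  by (rule has_derivative_transform_within[OF _ e(1) x(1)])
   (use U(3) e(2) in \<open>auto simp: dist_commute subset_iff\<close>)
 then show ?thesis by blast
qed

text \<open>Along a segment from \<open>x\<close> into \<open>S\<close> the one-sided derivative is
  unique. Since \<open>S\<close> has interior, every vector is a multiple of a difference of two
  such directions. This makes the differential of a disc well defined at its boundary.\<close>

lemma has_derivative_unique_within_convex:
 fixes f :: "'e::euclidean_space => 'f::real_normed_vector"
 assumes "convex S" "interior S ~= {}" "x : S"
  and D: "(f has_derivative D) (at x within S)" and E: "(f has_derivative E) (at x within S)"
 shows "D = E"
proof -
 have lim: "((%t. f (x + t *\<^sub>R u)) has_vector_derivative D u) (at 0 within {0..1})"
  if u: "x + u : S" and D: "(f has_derivative D) (at x within S)" for u D
 proof -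
  have inS: "x + t *\<^sub>R u : S" if "0 <= t" "t <= 1" for t
  proof -
   have "(1 - t) *\<^sub>R x + t *\<^sub>R (x + u) : S" using assms(1,3) u that by (intro convexD) auto
   then show ?thesis by (simp add: algebra_simps)
  qed
  have "((%t. x + t *\<^sub>R u) has_derivative (%t. t *\<^sub>R u)) (at 0 within {0..1})"
   by (auto intro!: derivative_eq_intros)
  moreover have "(f has_derivative D) (at (x + 0 *\<^sub>R u) within (%t. x + t *\<^sub>R u) ` {0..1})"
   using has_derivative_subset[OF D] inS by (auto simp: image_subset_iff)
  ultimately have "((%t. f (x + t *\<^sub>R u)) has_derivative (%t. D (t *\<^sub>R u))) (at 0 within {0..1})"
   by (rule has_derivative_in_compose)
  moreover have "(%t. D (t *\<^sub>R u)) = (%t. t *\<^sub>R D u)"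
   using has_derivative_linear[OF D] by (simp add: linear_cmul)
  ultimately show ?thesis by (simp add: has_vector_derivative_def)
 qed
 have eq: "D u = E u" if "x + u : S" for u
  by (rule vector_derivative_unique_within[OF _ lim[OF that D] lim[OF that E]])
   (simp add: at_within_Icc_at_right)
 obtain y e where y: "e > 0" "ball y e <= S"
  using assms(2) by (metis all_not_in_conv mem_interior)
 have linD: "linear D" and linE: "linear E" using D E has_derivative_linear by blast+
 show ?thesis
 proof
  fix w
  show "D w = E w"
  proof (cases "w = 0")
   case True
   then show ?thesis using linD linE by (simp add: linear_0)
  next
   case False
   \<comment> \<open>With this factor both \<open>y\<close> and \<open>y + ?s *\<^sub>R w\<close>
     lie in the ball, so \<open>w\<close> is, up to scale, a difference of two directions into
     \<open>S\<close>.\<close>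
   let ?s = "e / (2 * norm w)"
   have s: "?s > 0" using y False by simp
   have "y : ball y e" "y + ?s *\<^sub>R w : ball y e" using y False by (simp_all add: dist_norm)
   then have "x + (y - x) : S" "x + (y - x + ?s *\<^sub>R w) : S" using y(2) by (auto simp: subset_iff)
   then have "D (y - x) = E (y - x)" "D (y - x + ?s *\<^sub>R w) = E (y - x + ?s *\<^sub>R w)" using eq by blast+
   then have "?s *\<^sub>R D w = ?s *\<^sub>R E w" by (simp add: linear_add[OF linD] linear_add[OF linE] linear_cmul[OF linD] linear_cmul[OF linE])
   then show ?thesis using False y(1) by simp
  qed
 qed
qed

abbreviation unit_disc :: "(real^2) set" where "unit_disc == cball 0 1"

lemma unit_disc_derivative_unique:
 assumes "x : unit_disc" "(f has_derivative D) (at x within unit_disc)"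
 shows "frechet_derivative f (at x within unit_disc) = D"
proof -
 have "f differentiable (at x within unit_disc)" using assms(2) by (auto simp: differentiable_def)
 then have 1: "(f has_derivative frechet_derivative f (at x within unit_disc)) (at x within unit_disc)"
  using frechet_derivative_works by blast
 show ?thesis
  by (rule has_derivative_unique_within_convex[OF convex_cball _ assms(1) 1 assms(2)]) simp
qed

context closed_manifold
begin

lemma smooth_into_nbhd:
 assumes f: "smooth_into M S f" and x: "x : S" and U: "openin (mtop M) U" "f x : U"
 obtains T where "open T" "x : T" "f ` (S Int T) <= U"
proof -
 obtain d T where d: "d : charts_at M (f x)" and T: "open T" "x : T" "f ` (S Int T) <= cdom d"
   "smooth_on (S Int T) (cmap d o f)"
  using f x unfolding smooth_into_def by blast
 have da: "d : atlas M" "f x : cdom d" using d by (auto simp: charts_at_def)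
 have "open (cmap d ` (cdom d Int U))" by (rule open_cmap_image[OF da(1) U(1)])
 with smooth_on_continuous[OF T(4)] have "openin (top_of_set (S Int T)) (S Int T Int (cmap d o f) -` (cmap d ` (cdom d Int U)))"
  by (rule continuous_openin_preimage_gen)
 then obtain T' where T': "open T'" "S Int T Int (cmap d o f) -` (cmap d ` (cdom d Int U)) = S Int T Int T'"
  unfolding openin_open by blast
 show ?thesis
 proof (rule that[of "T Int T'"])
  show "open (T Int T')" using T T' by blast
  have "x : S Int T Int (cmap d o f) -` (cmap d ` (cdom d Int U))" using x T da U(2) by auto
  then show "x : T Int T'" using T' by blast
  show "f ` (S Int (T Int T')) <= U"
  proof
   fix q assume "q : f ` (S Int (T Int T'))"
   then obtain y where y: "y : S Int T Int T'" "q = f y" by blast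
   then have "y : S Int T Int (cmap d o f) -` (cmap d ` (cdom d Int U))" unfolding T'(2) by blast
   then have "cmap d q : cmap d ` (cdom d Int U)" using y(2) by simp
   moreover have "q : cdom d" using y T(3) by blast
   ultimately show "q : U" using inj_on_cmap[OF da(1)] by (auto simp: inj_on_def)
  qed
 qed
qed

lemma smooth_into_chart:
 assumes f: "smooth_into M S f" and x: "x : S" and c: "c : charts_at M (f x)"
 obtains T where "open T" "x : T" "f ` (S Int T) <= cdom c" "smooth_on (S Int T) (cmap c o f)"
proof -
 obtain d T where d: "d : charts_at M (f x)" and T: "open T" "x : T" "f ` (S Int T) <= cdom d"
   "smooth_on (S Int T) (cmap d o f)"
  using f x unfolding smooth_into_def by blast
 have da: "d : atlas M" "c : atlas M" "f x : cdom c" using d c by (auto simp: charts_at_def)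
 obtain T' where T': "open T'" "x : T'" "f ` (S Int T') <= cdom c"
  by (rule smooth_into_nbhd[OF f x openin_cdom[OF da(2)] da(3)], rule that)
 let ?T = "T Int T'"
 have sm: "smooth_on (S Int ?T) (cmap d o f)" by (rule smooth_on_subset[OF T(4)]) blast
 have "(cmap d o f) ` (S Int ?T) <= cmap d ` (cdom d Int cdom c)" using T(3) T'(3) by auto
 from smooth_on_compose[OF sm Cinf_on_transition[OF da(1,2)] this]
 have "smooth_on (S Int ?T) (transition d c o (cmap d o f))" .
 moreover have "(transition d c o (cmap d o f)) y = (cmap c o f) y" if "y : S Int ?T" for y
  using that T(3) cinv_cmap[OF da(1)] by (auto simp: image_subset_iff)
 ultimately have "smooth_on (S Int ?T) (cmap c o f)"
  unfolding smooth_on_def by (metis IntD1)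
 then show ?thesis using T T' by (intro that[of ?T]) auto
qed

lemma disc_differential:
 assumes f: "smooth_into M unit_disc f" and x: "x : unit_disc" and c: "c : charts_at M (f x)"
 obtains L where "((cmap c o f) has_derivative L) (at x within unit_disc)"
  "!!u. differential_within M unit_disc f x u = tvec (f x) c (L u)"
proof -
 obtain T where T: "open T" "x : T" "f ` (unit_disc Int T) <= cdom c" "smooth_on (unit_disc Int T) (cmap c o f)"
  by (rule smooth_into_chart[OF f x c], rule that)
 obtain L where L: "((cmap c o f) has_derivative L) (at x within unit_disc)"
  using smooth_on_has_derivative_within[OF T(4) x T(2,1)] by blast
 have ca: "c : atlas M" "f x : cdom c" using c by (auto simp: charts_at_def)
 have "differential_within M unit_disc f x u d = tvec (f x) c (L u) d" for u d
 proof (cases "d : charts_at M (f x)")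
  case True
  let ?D = "fd (transition c d) (cmap c (f x))"
  have da: "d : atlas M" "f x : cdom d" using True by (auto simp: charts_at_def)
  obtain T' where T': "open T'" "x : T'" "f ` (unit_disc Int T') <= cdom d"
   by (rule smooth_into_nbhd[OF f x openin_cdom[OF da(1)] da(2)], rule that)
  have "open (T Int T')" using T T' by blast
  then obtain e where e: "e > 0" "ball x e <= T Int T'" using T(2) T'(2) openE by blast
  have "(transition c d has_derivative ?D) (at ((cmap c o f) x))"
   unfolding o_apply[of "cmap c"] by (rule transition_has_derivative[OF c True])
  from has_derivative_compose[OF L this]
  have "((cmap d o f) has_derivative (%u. ?D (L u))) (at x within unit_disc)"
  proof (rule has_derivative_transform_within[OF _ e(1) x])
   fix y assume "y : unit_disc" "dist y x < e"
   then have "y : unit_disc Int T" using e(2) by (auto simp: dist_commute subset_iff)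
   then have "f y : cdom c" using T(3) by blast
   then show "transition c d ((cmap c o f) y) = (cmap d o f) y" using cinv_cmap[OF ca(1)] by simp
  qed
  from unit_disc_derivative_unique[OF x this] show ?thesis
   using True by (simp only: differential_within_def tvec_def if_True)
 next
  case False
  then show ?thesis by (simp only: differential_within_def tvec_def if_False)
 qed
 then show ?thesis using L by (intro that[of L]) blast+
qed

lemma tvec_add: "c : charts_at M p ==> tvec p c (v + w) = (%d. tvec p c v d + tvec p c w d)"
 using linear_add[OF transition_linear] by (auto simp: tvec_def fun_eq_iff)

lemma tvec_inj: "c : charts_at M p ==> tvec p c v = tvec p c w ==> v = w"
 using tvec_chart by metis

definition smooth_field :: "'a plane_field => bool" where
 "smooth_field ksi \<longleftrightarrow> (\<forall>p\<in>points M. \<exists>c V A. represents ksi c V A & p : cdom c & cmap c p : V)"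

text \<open>A plane has codimension one, so transversality means that one vector of the differential
  leaves the plane. Both conditions at the boundary then ask whether single vectors lie in planes, a
  form that is easily transported by maps.\<close>

lemma overtwisted_disc_iff:
 assumes ksi: "smooth_field ksi"
 shows "overtwisted_disc M ksi F f \<longleftrightarrow> smooth_into M unit_disc f & inj_on f unit_disc &
  (\<forall>x\<in>unit_disc. inj (differential_within M unit_disc f x)) &
  (\<forall>x\<in>sphere 0 1. f x ~: F &
    (\<forall>u. u \<bullet> x = 0 --> differential_within M unit_disc f x u : ksi (f x)) &
    (\<exists>u. differential_within M unit_disc f x u ~: ksi (f x)))"
proof -
 have "(\<forall>w\<in>tangent_space M (f x). \<exists>u. \<exists>v\<in>ksi (f x). w = (%c. differential_within M unit_disc f x u c + v c))
   \<longleftrightarrow> (\<exists>u. differential_within M unit_disc f x u ~: ksi (f x))"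
  if f: "smooth_into M unit_disc f" and x: "x : sphere 0 1" for x
 proof -
  have xd: "x : unit_disc" using x by simp
  have "f x : points M" using f xd unfolding smooth_into_def by blast
  then obtain c V A where R: "represents ksi c V A" and p: "f x : cdom c" "cmap c (f x) : V"
   using ksi unfolding smooth_field_def by blast
  note pl = represents_plane[OF R p] and tv = represents_tvec[OF R p]
  let ?a = "A (cmap c (f x))"
  have a0: "?a ~= 0" by (rule representsD(5)[OF R p(2)])
  obtain L where L: "((cmap c o f) has_derivative L) (at x within unit_disc)"
   "!!u. differential_within M unit_disc f x u = tvec (f x) c (L u)"
   by (rule disc_differential[OF f xd pl(2)], rule that)
  have lin: "linear L" by (rule has_derivative_linear[OF L(1)])
  show ?thesis unfolding L(2)
  proof
   assume *: "\<forall>w\<in>tangent_space M (f x). \<exists>u. \<exists>v\<in>ksi (f x). w = (%d. tvec (f x) c (L u) d + v d)"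
   obtain u v where uv: "v : ksi (f x)" "tvec (f x) c ?a = (%d. tvec (f x) c (L u) d + v d)"
    using * tvec_tangent[OF pl(2)] by blast
   have "?a = L u + v c" using fun_cong[OF uv(2), of c] tvec_chart[OF pl(2)] by simp
   moreover have "?a \<bullet> v c = 0" using uv(1) pl(1) by simp
   ultimately have "?a \<bullet> L u = ?a \<bullet> ?a" by (metis add.right_neutral inner_add_right)
   then show "\<exists>u. tvec (f x) c (L u) ~: ksi (f x)" using tv a0 by (intro exI[of _ u]) simp
  next
   assume "\<exists>u. tvec (f x) c (L u) ~: ksi (f x)"
   then obtain u where u: "?a \<bullet> L u ~= 0" using tv by blast
   show "\<forall>w\<in>tangent_space M (f x). \<exists>u. \<exists>v\<in>ksi (f x). w = (%d. tvec (f x) c (L u) d + v d)"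
   proof
    fix w assume w: "w : tangent_space M (f x)"
    let ?s = "(?a \<bullet> w c) / (?a \<bullet> L u)"
    let ?u = "?s *\<^sub>R u" and ?v = "w c - ?s *\<^sub>R L u"
    have "?a \<bullet> ?v = 0" using u by (simp add: inner_diff_right)
    then have "tvec (f x) c ?v : ksi (f x)" using tv by blast
    moreover have "L ?u + ?v = w c" by (simp add: linear_cmul[OF lin])
    then have "w = tvec (f x) c (L ?u + ?v)" by (simp only:) (rule tangent_eq_tvec[OF pl(2) w])
    then have "w = (%d. tvec (f x) c (L ?u) d + tvec (f x) c ?v d)"
     unfolding tvec_add[OF pl(2)] .
    ultimately show "\<exists>u. \<exists>v\<in>ksi (f x). w = (%d. tvec (f x) c (L u) d + v d)" by blast
   qed
  qed
 qed
 then show ?thesis unfolding overtwisted_disc_def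
  by (intro conj_cong refl ball_cong)
qed

definition chart_lift :: "'a chart => (real^3 => real^3) => 'a => 'a" where
 "chart_lift c Psi p = (if p : cdom c then cinv c (Psi (cmap c p)) else p)"


lemma continuous_cinv:
 assumes c: "c : atlas M"
 shows "continuous_map (top_of_set (cimage c)) (mtop M) (cinv c)"
proof -
 obtain g where g: "homeomorphic_maps (subtopology (mtop M) (cdom c)) (top_of_set (cimage c)) (cmap c) g"
  using chart_homeo[OF c] homeomorphic_map_maps by blast
 have "g x = cinv c x" if "x : cimage c" for x
  using g that inj_on_cmap[OF c] cdom_subset[OF c]
  by (auto simp: homeomorphic_maps_def continuous_map_def topspace_subtopology inv_into_f_f Pi_iff)
 then have "homeomorphic_maps (subtopology (mtop M) (cdom c)) (top_of_set (cimage c)) (cmap c) (cinv c)"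
  using homeomorphic_maps_eq[OF g, of "cmap c" "cinv c"] by simp
 then show ?thesis by (simp add: homeomorphic_maps_def continuous_map_in_subtopology)
qed

lemma compactin_cinv:
 assumes c: "c : atlas M" and C: "compact C" "C <= cimage c"
 shows "compactin (mtop M) (cinv c ` C)"
 using C by (intro image_compactin[OF _ continuous_cinv[OF c]]) (simp add: compactin_subtopology)

lemma compact_cmap:
 assumes c: "c : atlas M" and S: "compactin (mtop M) S" "S <= cdom c"
 shows "compact (cmap c ` S)"
proof -
 have "compactin (subtopology (mtop M) (cdom c)) S" using S by (simp add: compactin_subtopology)
 from image_compactin[OF this homeomorphic_imp_continuous_map[OF chart_homeo[OF c]]]
 show ?thesis by (simp add: compactin_subtopology)
qed

lemma smooth_into_continuous:
 assumes f: "smooth_into M S f"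
 shows "continuous_map (top_of_set S) (mtop M) f"
 unfolding continuous_map_def
proof (intro conjI allI impI)
 show "f : topspace (top_of_set S) \<rightarrow> points M" using f by (auto simp: smooth_into_def)
 fix U assume U: "openin (mtop M) U"
 have "openin (top_of_set S) {x : S. f x : U}"
 proof (subst openin_subopen, intro ballI)
  fix x assume x: "x : {x : S. f x : U}"
  then obtain T where T: "open T" "x : T" "f ` (S Int T) <= U"
   using smooth_into_nbhd[OF f _ U, of x] by blast
  then show "\<exists>T. openin (top_of_set S) T & x : T & T <= {x : S. f x : U}"
   using x by (intro exI[of _ "S Int T"]) (auto simp: openin_open_Int)
 qed
 then show "openin (top_of_set S) {x : topspace (top_of_set S). f x : U}" by simp
qed

lemma compactin_disc_boundary:
 assumes f: "smooth_into M unit_disc f"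
 shows "compactin (mtop M) (f ` sphere 0 1)"
proof (rule image_compactin[OF _ smooth_into_continuous[OF f]])
 show "compactin (top_of_set unit_disc) (sphere 0 1)"
  by (simp add: compactin_subtopology subset_iff)
qed

text \<open>The disc is carried along by a chart diffeomorphism extended by the identity, and
  \<open>inside\<close> and \<open>outside\<close> compare the plane fields along its boundary.
  Where \<open>f\<close> runs in the chart, the new disc is \<open>f\<close> composed with
  \<open>Psi\<close> in coordinates; where it does not, the new disc agrees with \<open>f\<close> on
  a neighbourhood, since the support of \<open>Psi\<close> is compact and hence closed in the
  Hausdorff space \<open>M\<close>.\<close>

lemma overtwisted_disc_transport:
 assumes OT: "overtwisted_disc M ksi F f" and ksi: "smooth_field ksi" "smooth_field ksi'"
  and c: "c : atlas M"
  and Psi: "Cinf_on (cimage c) Psi" "Psi ` cimage c <= cimage c" "inj_on Psi (cimage c)"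
   "!!x. x : cimage c ==> inj (fd Psi x)"
  and C: "compact C" "C <= cimage c" "!!x. x : cimage c - C ==> Psi x = x"
  and inside: "!!p. p : f ` sphere 0 1 ==> p : cdom c ==> chart_lift c Psi p ~: F' &
   (\<forall>w. tvec p c w : ksi p \<longleftrightarrow> tvec (chart_lift c Psi p) c (fd Psi (cmap c p) w) : ksi' (chart_lift c Psi p))"
  and outside: "!!p. p : f ` sphere 0 1 ==> p ~: cdom c ==> p ~: F' & ksi' p = ksi p"
 shows "overtwisted_disc M ksi' F' (chart_lift c Psi o f)"
proof -
 let ?psi = "chart_lift c Psi" and ?g = "chart_lift c Psi o f"
 have f: "smooth_into M unit_disc f" "inj_on f unit_disc" "!!x. x : unit_disc ==> inj (differential_within M unit_disc f x)"
  and bd: "!!x u. x : sphere 0 1 ==> u \<bullet> x = 0 ==> differential_within M unit_disc f x u : ksi (f x)"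
   "!!x. x : sphere 0 1 ==> \<exists>u. differential_within M unit_disc f x u ~: ksi (f x)"
  using OT unfolding overtwisted_disc_iff[OF ksi(1)] by blast+
 have inpsi: "?psi p : cdom c" "cmap c (?psi p) = Psi (cmap c p)" if "p : cdom c" for p
 proof -
  have "Psi (cmap c p) : cimage c" using that Psi(2) by blast
  then show "?psi p : cdom c" "cmap c (?psi p) = Psi (cmap c p)"
   using that by (simp_all add: chart_lift_def cinv_cdom cmap_cinv)
 qed
 have outpsi: "?psi p = p" if "p ~: cinv c ` C" for p
 proof (cases "p : cdom c")
  case True
  have "cmap c p ~: C" using that cinv_cmap[OF c True] by (metis imageI)
  then have "Psi (cmap c p) = cmap c p" using C(3) True by blast
  then show ?thesis using True cinv_cmap[OF c True] by (simp add: chart_lift_def)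
 qed (simp add: chart_lift_def)
 have closedC: "closedin (mtop M) (cinv c ` C)"
  by (rule compactin_imp_closedin[OF Hausdorff_points compactin_cinv[OF c C(1,2)]])
 have openC: "openin (mtop M) (points M - cinv c ` C)" using closedC by blast
 have fpts: "f x : points M" if "x : unit_disc" for x
  using f(1) that unfolding smooth_into_def by blast
 have psicd: "?psi p : cdom c \<longleftrightarrow> p : cdom c" for p using inpsi(1) by (auto simp: chart_lift_def)
 have injpsi: "inj ?psi"
 proof (rule injI)
  fix p q assume eq: "?psi p = ?psi q"
  show "p = q"
  proof (cases "p : cdom c")
   case True
   then have q: "q : cdom c" using eq psicd by metis
   have "Psi (cmap c p) = Psi (cmap c q)" using inpsi(2)[OF True] inpsi(2)[OF q] eq by simp
   then have "cmap c p = cmap c q" using Psi(3) True q by (simp add: inj_on_def)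
   then show ?thesis using inj_on_cmap[OF c] True q by (simp add: inj_on_def)
  next
   case False
   then have "q ~: cdom c" using eq psicd by metis
   then show ?thesis using False eq by (simp add: chart_lift_def)
  qed
 qed
 have gin: "\<exists>T. open T & x : T & ?g ` (unit_disc Int T) <= cdom c & smooth_on (unit_disc Int T) (cmap c o ?g)"
  if x: "x : unit_disc" "f x : cdom c" for x
 proof -
  have ch: "c : charts_at M (f x)" using c x by (simp add: charts_at_def)
  obtain T where T: "open T" "x : T" "f ` (unit_disc Int T) <= cdom c" "smooth_on (unit_disc Int T) (cmap c o f)"
   by (rule smooth_into_chart[OF f(1) x(1) ch], rule that)
  have "smooth_on (unit_disc Int T) (Psi o (cmap c o f))"
   by (rule smooth_on_compose[OF T(4) Psi(1)]) (use T(3) in auto)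
  moreover have "(Psi o (cmap c o f)) y = (cmap c o ?g) y" if "y : unit_disc Int T" for y
  proof -
   have "f y : cdom c" using that T(3) by blast
   then show ?thesis using inpsi(2)[of "f y"] by simp
  qed
  ultimately have "smooth_on (unit_disc Int T) (cmap c o ?g)"
   unfolding smooth_on_def by (metis IntD1)
  moreover have "?g ` (unit_disc Int T) <= cdom c" using T(3) inpsi(1) by auto
  ultimately show ?thesis using T(1,2) by blast
 qed
 have gout: "\<exists>T. open T & x : T & (\<forall>y\<in>unit_disc Int T. ?g y = f y)"
  if x: "x : unit_disc" "f x ~: cdom c" for x
 proof -
  have "f x : points M - cinv c ` C" using fpts[OF x(1)] x(2) cinv_image_subset[OF C(2)] by blast
  then obtain T where "open T" "x : T" "f ` (unit_disc Int T) <= points M - cinv c ` C"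
   by (rule smooth_into_nbhd[OF f(1) x(1) openC])
  then show ?thesis using outpsi by (intro exI[of _ T]) auto
 qed
 have g: "smooth_into M unit_disc ?g"
  unfolding smooth_into_def
 proof (intro conjI ballI)
  show "?g ` unit_disc <= points M"
   using fpts inpsi(1) cdom_subset[OF c] by (auto simp: chart_lift_def)
  fix x assume x: "x : unit_disc"
  show "\<exists>d\<in>charts_at M (?g x). \<exists>T. open T & x : T & ?g ` (unit_disc Int T) <= cdom d & smooth_on (unit_disc Int T) (cmap d o ?g)"
  proof (cases "f x : cdom c")
   case True
   then have "c : charts_at M (?g x)" using c inpsi(1) by (simp add: charts_at_def)
   then show ?thesis using gin[OF x True] by blast
  next
   case False
   obtain T where T: "open T" "x : T" "\<forall>y\<in>unit_disc Int T. ?g y = f y" using gout[OF x False] by blast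
   obtain d T' where d: "d : charts_at M (f x)" and T': "open T'" "x : T'" "f ` (unit_disc Int T') <= cdom d"
     "smooth_on (unit_disc Int T') (cmap d o f)"
    using f(1) x unfolding smooth_into_def by blast
   have "smooth_on (unit_disc Int (T Int T')) (cmap d o f)" by (rule smooth_on_subset[OF T'(4)]) blast
   then have "smooth_on (unit_disc Int (T Int T')) (cmap d o ?g)"
    using T(3) unfolding smooth_on_def by (metis (no_types, lifting) IntD1 IntD2 IntI comp_apply)
   moreover have "?g ` (unit_disc Int (T Int T')) <= cdom d" using T(3) T'(3) by auto
   moreover have "d : charts_at M (?g x)" using d T(2,3) x by auto
   ultimately show ?thesis using T(1,2) T'(1,2) by (intro bexI[of _ d] exI[of _ "T Int T'"]) auto
  qed
 qed
 have din: "differential_within M unit_disc ?g x u = tvec (?g x) c (fd Psi (cmap c (f x)) (L u))"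
  if x: "x : unit_disc" "f x : cdom c" and L: "((cmap c o f) has_derivative L) (at x within unit_disc)" for x u L
 proof -
  have ch: "c : charts_at M (f x)" "c : charts_at M (?g x)" using c x inpsi(1) by (simp_all add: charts_at_def)
  obtain L' where L': "((cmap c o ?g) has_derivative L') (at x within unit_disc)"
   "!!u. differential_within M unit_disc ?g x u = tvec (?g x) c (L' u)"
   by (rule disc_differential[OF g x(1) ch(2)], rule that)
  obtain T where T: "open T" "x : T" "f ` (unit_disc Int T) <= cdom c"
   by (rule smooth_into_nbhd[OF f(1) x(1) openin_cdom[OF c] x(2)], rule that)
  obtain e where e: "e > 0" "ball x e <= T" using T openE by blast
  have "cmap c (f x) : cimage c" using x(2) by blast
  then have "(Psi has_derivative fd Psi (cmap c (f x))) (at ((cmap c o f) x))"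
   using Cinf_on_has_derivative[OF Psi(1)] by simp
  from has_derivative_compose[OF L this]
  have "((%y. Psi ((cmap c o f) y)) has_derivative (%u. fd Psi (cmap c (f x)) (L u))) (at x within unit_disc)" .
  then have "((cmap c o ?g) has_derivative (%u. fd Psi (cmap c (f x)) (L u))) (at x within unit_disc)"
  proof (rule has_derivative_transform_within[OF _ e(1) x(1)])
   fix y assume "y : unit_disc" "dist y x < e"
   then have "f y : cdom c" using e(2) T(3) by (auto simp: dist_commute subset_iff image_subset_iff)
   then show "Psi ((cmap c o f) y) = (cmap c o ?g) y" using inpsi(2) by simp
  qed
  then have "L' = (%u. fd Psi (cmap c (f x)) (L u))"
   using unit_disc_derivative_unique[OF x(1) L'(1)] unit_disc_derivative_unique[OF x(1)] by metis
  then show ?thesis using L'(2) by simp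
 qed
 have dout: "differential_within M unit_disc ?g x = differential_within M unit_disc f x" "?g x = f x"
  if x: "x : unit_disc" "f x ~: cdom c" for x
 proof -
  show gx: "?g x = f x" using x(2) by (simp add: chart_lift_def)
  obtain T where T: "open T" "x : T" "\<forall>y\<in>unit_disc Int T. ?g y = f y" using gout[OF x] by blast
  obtain e where e: "e > 0" "ball x e <= T" using T openE by blast
  obtain d where d: "d : charts_at M (f x)" using ex_chart[OF fpts[OF x(1)]] by blast
  obtain L where L: "((cmap d o f) has_derivative L) (at x within unit_disc)"
   "!!u. differential_within M unit_disc f x u = tvec (f x) d (L u)"
   by (rule disc_differential[OF f(1) x(1) d], rule that)
  obtain L' where L': "((cmap d o ?g) has_derivative L') (at x within unit_disc)"
   "!!u. differential_within M unit_disc ?g x u = tvec (?g x) d (L' u)"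
   by (rule disc_differential[OF g x(1) d[folded gx]], rule that)
  have "((cmap d o ?g) has_derivative L) (at x within unit_disc)"
   by (rule has_derivative_transform_within[OF L(1) e(1) x(1)])
    (use T(3) e(2) in \<open>auto simp: dist_commute subset_iff\<close>)
  then have "L' = L" using unit_disc_derivative_unique[OF x(1) L'(1)] unit_disc_derivative_unique[OF x(1)] by metis
  then show "differential_within M unit_disc ?g x = differential_within M unit_disc f x"
   using L(2) L'(2) gx by (simp add: fun_eq_iff)
 qed
 show ?thesis
  unfolding overtwisted_disc_iff[OF ksi(2)]
 proof (intro conjI ballI)
  show "smooth_into M unit_disc ?g" by (rule g)
  show "inj_on ?g unit_disc" using f(2) injpsi by (simp add: comp_inj_on inj_on_subset)
  fix x assume x: "x : unit_disc"
  show "inj (differential_within M unit_disc ?g x)"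
  proof (cases "f x : cdom c")
   case True
   have ch: "c : charts_at M (f x)" "c : charts_at M (?g x)" using c True inpsi(1) by (simp_all add: charts_at_def)
   obtain L where L: "((cmap c o f) has_derivative L) (at x within unit_disc)"
    "!!u. differential_within M unit_disc f x u = tvec (f x) c (L u)"
    by (rule disc_differential[OF f(1) x ch(1)], rule that)
   have cf: "cmap c (f x) : cimage c" using True by blast
   show ?thesis
   proof (rule injI)
    fix u v assume "differential_within M unit_disc ?g x u = differential_within M unit_disc ?g x v"
    then have "fd Psi (cmap c (f x)) (L u) = fd Psi (cmap c (f x)) (L v)"
     unfolding din[OF x True L(1)] by (rule tvec_inj[OF ch(2)])
    then have "L u = L v" using Psi(4)[OF cf] by (simp add: inj_eq)
    then have "differential_within M unit_disc f x u = differential_within M unit_disc f x v" using L(2) by simp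
    then show "u = v" using f(3)[OF x] by (simp add: inj_eq)
   qed
  qed (use dout(1)[OF x] f(3)[OF x] in simp)
 next
  fix x :: "real^2" assume x: "x : sphere 0 1"
  then have xd: "x : unit_disc" by simp
  have "?g x ~: F' & (\<forall>u. differential_within M unit_disc f x u : ksi (f x) \<longleftrightarrow> differential_within M unit_disc ?g x u : ksi' (?g x))"
  proof (cases "f x : cdom c")
   case True
   have ch: "c : charts_at M (f x)" using c True by (simp add: charts_at_def)
   obtain L where L: "((cmap c o f) has_derivative L) (at x within unit_disc)"
    "!!u. differential_within M unit_disc f x u = tvec (f x) c (L u)"
    by (rule disc_differential[OF f(1) xd ch], rule that)
   show ?thesis using inside[of "f x"] x True unfolding din[OF xd True L(1)] L(2) by simp
  next
   case False
   show ?thesis using outside[of "f x"] x False unfolding dout[OF xd False] by simp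
  qed
  then show "?g x ~: F'" "\<exists>u. differential_within M unit_disc ?g x u ~: ksi' (?g x)"
   "\<forall>u. u \<bullet> x = 0 --> differential_within M unit_disc ?g x u : ksi' (?g x)"
   using bd[OF x] by blast+
 qed
qed

end

section \<open>Diffeomorphisms along the lines of a box\<close>

abbreviation pd :: "3 => (real^3 => real) => real^3 => real" where
 "pd i f x == fd f x (axis i 1)"

abbreviation on_line :: "real => real^3 => real^3" where
 "on_line s p == vec3 s (p $ 2) (p $ 3)"

lemma on_line_self: "on_line (p $ 1) p = p" by (rule vec3_eta)

lemma same_line: "q $ 2 = p $ 2 ==> q $ 3 = p $ 3 ==> q = on_line (q $ 1) p"
 by (simp add: vec_eq_iff forall_3)

lemma mem_box3: "x : box a b \<longleftrightarrow> (\<forall>i. a $ i < x $ i & x $ i < b $ i)" for x :: "real^3"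
 by (simp add: mem_box_cart)

lemma on_line_box:
 fixes p q :: "real^3"
 assumes "p : box a b" "q : box a b" "p $ 1 <= s" "s <= q $ 1"
 shows "on_line s p : box a b"
 using assms by (auto simp: mem_box3 forall_3 intro: less_le_trans le_less_trans)

lemma on_line_deriv:
 assumes "Cinf_on V H" "on_line s p : V"
 shows "((%t. H (on_line t p)) has_real_derivative pd 1 H (on_line s p)) (at s)"
proof -
 have "((%t. on_line 0 p + t *\<^sub>R axis 1 1) has_derivative (%t. t *\<^sub>R axis 1 1)) (at s)"
  by (auto intro!: derivative_eq_intros)
 moreover have "(%t. on_line 0 p + t *\<^sub>R axis 1 1) = (%t. on_line t p)"
  by (auto simp: fun_eq_iff vec_eq_iff forall_3 axis_def)
 ultimately have "((%t. on_line t p) has_derivative (%t. t *\<^sub>R axis 1 1)) (at s)" by simp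
 from has_derivative_compose[OF this Cinf_on_has_derivative[OF assms]]
 have "((%t. H (on_line t p)) has_derivative (%t. fd H (on_line s p) (t *\<^sub>R axis 1 1))) (at s)" .
 moreover have "fd H (on_line s p) (t *\<^sub>R axis 1 1) = pd 1 H (on_line s p) * t" for t
  using linear_frechet_derivative[OF Cinf_on_differentiable[OF assms]] by (simp add: linear_cmul)
 ultimately show ?thesis by (simp add: has_field_derivative_def)
qed

lemma line_mono:
 assumes H: "Cinf_on (box a b) H" "!!x. x : box a b ==> pd 1 H x >= 0"
  and pq: "p : box a b" "q : box a b" "q $ 2 = p $ 2" "q $ 3 = p $ 3" "p $ 1 <= q $ 1"
 shows "H p <= H q"
proof -
 have "H (on_line (p $ 1) p) <= H (on_line (q $ 1) p)"
 proof (rule DERIV_nonneg_imp_nondecreasing[OF pq(5)])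
  fix s assume "p $ 1 <= s" "s <= q $ 1"
  then have "on_line s p : box a b" by (rule on_line_box[OF pq(1,2)])
  then show "\<exists>y. ((%t. H (on_line t p)) has_real_derivative y) (at s) & 0 <= y"
   using on_line_deriv[OF H(1)] H(2) by blast
 qed
 then show ?thesis using on_line_self same_line[OF pq(3,4)] by metis
qed

text \<open>A positive derivative at one end gives a strict increase next to it, and on the rest of
  the segment \<open>H\<close> does not decrease. So contactness at one of the two points is
  enough.\<close>

lemma line_strict_mono:
 assumes H: "Cinf_on (box a b) H" "!!x. x : box a b ==> pd 1 H x >= 0"
  and pq: "p : box a b" "q : box a b" "q $ 2 = p $ 2" "q $ 3 = p $ 3" "p $ 1 < q $ 1"
  and pos: "pd 1 H p > 0 \<or> pd 1 H q > 0"
 shows "H p < H q"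
proof -
 let ?h = "%t. H (on_line t p)"
 have q: "on_line (q $ 1) p = q" using same_line[OF pq(3,4)] by simp
 have inb: "on_line s p : box a b" if "p $ 1 <= s" "s <= q $ 1" for s
  using on_line_box[OF pq(1,2) that] .
 have mono: "?h s <= ?h t" if "p $ 1 <= s" "s <= t" "t <= q $ 1" for s t
  using line_mono[OF H, of "on_line s p" "on_line t p"] inb that by simp
 show ?thesis
 proof (cases "pd 1 H p > 0")
  case True
  have "(?h has_real_derivative pd 1 H p) (at (p $ 1))"
   using on_line_deriv[OF H(1) inb[of "p $ 1"]] pq(5) by (simp add: on_line_self)
  from DERIV_pos_inc_right[OF this True] obtain d where d: "d > 0" "!!h. 0 < h ==> h < d ==> ?h (p $ 1) < ?h (p $ 1 + h)"
   by blast
  let ?e = "min (d / 2) (q $ 1 - p $ 1)"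
  have "?h (p $ 1) < ?h (p $ 1 + ?e)" using d pq(5) by (intro d(2)) auto
  also have "... <= ?h (q $ 1)" using d pq(5) by (intro mono) auto
  finally show ?thesis by (simp add: q on_line_self)
 next
  case False
  then have pos: "pd 1 H q > 0" using pos by blast
  have "(?h has_real_derivative pd 1 H q) (at (q $ 1))"
   using on_line_deriv[OF H(1) inb[of "q $ 1"]] pq(5) by (simp add: q)
  from DERIV_pos_inc_left[OF this pos] obtain d where d: "d > 0" "!!h. 0 < h ==> h < d ==> ?h (q $ 1 - h) < ?h (q $ 1)"
   by blast
  let ?e = "min (d / 2) (q $ 1 - p $ 1)"
  have "?h (p $ 1) <= ?h (q $ 1 - ?e)" using d pq(5) by (intro mono) auto
  also have "... < ?h (q $ 1)" using d pq(5) by (intro d(2)) auto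
  finally show ?thesis by (simp add: q on_line_self)
 qed
qed

text \<open>Moves each point along its x-line. With \<open>tau = H\<close> it is also the passage to
  the coordinates \<open>(H, y, z)\<close>, in which \<open>dz + H dy\<close> reads
  \<open>dz + x dy\<close>.\<close>

definition line_map :: "(real^3 => real) => real^3 => real^3" where
 "line_map tau p = on_line (tau p) p"

lemma line_map_nth [simp]: "line_map tau p $ 1 = tau p" "line_map tau p $ 2 = p $ 2" "line_map tau p $ 3 = p $ 3"
 by (simp_all add: line_map_def)

lemma Cinf_on_line_map: "Cinf_on V tau ==> Cinf_on V (line_map tau)"
 unfolding line_map_def[abs_def]
 by (intro smooth_intros) (auto intro: Cinf_on_open)

lemma line_map_has_derivative:
 assumes "(tau has_derivative D) (at p)"
 shows "(line_map tau has_derivative (%v. on_line (D v) v)) (at p)"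
 unfolding line_map_def[abs_def] vec3_decomp
 by (auto intro!: derivative_eq_intros assms bounded_linear.has_derivative[OF bounded_linear_vec_nth])

lemma line_map_derivative:
 assumes "Cinf_on V tau" "p : V"
 shows "fd (line_map tau) p = (%v. on_line (fd tau p v) v)"
 using frechet_derivative_at[OF line_map_has_derivative[OF Cinf_on_has_derivative[OF assms]]] by simp

lemma line_map_det:
 assumes "Cinf_on V tau" "p : V"
 shows "det (matrix (fd (line_map tau) p)) = pd 1 tau p"
 unfolding line_map_derivative[OF assms]
 by (simp add: det_3 matrix_def axis_def)

lemma line_map_derivative_inj:
 assumes "Cinf_on V tau" "p : V" "pd 1 tau p ~= 0"
 shows "inj (fd (line_map tau) p)"
proof (rule injI)
 let ?D = "fd tau p"
 fix v w assume "fd (line_map tau) p v = fd (line_map tau) p w"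
 then have eq: "on_line (?D v) v = on_line (?D w) w" by (simp add: line_map_derivative[OF assms(1,2)])
 then have 23: "v $ 2 = w $ 2" "v $ 3 = w $ 3" "?D v = ?D w" by (auto simp: vec_eq_iff forall_3)
 have lin: "linear ?D" using linear_frechet_derivative[OF Cinf_on_differentiable[OF assms(1,2)]] .
 have "v - w = (v $ 1 - w $ 1) *\<^sub>R axis 1 1" using 23 by (simp add: vec_eq_iff forall_3 axis_def)
 then have "?D (v - w) = (v $ 1 - w $ 1) * ?D (axis 1 1)" by (simp add: linear_cmul[OF lin])
 then have "(v $ 1 - w $ 1) * ?D (axis 1 1) = 0" using 23(3) by (simp add: linear_diff[OF lin])
 then have "v $ 1 = w $ 1" using assms(3) by simp
 then show "v = w" using 23 by (simp add: vec_eq_iff forall_3)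
qed

lemma line_map_inj_on:
 assumes "Cinf_on (box a b) tau" "!!x. x : box a b ==> pd 1 tau x >= 0"
  and "S <= box a b" "!!x. x : S ==> pd 1 tau x > 0"
 shows "inj_on (line_map tau) S"
proof (rule inj_onI)
 fix p q assume pq: "p : S" "q : S" "line_map tau p = line_map tau q"
 have b: "p : box a b" "q : box a b" using pq assms(3) by auto
 have 23: "p $ 2 = q $ 2" "p $ 3 = q $ 3" "tau p = tau q"
  using pq(3) line_map_nth by metis+
 have "\<not> p $ 1 < q $ 1" "\<not> q $ 1 < p $ 1"
  using line_strict_mono[OF assms(1,2) b] line_strict_mono[OF assms(1,2) b(2,1)] 23 assms(4) pq by force+
 then show "p = q" using 23 by (simp add: vec_eq_iff forall_3)
qed

lemma chain_on_line:
 assumes "Cinf_on V H" "Cinf_on U tau" "p : U" "line_map tau p : V"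
 shows "fd (%x. H (line_map tau x)) p (axis 1 1) = pd 1 H (line_map tau p) * pd 1 tau p"
proof -
 let ?D = "fd H (line_map tau p)"
 have 1: "((%x. H (line_map tau x)) has_derivative (%v. ?D (on_line (fd tau p v) v))) (at p)"
  by (rule has_derivative_compose[OF line_map_has_derivative[OF Cinf_on_has_derivative[OF assms(2,3)]]
     Cinf_on_has_derivative[OF assms(1,4)]])
 have "fd (%x. H (line_map tau x)) p (axis 1 1) = ?D (on_line (pd 1 tau p) (axis 1 1))"
  by (rule fun_cong[OF frechet_derivative_at[OF 1], symmetric])
 also have "on_line (pd 1 tau p) (axis 1 1) = pd 1 tau p *\<^sub>R axis 1 1"
  by (simp add: vec_eq_iff forall_3 axis_def)
 also have "?D ... = pd 1 H (line_map tau p) * pd 1 tau p"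
  using linear_frechet_derivative[OF Cinf_on_differentiable[OF assms(1,4)]] by (simp add: linear_cmul)
 finally show ?thesis .
qed

section \<open>Solving for a map that intertwines two normal forms\<close>

lemma compact_continuous_bound:
 fixes f :: "'a::topological_space => real"
 assumes "compact S" "continuous_on S f"
 obtains B where "B > 0" "!!x. x : S ==> \<bar>f x\<bar> <= B"
 using compact_imp_bounded[OF compact_continuous_image[OF assms(2,1)]] that
 unfolding bounded_pos by auto

lemma compact_continuous_pos_bound:
 fixes f :: "'a::topological_space => real"
 assumes "compact S" "continuous_on S f" "!!x. x : S ==> f x > 0"
 obtains m where "m > 0" "!!x. x : S ==> m <= f x"
proof (cases "S = {}")
 case True
 then show ?thesis using that[of 1] by simp
next
 case False
 then obtain x where "x : S" "\<forall>y\<in>S. f x <= f y"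
  using continuous_attains_inf[OF assms(1) _ assms(2)] by blast
 then show ?thesis using that[of "f x"] assms(3) by blast
qed

text \<open>The map from \<open>(p, x)\<close> to \<open>(p, E (p, x))\<close> is injective on
  \<open>W\<close>, and \<open>tau\<close> is read off from its inverse at \<open>(p, 0)\<close>.
  This covers a \<open>tau\<close> obtained by mere choice: its continuity comes with the
  differentiability of that inverse. The derivative of \<open>tau\<close> is \<open>L\<close> at
  \<open>(p, tau p)\<close> with \<open>L\<close> smooth, so smoothness improves by one order at a
  time.\<close>

lemma Cinf_on_implicit:
 fixes E :: "'v::euclidean_space \<times> real => real"
 assumes E: "Cinf_on W E" "!!z. z : W ==> fd E z (0, 1) ~= 0"
   "!!p x y. (p, x) : W ==> (p, y) : W ==> E (p, x) = E (p, y) ==> x = y"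
  and V: "open V" "!!p. p : V ==> (p, tau p) : W" "!!p. p : V ==> E (p, tau p) = 0"
 shows "Cinf_on V tau"
proof -
 let ?D = "%z. fd E z"
 let ?T = "%z. (fst z, E z)"
 define L where "L z v = - ?D z (v, 0) * inverse (?D z (0, 1))" for z v
 have smT: "Cinf_on W ?T" by (intro smooth_intros E(1) Cinf_on_open[OF E(1)])
 have inj: "inj_on ?T W" by (rule inj_onI) (use E(3) in \<open>auto simp: prod_eq_iff\<close>)
 have der: "(tau has_derivative L (p, tau p)) (at p)" if p: "p : V" for p
 proof -
  let ?z = "(p, tau p)"
  define G where "G w = (fst w, (snd w - ?D ?z (fst w, 0)) * inverse (?D ?z (0, 1)))" for w
  note dE = Cinf_on_has_derivative[OF E(1) V(2)[OF p]]
  have D: "?D ?z (v, s) = ?D ?z (v, 0) + s * ?D ?z (0, 1)" for v s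
   using has_derivative_linear[OF dE, THEN linear_add, of "(v, 0)" "s *\<^sub>R (0, 1)"]
    has_derivative_linear[OF dE, THEN linear_cmul, of s "(0, 1)"] by simp
  have "(inv_into W ?T has_derivative G) (at (?T ?z))"
  proof (rule has_derivative_inverse_strong[OF Cinf_on_open[OF E(1)] V(2)[OF p] Cinf_on_continuous[OF smT] inv_into_f_f[OF inj]])
   show "(?T has_derivative (%w. (fst w, ?D ?z w))) (at ?z)"
    by (intro has_derivative_Pair has_derivative_fst has_derivative_ident dE)
   have "?D ?z (fst w, (snd w - ?D ?z (fst w, 0)) * inverse (?D ?z (0, 1))) = snd w" for w
    using E(2)[OF V(2)[OF p]] by (subst D) (simp add: mult.assoc)
   then show "(%w. (fst w, ?D ?z w)) o G = id" by (auto simp: fun_eq_iff G_def)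
  qed
  then have "(inv_into W ?T has_derivative G) (at (p, 0))" using V(3)[OF p] by simp
  from has_derivative_snd[OF has_derivative_compose[OF has_derivative_Pair[OF has_derivative_ident has_derivative_const] this]]
  have "((%q. snd (inv_into W ?T (q, 0))) has_derivative L (p, tau p)) (at p)" by (simp add: G_def L_def[abs_def])
  then show ?thesis
  proof (rule has_derivative_transform_within_open[OF _ V(1) p])
   show "snd (inv_into W ?T (q, 0)) = tau q" if "q : V" for q
    using inv_into_f_f[OF inj V(2)[OF that]] V(3)[OF that] by simp
  qed
 qed
 have L: "Ck_on k W (%z. L z v)" for k v
 proof -
  have "Cinf_on W (%z. L z v)" unfolding L_def
   by (intro smooth_intros Cinf_on_derivative E)
  then show ?thesis by (simp add: Cinf_on_def)
 qed
 have "Ck_on k V tau" for k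
 proof (induction k)
  case 0
  show ?case using der has_derivative_continuous continuous_at_imp_continuous_on by (metis Ck_on.simps(1))
 next
  case (Suc k)
  have "Cinf_on V (%p. (p, 0::real))" by (intro smooth_intros V(1))
  then have "Ck_on k V (%p. (p, 0) + tau p *\<^sub>R (0, 1::real))"
   by (intro Ck_on_add Ck_on_bilinear[OF V(1) bounded_bilinear_scaleR] Suc Ck_on_const V(1)) (auto simp: Cinf_on_def)
  then have "Ck_on k V (%p. (p, tau p))" by simp
  then show ?case
   by (intro Ck_on_SucI[OF V(1) der] Ck_on_compose[OF V(1) Cinf_on_open[OF E(1)] _ L]) (use V(2) in auto)
 qed
 then show ?thesis using V(1) by (simp add: Cinf_on_def)
qed

text \<open>The map intertwining the plane fields \<open>ker (dz + H dy)\<close> and \<open>ker (dz + H' dy)\<close> sends \<open>p\<close> to the point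
 of its line where \<open>H'\<close> takes the value \<open>H p\<close>, which is well behaved near \<open>K0\<close> only. Adding \<open>sig p (x - p1)\<close> to \<open>H'\<close>
 makes the equation uniquely solvable everywhere; \<open>sig >= 0\<close> vanishes near \<open>K0\<close> and is constant far from it.\<close>

lemma line_diffeo:
 fixes H H' :: "real^3 => real"
 assumes H: "Cinf_on (box a b) H" "!!x. x : box a b ==> pd 1 H x >= 0"
  and H': "Cinf_on (box a b) H'" "!!x. x : box a b ==> pd 1 H' x >= 0"
  and C: "compact C" "C <= box a b" "!!x. x : box a b - C ==> H x = H' x"
  and K0: "compact K0" "K0 <= C" "!!y. y : K0 ==> pd 1 H y > 0"
   "!!y. y : K0 ==> \<exists>q\<in>box a b. q $ 2 = y $ 2 & q $ 3 = y $ 3 & H' q = H y & pd 1 H' q > 0"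
 obtains tau where "Cinf_on (box a b) tau" "!!x. x : box a b ==> line_map tau x : box a b"
  "!!x. x : box a b ==> pd 1 tau x > 0" "!!x. x : box a b - C ==> tau x = x $ 1"
  "!!y. y : K0 ==> H' (line_map tau y) = H y" "!!y. y : K0 ==> pd 1 H' (line_map tau y) > 0"
proof -
 have ob: "open (box a b)" by (rule open_box)
 \<comment> \<open>The contact points of the second field. There \<open>line_map H'\<close> is a
   local diffeomorphism, so its values fill an open set; hence the points that have an acceptable
   target form an open set \<open>U\<close> too.\<close>
 define U' where "U' = {q : box a b. pd 1 H' q > 0}"
 have cpd: "continuous_on (box a b) (pd 1 H)" "continuous_on (box a b) (pd 1 H')"
  using Cinf_on_continuous[OF Cinf_on_derivative[OF H(1)]] Cinf_on_continuous[OF Cinf_on_derivative[OF H'(1)]] by auto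
 have "U' = box a b Int pd 1 H' -` {0<..}" by (auto simp: U'_def)
 then have oU': "open U'" using continuous_open_preimage[OF cpd(2) ob open_greaterThan] by simp
 have U'b: "U' <= box a b" by (auto simp: U'_def)
 have injU': "inj_on (line_map H') U'"
  by (rule line_map_inj_on[OF H' U'b]) (auto simp: U'_def)
 have smU': "Cinf_on U' H'" by (rule Cinf_on_subset[OF H'(1) oU' U'b])
 have detU': "det (matrix (fd (line_map H') x)) ~= 0" if "x : U'" for x
  using line_map_det[OF smU' that] that by (simp add: U'_def)
 have oim: "open (line_map H' ` U')"
  by (rule Cinf_on_inverse_real3(1)[OF Cinf_on_line_map[OF smU'] injU' detU'])
 define U where "U = (box a b Int pd 1 H -` {0<..}) Int (box a b Int line_map H -` (line_map H' ` U'))"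
 have oU: "open U" unfolding U_def
  by (intro open_Int continuous_open_preimage[OF cpd(1) ob] open_greaterThan
    continuous_open_preimage[OF Cinf_on_continuous[OF Cinf_on_line_map[OF H(1)]] ob oim])
 have U: "p : box a b" "pd 1 H p > 0" "\<exists>x. on_line x p : box a b & H' (on_line x p) = H p & pd 1 H' (on_line x p) > 0"
  if p: "p : U" for p
 proof -
  show "p : box a b" "pd 1 H p > 0" using p by (auto simp: U_def)
  obtain q where q: "q : U'" "line_map H p = line_map H' q" using p by (auto simp: U_def)
  have q': "q $ 2 = p $ 2" "q $ 3 = p $ 3" "H' q = H p" using q(2) line_map_nth by metis+
  have "q = on_line (q $ 1) p" by (rule same_line[OF q'(1,2)])
  then show "\<exists>x. on_line x p : box a b & H' (on_line x p) = H p & pd 1 H' (on_line x p) > 0"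
   using q(1) q'(3) unfolding U'_def by (intro exI[of _ "q $ 1"]) auto
 qed
 have K0U: "K0 <= U"
 proof
  fix y assume y: "y : K0"
  then obtain q where q: "q : box a b" "q $ 2 = y $ 2" "q $ 3 = y $ 3" "H' q = H y" "pd 1 H' q > 0"
   using K0(4) by blast
  then have "line_map H y = line_map H' q" "q : U'" by (simp_all add: vec_eq_iff forall_3 U'_def)
  then show "y : U" using K0(2,3) C(2) y by (auto simp: U_def)
 qed
 obtain rho V C1 where rho: "Cinf_on UNIV rho" "!!x. 0 <= rho x" "!!x. rho x <= (1::real)"
  "open V" "K0 <= V" "!!x. x : V ==> rho x = 1" "compact C1" "C1 <= U" "!!x. x ~: C1 ==> rho x = 0"
  by (rule smooth_bump[OF K0(1) oU K0U], rule that)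
 have C1b: "C1 <= box a b" using rho(8) U(1) by blast
 obtain B where B: "B > 0" "!!x. x : C1 ==> \<bar>pd 1 rho x\<bar> <= B"
  by (rule compact_continuous_bound[OF rho(7) continuous_on_subset[OF Cinf_on_continuous[OF Cinf_on_derivative[OF rho(1)]] subset_UNIV]], rule that)
 obtain m where m: "m > 0" "!!x. x : C1 ==> m <= pd 1 H x"
  by (rule compact_continuous_pos_bound[OF rho(7) continuous_on_subset[OF cpd(1) C1b]]) (use U(2) rho(8) in blast, rule that)
 define R where "R = \<bar>b $ 1 - a $ 1\<bar> + 1"
 \<comment> \<open>In the derivative of the defining equation the variation of \<open>sig\<close>
   contributes at most \<open>eps * (B * R)\<close> on the support of \<open>rho\<close>, where the
   derivative of \<open>H\<close> is at least \<open>m\<close>; \<open>R\<close> bounds the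
   displacement along a line of the box.\<close>
 define eps where "eps = m / (2 * (B * R))"
 have BR: "B * R > 0" using B(1) by (simp add: R_def)
 then have eps: "eps > 0" "eps * (B * R) < m" using m(1) by (simp_all add: eps_def)
 define sig where "sig p = eps * (1 - rho p)" for p
 have sig0: "sig p >= 0" for p using eps(1) rho(3) by (simp add: sig_def)
 have sigU: "p : U" if "\<not> sig p > 0" for p
  using that eps(1) rho(3)[of p] rho(8,9) by (cases "p : C1") (auto simp: sig_def zero_less_mult_iff)
 define E where "E z = H' (on_line (snd z) (fst z)) + sig (fst z) * (snd z - fst z $ 1) - H (fst z)" for z
 define W0 where "W0 = {z. fst z : box a b & on_line (snd z) (fst z) : box a b}"
 \<comment> \<open>Here the equation is strictly increasing in its last variable: the second field
   is contact at the target or the correction \<open>sig\<close> is positive.\<close>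
 define W where "W = {z : W0. pd 1 H' (on_line (snd z) (fst z)) + sig (fst z) > 0}"
 have oW0: "open W0" unfolding W0_def
  by (intro open_Collect_conj open_vimage[OF ob, unfolded vimage_def] continuous_intros)
 have sml: "Cinf_on W0 (%z. on_line (snd z) (fst z))" "Cinf_on W0 fst"
  using oW0 by (auto intro!: smooth_intros)
 have im: "(%z. on_line (snd z) (fst z)) ` W0 <= box a b" "fst ` W0 <= box a b" by (auto simp: W0_def)
 have smsig: "Cinf_on UNIV sig" unfolding sig_def by (intro smooth_intros rho(1) open_UNIV)
 note smW = Cinf_on_compose[OF sml(1) H'(1) im(1)] Cinf_on_compose[OF sml(2) H(1) im(2)]
  Cinf_on_compose_UNIV[OF smsig sml(2)] Cinf_on_compose[OF sml(1) Cinf_on_derivative[OF H'(1)] im(1)]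
 have smE: "Cinf_on W0 E" unfolding E_def by (intro smooth_intros smW oW0)
 have "continuous_on W0 (%z. pd 1 H' (on_line (snd z) (fst z)) + sig (fst z))"
  by (intro Cinf_on_continuous smooth_intros smW)
 from continuous_open_preimage[OF this oW0 open_greaterThan[of 0]]
 have oW: "open W" by (simp add: W_def vimage_def Int_def)
 have WW0: "W <= W0" by (auto simp: W_def)
 have uniq: "x = y" if x: "(p, x) : W" and y: "(p, y) : W0" and eq: "E (p, x) = E (p, y)" for p x y
 proof -
  let ?x = "on_line x p" and ?y = "on_line y p"
  have b: "?x : box a b" "?y : box a b" and pos: "pd 1 H' ?x + sig p > 0"
   using x y by (auto simp: W_def W0_def)
  have e: "H' ?x + sig p * x = H' ?y + sig p * y" using eq by (simp add: E_def algebra_simps)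
  have "pd 1 H' ?x > 0 \<or> sig p > 0" using pos sig0[of p] H'(2)[OF b(1)] by linarith
  then show ?thesis
  proof
   assume d: "pd 1 H' ?x > 0"
   have "\<not> x < y" "\<not> y < x"
    using line_strict_mono[OF H' b] line_strict_mono[OF H' b(2,1)] e d
     mult_left_mono[of x y "sig p"] mult_left_mono[of y x "sig p"] sig0[of p] by fastforce+
   then show ?thesis by simp
  next
   assume s: "sig p > 0"
   have "\<not> x < y" "\<not> y < x"
    using line_mono[OF H' b] line_mono[OF H' b(2,1)] e mult_strict_left_mono[OF _ s, of x y]
     mult_strict_left_mono[OF _ s, of y x] by fastforce+
   then show ?thesis by simp
  qed
 qed
 \<comment> \<open>Positions between the faces of the box and \<open>C\<close>. On a line that meets
   \<open>C\<close> the two functions agree there, which supplies the end values for the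
   intermediate value theorem.\<close>
 obtain l r where lr: "a $ 1 < l" "r < b $ 1" "!!x. x : C ==> l < x $ 1 & x $ 1 < r"
 proof (cases "C = {}")
  case True
  show ?thesis by (rule that[of "a $ 1 + 1" "b $ 1 - 1"]) (use True in auto)
 next
  case False
  have c: "continuous_on C (%x. x $ 1)" by (intro continuous_intros)
  obtain u v where u: "u : C" "\<forall>x\<in>C. u $ 1 <= x $ 1" and v: "v : C" "\<forall>x\<in>C. x $ 1 <= v $ 1"
   using continuous_attains_inf[OF C(1) False c] continuous_attains_sup[OF C(1) False c] by blast
  have "a $ 1 < u $ 1" "v $ 1 < b $ 1" using u v C(2) by (auto simp: mem_box3)
  then show ?thesis using u v by (intro that[of "(a $ 1 + u $ 1) / 2" "(b $ 1 + v $ 1) / 2"]) fastforce+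
 qed
 have solve: "\<exists>x. (p, x) : W & E (p, x) = 0" if p: "p : box a b" for p
 proof (cases "sig p > 0")
  case False
  then have "sig p = 0" "p : U" using sig0[of p] sigU by force+
  then show ?thesis using U(3)[of p] p by (auto simp: W_def W0_def E_def)
 next
  case True
  have W: "(p, x) : W" if "on_line x p : box a b" for x
   using that p True H'(2)[OF that] by (simp add: W_def W0_def add_nonneg_pos)
  show ?thesis
  proof (cases "p : C")
   case False
   then show ?thesis using W[of "p $ 1"] p C(3)[of p] by (intro exI[of _ "p $ 1"]) (auto simp: E_def on_line_self)
  next
   case True
   have lp: "l < p $ 1" "p $ 1 < r" using lr(3)[OF True] by auto
   have inb: "on_line s p : box a b" if "l <= s" "s <= r" for s
    using that p lr by (auto simp: mem_box3 forall_3)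
   have ends: "on_line l p : box a b - C" "on_line r p : box a b - C"
    using inb lp lr(3)[of "on_line l p"] lr(3)[of "on_line r p"] by auto
   have "H (on_line l p) <= H p" "H p <= H (on_line r p)"
    by (rule line_mono[OF H]; use ends p lp in simp)+
   moreover have "sig p * (l - p $ 1) <= 0" "0 <= sig p * (r - p $ 1)"
    using lp sig0[of p] by (simp_all add: mult_nonneg_nonpos)
   ultimately have "E (p, l) <= 0" "0 <= E (p, r)"
    using C(3)[OF ends(1)] C(3)[OF ends(2)] by (simp_all add: E_def)
   moreover have "continuous_on {l..r} (%s. E (p, s))"
    by (rule continuous_on_compose2[OF Cinf_on_continuous[OF smE]])
     (use inb p in \<open>auto intro!: continuous_intros simp: W0_def\<close>)
   ultimately obtain s where "l <= s" "s <= r" "E (p, s) = 0" using IVT'[of "%s. E (p, s)" l 0 r] lp by auto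
   then show ?thesis using W inb by blast
  qed
 qed
 then obtain tau where tau: "!!p. p : box a b ==> (p, tau p) : W" "!!p. p : box a b ==> E (p, tau p) = 0" by metis
 have dE: "fd E z (0, 1) ~= 0" if z: "z : W" for z
 proof -
  obtain p x where zp: "z = (p, x)" by (cases z)
  have "((%t. (p, t)) has_derivative (%t. (0, t))) (at x)" by (auto intro!: derivative_eq_intros)
  from has_derivative_compose[OF this, of E "fd E z"] Cinf_on_has_derivative[OF smE] z WW0 zp
  have 1: "((%t. E (p, t)) has_derivative (%t. fd E z (0, t))) (at x)" by auto
  have "on_line x p : box a b" using z zp by (auto simp: W_def W0_def)
  then have "((%t. E (p, t)) has_real_derivative pd 1 H' (on_line x p) + sig p) (at x)"
   unfolding E_def by (auto intro!: derivative_eq_intros on_line_deriv[OF H'(1)])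
  from has_derivative_unique[OF 1 this[unfolded has_field_derivative_def], THEN fun_cong, of 1]
  show ?thesis using z zp by (simp add: W_def)
 qed
 have smtau: "Cinf_on (box a b) tau"
  by (rule Cinf_on_implicit[OF Cinf_on_subset[OF smE oW WW0] dE _ ob tau]) (use uniq WW0 in blast)+
 have taub: "line_map tau p : box a b" if "p : box a b" for p using tau(1)[OF that] by (simp add: line_map_def W_def W0_def)
 have eq: "H' (line_map tau p) = H p - sig p * (tau p - p $ 1)" if "p : box a b" for p
  using tau(2)[OF that] by (simp add: E_def line_map_def)
 have pos: "pd 1 H' (line_map tau p) + sig p > 0" if "p : box a b" for p
  using tau(1)[OF that] by (simp add: W_def line_map_def)
 show ?thesis
 proof (rule that[of tau])
  show "Cinf_on (box a b) tau" by (rule smtau)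
  show "line_map tau x : box a b" if "x : box a b" for x by (rule taub[OF that])
  \<comment> \<open>Off \<open>C\<close> the point itself solves its equation, and the solution is
    unique.\<close>
  show "tau x = x $ 1" if x: "x : box a b - C" for x
   by (rule uniq[OF tau(1)]) (use x tau(2)[of x] C(3)[OF x] in \<open>auto simp: W0_def E_def on_line_self\<close>)
  show "pd 1 tau p > 0" if p: "p : box a b" for p
  proof -
   have dsig: "(sig has_derivative (%v. - eps * fd rho p v)) (at p)" unfolding sig_def
    by (auto intro!: derivative_eq_intros Cinf_on_has_derivative[OF rho(1)])
   have "((%q. H q - sig q * (tau q - q $ 1)) has_derivative (%v. fd H p v
     - (sig p * (fd tau p v - v $ 1) + - eps * fd rho p v * (tau p - p $ 1)))) (at p)"
    by (intro has_derivative_diff has_derivative_mult dsig Cinf_on_has_derivative[OF H(1) p]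
      Cinf_on_has_derivative[OF smtau p] bounded_linear_imp_has_derivative bounded_linear_vec_nth)
   then have "((%q. H' (line_map tau q)) has_derivative (%v. fd H p v
     - (sig p * (fd tau p v - v $ 1) + - eps * fd rho p v * (tau p - p $ 1)))) (at p)"
    by (rule has_derivative_transform_within_open[OF _ ob p]) (simp add: eq)
   from fun_cong[OF frechet_derivative_at[OF this], of "axis 1 1"]
   have d: "(pd 1 H' (line_map tau p) + sig p) * pd 1 tau p = pd 1 H p + sig p + eps * (pd 1 rho p * (tau p - p $ 1))"
    unfolding chain_on_line[OF H'(1) smtau p taub[OF p]] by (simp add: algebra_simps)
   have "pd 1 H p + sig p + eps * (pd 1 rho p * (tau p - p $ 1)) > 0"
   proof (cases "p : C1")
    case True
    have "a $ 1 < p $ 1" "p $ 1 < b $ 1" using p by (auto simp: mem_box3)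
    moreover have "a $ 1 < tau p" "tau p < b $ 1" using taub[OF p] unfolding mem_box3 by (metis line_map_nth(1))+
    ultimately have "\<bar>tau p - p $ 1\<bar> <= R" by (simp add: R_def)
    then have "\<bar>pd 1 rho p * (tau p - p $ 1)\<bar> <= B * R"
     unfolding abs_mult using B(2)[OF True] B(1) by (intro mult_mono) auto
    then have "eps * - (B * R) <= eps * (pd 1 rho p * (tau p - p $ 1))" using eps(1) by (intro mult_left_mono) auto
    then show ?thesis using m(2)[OF True] eps(2) sig0[of p] by simp
   next
    case False
    have "open (- C1)" using compact_imp_closed[OF rho(7)] by blast
    then have "(rho has_derivative (%v. 0)) (at p)"
     by (rule has_derivative_transform_within_open[OF has_derivative_const[of 0]]) (use False rho(9) in auto)
    from frechet_derivative_at[OF this] have "pd 1 rho p = 0" by metis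
    then show ?thesis using H(2)[OF p] rho(9)[OF False] eps(1) by (simp add: sig_def)
   qed
   then show ?thesis using d pos[OF p] by (metis zero_less_mult_pos)
  qed
  fix y assume y: "y : K0"
  then have "y : box a b" "sig y = 0" using K0(2) C(2) rho(5,6) by (auto simp: sig_def)
  then show "H' (line_map tau y) = H y" "pd 1 H' (line_map tau y) > 0" using eq[of y] pos[of y] by auto
 qed
qed

lemma nf_contact_0: "nf_contact H (%_. 0) x = pd 1 H x"
 by (simp add: nf_contact_def)

section \<open>Discs moved between two normal forms\<close>

context closed_manifold
begin

definition noncontact :: "'a plane_field => 'a set" where
 "noncontact ksi = {p : points M. \<not> contact_at M ksi p}"

lemma contact_at_local:
 assumes ksi: "smooth_field ksi" and U: "openin (mtop M) U" "p : U" "!!q. q : U ==> ksi' q = ksi q"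
 shows "contact_at M ksi' p \<longleftrightarrow> contact_at M ksi p" "conf_at ksi' p \<longleftrightarrow> conf_at ksi p"
  "\<exists>c V A. represents ksi' c V A & p : cdom c & cmap c p : V"
proof -
 have "p : points M" using openin_subset[OF U(1)] U(2) by blast
 then obtain c V A where R: "represents ksi c V A" and p: "p : cdom c" "cmap c p : V"
  using ksi unfolding smooth_field_def by blast
 note D = representsD[OF R]
 let ?V = "V Int cmap c ` (cdom c Int U)"
 have oV: "open ?V" using D(4) open_cmap_image[OF D(1) U(1)] by blast
 have pV: "cmap c p : ?V" using p U(2) by blast
 have R1: "represents ksi c ?V A" by (rule represents_subset[OF R _ oV]) blast
 have R2: "represents ksi' c ?V A"
 proof (rule represents_cong[OF R1])
  fix x assume "x : ?V"
  then obtain q where "q : cdom c" "q : U" "x = cmap c q" by blast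
  then show "ksi' (cinv c x) = ksi (cinv c x)" using U(3) cinv_cmap[OF D(1)] by simp
 qed
 show "contact_at M ksi' p \<longleftrightarrow> contact_at M ksi p"
  using contact_at_represents[OF R1 p(1) pV] contact_at_represents[OF R2 p(1) pV] by simp
 show "conf_at ksi' p \<longleftrightarrow> conf_at ksi p"
  using conf_at_represents[OF R1 p(1) pV] conf_at_represents[OF R2 p(1) pV] by simp
 show "\<exists>c V A. represents ksi' c V A & p : cdom c & cmap c p : V" using R2 p(1) pV by blast
qed

lemma contact_at_nf:
 assumes R: "represents ksi c V (nf_covector h k)" and hk: "Cinf_on V h" "Cinf_on V k"
  and p: "p : cdom c" "cmap c p : V"
 shows "contact_at M ksi p \<longleftrightarrow> nf_contact h k (cmap c p) > 0"
  and "conf_at ksi p \<longleftrightarrow> nf_contact h k (cmap c p) >= 0"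
proof -
 have "contact_coeff_vec (nf_covector h k) (cmap c p) = nf_contact h k (cmap c p)"
  by (rule contact_coeff_nf[OF Cinf_on_differentiable[OF hk(1) p(2)] Cinf_on_differentiable[OF hk(2) p(2)]])
 then show "contact_at M ksi p \<longleftrightarrow> nf_contact h k (cmap c p) > 0" "conf_at ksi p \<longleftrightarrow> nf_contact h k (cmap c p) >= 0"
  using contact_at_represents[OF R p] conf_at_represents[OF R p] by simp_all
qed

lemma compact_disc_boundary_chart:
 assumes f: "smooth_into M unit_disc f" and c: "c : atlas M" and C: "compact C" "C <= cimage c"
 shows "compact (C Int cmap c ` (f ` sphere 0 1 Int cdom c))"
proof -
 let ?S = "f ` sphere 0 1 Int cinv c ` C"
 have "compactin (mtop M) ?S"
  by (rule compact_Int_closedin[OF compactin_disc_boundary[OF f]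
     compactin_imp_closedin[OF Hausdorff_points compactin_cinv[OF c C]]])
 then have "compact (cmap c ` ?S)"
  by (rule compact_cmap[OF c]) (use cinv_image_subset[OF C(2)] in blast)
 moreover have "cmap c ` ?S = C Int cmap c ` (f ` sphere 0 1 Int cdom c)"
 proof (intro equalityI subsetI)
  fix y assume "y : cmap c ` ?S"
  then obtain q where q: "q : f ` sphere 0 1" "q : cinv c ` C" "y = cmap c q" by blast
  from q(2) obtain x where x': "q = cinv c x" "x : C" by (rule imageE)
  with q have x: "x : C" "cinv c x : f ` sphere 0 1" "y = cmap c (cinv c x)" by auto
  have "x : cimage c" using x(1) C(2) by (rule subsetD[rotated])
  then have "y = x" "cinv c x : cdom c" using cmap_cinv[of x c] cinv_cdom[of x c] x(3) by auto
  then show "y : C Int cmap c ` (f ` sphere 0 1 Int cdom c)" using x by blast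
 next
  fix y assume "y : C Int cmap c ` (f ` sphere 0 1 Int cdom c)"
  then obtain p where p: "y : C" "p : f ` sphere 0 1" "p : cdom c" "y = cmap c p" by blast
  then have "p = cinv c y" using cinv_cmap[OF c] by simp
  then show "y : cmap c ` ?S" using p by blast
 qed
 ultimately show ?thesis by simp
qed

text \<open>A map along x-lines preserves the y- and z-components of vectors, so it takes the kernel
  of \<open>dz + H dy\<close> at a point to that of \<open>dz + H' dy\<close> at the image as soon
  as \<open>H'\<close> at the image equals \<open>H\<close> at the point. The hypothesis
  \<open>good\<close> provides, for each boundary point in \<open>C\<close>, a contact point on its
  line where this value is taken.\<close>

lemma overtwisted_line_move:
 assumes c: "c : atlas M" "cimage c = box a b" and ksi: "smooth_field ksi" "smooth_field ksi'"
  and R: "represents ksi c (box a b) (nf_covector H (%_. 0))" "represents ksi' c (box a b) (nf_covector H' (%_. 0))"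
  and H: "Cinf_on (box a b) H" "!!x. x : box a b ==> pd 1 H x >= 0"
  and H': "Cinf_on (box a b) H'" "!!x. x : box a b ==> pd 1 H' x >= 0"
  and C: "compact C" "C <= box a b" "!!x. x : box a b - C ==> H x = H' x"
  and eq: "!!p. p : points M ==> p ~: cinv c ` C ==> ksi' p = ksi p"
  and f: "overtwisted_disc M ksi (noncontact ksi) f"
  and good: "!!y. y : C ==> y : cmap c ` (f ` sphere 0 1 Int cdom c) ==>
   \<exists>q\<in>box a b. q $ 2 = y $ 2 & q $ 3 = y $ 3 & H' q = H y & pd 1 H' q > 0"
 shows "\<exists>f'. overtwisted_disc M ksi' (noncontact ksi') f'"
proof -
 have Cim: "C <= cimage c" using C(2) c(2) by simp
 let ?K = "C Int cmap c ` (f ` sphere 0 1 Int cdom c)"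
 have sf: "smooth_into M unit_disc f" and off: "!!x. x : sphere 0 1 ==> f x ~: noncontact ksi"
  using f unfolding overtwisted_disc_def by blast+
 have K: "compact ?K" by (rule compact_disc_boundary_chart[OF sf c(1) C(1) Cim])
 have cz: "Cinf_on (box a b) (%_. 0 :: real)" by (rule Cinf_on_const[OF open_box])
 have ct: "contact_at M ksi p \<longleftrightarrow> pd 1 H (cmap c p) > 0" "contact_at M ksi' p \<longleftrightarrow> pd 1 H' (cmap c p) > 0"
  if "p : cdom c" for p
 proof -
  have "cmap c p : box a b" using that c(2) by blast
  then show "contact_at M ksi p \<longleftrightarrow> pd 1 H (cmap c p) > 0" "contact_at M ksi' p \<longleftrightarrow> pd 1 H' (cmap c p) > 0"
   using contact_at_nf(1)[OF R(1) H(1) cz that] contact_at_nf(1)[OF R(2) H'(1) cz that] by (simp_all add: nf_contact_0)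
 qed
 have Kpos: "pd 1 H y > 0" if y: "y : ?K" for y
 proof -
  obtain x where x: "x : sphere 0 1" "f x : cdom c" "y = cmap c (f x)" using y by blast
  then have "contact_at M ksi (f x)" using off[OF x(1)] cdom_subset[OF c(1)] by (auto simp: noncontact_def)
  then show ?thesis using ct(1)[OF x(2)] x(3) by simp
 qed
 obtain tau where tau: "Cinf_on (box a b) tau" "!!x. x : box a b ==> line_map tau x : box a b"
  "!!x. x : box a b ==> pd 1 tau x > 0" "!!x. x : box a b - C ==> tau x = x $ 1"
  "!!y. y : ?K ==> H' (line_map tau y) = H y" "!!y. y : ?K ==> pd 1 H' (line_map tau y) > 0"
  by (rule line_diffeo[OF H H' C K _ Kpos]) (use good in blast)+
 let ?L = "line_map tau"
 have id: "?L x = x" if "x : box a b - C" for x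
  using tau(4)[OF that] by (simp add: vec_eq_iff forall_3)
 have "overtwisted_disc M ksi' (noncontact ksi') (chart_lift c ?L o f)"
 proof (rule overtwisted_disc_transport[OF f ksi c(1)])
  show "Cinf_on (cimage c) ?L" unfolding c(2) by (rule Cinf_on_line_map[OF tau(1)])
  show "?L ` cimage c <= cimage c" unfolding c(2) using tau(2) by blast
  show "inj_on ?L (cimage c)" unfolding c(2)
   by (rule line_map_inj_on[OF tau(1)]) (use tau(3) in \<open>auto intro: less_imp_le\<close>)
  show "inj (fd ?L x)" if "x : cimage c" for x
   using line_map_derivative_inj[OF tau(1)] tau(3)[of x] that c(2) by simp
  show "compact C" "C <= cimage c" by (rule C Cim)+
  show "?L x = x" if "x : cimage c - C" for x using id that c(2) by simp
  fix p assume p: "p : f ` sphere 0 1"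
  obtain x where x: "x : sphere 0 1" "p = f x" using p by blast
  have "f ` unit_disc <= points M" using sf by (simp add: smooth_into_def)
  moreover have "x : unit_disc" using x(1) by simp
  ultimately have pM: "p : points M" using x(2) by blast
  then have nc: "p : points M" "contact_at M ksi p"
   using x(2) off[OF x(1)] by (simp_all add: noncontact_def)
  show "p ~: noncontact ksi' & ksi' p = ksi p" if n: "p ~: cdom c"
  proof -
   have pC: "p ~: cinv c ` C" using n cinv_image_subset[OF Cim] by blast
   let ?U = "points M - cinv c ` C"
   have "openin (mtop M) ?U"
    using compactin_imp_closedin[OF Hausdorff_points compactin_cinv[OF c(1) C(1) Cim]] by blast
   then have "contact_at M ksi' p"
    using contact_at_local(1)[OF ksi(1), of ?U p ksi'] eq pC nc by blast
   then show ?thesis using eq[OF nc(1) pC] by (simp add: noncontact_def)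
  qed
  assume pc: "p : cdom c"
  let ?y = "cmap c p" and ?p' = "chart_lift c ?L p"
  have y: "?y : box a b" using pc c(2) by blast
  have Ly: "?L ?y : box a b" by (rule tau(2)[OF y])
  then have p': "?p' : cdom c" "cmap c ?p' = ?L ?y"
   using pc cinv_cdom[of "?L ?y" c] cmap_cinv[of "?L ?y" c] c(2) by (simp_all add: chart_lift_def)
  have H'y: "H' (?L ?y) = H ?y & pd 1 H' (?L ?y) > 0"
  proof (cases "?y : C")
   case True
   then have "?y : ?K" using p pc by blast
   then show ?thesis using tau(5,6) by blast
  next
   case False
   have yC: "?y : box a b - C" using y False by blast
   have pC: "p ~: cinv c ` C"
   proof
    assume "p : cinv c ` C"
    then obtain x where "x : C" "p = cinv c x" by blast
    then show False using False cmap_cinv[of x c] Cim by (metis subsetD)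
   qed
   let ?U = "points M - cinv c ` C"
   have "openin (mtop M) ?U"
    using compactin_imp_closedin[OF Hausdorff_points compactin_cinv[OF c(1) C(1) Cim]] by blast
   then have "contact_at M ksi' p"
    using contact_at_local(1)[OF ksi(1), of ?U p ksi'] eq pC nc by blast
   then show ?thesis using id[OF yC] C(3)[OF yC] ct(2)[OF pc] by simp
  qed
  have cy: "cmap c ?p' : box a b" using p'(2) Ly by simp
  have "contact_at M ksi' ?p'" using ct(2)[OF p'(1)] p'(2) H'y by simp
  moreover have "tvec p c w : ksi p \<longleftrightarrow> tvec ?p' c (fd ?L ?y w) : ksi' ?p'" for w
   unfolding represents_tvec[OF R(1) pc y] represents_tvec[OF R(2) p'(1) cy] nf_covector_inner p'(2)
    line_map_derivative[OF tau(1) y] using H'y by simp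
  ultimately show "?p' ~: noncontact ksi' & (\<forall>w. tvec p c w : ksi p \<longleftrightarrow> tvec ?p' c (fd ?L ?y w) : ksi' ?p')"
   by (simp add: noncontact_def)
 qed
 then show ?thesis by blast
qed

end

section \<open>General position\<close>

lemma tube_uniform:
 fixes O' :: "('a::metric_space \<times> 'b::metric_space) set"
 assumes "compact C" "open O'" "!!x. x : C ==> (s, x) : O'"
 obtains e where "e > 0" "!!t x. dist t s < e ==> x : C ==> (t, x) : O'"
proof -
 have "\<exists>U V. open U & open V & s : U & x : V & U \<times> V <= O'" if "x : C" for x
  using open_prod_elim[OF assms(2) assms(3)[OF that]] by (metis mem_Sigma_iff)
 then obtain U V where UV: "!!x. x : C ==> open (U x) & open (V x) & s : U x & x : V x & U x \<times> V x <= O'"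
  by metis
 have cov: "C <= (\<Union>x\<in>C. V x)" using UV by blast
 obtain D where D: "D <= C" "finite D" "C <= (\<Union>x\<in>D. V x)"
  by (rule compactE_image[OF assms(1) _ cov]) (use UV in blast, rule that)
 have "open (\<Inter>x\<in>D. U x)" using D UV by (intro open_INT) auto
 moreover have "s : (\<Inter>x\<in>D. U x)" using D UV by blast
 ultimately obtain e where e: "e > 0" "ball s e <= (\<Inter>x\<in>D. U x)" using openE by blast
 show ?thesis
 proof (rule that[OF e(1)])
  fix t x assume t: "dist t s < e" and x: "x : C"
  obtain y where y: "y : D" "x : V y" using D(3) x by blast
  have "t : ball s e" using t by (simp add: dist_commute)
  then have "t : U y" using e(2) y(1) by blast
  then show "(t, x) : O'" using UV[of y] D(1) y by blast
 qed
qed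

text \<open>A contact transformation of \<open>ker (dz + x dy)\<close> with generating function \<open>S\<close>: writing
 \<open>z' + x' y' = z + x' y + S (x', y, z)\<close> gives \<open>x = (x' + S\<^sub>y) / (1 + S\<^sub>z)\<close>, \<open>y' = y + S\<^sub>x\<close> and
 \<open>z' = z + S - x' S\<^sub>x\<close>. The map \<open>gen_source\<close> sends \<open>(x', y, z)\<close> to the source point, \<open>gen_target\<close> to its image.\<close>

definition gen_source :: "(real^3 => real) => real^3 => real^3" where
 "gen_source S = line_map (%q. (q $ 1 + pd 2 S q) / (1 + pd 3 S q))"

definition gen_target :: "(real^3 => real) => real^3 => real^3" where
 "gen_target S q = q + vec3 0 (pd 1 S q) (S q - q $ 1 * pd 1 S q)"

text \<open>Differentiating the relation that defines the transformation shows that the two contact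
  forms agree up to the factor \<open>1 + S_z\<close>, which is why this factor must not
  vanish.\<close>

lemma gen_contact:
 assumes S: "Cinf_on UNIV S" and z: "1 + pd 3 S q ~= 0"
  and D: "(gen_source S has_derivative D) (at q)" and E: "(gen_target S has_derivative E) (at q)"
 shows "E w $ 3 + gen_target S q $ 1 * E w $ 2 = (1 + pd 3 S q) * (D w $ 3 + gen_source S q $ 1 * D w $ 2)"
proof -
 have dS: "(S has_derivative fd S q) (at q)" using Cinf_on_has_derivative[OF S] by simp
 have lin: "linear (fd S q)" using has_derivative_linear[OF dS] .
 define P where "P = fd (pd 1 S) q"
 have dP: "(pd 1 S has_derivative P) (at q)" unfolding P_def
  using Cinf_on_has_derivative[OF Cinf_on_derivative[OF S]] by simp
 have vn: "((%q. q $ i) has_derivative (%w. w $ i)) (at q)" for i :: 3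
  by (rule bounded_linear_imp_has_derivative[OF bounded_linear_vec_nth])
 have "((%q. gen_target S q $ 2) has_derivative (%w. E w $ 2)) (at q)"
  "((%q. gen_target S q $ 3) has_derivative (%w. E w $ 3)) (at q)"
  by (rule bounded_linear.has_derivative[OF bounded_linear_vec_nth E])+
 moreover have "((%q. gen_target S q $ 2) has_derivative (%w. w $ 2 + P w)) (at q)"
  unfolding gen_target_def by (simp, intro has_derivative_add vn dP)
 moreover have "((%q. gen_target S q $ 3) has_derivative
   (%w. w $ 3 + (fd S q w - (q $ 1 * P w + w $ 1 * pd 1 S q)))) (at q)"
  unfolding gen_target_def by (simp, intro has_derivative_add has_derivative_diff has_derivative_mult vn dP dS)
 ultimately have E23: "E w $ 2 = w $ 2 + P w"
  "E w $ 3 = w $ 3 + (fd S q w - (q $ 1 * P w + w $ 1 * pd 1 S q))"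
  using has_derivative_unique by (metis (no_types, lifting))+
 have "((%q. gen_source S q $ 2) has_derivative (%w. D w $ 2)) (at q)"
  "((%q. gen_source S q $ 3) has_derivative (%w. D w $ 3)) (at q)"
  by (rule bounded_linear.has_derivative[OF bounded_linear_vec_nth D])+
 moreover have "((%q. gen_source S q $ 2) has_derivative (%w. w $ 2)) (at q)"
  "((%q. gen_source S q $ 3) has_derivative (%w. w $ 3)) (at q)"
  unfolding gen_source_def by (simp_all add: vn)
 ultimately have D23: "D w $ 2 = w $ 2" "D w $ 3 = w $ 3"
  using has_derivative_unique by (metis (no_types, lifting))+
 have "fd S q w = w $ 1 * pd 1 S q + w $ 2 * pd 2 S q + w $ 3 * pd 3 S q"
  using linear_real3[OF lin, of w] by simp
 then show ?thesis
  using z by (simp add: E23 D23 gen_source_def gen_target_def field_simps)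
qed

lemma frechet_slice:
 assumes "Cinf_on W J" "(v, q) : W"
 shows "((%q. J (v, q)) has_derivative (%w. fd J (v, q) (0, w))) (at q)"
proof -
 have "((%q. (v, q)) has_derivative (%w. (0, w))) (at q)" by (auto intro!: derivative_eq_intros)
 from has_derivative_compose[OF this Cinf_on_has_derivative[OF assms]] show ?thesis .
qed

lemma Cinf_on_slice:
 assumes "Cinf_on W J" "open V" "!!q. q : V ==> (v, q) : W"
 shows "Cinf_on V (%q. J (v, q))"
 by (rule Cinf_on_compose[OF Cinf_on_Pair[OF Cinf_on_const Cinf_on_ident] assms(1)]) (use assms in auto)

lemma line_map_inj_UNIV:
 assumes "Cinf_on UNIV tau" "!!x. pd 1 tau x > 0"
 shows "inj (line_map tau)"
proof (rule injI)
 fix p q assume eq: "line_map tau p = line_map tau q"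
 define r where "r = norm p + norm q + 1"
 have b: "\<bar>p $ i\<bar> < r & \<bar>q $ i\<bar> < r" for i
  using component_le_norm_cart[of p i] component_le_norm_cart[of q i] norm_ge_zero[of p] norm_ge_zero[of q]
  unfolding r_def by linarith
 let ?B = "box (\<chi> i. - r) (\<chi> i. r) :: (real^3) set"
 have "- r < p $ i & p $ i < r & - r < q $ i & q $ i < r" for i using b[of i] by (auto simp: abs_less_iff)
 then have "p : ?B" "q : ?B" by (simp_all add: mem_box3)
 moreover have "inj_on (line_map tau) ?B"
  by (rule line_map_inj_on[OF Cinf_on_subset[OF assms(1) open_box]])
   (use assms(2) in \<open>auto intro: less_imp_le\<close>)
 ultimately show "p = q" using eq by (simp add: inj_on_def)
qed

lemma Lipschitz_perturbation_inj:
 fixes R :: "'e::euclidean_space => 'e"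
 assumes R: "!!x. (R has_derivative D x) (at x)" "!!x v. norm (D x v) <= norm v / 2"
 shows "inj (%x. x + R x)" "inj (%v. v + D x v)"
proof -
 have "onorm (D x) <= 1 / 2" for x by (rule onorm_le) (use R(2) in simp)
 then have lip: "norm (R x - R y) <= 1 / 2 * norm (x - y)" for x y
  by (intro differentiable_bound[of UNIV R D]) (use R(1) in auto)
 show "inj (%x. x + R x)"
 proof (rule injI)
  fix x y assume "x + R x = y + R y"
  then have "R x - R y = y - x" by (simp add: algebra_simps)
  then have "norm (x - y) <= 1 / 2 * norm (x - y)" using lip[of x y] by (simp add: norm_minus_commute)
  then show "x = y" by simp
 qed
 show "inj (%v. v + D x v)"
 proof (rule injI)
  fix v w assume "v + D x v = w + D x w"
  then have "D x v - D x w = w - v" by (simp add: algebra_simps)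
  then have "D x (v - w) = w - v" using linear_diff[OF has_derivative_linear[OF R(1)]] by metis
  then have "norm (v - w) <= norm (v - w) / 2" using R(2)[of x "v - w"] by (simp add: norm_minus_commute)
  then show "v = w" by simp
 qed
qed

text \<open>The generating function is \<open>v1 + v2 y + v3 x\<close>, cut off by
  \<open>rho\<close>. Where \<open>rho\<close> is 1 it generates a translation that preserves
  \<open>dz + x dy\<close>, with \<open>v2\<close> entering as a shear in \<open>z\<close>; these
  translations act transitively, which provides the freedom needed for Sard's theorem. For small
  \<open>v\<close> the source map is a diffeomorphism along x-lines and the target map a small
  perturbation of the identity, so \<open>psi\<close> is the target map after the inverse of the
  source map.\<close>

lemma contact_translation:
 fixes rho :: "real^3 => real"
 assumes rho: "Cinf_on UNIV rho" and C: "compact C" "!!x. x ~: C ==> rho x = 0"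
  and W: "open W" "!!x. x : W ==> rho x = 1" and eta: "eta > 0"
 obtains dl where "dl > 0" "!!v :: real^3. norm v < dl ==> \<exists>psi. Cinf_on UNIV psi & inj psi &
  (\<forall>p. inj (fd psi p)) & (\<forall>p. p ~: C --> psi p = p) & (\<forall>p. dist (psi p) p < eta) &
  (\<forall>p u. fd psi p u $ 3 + psi p $ 1 * fd psi p u $ 2 = 0
    \<longleftrightarrow> u $ 3 + p $ 1 * u $ 2 = 0) &
  (\<forall>p. vec3 (p $ 1 - v $ 2) (p $ 2) (p $ 3) : W -->
    psi p = vec3 (p $ 1 - v $ 2) (p $ 2 + v $ 3) (p $ 3 + v $ 1 + v $ 2 * p $ 2))"
proof -
 define J where "J vq = rho (snd vq) * (fst vq $ 1 + fst vq $ 2 * snd vq $ 2 + fst vq $ 3 * snd vq $ 1)"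
  for vq :: "(real^3) \<times> (real^3)"
 have smJ: "Cinf_on UNIV J" unfolding J_def
  by (intro smooth_intros Cinf_on_compose_UNIV[OF rho]) auto
 define S where "S v q = J (v, q)" for v q
 have smS: "Cinf_on UNIV (S v)" for v unfolding S_def by (rule Cinf_on_slice[OF smJ]) auto
 define Ji where "Ji i vq = fd J vq (0, axis i 1)" for i :: 3 and vq
 have smJi: "Cinf_on UNIV (Ji i)" for i unfolding Ji_def by (rule Cinf_on_derivative[OF smJ])
 have pdS: "pd i (S v) q = Ji i (v, q)" for i v q
  unfolding S_def Ji_def by (rule fun_cong[OF frechet_derivative_at[OF frechet_slice[OF smJ UNIV_I], symmetric]])
 have S0: "S 0 = (%q. 0)" by (simp add: S_def J_def fun_eq_iff)
 have Ji0: "Ji i (0, q) = 0" for i q unfolding pdS[symmetric] S0 by simp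
 have oC: "open (- C)" using compact_imp_closed[OF C(1)] by (simp add: open_Compl)
 have SC: "S v q = 0" "Ji i (v, q) = 0" if "q ~: C" for v q i
 proof -
  show "S v q = 0" using C(2)[OF that] by (simp add: S_def J_def)
  have "((%q. 0 :: real) has_derivative (%w. 0)) (at q)" by simp
  then have "(S v has_derivative (%w. 0)) (at q)"
   by (rule has_derivative_transform_within_open[OF _ oC]) (use that C(2) in \<open>auto simp: S_def J_def\<close>)
  from fun_cong[OF frechet_derivative_at[OF this], of "axis i 1"] show "Ji i (v, q) = 0"
   unfolding pdS[symmetric] by simp
 qed
 define al where "al vq = (snd vq $ 1 + Ji 2 vq) / (1 + Ji 3 vq)" for vq
 define O1 where "O1 = {vq. 1 + Ji 3 vq > 1 / 2}"
 have cJi: "continuous_on UNIV (Ji i)" for i by (rule Cinf_on_continuous[OF smJi])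
 have oO1: "open O1" unfolding O1_def
  by (intro open_Collect_less continuous_intros cJi)
 have smal: "Cinf_on O1 al" unfolding al_def
  by (intro smooth_intros Cinf_on_subset[OF smJi oO1] oO1) (auto simp: O1_def)
 define N where "N vq = fd al vq (0, axis 1 1)" for vq
 have cN: "continuous_on O1 N" unfolding N_def by (rule Cinf_on_continuous[OF Cinf_on_derivative[OF smal]])
 have al0: "al (0, q) = q $ 1" for q by (simp add: al_def Ji0)
 have in0: "(0, q) : O1" for q by (simp add: O1_def Ji0)
 have N0: "N (0, q) = 1" for q
 proof -
  have "((%q. al (0, q)) has_derivative (%w. fd al (0, q) (0, w))) (at q)"
   by (rule frechet_slice[OF smal in0])
  then have "((%q. q $ 1) has_derivative (%w. fd al (0, q) (0, w))) (at q)" by (simp add: al0)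
  moreover have "((%q :: real^3. q $ 1) has_derivative (%w. w $ 1)) (at q)"
   by (rule bounded_linear_imp_has_derivative[OF bounded_linear_vec_nth])
  ultimately have "(%w. fd al (0, q) (0, w)) = (%w. w $ 1)" by (rule has_derivative_unique)
  from fun_cong[OF this, of "axis 1 1"] show ?thesis by (simp add: N_def)
 qed
 define R where "R vq = vec3 0 (Ji 1 vq) (J vq - snd vq $ 1 * Ji 1 vq)" for vq
 have smR: "Cinf_on UNIV R" unfolding R_def by (intro smooth_intros smJi smJ) auto
 define Ri where "Ri i vq = fd R vq (0, axis i 1)" for i :: 3 and vq
 have cRi: "continuous_on UNIV (Ri i)" for i unfolding Ri_def
  by (rule Cinf_on_continuous[OF Cinf_on_derivative[OF smR]])
 have vz: "vec3 0 0 0 = 0" by (simp add: vec_eq_iff forall_3)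
 have R0: "R (0, q) = 0" for q using S0 vz by (simp add: R_def Ji0 fun_eq_iff S_def)
 have Ri0: "Ri i (0, q) = 0" for i q
 proof -
  have "((%q. R (0, q)) has_derivative (%w. fd R (0, q) (0, w))) (at q)"
   by (rule frechet_slice[OF smR UNIV_I])
  then have "((%q. 0) has_derivative (%w. fd R (0, q) (0, w))) (at q)" by (simp add: R0)
  moreover have "((%q. 0) has_derivative (%w. 0)) (at q)" by simp
  ultimately have "(%w. fd R (0, q) (0, w)) = (%w. 0)" by (rule has_derivative_unique)
  from fun_cong[OF this, of "axis i 1"] show ?thesis by (simp add: Ri_def)
 qed
 \<comment> \<open>All estimates as one open condition on \<open>(v, q)\<close>. It holds for
   \<open>v = 0\<close>, where both maps are the identity, so over the compact \<open>C\<close> it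
   holds for all small \<open>v\<close> at once.\<close>
 define PP where "PP = (O1 Int N -` {0<..}) Int (O1 Int (%vq. \<bar>al vq - snd vq $ 1\<bar> + norm (R vq)) -` {..<eta})
  Int {vq. norm (Ri 1 vq) + norm (Ri 2 vq) + norm (Ri 3 vq) < 1 / 2}"
 have "open PP" unfolding PP_def
  by (intro open_Int continuous_open_preimage cN oO1 open_greaterThan open_lessThan open_Collect_less
    continuous_intros continuous_on_subset[OF Cinf_on_continuous[OF smR]] Cinf_on_continuous[OF smal] cRi) auto
 moreover have "(0, q) : PP" for q using in0 eta by (simp add: PP_def N0 al0 R0 Ri0)
 ultimately obtain dl where dl: "dl > 0" "!!v q. dist v 0 < dl ==> q : C ==> (v, q) : PP"
  by (rule tube_uniform[OF C(1)]) blast+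
 show ?thesis
 proof (rule that[OF dl(1)])
  fix v :: "real^3" assume v: "norm v < dl"
  have vO: "(v, q) : PP" if "q : C" for q using dl(2)[OF _ that] v by simp
  have inO1: "(v, q) : O1" for q
  proof (cases "q : C")
   case True then show ?thesis using vO by (simp add: PP_def)
  next
   case False then show ?thesis using SC by (simp add: O1_def)
  qed
  define a where "a q = al (v, q)" for q
  have sma: "Cinf_on UNIV a" unfolding a_def by (rule Cinf_on_slice[OF smal]) (use inO1 in auto)
  have aout: "a q = q $ 1" if "q ~: C" for q using SC(2)[OF that] by (simp add: a_def al_def)
  have pda: "pd 1 a q = N (v, q)" for q unfolding a_def N_def
   by (rule fun_cong[OF frechet_derivative_at[OF frechet_slice[OF smal inO1], symmetric]])
  have apos: "pd 1 a q > 0" for q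
  proof (cases "q : C")
   case True then show ?thesis using vO unfolding pda by (simp add: PP_def)
  next
   case False
   have "((%q :: real^3. q $ 1) has_derivative (%w. w $ 1)) (at q)"
    by (rule bounded_linear_imp_has_derivative[OF bounded_linear_vec_nth])
   then have "(a has_derivative (%w. w $ 1)) (at q)"
    by (rule has_derivative_transform_within_open[OF _ oC]) (use False aout in auto)
   from fun_cong[OF frechet_derivative_at[OF this], of "axis 1 1"] show ?thesis by simp
  qed
  have Aeq: "gen_source (S v) = line_map a"
   by (simp add: gen_source_def a_def[abs_def] al_def pdS)
  let ?A = "line_map a" and ?E = "gen_target (S v)"
  have smA: "Cinf_on UNIV ?A" by (rule Cinf_on_line_map[OF sma])
  have injA: "inj ?A" by (rule line_map_inj_UNIV[OF sma apos])
  obtain r where r: "!!q. q : C ==> norm q <= r" using compact_imp_bounded[OF C(1)] by (auto simp: bounded_iff)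
  \<comment> \<open>On each line the map is the identity far out, and the intermediate value theorem
    fills the rest.\<close>
  have surjA: "surj ?A"
  proof -
   have "\<exists>q. ?A q = p" for p
   proof -
    obtain m where m: "\<bar>r\<bar> < m" "\<bar>p $ 1\<bar> <= m"
     by (rule that[of "\<bar>r\<bar> + 1 + \<bar>p $ 1\<bar>"]) (linarith+)
    then have pb: "- m <= p $ 1" "p $ 1 <= m" "- m <= m" by (simp_all add: abs_le_iff)
    have n: "a (on_line s p) = s" if "\<bar>s\<bar> = m" for s
    proof -
     have "on_line s p ~: C"
     proof
      assume "on_line s p : C"
      then have "norm (on_line s p) <= r" by (rule r)
      moreover have "\<bar>on_line s p $ 1\<bar> <= norm (on_line s p)" by (rule component_le_norm_cart)
      moreover have "on_line s p $ 1 = s" by simp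
      ultimately show False using that m(1) by linarith
     qed
     from aout[OF this] show ?thesis by simp
    qed
    have "\<exists>s. - m <= s & s <= m & a (on_line s p) = p $ 1"
    proof (rule IVT')
     show "continuous_on {- m..m} (%s. a (on_line s p))"
      by (rule continuous_on_compose2[OF Cinf_on_continuous[OF sma]]) (auto intro!: continuous_intros continuous_on_vec3)
     have "\<bar>m\<bar> = m" "\<bar>- m\<bar> = m" using pb by linarith+
     then show "a (on_line (- m) p) <= p $ 1" "p $ 1 <= a (on_line m p)"
      unfolding n[OF \<open>\<bar>m\<bar> = m\<close>] n[OF \<open>\<bar>- m\<bar> = m\<close>] using pb by simp_all
     show "- m <= m" by (rule pb)
    qed
    then obtain s where "a (on_line s p) = p $ 1" by blast
    then have "?A (on_line s p) = p" by (simp add: vec_eq_iff forall_3)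
    then show ?thesis by blast
   qed
   then show ?thesis by (metis surjI)
  qed
  have detA: "det (matrix (fd ?A q)) ~= 0" for q
   using line_map_det[OF sma UNIV_I] apos[of q] by simp
  define B where "B = inv ?A"
  have smB: "Cinf_on UNIV B" using Cinf_on_inverse_real3(2)[OF smA injA detA] surjA by (simp add: B_def)
  have AB: "?A (B p) = p" for p unfolding B_def by (rule surj_f_inv_f[OF surjA])
  have BA: "B (?A q) = q" for q unfolding B_def by (rule inv_f_f[OF injA])
  have Eeq: "?E q = q + R (v, q)" for q
   by (simp add: gen_target_def R_def pdS S_def)
  have dR: "((%q. R (v, q)) has_derivative (%w. fd R (v, q) (0, w))) (at q)" for q
   by (rule frechet_slice[OF smR UNIV_I])
  have Rout: "R (v, q) = 0" if "q ~: C" for q using SC[OF that] vz by (simp add: R_def S_def)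
  have bound: "norm (fd R (v, q) (0, w)) <= norm w / 2" for q w
  proof (cases "q : C")
   case True
   have l: "linear (%w. fd R (v, q) (0, w))" by (rule has_derivative_linear[OF dR])
   have "norm (fd R (v, q) (0, w)) = norm (w $ 1 *\<^sub>R Ri 1 (v, q) + w $ 2 *\<^sub>R Ri 2 (v, q) + w $ 3 *\<^sub>R Ri 3 (v, q))"
    using linear_real3[OF l, of w] by (simp add: Ri_def)
   also have "... <= norm w * norm (Ri 1 (v, q)) + norm w * norm (Ri 2 (v, q)) + norm w * norm (Ri 3 (v, q))"
    by (intro norm_triangle_le add_mono) (auto intro!: mult_right_mono component_le_norm_cart)
   also have "... = norm w * (norm (Ri 1 (v, q)) + norm (Ri 2 (v, q)) + norm (Ri 3 (v, q)))"
    by (simp add: algebra_simps)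
   also have "... <= norm w * (1 / 2)" using vO[OF True] by (intro mult_left_mono) (auto simp: PP_def)
   finally show ?thesis by simp
  next
   case False
   have "((%q. 0 :: real^3) has_derivative (%w. 0)) (at q)" by simp
   then have "((%q. R (v, q)) has_derivative (%w. 0)) (at q)"
    by (rule has_derivative_transform_within_open[OF _ oC]) (use False Rout in auto)
   with dR have "(%w. fd R (v, q) (0, w)) = (%w. 0)" by (rule has_derivative_unique)
   from fun_cong[OF this, of w] show ?thesis by simp
  qed
  have Efun: "?E = (%q. q + R (v, q))" by (rule ext) (rule Eeq)
  have injE: "inj ?E" unfolding Efun by (rule Lipschitz_perturbation_inj(1)[OF dR bound])
  have dE: "(?E has_derivative (%w. w + fd R (v, q) (0, w))) (at q)" for q
   unfolding Efun by (intro has_derivative_add has_derivative_ident dR)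
  have injdE: "inj (%w. w + fd R (v, q) (0, w))" for q
   by (rule Lipschitz_perturbation_inj(2)[OF dR bound])
  have smE: "Cinf_on UNIV ?E" unfolding Efun
   by (intro smooth_intros Cinf_on_slice[OF smR]) auto
  let ?psi = "%p. ?E (B p)"
  have dB: "(B has_derivative fd B p) (at p)" for p using Cinf_on_has_derivative[OF smB] by simp
  have dA: "(?A has_derivative fd ?A q) (at q)" for q using Cinf_on_has_derivative[OF smA] by simp
  have dpsi: "(?psi has_derivative (%u. fd B p u + fd R (v, B p) (0, fd B p u))) (at p)" for p
   by (rule has_derivative_compose[OF dB dE])
  have fpsi: "fd ?psi p = (%u. fd B p u + fd R (v, B p) (0, fd B p u))" for p
   by (rule frechet_derivative_at[OF dpsi, symmetric])
  have DADB: "fd ?A (B p) (fd B p u) = u" for p u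
  proof -
   have "((%p. ?A (B p)) has_derivative (%u. fd ?A (B p) (fd B p u))) (at p)"
    by (rule has_derivative_compose[OF dB dA])
   moreover have "((%p. ?A (B p)) has_derivative (%u. u)) (at p)" by (simp add: AB)
   ultimately show ?thesis using has_derivative_unique by metis
  qed
  have Bout: "B p = p" if "p ~: C" for p
  proof -
   have "?A p = p" using aout[OF that] by (simp add: vec_eq_iff forall_3)
   then show ?thesis using BA by metis
  qed
  have BC: "B p : C" if "p : C" for p
  proof (rule ccontr)
   assume n: "B p ~: C"
   have "?A (B p) = B p" using aout[OF n] by (simp add: vec_eq_iff forall_3)
   then show False using AB[of p] n that by simp
  qed
  show "\<exists>psi. Cinf_on UNIV psi & inj psi &
  (\<forall>p. inj (fd psi p)) & (\<forall>p. p ~: C --> psi p = p) & (\<forall>p. dist (psi p) p < eta) &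
  (\<forall>p u. fd psi p u $ 3 + psi p $ 1 * fd psi p u $ 2 = 0
    \<longleftrightarrow> u $ 3 + p $ 1 * u $ 2 = 0) &
  (\<forall>p. vec3 (p $ 1 - v $ 2) (p $ 2) (p $ 3) : W -->
    psi p = vec3 (p $ 1 - v $ 2) (p $ 2 + v $ 3) (p $ 3 + v $ 1 + v $ 2 * p $ 2))"
  proof (intro exI[of _ ?psi] conjI allI impI)
   show "Cinf_on UNIV ?psi" by (rule Cinf_on_compose_UNIV[OF smE smB])
   have injB: "inj B" by (rule inj_on_inverseI[where g = ?A]) (rule AB)
   show "inj ?psi" using inj_compose[OF injE injB] by (simp only: comp_def)
   fix p u
   show "inj (fd ?psi p)"
   proof (rule injI)
    fix u w assume "fd ?psi p u = fd ?psi p w"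
    then have "fd B p u = fd B p w"
     unfolding fpsi by (rule injD[OF injdE])
    then have "fd ?A (B p) (fd B p u) = fd ?A (B p) (fd B p w)"
     by (rule arg_cong)
    then show "u = w" unfolding DADB .
   qed
   show "?psi p = p" if "p ~: C" using Bout[OF that] Rout[OF that] by (simp add: Eeq)
   show "dist (?psi p) p < eta"
   proof (cases "p : C")
    case True
    let ?q = "B p"
    have "line_map a ?q $ i = p $ i" for i by (simp only: AB)
    from this[of 1] this[of 2] this[of 3] have "p $ 1 = a ?q" "p $ 2 = ?q $ 2" "p $ 3 = ?q $ 3" by simp_all
    then have "?q - p = (?q $ 1 - a ?q) *\<^sub>R axis 1 1" by (simp add: vec_eq_iff forall_3 axis_def)
    then have "norm (?q - p) = \<bar>a ?q - ?q $ 1\<bar>" by (simp add: abs_minus_commute)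
    moreover have "dist (?psi p) p <= norm (?q - p) + norm (R (v, ?q))"
     unfolding Eeq dist_norm using norm_triangle_ineq[of "?q - p" "R (v, ?q)"] by (simp add: algebra_simps)
    ultimately show ?thesis using vO[OF BC[OF True]] by (simp add: PP_def a_def)
   next
    case False
    then show ?thesis using Bout[OF False] Rout[OF False] eta by (simp add: Eeq)
   qed
   show "fd ?psi p u $ 3 + ?psi p $ 1 * fd ?psi p u $ 2 = 0
    \<longleftrightarrow> u $ 3 + p $ 1 * u $ 2 = 0"
   proof -
    have z: "1 + pd 3 (S v) (B p) ~= 0" using inO1[of "B p"] by (simp add: O1_def pdS)
    from gen_contact[OF smS z dA[folded Aeq] dE, of "fd B p u"]
    show ?thesis unfolding fpsi Aeq DADB AB using z by simp
   qed
   assume q: "vec3 (p $ 1 - v $ 2) (p $ 2) (p $ 3) : W"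
   let ?q = "vec3 (p $ 1 - v $ 2) (p $ 2) (p $ 3)"
   have "((%q. v $ 1 + v $ 2 * q $ 2 + v $ 3 * q $ 1) has_derivative (%w. 0 + v $ 2 * w $ 2 + v $ 3 * w $ 1)) (at ?q)"
    by (intro has_derivative_add has_derivative_const has_derivative_mult_right
      bounded_linear_imp_has_derivative bounded_linear_vec_nth)
   then have "(S v has_derivative (%w. 0 + v $ 2 * w $ 2 + v $ 3 * w $ 1)) (at ?q)"
    by (rule has_derivative_transform_within_open[OF _ W(1) q]) (use W(2) in \<open>simp add: S_def J_def\<close>)
   then have pdv: "pd i (S v) ?q = (%w. 0 + v $ 2 * w $ 2 + v $ 3 * w $ 1) (axis i 1)" for i
    by (rule fun_cong[OF frechet_derivative_at, symmetric])
   have pdv: "pd 1 (S v) ?q = v $ 3" "pd 2 (S v) ?q = v $ 2" "pd 3 (S v) ?q = 0"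
    unfolding pdv by (simp_all add: axis_def)
   have Sv: "S v ?q = v $ 1 + v $ 2 * p $ 2 + v $ 3 * (p $ 1 - v $ 2)" using W(2)[OF q] by (simp add: S_def J_def)
   have "a ?q = p $ 1" using pdv by (simp add: a_def al_def pdS[symmetric])
   then have "?A ?q = p" by (simp add: vec_eq_iff forall_3)
   then have Bp: "B p = ?q" using BA[of ?q] by simp
   show "?psi p = vec3 (p $ 1 - v $ 2) (p $ 2 + v $ 3) (p $ 3 + v $ 1 + v $ 2 * p $ 2)"
    unfolding Bp by (simp add: gen_target_def pdv Sv vec_eq_iff forall_3 algebra_simps)
  qed
 qed
qed

section \<open>Sets avoided by a curve after a small contact translation\<close>

text \<open>The image of a map from a part of the plane whose derivative has rank at most one
  everywhere; \<open>e\<close> is a direction that it kills. The derivative is taken in the full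
  plane, although only the points of \<open>U\<close> are mapped.\<close>

definition degenerate_image :: "(real^3) set => bool" where
 "degenerate_image S \<longleftrightarrow> (\<exists>U sig. S = sig ` U &
  (\<forall>u\<in>U. \<exists>D e. (sig has_derivative D) (at (u :: real^2)) & e ~= 0 & D e = 0))"

lemma degenerate_imageE:
 assumes "degenerate_image S"
 obtains U sig where "S = sig ` U"
  "!!u. u : U ==> \<exists>D e. (sig has_derivative D) (at (u :: real^2)) & e ~= 0 & D e = 0"
 using assms unfolding degenerate_image_def by blast

definition thin :: "(real^3) set => bool" where
 "thin Lam \<longleftrightarrow> (\<exists>\<S>. countable \<S> & Lam <= \<Union>\<S> & (\<forall>S\<in>\<S>. degenerate_image S))"

text \<open>For given \<open>u\<close> and \<open>theta\<close> exactly one \<open>v\<close>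
  translates \<open>kp theta\<close> to \<open>sig u\<close>. As a function \<open>Theta\<close> of
  the three variables \<open>(u, theta)\<close> it has a derivative that kills the degenerate
  direction of \<open>sig\<close>, so by Sard's theorem these \<open>v\<close> form a negligible
  set.\<close>

lemma thin_translation_negligible_image:
 fixes sig :: "real^2 => real^3" and kp :: "real => real^3"
 assumes sig: "!!u. u : U ==> \<exists>D e. (sig has_derivative D) (at u) & e ~= 0 & D e = 0"
  and kp: "!!theta. theta : T ==> \<exists>E. (kp has_derivative E) (at theta)"
 shows "negligible {v :: real^3. \<exists>theta\<in>T. vec3 (kp theta $ 1 - v $ 2) (kp theta $ 2 + v $ 3) (kp theta $ 3 + v $ 1 + v $ 2 * kp theta $ 2) : sig ` U}"
proof -
 define pr :: "real^3 => real^2" where "pr w = vector [w $ 1, w $ 2]" for w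
 have lin: "bounded_linear pr"
  unfolding linear_conv_bounded_linear[symmetric] by (rule linearI) (auto simp: pr_def vec_eq_iff forall_2)
 have dpr: "(pr has_derivative pr) (at w)" for w by (rule bounded_linear_imp_has_derivative[OF lin])
 have vn: "((%w :: real^3. w $ 3) has_derivative (%w. w $ 3)) (at w)" for w
  by (rule bounded_linear_imp_has_derivative[OF bounded_linear_vec_nth])
 define s k where "s w = sig (pr w)" and "k w = kp (w $ 3)" for w
 define Theta where "Theta w = vec3 (s w $ 3 - k w $ 3 - (k w $ 1 - s w $ 1) * k w $ 2) (k w $ 1 - s w $ 1) (s w $ 2 - k w $ 2)" for w
 define S where "S = {w. pr w : U & w $ 3 : T}"
 have "\<exists>D. (Theta has_derivative D) (at w within S) & rank (matrix D) < CARD(3)" if w: "w : S" for w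
 proof -
  obtain D e where D: "(sig has_derivative D) (at (pr w))" "e ~= 0" "D e = 0" using sig[of "pr w"] w by (auto simp: S_def)
  obtain E where E: "(kp has_derivative E) (at (w $ 3))" using kp[of "w $ 3"] w by (auto simp: S_def)
  have ds: "(s has_derivative (%x. D (pr x))) (at w)" unfolding s_def
   using has_derivative_compose[OF dpr D(1)] .
  have dk: "(k has_derivative (%x. E (x $ 3))) (at w)" unfolding k_def
   using has_derivative_compose[OF vn E] .
  note dsi = bounded_linear.has_derivative[OF bounded_linear_vec_nth ds]
  note dki = bounded_linear.has_derivative[OF bounded_linear_vec_nth dk]
  define G where "G x = vec3 (D (pr x) $ 3 - E (x $ 3) $ 3 -
     ((k w $ 1 - s w $ 1) * E (x $ 3) $ 2 + (E (x $ 3) $ 1 - D (pr x) $ 1) * k w $ 2))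
    (E (x $ 3) $ 1 - D (pr x) $ 1) (D (pr x) $ 2 - E (x $ 3) $ 2)" for x
  have dG: "(Theta has_derivative G) (at w)"
   unfolding Theta_def G_def vec3_decomp
   by (intro has_derivative_add has_derivative_scaleR_left has_derivative_diff has_derivative_mult dsi dki)
  define x where "x = vec3 (e $ 1) (e $ 2) 0"
  have x3: "x $ 3 = 0" by (simp add: x_def)
  have px: "pr x = e" by (simp add: pr_def x_def vec_eq_iff forall_2)
  have E0: "E 0 = 0" by (rule linear_0[OF has_derivative_linear[OF E]])
  have "G x = vec3 0 0 0" unfolding G_def px x3 E0 D(3) by simp
  then have "G x = 0" by (simp add: vec_eq_iff forall_3)
  moreover have "x ~= 0" using D(2) by (auto simp: x_def vec_eq_iff forall_3 forall_2)
  moreover have linG: "linear G" by (rule has_derivative_linear[OF dG])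
  ultimately have "\<not> inj G" using linear_0[OF linG] unfolding inj_def by metis
  moreover have "(*v) (matrix G) = G" by (rule matrix_vector_mul(2)[OF linG])
  ultimately have "rank (matrix G) < CARD(3)" unfolding less_rank_noninjective by (simp only: not_False_eq_True)
  then show ?thesis using has_derivative_at_withinI[OF dG] by blast
 qed
 then obtain D where D: "!!w. w : S ==> (Theta has_derivative D w) (at w within S)"
  "!!w. w : S ==> rank (matrix (D w)) < CARD(3)" by metis
 have "negligible (Theta ` S)" by (rule baby_Sard[OF order_refl D])
 moreover have "{v :: real^3. \<exists>theta\<in>T. vec3 (kp theta $ 1 - v $ 2) (kp theta $ 2 + v $ 3) (kp theta $ 3 + v $ 1 + v $ 2 * kp theta $ 2) : sig ` U} <= Theta ` S"
 proof clarify
  fix v :: "real^3" and theta u assume theta: "theta : T" and u: "u : U"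
   "vec3 (kp theta $ 1 - v $ 2) (kp theta $ 2 + v $ 3) (kp theta $ 3 + v $ 1 + v $ 2 * kp theta $ 2) = sig u"
  let ?w = "vec3 (u $ 1) (u $ 2) theta"
  have pw: "pr ?w = u" by (simp add: pr_def vec_eq_iff forall_2)
  have su: "sig u $ 1 = kp theta $ 1 - v $ 2" "sig u $ 2 = kp theta $ 2 + v $ 3" "sig u $ 3 = kp theta $ 3 + v $ 1 + v $ 2 * kp theta $ 2"
   unfolding u(2)[symmetric] by simp_all
  have "Theta ?w = v" by (simp add: Theta_def s_def k_def pw su vec_eq_iff forall_3)
  moreover have "?w : S" using theta u(1) by (simp add: S_def pw)
  ultimately show "v : Theta ` S" by blast
 qed
 ultimately show ?thesis by (rule negligible_subset)
qed

lemma thin_translation_negligible: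
 fixes kp :: "real => real^3"
 assumes "thin Lam" and kp: "!!theta. theta : T ==> \<exists>E. (kp has_derivative E) (at theta)"
 shows "negligible {v :: real^3. \<exists>theta\<in>T. vec3 (kp theta $ 1 - v $ 2) (kp theta $ 2 + v $ 3) (kp theta $ 3 + v $ 1 + v $ 2 * kp theta $ 2) : Lam}"
proof -
 let ?B = "%L. {v :: real^3. \<exists>theta\<in>T. vec3 (kp theta $ 1 - v $ 2) (kp theta $ 2 + v $ 3) (kp theta $ 3 + v $ 1 + v $ 2 * kp theta $ 2) : L}"
 obtain \<S> where S: "countable \<S>" "Lam <= \<Union>\<S>" "!!S. S : \<S> ==> degenerate_image S"
  using assms(1) unfolding thin_def by blast
 have neg: "negligible (?B S)" if "S : \<S>" for S
 proof -
  obtain U sig where sig: "S = sig ` U" "!!u. u : U ==> \<exists>D e. (sig has_derivative D) (at (u :: real^2)) & e ~= 0 & D e = 0"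
   by (rule degenerate_imageE[OF S(3)[OF \<open>S : \<S>\<close>]], rule that)
  show ?thesis unfolding sig(1) by (rule thin_translation_negligible_image[OF sig(2) kp])
 qed
 have "negligible (\<Union>(?B ` \<S>))"
  by (rule negligible_countable_Union[OF countable_image[OF S(1)]]) (use neg in blast)
 then show ?thesis by (rule negligible_subset) (use S(2) in blast)
qed

lemma small_non_negligible:
 fixes B :: "(real^3) set"
 assumes "negligible B" "dl > 0"
 obtains v where "v ~: B" "norm v < dl"
proof -
 have "\<not> negligible (ball (0 :: real^3) dl)" by (rule open_not_negligible) (use assms(2) in auto)
 then have "\<not> ball 0 dl <= B" using negligible_subset[OF assms(1)] by blast
 then show ?thesis using that by (auto simp: subset_iff)
qed

context closed_manifold
begin

lemma disc_boundary_differentiable: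
 assumes f: "smooth_into M unit_disc f" and c: "c : charts_at M (f (vector [cos theta, sin theta]))"
 shows "\<exists>E. ((%theta. cmap c (f (vector [cos theta, sin theta]))) has_derivative E) (at theta)"
proof -
 let ?gam = "%theta. vector [cos theta, sin theta] :: real^2"
 have eq: "?gam = (%theta. cos theta *\<^sub>R axis 1 1 + sin theta *\<^sub>R axis 2 1)"
  by (auto simp: fun_eq_iff vec_eq_iff forall_2 axis_def)
 have n: "norm (?gam t) = 1" for t by (simp add: norm_vec_def L2_set_def sum_2)
 then have in1: "?gam t : unit_disc" for t by simp
 obtain L where L: "((cmap c o f) has_derivative L) (at (?gam theta) within unit_disc)"
  by (rule disc_differential[OF f in1 c])
 have "\<exists>G. (?gam has_derivative G) (at theta)"
  unfolding eq by (rule exI) (auto intro!: derivative_eq_intros)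
 then obtain G where G: "(?gam has_derivative G) (at theta)" by blast
 have "((cmap c o f o ?gam) has_derivative (L o G)) (at theta)"
  by (rule diff_chain_within[of _ _ _ UNIV, simplified, OF G])
   (rule has_derivative_subset[OF L], use in1 in auto)
 then show ?thesis unfolding comp_def by blast
qed

text \<open>Almost every small contact translation moves the boundary curve off \<open>Lam\<close>.
  The translation is cut off around the compact set where the curve meets \<open>Lam\<close>; the
  part of the curve away from that set keeps a distance to \<open>Lam\<close> larger than any
  displacement.\<close>

lemma overtwisted_general_position:
 assumes d: "d : atlas M" and ksi: "smooth_field ksi"
  and R: "represents ksi d (cimage d) (nf_covector (%p. p $ 1) (%_. 0))"
  and f: "overtwisted_disc M ksi (noncontact ksi) f" and Lam: "closed Lam" "thin Lam"
  and B: "compact (cmap d ` (f ` sphere 0 1 Int cdom d) Int Lam)"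
 shows "\<exists>f'. overtwisted_disc M ksi (noncontact ksi) f' & cmap d ` (f' ` sphere 0 1 Int cdom d) Int Lam = {}"
proof -
 let ?K = "cmap d ` (f ` sphere 0 1 Int cdom d)"
 let ?B = "?K Int Lam"
 have sf: "smooth_into M unit_disc f" and off: "!!x. x : sphere 0 1 ==> f x ~: noncontact ksi"
  using f unfolding overtwisted_disc_def by blast+
 have oim: "open (cimage d)" by (rule representsD(4)[OF R])
 have Bim: "?B <= cimage d" by blast
 obtain rho :: "real^3 => real" and V C where rho: "Cinf_on UNIV rho" "!!x. 0 <= rho x" "!!x. rho x <= 1"
  "open V" "?B <= V" "!!x. x : V ==> rho x = 1"
  and C: "compact C" "C <= cimage d" "!!x. x ~: C ==> rho x = 0"
  by (rule smooth_bump[OF B oim Bim], rule that)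
 have VC: "V <= C" using rho(6) C(3) by force
 have "\<exists>r>0. \<forall>x\<in>?B. ball x r <= V"
 proof (cases "?B = {}")
  case False
  have "closed (- V)" using rho(4) by (simp add: closed_def)
  moreover have "?B Int - V = {}" using rho(5) by blast
  ultimately obtain r where r: "r > 0" "\<forall>x\<in>?B. \<forall>y\<in>- V. r <= dist x y"
   using separate_compact_closed[OF B] by blast
  then have "ball x r <= V" if "x : ?B" for x using that by (force simp: not_le)
  then show ?thesis using r(1) by blast
 qed (rule exI[of _ 1], simp)
 then obtain r where r: "r > 0" "!!x. x : ?B ==> ball x r <= V" by blast
 define P where "P = (\<Union>x\<in>?B. ball x (r / 2))"
 have K1: "compact (C Int ?K)" by (rule compact_disc_boundary_chart[OF sf d C(1,2)])
 have oP: "open P" unfolding P_def by blast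
 have K2: "compact (C Int ?K - P)" by (rule compact_diff[OF K1 oP])
 have BP: "?B <= P" unfolding P_def using r(1) by force
 then have "(C Int ?K - P) Int Lam = {}" by blast
 then obtain eta where eta: "eta > 0" "\<forall>x\<in>C Int ?K - P. \<forall>y\<in>Lam. eta <= dist x y"
  using separate_compact_closed[OF K2 Lam(1)] by blast
 define kp where "kp = (%theta. cmap d (f (vector [cos theta, sin theta])))"
 define T where "T = {theta. f (vector [cos theta, sin theta]) : cdom d}"
 have dk: "\<exists>E. (kp has_derivative E) (at theta)" if "theta : T" for theta
  unfolding kp_def by (rule disc_boundary_differentiable[OF sf]) (use that d in \<open>simp add: T_def charts_at_def\<close>)
 have KT: "?K <= kp ` T"
 proof
  fix y assume "y : ?K"
  then obtain x where x: "x : sphere 0 1" "f x : cdom d" "y = cmap d (f x)" by blast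
  have "(x $ 1)\<^sup>2 + (x $ 2)\<^sup>2 = 1" using x(1) by (simp add: norm_vec_def L2_set_def sum_2)
  then obtain theta where "x $ 1 = cos theta" "x $ 2 = sin theta" by (rule sincos_total_2pi)
  then have "x = vector [cos theta, sin theta]" by (simp add: vec_eq_iff forall_2)
  then show "y : kp ` T" using x(2,3) by (auto simp: kp_def T_def)
 qed
 let ?tr = "%v p. vec3 (p $ 1 - v $ 2) (p $ 2 + v $ 3) (p $ 3 + v $ 1 + v $ 2 * p $ 2) :: real^3"
 have neg: "negligible {v :: real^3. \<exists>theta\<in>T. ?tr v (kp theta) : Lam}"
  by (rule thin_translation_negligible[OF Lam(2) dk])
 obtain dl where dl: "dl > 0" "!!v :: real^3. norm v < dl ==> \<exists>psi. Cinf_on UNIV psi & inj psi &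
  (\<forall>p. inj (fd psi p)) & (\<forall>p. p ~: C --> psi p = p) & (\<forall>p. dist (psi p) p < eta) &
  (\<forall>p u. fd psi p u $ 3 + psi p $ 1 * fd psi p u $ 2 = 0
    \<longleftrightarrow> u $ 3 + p $ 1 * u $ 2 = 0) &
  (\<forall>p. vec3 (p $ 1 - v $ 2) (p $ 2) (p $ 3) : V --> psi p = ?tr v p)"
  by (rule contact_translation[OF rho(1) C(1,3) rho(4,6) eta(1)]; (assumption | rule that))
 \<comment> \<open>The first bound makes the contact transformation available. The second keeps a
   point of \<open>P\<close>, shifted by \<open>v $ 2\<close>, within distance \<open>r\<close> of
   the intersection with \<open>Lam\<close>, hence in \<open>V\<close> where the transformation is
   an exact translation.\<close>
 have m0: "min dl (r / 2) > 0" using dl(1) r(1) by simp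
 obtain v where v: "v ~: {v :: real^3. \<exists>theta\<in>T. ?tr v (kp theta) : Lam}" "norm v < min dl (r / 2)"
  by (rule small_non_negligible[OF neg m0], rule that)
 then obtain psi where psi: "Cinf_on UNIV psi" "inj psi" "!!p. inj (fd psi p)"
  "!!p. p ~: C ==> psi p = p" "!!p. dist (psi p) p < eta"
  "!!p u. fd psi p u $ 3 + psi p $ 1 * fd psi p u $ 2 = 0
    \<longleftrightarrow> u $ 3 + p $ 1 * u $ 2 = 0"
  "!!p. vec3 (p $ 1 - v $ 2) (p $ 2) (p $ 3) : V ==> psi p = ?tr v p"
  using dl(2)[of v] v(2) by (auto del: injI)
 have psiC: "psi x : C" if "x : C" for x
 proof (rule ccontr)
  assume n: "psi x ~: C"
  then have "psi (psi x) = psi x" by (rule psi(4))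
  then have "psi x = x" by (rule injD[OF psi(2)])
  then show False using n that by simp
 qed
 have psiim: "psi x : cimage d" if "x : cimage d" for x
 proof (cases "x : C")
  case True then show ?thesis using psiC C(2) by blast
 next
  case False then show ?thesis using psi(4)[OF False] that by simp
 qed
 \<comment> \<open>Points of \<open>C\<close> outside \<open>P\<close> move by less than their
   distance to \<open>Lam\<close>; points of \<open>P\<close> undergo a translation by the generic
   \<open>v\<close>; all others stay fixed and are not in \<open>Lam\<close>.\<close>
 have move: "psi y ~: Lam" if y: "y : ?K" for y
 proof (cases "y : C - P")
  case True
  then have "eta <= dist y z" if "z : Lam" for z using eta(2) y that by blast
  from this[of "psi y"] show ?thesis using psi(5)[of y] by (auto simp: dist_commute)
 next
  case False
  show ?thesis
  proof (cases "y : P")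
   case True
   then obtain x where x: "x : ?B" "dist x y < r / 2" unfolding P_def by auto
   let ?y = "vec3 (y $ 1 - v $ 2) (y $ 2) (y $ 3)"
   have "y - ?y = v $ 2 *\<^sub>R axis 1 1" by (simp add: vec_eq_iff forall_3 axis_def)
   then have "dist y ?y = \<bar>v $ 2\<bar>" by (simp add: dist_norm)
   also have "... < r / 2" using component_le_norm_cart[of v 2] v(2) by simp
   finally have "dist x ?y < r" using x(2) dist_triangle[of x ?y y] by simp
   then have "?y : V" using r(2)[OF x(1)] by (simp add: subset_iff)
   then have "psi y = ?tr v y" by (rule psi(7))
   moreover obtain theta where "theta : T" "y = kp theta" using KT y by blast
   ultimately show ?thesis using v(1) by auto
  next
   case nP: False
   then have "y ~: C" using False by blast
   then have "psi y = y" by (rule psi(4))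
   then show ?thesis using y nP BP by auto
  qed
 qed
 let ?f = "chart_lift d psi o f"
 have ct: "contact_at M ksi p" if p: "p : cdom d" for p
 proof -
  have "((%p :: real^3. p $ 1) has_derivative (%w. w $ 1)) (at (cmap d p))"
   by (rule bounded_linear_imp_has_derivative[OF bounded_linear_vec_nth])
  from fun_cong[OF frechet_derivative_at[OF this], of "axis 1 1"]
  have "pd 1 (%p. p $ 1) (cmap d p) = 1" by simp
  moreover have "cmap d p : cimage d" using p by blast
  ultimately show ?thesis
   using contact_at_nf(1)[OF R _ _ p] by (simp add: nf_contact_0 Cinf_on_vec_nth Cinf_on_const Cinf_on_ident oim)
 qed
 have lift: "chart_lift d psi p : cdom d" "cmap d (chart_lift d psi p) = psi (cmap d p)" if p: "p : cdom d" for p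
 proof -
  have "psi (cmap d p) : cimage d" using p by (intro psiim) blast
  then show "chart_lift d psi p : cdom d" "cmap d (chart_lift d psi p) = psi (cmap d p)"
   using p cinv_cdom[of "psi (cmap d p)" d] cmap_cinv[of "psi (cmap d p)" d] by (simp_all add: chart_lift_def)
 qed
 have "overtwisted_disc M ksi (noncontact ksi) ?f"
 proof (rule overtwisted_disc_transport[OF f ksi ksi d])
  show "Cinf_on (cimage d) psi" by (rule Cinf_on_subset[OF psi(1) oim]) simp
  show "psi ` cimage d <= cimage d" using psiim by blast
  show "inj_on psi (cimage d)" by (rule inj_on_subset[OF psi(2)]) simp
  show "inj (fd psi x)" for x by (rule psi(3))
  show "compact C" "C <= cimage d" by (rule C)+
  show "psi x = x" if "x : cimage d - C" for x using that psi(4) by blast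
  fix p assume p: "p : f ` sphere 0 1"
  show "p ~: noncontact ksi & ksi p = ksi p" using p off by blast
  assume pd: "p : cdom d"
  have "chart_lift d psi p ~: noncontact ksi" using ct[OF lift(1)[OF pd]] by (simp add: noncontact_def)
  moreover have "tvec p d w : ksi p \<longleftrightarrow>
   tvec (chart_lift d psi p) d (fd psi (cmap d p) w) : ksi (chart_lift d psi p)" for w
  proof -
   have i: "cmap d p : cimage d" "cmap d (chart_lift d psi p) : cimage d" using pd lift[OF pd] by blast+
   show ?thesis
    unfolding represents_tvec[OF R pd i(1)] represents_tvec[OF R lift(1)[OF pd] i(2)] nf_covector_inner lift(2)[OF pd]
    using psi(6)[of "cmap d p" w] by (simp add: add.commute)
  qed
  ultimately show "chart_lift d psi p ~: noncontact ksi & (\<forall>w. tvec p d w : ksi p \<longleftrightarrow>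
   tvec (chart_lift d psi p) d (fd psi (cmap d p) w) : ksi (chart_lift d psi p))" by blast
 qed
 moreover have "cmap d ` (?f ` sphere 0 1 Int cdom d) Int Lam = {}"
 proof -
  have False if "x : sphere 0 1" "?f x : cdom d" "cmap d (?f x) : Lam" for x
  proof -
   have "f x : cdom d" using that(2) by (auto simp: chart_lift_def split: if_splits)
   then show False using lift(2)[of "f x"] move[of "cmap d (f x)"] that(1,3) by auto
  qed
  then show ?thesis by blast
 qed
 ultimately show ?thesis by blast
qed

end

section \<open>Perturbations in one chart\<close>

lemma Cinf_on_bump_mult:
 fixes rho k :: "'e::euclidean_space => real"
 assumes "Cinf_on UNIV rho" "Cinf_on V k" "compact C" "C <= V" "!!x. x ~: C ==> rho x = 0"
 shows "Cinf_on UNIV (%x. rho x * k x)"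
proof (rule Cinf_on_local[OF open_UNIV])
 fix x
 show "\<exists>U. x : U & Cinf_on U (%x. rho x * k x)"
 proof (cases "x : V")
  case True
  have "Cinf_on V (%x. rho x * k x)"
   by (intro smooth_intros Cinf_on_subset[OF assms(1)] assms(2)) (auto intro: Cinf_on_open[OF assms(2)])
  then show ?thesis using True by blast
 next
  case False
  have "open (- C)" using compact_imp_closed[OF assms(3)] by (simp add: open_Compl)
  then have "Cinf_on (- C) (%x. rho x * k x)"
   by (rule Cinf_on_cong[OF Cinf_on_const[of _ 0]]) (use assms(5) in auto)
  then show ?thesis using False assms(4) by blast
 qed
qed

section \<open>Straightening Legendrian curves\<close>

abbreviation cube :: "real => (real^3) set" where "cube r == box (vec3 (-r) (-r) (-r)) (vec3 r r r)"
abbreviation ccube :: "real => (real^3) set" where "ccube r == cbox (vec3 (-r) (-r) (-r)) (vec3 r r r)"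

lemma mem_cube: "x : cube r \<longleftrightarrow> \<bar>x $ 1\<bar> < r & \<bar>x $ 2\<bar> < r & \<bar>x $ 3\<bar> < r"
 by (auto simp: mem_box3 forall_3)

lemma mem_ccube: "x : ccube r \<longleftrightarrow> \<bar>x $ 1\<bar> <= r & \<bar>x $ 2\<bar> <= r & \<bar>x $ 3\<bar> <= r"
 by (auto simp: mem_box_cart forall_3)

text \<open>Curves with constant \<open>y\<close> tangent to \<open>k dx + h dy + dz\<close> solve
  \<open>dz/dx = - k\<close>. Cutting \<open>k\<close> off gives a global flow. By the bound 1/8, a
  curve over \<open>|x| < 3/2\<close> with \<open>|z| < 3/2\<close> at the start stays below
  \<open>|z| = 7/4\<close>, where the cutoff is still 1.\<close>

lemma Legendrian_flow:
 assumes k: "Cinf_on (cube 2) k" "!!x. x : cube 2 ==> \<bar>k x\<bar> <= 1 / 8"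
 obtains Z where "Cinf_on UNIV Z"
  "!!p. p : cube (3 / 2) ==> pd 1 Z p = - k (vec3 (p $ 1) (p $ 2) (Z p))"
  "!!p. pd 3 Z p > 0" "!!p. \<bar>Z p - p $ 3\<bar> <= 1 / 8 * \<bar>p $ 1\<bar>"
proof -
 have sub: "ccube (7 / 4) <= cube 2" unfolding subset_iff mem_cube mem_ccube by auto
 obtain rho :: "real^3 => real" and U C where rho: "Cinf_on UNIV rho" "!!x. 0 <= rho x" "!!x. rho x <= 1"
  "open U" "ccube (7 / 4) <= U" "!!x. x : U ==> rho x = 1" and C: "compact C" "C <= cube 2" "!!x. x ~: C ==> rho x = 0"
  by (rule smooth_bump[OF compact_cbox open_box sub], rule that)
 define g where "g x = rho x * (- k x)" for x
 have g: "Cinf_on UNIV g" unfolding g_def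
  by (rule Cinf_on_bump_mult[OF rho(1) _ C]) (intro smooth_intros k)
 have B: "\<bar>g p\<bar> <= 1 / 8" for p
 proof (cases "p : C")
  case True
  have "\<bar>rho p\<bar> * \<bar>k p\<bar> <= 1 * (1 / 8)" using rho(2,3)[of p] k(2)[of p] True C(2) by (intro mult_mono) auto
  then show ?thesis by (simp add: g_def abs_mult)
 qed (simp add: g_def C(3))
 obtain L where L: "L > 0" "!!x. x : C ==> \<bar>pd 3 g x\<bar> <= L"
  by (rule compact_continuous_bound[OF C(1) continuous_on_subset[OF Cinf_on_continuous[OF Cinf_on_derivative[OF g]]]])
   (use that in auto)
 have L': "\<bar>pd 3 g p\<bar> <= L" for p
 proof (cases "p : C")
  case False
  have "open (- C)" using compact_imp_closed[OF C(1)] by (simp add: open_Compl)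
  have "((%x. 0 :: real) has_derivative (%w. 0)) (at p)" by simp
  then have "(g has_derivative (%w. 0)) (at p)"
   by (rule has_derivative_transform_within_open[OF _ \<open>open (- C)\<close>]) (use False C(3) in \<open>auto simp: g_def\<close>)
  from fun_cong[OF frechet_derivative_at[OF this], of "axis 3 1"] show ?thesis using L(1) by simp
 qed (rule L(2))
 obtain Z where Z: "Cinf_on UNIV Z" "!!y z. Z (vec3 0 y z) = z" "!!p. pd 1 Z p = g (vec3 (p $ 1) (p $ 2) (Z p))"
  "!!p. pd 3 Z p > 0" "!!p. \<bar>Z p - p $ 3\<bar> <= 1 / 8 * \<bar>p $ 1\<bar>"
  by (rule scalar_ode_flow[OF g B L'], rule that)
 show ?thesis
 proof (rule that[OF Z(1) _ Z(4,5)])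
  fix p assume p: "p : cube (3 / 2)"
  have "\<bar>Z p\<bar> <= 7 / 4" using Z(5)[of p] p unfolding mem_cube by arith
  then have "vec3 (p $ 1) (p $ 2) (Z p) : ccube (7 / 4)" using p unfolding mem_cube mem_ccube by simp
  then show "pd 1 Z p = - k (vec3 (p $ 1) (p $ 2) (Z p))" using Z(3) rho(5,6) by (simp add: g_def subset_iff)
 qed
qed

definition vert_map :: "(real^3 => real) => real^3 => real^3" where
 "vert_map Z p = vec3 (p $ 1) (p $ 2) (Z p)"

lemma vert_map_derivative:
 assumes "Cinf_on UNIV Z"
 shows "fd (vert_map Z) p = (%v. vec3 (v $ 1) (v $ 2) (fd Z p v))"
proof -
 have d: "(Z has_derivative fd Z p) (at p)" using Cinf_on_has_derivative[OF assms] by simp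
 have "(vert_map Z has_derivative (%v. vec3 (v $ 1) (v $ 2) (fd Z p v))) (at p)"
  unfolding vert_map_def[abs_def] vec3_decomp
  by (intro has_derivative_add has_derivative_scaleR_left d bounded_linear_imp_has_derivative bounded_linear_vec_nth)
 then show ?thesis by (rule frechet_derivative_at[symmetric])
qed

lemma inj_vert_map:
 assumes Z: "Cinf_on UNIV Z" "!!p. pd 3 Z p > 0"
 shows "inj (vert_map Z)"
proof (rule injI)
 fix p q assume eq: "vert_map Z p = vert_map Z q"
 then have 12: "p $ 1 = q $ 1" "p $ 2 = q $ 2" and Zeq: "Z p = Z q" by (auto simp: vert_map_def vec_eq_iff forall_3)
 let ?l = "%s. vec3 (p $ 1) (p $ 2) s"
 have der: "((%s. Z (?l s)) has_real_derivative pd 3 Z (?l s)) (at s)" for s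
 proof -
  have "(?l has_derivative (%s. s *\<^sub>R axis 3 1)) (at s)"
   unfolding vec3_decomp by (auto intro!: derivative_eq_intros)
  from has_derivative_compose[OF this Cinf_on_has_derivative[OF Z(1) UNIV_I]]
  show ?thesis using linear_frechet_derivative[OF Cinf_on_differentiable[OF Z(1) UNIV_I]]
   by (simp add: has_field_derivative_def linear_cmul mult_commute_abs)
 qed
 have lt: "Z (?l s) < Z (?l t)" if "s < t" for s t
  by (rule DERIV_pos_imp_increasing[OF that]) (use der Z(2) in blast)
 have "p = ?l (p $ 3)" "q = ?l (q $ 3)" using 12 by (simp_all add: vec_eq_iff forall_3)
 then have "p $ 3 = q $ 3" using lt Zeq by (metis less_irrefl linorder_less_linear)
 then show "p = q" using 12 by (simp add: vec_eq_iff forall_3)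
qed

context closed_manifold
begin

lemma represents_scale:
 assumes R: "represents ksi c V A" and B: "Cinf_on V B" "!!x. x : V ==> \<exists>r. r ~= 0 & A x = r *\<^sub>R B x"
 shows "represents ksi c V B"
 unfolding represents_def
proof (intro conjI ballI)
 note D = representsD[OF R]
 show "c : atlas M" "V <= cimage c" "Cinf_on V B" by (rule D B)+
 fix x assume x: "x : V"
 obtain r where r: "r ~= 0" "A x = r *\<^sub>R B x" using B(2)[OF x] by blast
 show "B x ~= 0" using r D(5)[OF x] by auto
 show "ksi (cinv c x) = ker_at (cinv c x) c (B x)"
  unfolding D(6)[OF x] r(2) using r(1) by simp
qed

text \<open>The new chart is described by its parametrisation \<open>R\<close> in the old
  coordinates, so that defining forms are pulled back along a map given explicitly.\<close>

lemma chart_pullback: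
 assumes c: "c : atlas M" and R: "Cinf_on U R" "inj_on R U" "R ` U <= cimage c"
  and det: "!!x. x : U ==> det (matrix (fd R x)) > 0"
 obtains d where "d : atlas M" "cimage d = U" "!!y. y : U ==> cinv d y = cinv c (R y)"
  "!!ksi V A. represents ksi c V A ==> R ` U <= V ==> represents ksi d U (cov_pull R A)"
proof -
 let ?T = "inv_into U R" and ?V = "R ` U"
 have det0: "det (matrix (fd R x)) ~= 0" if "x : U" for x using det[OF that] by simp
 note inv = Cinf_on_inverse_real3[OF R(1,2) det0]
 have iT: "inj_on ?T ?V" by (rule inj_on_inv_into) simp
 have Tim: "?T ` ?V = U" by (rule inv_into_image_cancel[OF R(2)]) simp
 have TR: "?T (R x) = x" if "x : U" for x by (rule inv_into_f_f[OF R(2) that])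
 have dT: "det (matrix (fd ?T y)) > 0" if y: "y : ?V" for y
 proof -
  obtain x where x: "x : U" "y = R x" using y by blast
  note D1 = Cinf_on_has_derivative[OF R(1) x(1)]
  have D2: "(?T has_derivative fd ?T (R x)) (at (R x))"
   using Cinf_on_has_derivative[OF inv(2)] x by blast
  have "((%x. ?T (R x)) has_derivative (%w. fd ?T (R x) (fd R x w))) (at x)"
   by (rule has_derivative_compose[OF D1 D2])
  moreover have "((%x. ?T (R x)) has_derivative (%w. w)) (at x)"
   by (rule has_derivative_transform_within_open[OF has_derivative_ident Cinf_on_open[OF R(1)] x(1)]) (simp add: TR)
  ultimately have "(%w. fd ?T (R x) (fd R x w)) = (%w. w)"
   by (rule has_derivative_unique)
  then have "det (matrix (fd ?T (R x))) * det (matrix (fd R x)) = det (matrix (%w :: real^3. w))"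
   using matrix_det_compose[OF has_derivative_linear[OF D1] has_derivative_linear[OF D2]] by simp
  also have "... = 1" by (simp add: matrix_id_mat_1[unfolded id_def])
  finally show ?thesis using det[OF x(1)] x(2) by (metis zero_less_mult_pos2 zero_less_one)
 qed
 define d where "d = ({p : cdom c. cmap c p : ?V}, ?T o cmap c)"
 note re = atlas_reparametrize[OF c R(3) inv(2) iT dT, folded d_def]
 have d: "d : atlas M" "cimage d = U" using re(1,2) Tim by simp_all
 have inv_d: "cinv d y = cinv c (R y)" if y: "y : U" for y
  using re(3)[of "R y"] y by (simp add: TR)
 show ?thesis
 proof (rule that[OF d inv_d])
  fix ksi V A assume rep: "represents ksi c V A" and RV: "R ` U <= V"
  have tr: "transition d c y = R y" if "y : U" for y
   using inv_d[OF that] cmap_cinv[of "R y" c] R(3) that by auto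
  have set: "cmap d ` (cdom d Int cinv c ` V) = U"
  proof
   show "cmap d ` (cdom d Int cinv c ` V) <= U" using d(2) by blast
   show "U <= cmap d ` (cdom d Int cinv c ` V)"
   proof
    fix y assume y: "y : U"
    have "y : cimage d" using y d(2) by simp
    then have "cmap d (cinv d y) = y" "cinv d y : cdom d" by (rule cmap_cinv, rule cinv_cdom)
    moreover have "cinv d y : cinv c ` V" using inv_d[OF y] RV y by auto
    ultimately show "y : cmap d ` (cdom d Int cinv c ` V)" by (metis IntI imageI)
   qed
  qed
  have sm: "Cinf_on U (cov_pull R A)" by (rule Cinf_on_cov_pull[OF R(1) representsD(3)[OF rep] RV])
  have "represents ksi d U (cov_pull (transition d c) A)" using represents_transport[OF rep d(1)] set by simp
  then show "represents ksi d U (cov_pull R A)"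
  proof (rule represents_scale[OF _ sm])
   fix x assume x: "x : U"
   have "(transition d c has_derivative fd R x) (at x)"
    by (rule has_derivative_transform_within_open[OF Cinf_on_has_derivative[OF R(1) x] Cinf_on_open[OF R(1)] x])
     (simp only: tr)
   then have "fd R x = fd (transition d c) x" by (rule frechet_derivative_at)
   then show "\<exists>r. r ~= 0 & cov_pull (transition d c) A x = r *\<^sub>R cov_pull R A x"
    using tr[OF x] by (intro exI[of _ 1]) (simp add: cov_pull_def del: o_apply)
  qed
 qed
qed

text \<open>Along the flow \<open>Z\<close> of the Legendrian curves the form pulls back to
  \<open>Z_z (dz + G dy)\<close> with \<open>G = (h + Z_y) / Z_z\<close>. The coordinates depend on
  \<open>k\<close> alone, so plane fields with the same \<open>k\<close> are brought into the form
  \<open>dz + G dy\<close> simultaneously. The image contains \<open>ccube 1\<close>, so changes of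
  \<open>h\<close> supported there are seen completely by the new chart.\<close>

lemma Legendrian_rectify:
 assumes c: "c : atlas M" "cube 2 <= cimage c" and k: "Cinf_on (cube 2) k" "!!x. x : cube 2 ==> \<bar>k x\<bar> <= 1 / 8"
 obtains d R G where "d : atlas M" "cimage d = cube (3 / 2)" "!!y. y : cube (3 / 2) ==> R y : cube 2 & cinv d y = cinv c (R y)"
  "ccube 1 <= R ` cube (3 / 2)" "Cinf_on UNIV R"
  "!!ksi h. Cinf_on (cube 2) h ==> represents ksi c (cube 2) (nf_covector h k) ==>
   Cinf_on (cube (3 / 2)) (G h) & represents ksi d (cube (3 / 2)) (nf_covector (G h) (%_. 0))"
  "!!h h' y. G h y = G h' y \<longleftrightarrow> h (R y) = h' (R y)"
proof -
 obtain Z where Z: "Cinf_on UNIV Z" "!!p. p : cube (3 / 2) ==> pd 1 Z p = - k (vec3 (p $ 1) (p $ 2) (Z p))"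
  "!!p. pd 3 Z p > 0" "!!p. \<bar>Z p - p $ 3\<bar> <= 1 / 8 * \<bar>p $ 1\<bar>"
  by (rule Legendrian_flow[OF k]; (assumption | rule that))
 let ?R = "vert_map Z"
 have smR: "Cinf_on UNIV ?R" unfolding vert_map_def[abs_def] by (intro smooth_intros Z(1)) auto
 have inR: "?R y : cube 2" if "y : cube (3 / 2)" for y
 proof -
  have "\<bar>Z y\<bar> < 2" using Z(4)[of y] that unfolding mem_cube by arith
  then show ?thesis using that unfolding mem_cube by (simp add: vert_map_def)
 qed
 have DR: "fd ?R p = (%v. vec3 (v $ 1) (v $ 2) (fd Z p v))" for p
  by (rule vert_map_derivative[OF Z(1)])
 have det: "det (matrix (fd ?R p)) > 0" for p
  unfolding DR using Z(3)[of p] by (simp add: det_3 matrix_def axis_def)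
 have Rim: "?R ` cube (3 / 2) <= cube 2" using inR by blast
 have smR': "Cinf_on (cube (3 / 2)) ?R" by (rule Cinf_on_subset[OF smR open_box]) simp
 have injR: "inj_on ?R (cube (3 / 2))" by (rule inj_on_subset[OF inj_vert_map[OF Z(1,3)]]) simp
 obtain d where d: "d : atlas M" "cimage d = cube (3 / 2)" "!!y. y : cube (3 / 2) ==> cinv d y = cinv c (?R y)"
  "!!ksi V A. represents ksi c V A ==> ?R ` cube (3 / 2) <= V ==> represents ksi d (cube (3 / 2)) (cov_pull ?R A)"
  by (rule chart_pullback[OF c(1) smR' injR order_trans[OF Rim c(2)] det], rule that)
 define G where "G h y = (h (?R y) + pd 2 Z y) / pd 3 Z y" for h y
 show ?thesis
 proof (rule that[OF d(1,2) _ _ smR])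
  show "?R y : cube 2 & cinv d y = cinv c (?R y)" if "y : cube (3 / 2)" for y using inR d(3) that by blast
  show "ccube 1 <= ?R ` cube (3 / 2)"
  proof
   fix x assume x: "x : ccube 1"
   let ?l = "%s. vec3 (x $ 1) (x $ 2) s"
   have b: "\<bar>Z (?l s) - s\<bar> <= 1 / 8" for s using Z(4)[of "?l s"] x unfolding mem_ccube by simp
   have "\<exists>s. x $ 3 - 1 / 8 <= s & s <= x $ 3 + 1 / 8 & Z (?l s) = x $ 3"
   proof (rule IVT')
    show "Z (?l (x $ 3 - 1 / 8)) <= x $ 3" "x $ 3 <= Z (?l (x $ 3 + 1 / 8))"
     using b[of "x $ 3 - 1 / 8"] b[of "x $ 3 + 1 / 8"] by arith+
    show "continuous_on {x $ 3 - 1 / 8..x $ 3 + 1 / 8} (%s. Z (?l s))"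
     by (rule continuous_on_compose2[OF Cinf_on_continuous[OF Z(1)]]) (auto intro!: continuous_on_vec3 continuous_intros)
   qed simp
   then obtain s where s: "x $ 3 - 1 / 8 <= s" "s <= x $ 3 + 1 / 8" "Z (?l s) = x $ 3" by blast
   have "?R (?l s) = x" using s(3) by (simp add: vert_map_def vec_eq_iff forall_3)
   moreover have "?l s : cube (3 / 2)" using s(1,2) x unfolding mem_cube mem_ccube by simp arith
   ultimately show "x : ?R ` cube (3 / 2)" by (metis imageI)
  qed
  show "G h y = G h' y \<longleftrightarrow> h (?R y) = h' (?R y)" for h h' y using Z(3)[of y] by (simp add: G_def)
  fix ksi h assume h: "Cinf_on (cube 2) h" and R: "represents ksi c (cube 2) (nf_covector h k)"
  have sG: "Cinf_on (cube (3 / 2)) (G h)" unfolding G_def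
   by (intro smooth_intros Cinf_on_compose[OF smR' h Rim] Cinf_on_subset[OF Cinf_on_derivative[OF Z(1)]])
    (use Z(3) in \<open>auto simp: less_imp_neq[symmetric] open_box\<close>)
  have "represents ksi d (cube (3 / 2)) (nf_covector (G h) (%_. 0))"
  proof (rule represents_scale[OF d(4)[OF R Rim]])
   show "Cinf_on (cube (3 / 2)) (nf_covector (G h) (%_. 0))"
    by (intro Cinf_on_nf_covector sG Cinf_on_const open_box)
   fix y assume y: "y : cube (3 / 2)"
   have "cov_pull ?R (nf_covector h k) y = pd 3 Z y *\<^sub>R nf_covector (G h) (%_. 0) y"
    using Z(2)[OF y] Z(3)[of y]
    by (simp add: cov_pull_def inner_vec_def[of "vec3 _ _ _"] sum_3 DR vec_eq_iff forall_3 axis_def nf_covector_def G_def vert_map_def[of Z y, symmetric])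
   then show "\<exists>r. r ~= 0 & cov_pull ?R (nf_covector h k) y = r *\<^sub>R nf_covector (G h) (%_. 0) y"
    using Z(3)[of y] by (metis less_irrefl)
  qed
  then show "Cinf_on (cube (3 / 2)) (G h) & represents ksi d (cube (3 / 2)) (nf_covector (G h) (%_. 0))"
   using sG by blast
 qed
qed

section \<open>Overtwistedness under a change in one box\<close>

text \<open>Weaker than having \<open>F\<close> as maximal integral surface: degenerate points lie
  in \<open>F\<close> and have tangent planes there, but \<open>F\<close> may contain contact
  points. This is what survives when contactness is pushed into \<open>F\<close>.\<close>

definition integral_confoliation :: "'a set => 'a plane_field => bool" where
 "integral_confoliation F ksi \<longleftrightarrow> smooth_field ksi & (\<forall>p\<in>points M. conf_at ksi p) & compact_smooth_surface M F &
  noncontact ksi <= F & (\<forall>p\<in>noncontact ksi. ksi p = surface_tangent_plane M F p)"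

definition overtwisted :: "'a plane_field => bool" where
 "overtwisted ksi \<longleftrightarrow> (\<exists>f. overtwisted_disc M ksi (noncontact ksi) f)"

text \<open>At a degenerate point the plane is tangent to \<open>F\<close>, and it contains the
  x-direction since the form has no \<open>dx\<close>. The derivative of \<open>line_map H\<close>
  kills the x-direction there, as \<open>H\<close> has x-derivative 0. So \<open>line_map H\<close>,
  restricted to \<open>F\<close> in a flattening chart, is degenerate at these points, and finitely
  many such charts cover \<open>F\<close>.\<close>

lemma thin_line_image:
 assumes ksi: "integral_confoliation F ksi" and d: "d : atlas M"
  and R: "represents ksi d V (nf_covector H (%_. 0))" and H: "Cinf_on V H"
  and N: "N <= V" "!!y. y : N ==> pd 1 H y = 0"
 shows "thin (line_map H ` N)"
proof -
 have F: "compactin (mtop M) F" "!!p. p : F ==> \<exists>e. e : charts_at M p & flattens e F"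
  and NF: "noncontact ksi <= F" and tan: "!!p. p : noncontact ksi ==> ksi p = surface_tangent_plane M F p"
  using ksi unfolding integral_confoliation_def compact_smooth_surface_def by (blast, blast, blast, blast)
 note D = representsD[OF R]
 have non: "cinv d y : noncontact ksi" "cinv d y : cdom d" "cmap d (cinv d y) = y" if y: "y : N" for y
 proof -
  have yV: "y : V" "y : cimage d" using y N(1) D(2) by blast+
  show i: "cinv d y : cdom d" "cmap d (cinv d y) = y" using cinv_cdom[OF yV(2)] cmap_cinv[OF yV(2)] .
  then have "\<not> contact_at M ksi (cinv d y)"
   using contact_at_nf(1)[OF R H Cinf_on_const[OF D(4)] i(1)] yV(1) N(2)[OF y] by (simp add: nf_contact_0)
  then show "cinv d y : noncontact ksi" using i(1) cdom_subset[OF d] by (auto simp: noncontact_def)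
 qed
 define \<E> where "\<E> = {e : atlas M. flattens e F}"
 define \<U> where "\<U> = cdom ` \<E>"
 have oU: "openin (mtop M) U" if "U : \<U>" for U using that unfolding \<U>_def \<E>_def using openin_cdom by auto
 have cU: "F <= \<Union>\<U>"
 proof
  fix p assume "p : F"
  from F(2)[OF this] obtain e where e: "e : charts_at M p" "flattens e F" by (elim exE conjE) (rule that)
  then have "e : \<E>" "p : cdom e" using charts_atD[of e p] unfolding \<E>_def by simp_all
  then show "p : \<Union>\<U>" unfolding \<U>_def by (rule UN_I)
 qed
 have "\<exists>\<F>. finite \<F> & \<F> <= \<U> & F <= \<Union>\<F>" by (rule compactinD[OF F(1) _ cU]) (rule oU)
 then obtain \<F> where \<F>: "finite \<F>" "\<F> <= \<U>" "F <= \<Union>\<F>"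
  by (elim exE conjE) (rule that)
 define S where "S U = line_map H ` {y : N. cinv d y : U}" for U
 have "degenerate_image (S U)" if U: "U : \<F>" for U
 proof -
  have "U : cdom ` \<E>" using U \<F>(2) unfolding \<U>_def by (rule subsetD[rotated])
  then obtain e where "e : \<E>" and eU: "U = cdom e" by (rule imageE)
  then have e: "e : atlas M" "flattens e F" "U = cdom e" unfolding \<E>_def by simp_all
  have ez: "cmap e p $ 3 = 0" if "p : F" "p : cdom e" for p
  proof -
   have "cmap e p : cmap e ` (F Int cdom e)" using that by blast
   then show ?thesis using e(2) unfolding flattens_def by auto
  qed
  define j where "j u = vec3 (u $ 1) (u $ 2) 0" for u :: "real^2"
  let ?T = "transition e d"
  define sig where "sig u = line_map H (?T (j u))" for u
  define P where "P = {u. j u : cmap e ` (cdom e Int cdom d) & ?T (j u) : N}"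
  have "S U = sig ` P"
  proof (intro equalityI subsetI)
   fix x assume "x : S U"
   then obtain y where y: "y : N" "cinv d y : cdom e" "x = line_map H y" unfolding S_def e(3) by blast
   let ?p = "cinv d y"
   have p: "?p : F" using non(1)[OF y(1)] NF by blast
   define u where "u = (vector [cmap e ?p $ 1, cmap e ?p $ 2] :: real^2)"
   have ju: "j u = cmap e ?p" using ez[OF p y(2)] by (simp add: j_def u_def vec_eq_iff forall_3)
   have T: "?T (j u) = y" unfolding ju using transition_cmap[OF e(1) y(2)] non(3)[OF y(1)] by simp
   have "j u : cmap e ` (cdom e Int cdom d)" unfolding ju using y(2) non(2)[OF y(1)] by blast
   moreover have "?T (j u) : N" unfolding T by (rule y(1))
   ultimately have "u : P" unfolding P_def by (intro CollectI conjI)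
   then show "x : sig ` P" using y(3) T by (auto simp: sig_def simp del: o_apply)
  next
   fix x assume "x : sig ` P"
   then obtain u where u: "j u : cmap e ` (cdom e Int cdom d)" "?T (j u) : N" "x = line_map H (?T (j u))"
    unfolding P_def sig_def by blast
   then obtain p where p: "p : cdom e" "p : cdom d" "j u = cmap e p" by blast
   have "?T (j u) = cmap d p" using transition_cmap[OF e(1) p(1)] p(3) by simp
   then have "cinv d (?T (j u)) = p" using cinv_cmap[OF d p(2)] by simp
   then show "x : S U" unfolding S_def e(3) using u(2,3) p(1) by blast
  qed
  moreover have "\<exists>D' v. (sig has_derivative D') (at u) & v ~= 0 & D' v = 0" if u: "u : P" for u
  proof -
   obtain p where p: "p : cdom e" "p : cdom d" "j u = cmap e p" and yN: "?T (j u) : N" using u unfolding P_def by blast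
   have Tp: "?T (cmap e p) = cmap d p" by (rule transition_cmap[OF e(1) p(1)])
   then have y: "cmap d p : N" using yN p(3) by simp
   then have pn: "p : noncontact ksi" using non(1) cinv_cmap[OF d p(2)] by fastforce
   have ce: "e : charts_at M p" "d : charts_at M p" using p e(1) d by (simp_all add: charts_at_def)
   define DT where "DT = fd ?T (cmap e p)"
   have dT: "(?T has_derivative DT) (at (cmap e p))" unfolding DT_def by (rule transition_has_derivative[OF ce])
   have lin: "linear DT" by (rule has_derivative_linear[OF dT])
   define v where "v = fd (transition d e) (cmap d p) (axis 1 1)"
   have DTv: "DT v = axis 1 1" unfolding DT_def v_def
    using transition_chain[OF ce(2,1,2)] transition_same[OF ce(2)] by simp
   have yV: "cmap d p : V" using y N(1) by blast
   have plane: "tvec p d w : ksi p \<longleftrightarrow> H (cmap d p) * w $ 2 + w $ 3 = 0" for w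
    using represents_tvec[OF R p(2) yV] by (simp add: nf_covector_inner)
   define mu where "mu w = H (cmap d p) * DT w $ 2 + DT w $ 3" for w
   have lam: "mu w = 0" if "w $ 3 = 0" for w
   proof -
    let ?t = "tvec p e w"
    have "?t : surface_tangent_plane M F p"
     unfolding surface_tangent_plane_def using tvec_tangent[OF ce(1)] tvec_chart[OF ce(1)] ce(1) e(2) that by auto
    then have "?t : ksi p" using tan[OF pn] by simp
    moreover have "?t = tvec p d (DT w)"
     using tangent_eq_tvec[OF ce(2) tvec_tangent[OF ce(1)]] ce(2) by (simp add: tvec_def DT_def)
    ultimately show ?thesis using plane by (simp add: mu_def)
   qed
   have linmu: "linear mu" unfolding mu_def using lin
    by (intro linearI) (simp_all add: linear_add linear_cmul algebra_simps)
   have split: "mu w = w $ 3 * mu (axis 3 1)" for w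
   proof -
    have "w = vec3 (w $ 1) (w $ 2) 0 + w $ 3 *\<^sub>R axis 3 1" by (simp add: vec_eq_iff forall_3 axis_def)
    then have "mu w = mu (vec3 (w $ 1) (w $ 2) 0) + w $ 3 * mu (axis 3 1)"
     using linear_add[OF linmu] linear_cmul[OF linmu] by (metis real_scaleR_def)
    then show ?thesis using lam by simp
   qed
   define w3 where "w3 = fd (transition d e) (cmap d p) (axis 3 1)"
   have "DT w3 = axis 3 1" unfolding DT_def w3_def
    using transition_chain[OF ce(2,1,2)] transition_same[OF ce(2)] by simp
   then have "mu w3 = 1" by (simp add: mu_def axis_def)
   then have "mu (axis 3 1) ~= 0" using split[of w3] by auto
   moreover have "mu v = 0" by (simp add: mu_def DTv axis_def)
   ultimately have v3: "v $ 3 = 0" using split[of v] by auto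
   define v' where "v' = (vector [v $ 1, v $ 2] :: real^2)"
   have jv: "j v' = v" using v3 by (simp add: j_def v'_def vec_eq_iff forall_3)
   have lj: "linear j" unfolding j_def by (rule linearI) (simp_all add: vec_eq_iff forall_3)
   have dj: "(j has_derivative j) (at u)"
    by (rule bounded_linear_imp_has_derivative) (simp add: linear_conv_bounded_linear[symmetric] lj)
   have dH: "(line_map H has_derivative fd (line_map H) (cmap d p)) (at (cmap d p))"
    by (rule Cinf_on_has_derivative[OF Cinf_on_line_map[OF H] yV])
   have d1: "((%u. ?T (j u)) has_derivative (%w. DT (j w))) (at u)"
    by (rule has_derivative_compose[OF dj]) (simp only: p(3) dT)
   have "(sig has_derivative (%w. fd (line_map H) (cmap d p) (DT (j w)))) (at u)"
    unfolding sig_def by (rule has_derivative_compose[OF d1]) (simp only: p(3) Tp dH)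
   moreover have "fd (line_map H) (cmap d p) (DT (j v')) = 0"
    unfolding jv DTv line_map_derivative[OF H yV] using N(2)[OF y] by (simp add: vec_eq_iff forall_3 axis_def)
   moreover have "v' ~= 0"
   proof
    assume "v' = 0"
    then have "v = 0" using jv linear_0[OF lj] by simp
    then have "axis 1 1 = (0 :: real^3)" using DTv linear_0[OF lin] by simp
    then show False by (simp add: axis_eq_0_iff)
   qed
   ultimately show ?thesis by blast
  qed
  ultimately show ?thesis unfolding degenerate_image_def by blast
 qed
 moreover have "line_map H ` N <= \<Union>(S ` \<F>)"
 proof
  fix x assume "x : line_map H ` N"
  then obtain y where y: "y : N" "x = line_map H y" by blast
  have "cinv d y : F" using non(1)[OF y(1)] NF by blast
  then obtain U where "U : \<F>" "cinv d y : U" using \<F>(3) by blast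
  then show "x : \<Union>(S ` \<F>)" using y unfolding S_def by blast
 qed
 ultimately show ?thesis unfolding thin_def using countable_finite[OF finite_imageI[OF \<F>(1), of S]] by blast
qed


text \<open>Towards both ends of a line the point leaves \<open>C\<close>, where the functions
  agree; monotonicity of \<open>H\<close> puts the wanted value between those two values.\<close>

lemma line_value_exists:
 assumes H: "Cinf_on (box a b) H" "!!x. x : box a b ==> pd 1 H x >= 0"
  and H': "Cinf_on (box a b) H'"
  and C: "compact C" "C <= box a b" "!!x. x : box a b - C ==> H x = H' x"
  and y: "y : box a b"
 obtains q where "q : box a b" "q $ 2 = y $ 2" "q $ 3 = y $ 3" "H' q = H y"
proof -
 have cC: "closed C" by (rule compact_imp_closed[OF C(1)])
 have ab: "a $ i < y $ i" "y $ i < b $ i" for i using y by (simp_all add: mem_box3)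
 have "on_line (a $ 1) y ~: box a b" "on_line (b $ 1) y ~: box a b" unfolding mem_box3 forall_3 by simp_all
 then have n: "on_line (a $ 1) y ~: C" "on_line (b $ 1) y ~: C" using C(2) by blast+
 have cl: "((%s. on_line s y) \<longlongrightarrow> on_line s0 y) (at s0)" for s0
  unfolding vec3_decomp by (intro tendsto_intros)
 have o: "open (- C)" using cC by (simp add: open_Compl)
 have out: "\<forall>\<^sub>F s in at s0 within S. on_line s y ~: C" if "on_line s0 y ~: C" for s0 S
  using topological_tendstoD[OF tendsto_within_subset[OF cl[of s0] subset_UNIV[of S]] o] that by simp
 have "\<forall>\<^sub>F s in at_right (a $ 1). on_line s y ~: C & s : {a $ 1<..<y $ 1}"
  by (rule eventually_conj[OF out[OF n(1)] eventually_at_right_real[OF ab(1)]])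
 from eventually_happens'[OF trivial_limit_at_right_real this]
 obtain l where l: "on_line l y ~: C" "a $ 1 < l" "l < y $ 1" by auto
 have "\<forall>\<^sub>F s in at_left (b $ 1). on_line s y ~: C & s : {y $ 1<..<b $ 1}"
  by (rule eventually_conj[OF out[OF n(2)] eventually_at_left_real[OF ab(2)]])
 from eventually_happens'[OF trivial_limit_at_left_real this]
 obtain r where r: "on_line r y ~: C" "y $ 1 < r" "r < b $ 1" by auto
 have inb: "on_line s y : box a b" if "l <= s" "s <= r" for s
  using that l r ab by (simp add: mem_box3 forall_3)
 have "\<exists>s. l <= s & s <= r & H' (on_line s y) = H y"
 proof (rule IVT')
  have "H (on_line l y) <= H y" "H y <= H (on_line r y)"
   using line_mono[OF H inb[of l] y] line_mono[OF H y inb[of r]] l r by simp_all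
  then show "H' (on_line l y) <= H y" "H y <= H' (on_line r y)"
   using C(3)[of "on_line l y"] C(3)[of "on_line r y"] inb[of l] inb[of r] l r by auto
  show "continuous_on {l..r} (%s. H' (on_line s y))"
   by (rule continuous_on_compose2[OF Cinf_on_continuous[OF H']])
    (use inb in \<open>auto intro!: continuous_on_vec3 continuous_intros\<close>)
 qed (use l r in simp)
 then obtain s where s: "l <= s" "s <= r" "H' (on_line s y) = H y" by blast
 show ?thesis by (rule that[OF inb[OF s(1,2)]]) (simp_all add: s(3))
qed

text \<open>By \<open>up\<close>, the new field is contact wherever the old one is and wherever
  \<open>H\<close> changes. Towards the new field targets are then automatically contact. Towards
  the old field the degenerate points of \<open>H\<close> in \<open>C\<close> are in the way; the
  disc is first put in general position in the coordinates \<open>(H', y, z)\<close>, where the new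
  field is \<open>dz + x dy\<close> and the obstacle is thin.\<close>

lemma overtwisted_box_step:
 assumes good: "integral_confoliation F ksi" and ksi': "smooth_field ksi'" "!!p. p : points M ==> conf_at ksi' p"
  and d: "d : atlas M" "cimage d = box a b"
  and R: "represents ksi d (box a b) (nf_covector H (%_. 0))" "represents ksi' d (box a b) (nf_covector H' (%_. 0))"
  and H: "Cinf_on (box a b) H" "Cinf_on (box a b) H'"
  and C: "compact C" "C <= box a b" "!!x. x : box a b - C ==> H x = H' x"
  and eq: "!!p. p : points M ==> p ~: cinv d ` C ==> ksi' p = ksi p"
  and up: "!!y. y : box a b ==> pd 1 H y > 0 \<or> H y ~= H' y ==> pd 1 H' y > 0"
 shows "overtwisted ksi \<longleftrightarrow> overtwisted ksi'"
proof -
 have ksi: "smooth_field ksi" "!!p. p : points M ==> conf_at ksi p" using good unfolding integral_confoliation_def by blast+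
 have cz: "Cinf_on (box a b) (%_. 0 :: real)" by (rule Cinf_on_const[OF open_box])
 have inv: "cinv d x : cdom d" "cmap d (cinv d x) = x" "cinv d x : points M" if "x : box a b" for x
 proof -
  have "x : cimage d" using that d(2) by simp
  then show "cinv d x : cdom d" "cmap d (cinv d x) = x" by (rule cinv_cdom, rule cmap_cinv)
  then show "cinv d x : points M" using cdom_subset[OF d(1)] by blast
 qed
 have nn: "pd 1 H x >= 0" "pd 1 H' x >= 0" if x: "x : box a b" for x
  using contact_at_nf(2)[OF R(1) H(1) cz inv(1)[OF x]] contact_at_nf(2)[OF R(2) H(2) cz inv(1)[OF x]]
   ksi(2) ksi'(2) inv[OF x] x by (simp_all add: nf_contact_0)
 have ct: "contact_at M ksi' p \<longleftrightarrow> pd 1 H' (cmap d p) > 0" if p: "p : cdom d" for p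
 proof -
  have "cmap d p : box a b" using p d(2) by blast
  then show ?thesis using contact_at_nf(1)[OF R(2) H(2) cz p] by (simp add: nf_contact_0)
 qed
 have uniq: "q = y" if "q : box a b" "y : box a b" "q $ 2 = y $ 2" "q $ 3 = y $ 3" "h q = h y" "pd 1 h y > 0"
  "Cinf_on (box a b) h" "!!x. x : box a b ==> pd 1 h x >= 0" for h q y
 proof -
  have "\<not> q $ 1 < y $ 1" using line_strict_mono[OF that(7,8,1,2)] that by auto
  moreover have "\<not> y $ 1 < q $ 1" using line_strict_mono[OF that(7,8,2,1)] that by auto
  ultimately show ?thesis using that(3,4) by (simp add: vec_eq_iff forall_3)
 qed
 show ?thesis
 proof
  assume "overtwisted ksi"
  then obtain f where f: "overtwisted_disc M ksi (noncontact ksi) f" unfolding overtwisted_def by blast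
  have "\<exists>f'. overtwisted_disc M ksi' (noncontact ksi') f'"
  proof (rule overtwisted_line_move[OF d ksi(1) ksi'(1) R H(1) nn(1) H(2) nn(2) C eq f])
   fix y assume y: "y : C" "y : cmap d ` (f ` sphere 0 1 Int cdom d)"
   then have yb: "y : box a b" using C(2) by blast
   obtain q where q: "q : box a b" "q $ 2 = y $ 2" "q $ 3 = y $ 3" "H' q = H y"
    by (rule line_value_exists[OF H(1) nn(1) H(2) C yb]; (assumption | rule that))
   obtain p where p: "p : f ` sphere 0 1" "p : cdom d" "y = cmap d p" using y(2) by blast
   have "p ~: noncontact ksi" using f p(1) unfolding overtwisted_disc_def by blast
   then have "contact_at M ksi p" using p(2) cdom_subset[OF d(1)] by (auto simp: noncontact_def)
   then have pos: "pd 1 H y > 0"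
    using contact_at_nf(1)[OF R(1) H(1) cz p(2)] p(3) yb by (simp add: nf_contact_0)
   \<comment> \<open>A target degenerate for \<open>H'\<close> would be degenerate for
     \<open>H\<close> and carry the same value of \<open>H\<close> as the contact point
     \<open>y\<close> of its line.\<close>
   have "pd 1 H' q > 0"
   proof (rule ccontr)
    assume n: "\<not> pd 1 H' q > 0"
    then have "H q = H' q" "\<not> pd 1 H q > 0" using up[OF q(1)] by blast+
    then show False using uniq[OF q(1) yb q(2,3) _ pos H(1) nn(1)] q(4) pos by auto
   qed
   then show "\<exists>q\<in>box a b. q $ 2 = y $ 2 & q $ 3 = y $ 3 & H' q = H y & pd 1 H' q > 0" using q by blast
  qed
  then show "overtwisted ksi'" unfolding overtwisted_def .
 next
  assume "overtwisted ksi'"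
  then obtain f where f: "overtwisted_disc M ksi' (noncontact ksi') f" unfolding overtwisted_def by blast
  define N where "N = C Int {y. pd 1 H y = 0}"
  have Nb: "N <= box a b" using C(2) unfolding N_def by blast
  have "closedin (top_of_set C) (C Int pd 1 H -` {0})"
   by (rule continuous_closedin_preimage[OF continuous_on_subset[OF Cinf_on_continuous[OF Cinf_on_derivative[OF H(1)]] C(2)]]) simp
  then have Nc: "compact N" using closedin_compact[OF C(1)] unfolding N_def vimage_def by simp
  define Lam where "Lam = line_map H ` N"
  have Lamc: "compact Lam" unfolding Lam_def
   by (rule compact_continuous_image[OF continuous_on_subset[OF Cinf_on_continuous[OF Cinf_on_line_map[OF H(1)]] Nb] Nc])
  have thin: "thin Lam" unfolding Lam_def
   by (rule thin_line_image[OF good d(1) R(1) H(1) Nb]) (simp add: N_def)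
  \<comment> \<open>Off \<open>C\<close> the functions agree, so a contact point there sharing its
    value of \<open>H\<close> with a degenerate point of its line would coincide with that point,
    which lies in \<open>C\<close>. Hence the curve meets \<open>Lam\<close> only through its part
    in \<open>C\<close>, and the intersection is compact.\<close>
  have bad: "y : C" if y: "y : box a b" "pd 1 H' y > 0" "line_map H' y : Lam" for y
  proof (rule ccontr)
   assume yC: "y ~: C"
   obtain q where q: "q : N" "line_map H' y = line_map H q" using y(3) unfolding Lam_def by blast
   have qe: "H q = H' y" "q $ 2 = y $ 2" "q $ 3 = y $ 3" using line_map_nth[of H q] line_map_nth[of H' y] q(2) by simp_all
   have o: "open (box a b - C)" using compact_imp_closed[OF C(1)] by (simp add: open_Diff open_box)
   have ybC: "y : box a b - C" using y(1) yC by blast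
   have "(H' has_derivative fd H y) (at y)"
    by (rule has_derivative_transform_within_open[OF Cinf_on_has_derivative[OF H(1) y(1)] o ybC]) (rule C(3))
   then have "fd H y = fd H' y" by (rule frechet_derivative_at)
   then have "pd 1 H y > 0" using y(2) by simp
   moreover have "H y = H' y" by (rule C(3)[OF ybC])
   moreover have "q : box a b" using q(1) Nb by blast
   ultimately have "q = y" using uniq[OF _ y(1) qe(2,3) _ _ H(1) nn(1)] qe(1) by simp
   then show False using q(1) yC unfolding N_def by blast
  qed
  \<comment> \<open>The contact part of the new field in the box, on which \<open>(H', y, z)\<close>
    are coordinates. The boundary of the disc stays in \<open>W\<close> whenever it is in the
    box.\<close>
  define W where "W = box a b Int pd 1 H' -` {0<..}"
  have oW: "open W" unfolding W_def
   by (rule continuous_open_preimage[OF Cinf_on_continuous[OF Cinf_on_derivative[OF H(2)]] open_box open_greaterThan])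
  have Wb: "W <= box a b" unfolding W_def by blast
  have Wp: "pd 1 H' x > 0" if "x : W" for x using that unfolding W_def by simp
  have LW: "Cinf_on W (line_map H')" by (rule Cinf_on_subset[OF Cinf_on_line_map[OF H(2)] oW Wb])
  have injW: "inj_on (line_map H') W" by (rule line_map_inj_on[OF H(2) nn(2) Wb Wp])
  have detW: "det (matrix (fd (line_map H') x)) > 0" if "x : W" for x
   using line_map_det[OF H(2)] that Wb Wp by (simp add: subset_iff)
  have detW0: "det (matrix (fd (line_map H') x)) ~= 0" if "x : W" for x using detW[OF that] by simp
  define e where "e = ({p : cdom d. cmap d p : W}, line_map H' o cmap d)"
  note re' = atlas_reparametrize[OF d(1) Wb[folded d(2)] LW injW detW, folded e_def]
  have re: "e : atlas M" "cimage e = line_map H' ` W" "!!y. y : line_map H' ` W ==> cinv e y = cinv d (inv_into W (line_map H') y)"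
   using re'(1,2,4) by simp_all
  let ?i = "inv_into W (line_map H')"
  have inv': "open (line_map H' ` W)" "Cinf_on (line_map H' ` W) ?i"
   using Cinf_on_inverse_real3[OF LW injW detW0] by simp_all
  have Re: "represents ksi' e (cimage e) (nf_covector (%p. p $ 1) (%_. 0))"
  proof -
   let ?A = "nf_covector H' (%_. 0)"
   have RW: "represents ksi' d W ?A" by (rule represents_subset[OF R(2) Wb oW])
   have set: "cmap e ` (cdom e Int cinv d ` W) = cimage e"
   proof -
    have "cdom e <= cinv d ` W" using chart_preimage_eq[OF d(1) Wb[folded d(2)]] unfolding e_def by auto
    then show ?thesis by (simp add: Int_absorb2)
   qed
   have "represents ksi' e (cimage e) (cov_pull (transition e d) ?A)"
    using represents_transport[OF RW re(1)] set by simp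
   then show ?thesis
   proof (rule represents_scale)
    show "Cinf_on (cimage e) (nf_covector (%p. p $ 1) (%_. 0))"
     using open_cimage[OF re(1)] by (intro Cinf_on_nf_covector smooth_intros)
    fix y assume y: "y : cimage e"
    then have yW: "y : line_map H' ` W" using re(2) by simp
    then obtain x where x: "x : W" "y = line_map H' x" by blast
    have tr: "transition e d z = ?i z" if z: "z : line_map H' ` W" for z
    proof -
     have "?i z : W" using z by (rule inv_into_into)
     then have "?i z : cimage d" using Wb d(2) by blast
     then show ?thesis using re(3)[OF z] cmap_cinv[of "?i z" d] by simp
    qed
    have iy: "?i y = x" unfolding x(2) by (rule inv_into_f_f[OF injW x(1)])
    let ?D = "fd (transition e d) y"
    have dT: "(transition e d has_derivative fd ?i y) (at y)"
     by (rule has_derivative_transform_within_open[OF Cinf_on_has_derivative[OF inv'(2) yW] inv'(1) yW]) (rule tr[symmetric])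
    then have D: "?D = fd ?i y" by (rule frechet_derivative_at[symmetric])
    have xb: "x : box a b" using x(1) Wb by blast
    have trx: "transition e d y = x" using tr[OF yW] iy by simp
    have dL: "(line_map H' has_derivative fd (line_map H') x) (at (transition e d y))"
     unfolding trx by (rule Cinf_on_has_derivative[OF LW x(1)])
    have "((%z. line_map H' (transition e d z)) has_derivative (%w. fd (line_map H') x (?D w))) (at y)"
     unfolding D by (rule has_derivative_compose[OF dT dL])
    moreover have "((%z. line_map H' (transition e d z)) has_derivative (%w. w)) (at y)"
     by (rule has_derivative_transform_within_open[OF has_derivative_ident inv'(1) yW])
      (subst tr, assumption, rule f_inv_into_f[symmetric], assumption)
    ultimately have "(%w. fd (line_map H') x (?D w)) = (%w. w)" by (rule has_derivative_unique)
    from fun_cong[OF this] have "on_line (fd H' x (?D w)) (?D w) = w" for w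
     unfolding line_map_derivative[OF H(2) xb] .
    then have "on_line (fd H' x (?D w)) (?D w) $ i = w $ i" for w i by (rule arg_cong)
    from this[of _ 2] this[of _ 3] have D23: "?D w $ 2 = w $ 2" "?D w $ 3 = w $ 3" for w by simp_all
    have "cov_pull (transition e d) ?A y = nf_covector (%p. p $ 1) (%_. 0) y"
     unfolding cov_pull_def nf_covector_inner trx D23 unfolding nf_covector_def x(2)
     by (simp add: vec_eq_iff forall_3 axis_def)
    then show "\<exists>r. r ~= 0 & cov_pull (transition e d) ?A y = r *\<^sub>R nf_covector (%p. p $ 1) (%_. 0) y"
     by (intro exI[of _ 1]) simp
   qed
  qed
  let ?K = "cmap e ` (f ` sphere 0 1 Int cdom e)"
  have sf: "smooth_into M unit_disc f" using f unfolding overtwisted_disc_def by blast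
  let ?KC = "C Int cmap d ` (f ` sphere 0 1 Int cdom d)"
  have KC: "compact ?KC" by (rule compact_disc_boundary_chart[OF sf d(1) C(1)]) (use C(2) d(2) in blast)
  have KW: "cmap d p : W" if "p : f ` sphere 0 1" "p : cdom d" for p
  proof -
   have "p ~: noncontact ksi'" using f that(1) unfolding overtwisted_disc_def by blast
   then have "contact_at M ksi' p" using that(2) cdom_subset[OF d(1)] by (auto simp: noncontact_def)
   moreover have "cmap d p : box a b" using that(2) d(2) by blast
   ultimately show ?thesis using ct[OF that(2)] unfolding W_def by simp
  qed
  have ecd: "p : cdom e \<longleftrightarrow> p : cdom d & cmap d p : W" "cmap e p = line_map H' (cmap d p)" for p
   unfolding e_def by simp_all
  have "?K Int Lam = line_map H' ` ?KC Int Lam"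
  proof (intro equalityI subsetI)
   fix z assume z: "z : ?K Int Lam"
   then obtain p where p: "p : f ` sphere 0 1" "p : cdom e" "z = cmap e p" by blast
   then have y: "cmap d p : W" "p : cdom d" "z = line_map H' (cmap d p)" using ecd by simp_all
   have "cmap d p : C" using bad[of "cmap d p"] y z Wp Wb by blast
   then show "z : line_map H' ` ?KC Int Lam" using p(1) y z by blast
  next
   fix z assume z: "z : line_map H' ` ?KC Int Lam"
   then obtain p where p: "p : f ` sphere 0 1" "p : cdom d" "z = line_map H' (cmap d p)" by blast
   then have "p : cdom e" "z = cmap e p" using ecd KW by simp_all
   then show "z : ?K Int Lam" using z p(1) by blast
  qed
  moreover have "compact (line_map H' ` ?KC Int Lam)"
  proof (rule compact_Int[OF compact_continuous_image[OF _ KC] Lamc])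
   show "continuous_on ?KC (line_map H')"
    by (rule continuous_on_subset[OF Cinf_on_continuous[OF Cinf_on_line_map[OF H(2)]]]) (use C(2) in blast)
  qed
  ultimately have B: "compact (?K Int Lam)" by simp
  obtain f' where f': "overtwisted_disc M ksi' (noncontact ksi') f'" "cmap e ` (f' ` sphere 0 1 Int cdom e) Int Lam = {}"
   using overtwisted_general_position[OF re(1) ksi'(1) Re f compact_imp_closed[OF Lamc] thin B] by blast
  have C': "H' x = H x" if "x : box a b - C" for x using C(3)[OF that] by simp
  have eq': "ksi p = ksi' p" if "p : points M" "p ~: cinv d ` C" for p using eq[OF that] by simp
  have "\<exists>f''. overtwisted_disc M ksi (noncontact ksi) f''"
  proof (rule overtwisted_line_move[OF d ksi'(1) ksi(1) R(2,1) H(2) nn(2) H(1) nn(1) C(1,2) C' eq' f'(1)])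
   fix y assume y: "y : C" "y : cmap d ` (f' ` sphere 0 1 Int cdom d)"
   then have yb: "y : box a b" using C(2) by blast
   obtain q where q: "q : box a b" "q $ 2 = y $ 2" "q $ 3 = y $ 3" "H q = H' y"
    by (rule line_value_exists[OF H(2) nn(2) H(1) C(1,2) C' yb]; (assumption | rule that))
   obtain p where p: "p : f' ` sphere 0 1" "p : cdom d" "y = cmap d p" using y(2) by blast
   have "p ~: noncontact ksi'" using f'(1) p(1) unfolding overtwisted_disc_def by blast
   then have "contact_at M ksi' p" using p(2) cdom_subset[OF d(1)] by (auto simp: noncontact_def)
   then have pos: "pd 1 H' y > 0" using ct[OF p(2)] p(3) by simp
   then have pe: "p : cdom e" "cmap e p = line_map H' y" using ecd p yb unfolding W_def by simp_all
   have "pd 1 H q > 0"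
   proof (rule ccontr)
    assume "\<not> pd 1 H q > 0"
    then have z: "pd 1 H q = 0" using nn(1)[OF q(1)] by simp
    have "q : C"
    proof (rule ccontr)
     assume "q ~: C"
     then have "H' q = H' y" using C(3)[of q] q by simp
     then have "q = y" by (rule uniq[OF q(1) yb q(2,3) _ pos H(2) nn(2)])
     then show False using y(1) \<open>q ~: C\<close> by simp
    qed
    then have "q : N" using z unfolding N_def by simp
    moreover have "line_map H q = line_map H' y" using q by (simp add: vec_eq_iff forall_3)
    ultimately have "line_map H' y : Lam" unfolding Lam_def by (metis imageI)
    then show False using f'(2) pe p(1) by (metis IntI disjoint_iff imageI)
   qed
   then show "\<exists>q\<in>box a b. q $ 2 = y $ 2 & q $ 3 = y $ 3 & H q = H' y & pd 1 H q > 0" using q by blast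
  qed
  then show "overtwisted ksi" unfolding overtwisted_def .
 qed
qed


text \<open>The two fields share the coefficient \<open>k\<close>, so one straightening of
  Legendrian curves brings both into the form treated by \<open>overtwisted_box_step\<close>.
  Degenerate points only disappear, and at those that remain the planes are unchanged.\<close>

lemma overtwisted_cube_step:
 assumes good: "integral_confoliation F ksi" and ksi': "smooth_field ksi'"
  and c: "c : atlas M" "cube 2 <= cimage c"
  and R: "represents ksi c (cube 2) (nf_covector h k)" "represents ksi' c (cube 2) (nf_covector h' k)"
  and sm: "Cinf_on (cube 2) h" "Cinf_on (cube 2) h'" "Cinf_on (cube 2) k"
  and k: "!!x. x : cube 2 ==> \<bar>k x\<bar> <= 1 / 8"
  and C: "compact C" "C <= ccube 1" "!!x. x : cube 2 - C ==> h x = h' x"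
  and eq: "!!p. p : points M ==> p ~: cinv c ` C ==> ksi' p = ksi p"
  and up: "!!x. x : cube 2 ==> nf_contact h k x > 0 \<or> h x ~= h' x ==> nf_contact h' k x > 0"
  and nn: "!!x. x : cube 2 ==> nf_contact h' k x >= 0"
 shows "overtwisted ksi \<longleftrightarrow> overtwisted ksi'" "integral_confoliation F ksi'" "noncontact ksi' <= noncontact ksi"
proof -
 have ksi: "smooth_field ksi" "!!p. p : points M ==> conf_at ksi p" "compact_smooth_surface M F" "noncontact ksi <= F"
  "!!p. p : noncontact ksi ==> ksi p = surface_tangent_plane M F p"
  using good unfolding integral_confoliation_def by blast+
 have "C <= cube 2" using C(2) unfolding subset_iff mem_cube mem_ccube by force
 then have Cc: "C <= cube 2" "C <= cimage c" using c(2) by blast+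
 have inv: "cinv c x : cdom c" "cmap c (cinv c x) = x" if "x : cube 2" for x
  using cinv_cdom[of x c] cmap_cinv[of x c] that c(2) by blast+
 let ?U = "points M - cinv c ` C"
 have oU: "openin (mtop M) ?U"
  using compactin_imp_closedin[OF Hausdorff_points compactin_cinv[OF c(1) C(1) Cc(2)]] by blast
 have off: "contact_at M ksi' p \<longleftrightarrow> contact_at M ksi p" "conf_at ksi' p \<longleftrightarrow> conf_at ksi p"
  if "p : points M" "p ~: cinv c ` C" for p
  using contact_at_local(1,2)[OF ksi(1) oU, of p ksi'] eq that by blast+
 have at: "contact_at M ksi (cinv c x) \<longleftrightarrow> nf_contact h k x > 0" "contact_at M ksi' (cinv c x) \<longleftrightarrow> nf_contact h' k x > 0"
  "conf_at ksi' (cinv c x)" if x: "x : cube 2" for x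
  using contact_at_nf[OF R(1) sm(1,3) inv(1)[OF x]] contact_at_nf[OF R(2) sm(2,3) inv(1)[OF x]] nn[OF x] inv(2)[OF x] x
  by simp_all
 have conf': "conf_at ksi' p" if "p : points M" for p
  using off(2)[OF that] at(3) ksi(2)[OF that] Cc(1) by (cases "p : cinv c ` C") auto
 have more: "contact_at M ksi' p" if p: "p : points M" "contact_at M ksi p" for p
 proof (cases "p : cinv c ` C")
  case True
  then obtain x where "x : cube 2" "p = cinv c x" using Cc(1) by blast
  then show ?thesis using at up p(2) by simp
 qed (use off(1) p in blast)
 then show sub: "noncontact ksi' <= noncontact ksi" unfolding noncontact_def by blast
 have same: "ksi' p = ksi p" if p: "p : noncontact ksi'" for p
 proof (cases "p : cinv c ` C")
  case True
  then obtain x where x: "x : cube 2" "p = cinv c x" using Cc(1) by blast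
  then have "h x = h' x" using at(2)[OF x(1)] up[OF x(1)] p unfolding noncontact_def by blast
  then show ?thesis
   using representsD(6)[OF R(1) x(1)] representsD(6)[OF R(2) x(1)] x(2) by (simp add: nf_covector_def)
 qed (use eq p in \<open>auto simp: noncontact_def\<close>)
 show "integral_confoliation F ksi'"
  unfolding integral_confoliation_def using ksi' conf' ksi(3,4,5) sub same by (metis (no_types) subset_iff)
 obtain d R' G where d: "d : atlas M" "cimage d = cube (3 / 2)" "!!y. y : cube (3 / 2) ==> R' y : cube 2 & cinv d y = cinv c (R' y)"
  "ccube 1 <= R' ` cube (3 / 2)" "Cinf_on UNIV R'"
  "!!ksi h. Cinf_on (cube 2) h ==> represents ksi c (cube 2) (nf_covector h k) ==>
   Cinf_on (cube (3 / 2)) (G h) & represents ksi d (cube (3 / 2)) (nf_covector (G h) (%_. 0))"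
  "!!h h' y. G h y = G h' y \<longleftrightarrow> h (R' y) = h' (R' y)"
  by (rule Legendrian_rectify[OF c sm(3) k]; (assumption | rule that))
 note G = d(6)[OF sm(1) R(1)] d(6)[OF sm(2) R(2)]
 have dinv: "cinv d y : cdom d" "cmap d (cinv d y) = y" if "y : cube (3 / 2)" for y
  using cinv_cdom[of y d] cmap_cinv[of y d] that d(2) by simp_all
 have Cd: "cinv c ` C <= cdom d"
 proof
  fix p assume "p : cinv c ` C"
  then obtain x where x: "x : C" "p = cinv c x" by blast
  then obtain y where "y : cube (3 / 2)" "x = R' y" using C(2) d(4) by blast
  then show "p : cdom d" using d(3) dinv(1) x(2) by metis
 qed
 let ?C = "cmap d ` (cinv c ` C)"
 have C1: "compact ?C" by (rule compact_cmap[OF d(1) compactin_cinv[OF c(1) C(1) Cc(2)] Cd])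
 have C2: "?C <= cube (3 / 2)" using Cd d(2) by blast
 have C3: "cinv d ` ?C = cinv c ` C"
 proof -
  have "cinv d (cmap d p) = p" if "p : cinv c ` C" for p using cinv_cmap[OF d(1)] Cd that by blast
  then have "(%p. cinv d (cmap d p)) ` (cinv c ` C) = (%p. p) ` (cinv c ` C)" by (rule image_cong[OF refl])
  then show ?thesis by (simp only: image_image[of "cinv d"] image_ident)
 qed
 have cz: "Cinf_on (cube (3 / 2)) (%_. 0 :: real)" by (rule Cinf_on_const[OF open_box])
 have atd: "pd 1 (G h) y > 0 \<longleftrightarrow> nf_contact h k (R' y) > 0" "pd 1 (G h') y > 0 \<longleftrightarrow> nf_contact h' k (R' y) > 0"
  if y: "y : cube (3 / 2)" for y
  using contact_at_nf(1)[OF conjunct2[OF G(1)] conjunct1[OF G(1)] cz dinv(1)[OF y]]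
   contact_at_nf(1)[OF conjunct2[OF G(2)] conjunct1[OF G(2)] cz dinv(1)[OF y]]
   dinv(2)[OF y] y d(3)[OF y] at by (simp_all add: nf_contact_0)
 show "overtwisted ksi \<longleftrightarrow> overtwisted ksi'"
 proof (rule overtwisted_box_step[OF good ksi' conf' d(1,2) conjunct2[OF G(1)] conjunct2[OF G(2)] conjunct1[OF G(1)] conjunct1[OF G(2)] C1 C2])
  show "G h y = G h' y" if y: "y : cube (3 / 2) - ?C" for y
  proof -
   have "R' y ~: C"
   proof
    assume "R' y : C"
    then have "cmap d (cinv d y) : ?C" using d(3)[of y] y by blast
    then show False using dinv(2)[of y] y by simp
   qed
   then show ?thesis using C(3)[of "R' y"] d(3)[of y] y d(7) by blast
  qed
  show "ksi' p = ksi p" if "p : points M" "p ~: cinv d ` ?C" for p using eq that C3 by simp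
  show "pd 1 (G h') y > 0" if y: "y : cube (3 / 2)" "pd 1 (G h) y > 0 \<or> G h y ~= G h' y" for y
   using atd[OF y(1)] y(2) d(7) up[of "R' y"] d(3)[OF y(1)] by blast
 qed
qed

section \<open>Families of plane fields\<close>

definition fam_rep :: "(real => 'a plane_field) => 'a chart => (real \<times> (real^3)) set => (real \<times> (real^3) => real^3) => bool" where
 "fam_rep zeta c W A \<longleftrightarrow> c : atlas M & Cinf_on W A & (\<forall>t x. (t, x) : W --> x : cimage c & A (t, x) ~= 0 &
  zeta t (cinv c x) = ker_at (cinv c x) c (A (t, x)))"

text \<open>Smoothness is demanded near the parameter 0 only: a family is treated as a germ, and
  statements about it hold for all sufficiently small parameters.\<close>

definition smooth_family :: "(real => 'a plane_field) => bool" where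
 "smooth_family zeta \<longleftrightarrow> (\<forall>p\<in>points M. \<exists>c W A. fam_rep zeta c W A & p : cdom c & (0, cmap c p) : W)"

lemma fam_rep_slice:
 assumes "fam_rep zeta c W A"
 shows "represents (zeta t) c {x. (t, x) : W} (%x. A (t, x))"
proof -
 have A: "Cinf_on W A" using assms unfolding fam_rep_def by blast
 have "open {x. (t, x) : W}"
  using open_vimage[OF Cinf_on_open[OF A], of "%x. (t, x)"] by (simp add: vimage_def continuous_on_Pair)
 then have "Cinf_on {x. (t, x) : W} (%x. A (t, x))" by (rule Cinf_on_slice[OF A]) simp
 then show ?thesis using assms unfolding fam_rep_def represents_def by blast
qed

lemma fam_rep_restrict: "fam_rep zeta c W A ==> open V ==> V <= W ==> fam_rep zeta c V A"
 unfolding fam_rep_def using Cinf_on_subset[of W A V] by blast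

text \<open>The tube lemma in the form in which compactness of \<open>M\<close>, or of a part of it,
  turns pointwise ranges of the parameter into a common one.\<close>

lemma compactin_uniform:
 assumes K: "compactin (mtop M) K"
  and P: "!!p. p : K ==> \<exists>e>0. \<exists>U. openin (mtop M) U & p : U & (\<forall>t q. \<bar>t\<bar> < e --> q : U --> P t q)"
 obtains e :: real where "e > 0" "!!t q. \<bar>t\<bar> < e ==> q : K ==> P t q"
proof -
 obtain e U where eU: "!!p. p : K ==> e p > (0 :: real)" "!!p. p : K ==> openin (mtop M) (U p)" "!!p. p : K ==> p : U p"
  "!!p t q. p : K ==> \<bar>t\<bar> < e p ==> q : U p ==> P t q"
  using P by metis
 have "\<exists>\<F>. finite \<F> & \<F> <= U ` K & K <= \<Union>\<F>"
  by (rule compactinD[OF K]) (use eU(2,3) in auto)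
 then obtain \<F> where \<F>: "finite \<F>" "\<F> <= U ` K" "K <= \<Union>\<F>" by blast
 obtain D where D: "D <= K" "finite D" "\<F> = U ` D" using finite_subset_image[OF \<F>(1,2)] by blast
 define m where "m = Min (insert 1 (e ` D))"
 have "m > 0" unfolding m_def using D eU(1) by (subst Min_gr_iff) auto
 moreover have "P t q" if t: "\<bar>t\<bar> < m" and q: "q : K" for t q
 proof -
  obtain p where p: "p : D" "q : U p" using \<F>(3) D(3) q by blast
  have "m <= e p" unfolding m_def using D(2) p(1) by (intro Min_le) auto
  then show ?thesis using eU(4)[of p t q] p D(1) t by auto
 qed
 ultimately show ?thesis using that by blast
qed

lemma chart_nbhd:
 assumes c: "c : atlas M" and W: "open (W :: (real \<times> (real^3)) set)" and p: "p : cdom c" "(0, cmap c p) : W"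
 shows "\<exists>e>0. \<exists>U. openin (mtop M) U & p : U & (\<forall>t q. \<bar>t\<bar> < e --> q : U --> q : cdom c & (t, cmap c q) : W)"
proof -
 obtain A B where AB: "open A" "open B" "0 : A" "cmap c p : B" "A \<times> B <= W"
  using open_prod_elim[OF W p(2)] by (metis mem_Sigma_iff)
 obtain e where e: "e > 0" "ball 0 e <= A" using AB(1,3) openE by blast
 have "openin (mtop M) {q : cdom c. cmap c q : B}" by (rule openin_chart_preimage[OF c AB(2)])
 moreover have "t : A" if "\<bar>t\<bar> < e" for t using e(2) that by (auto simp: subset_iff)
 ultimately show ?thesis using e(1) p(1) AB(4,5)
  by (intro exI[of _ e] conjI exI[of _ "{q : cdom c. cmap c q : B}"]) auto
qed

lemma smooth_family_smooth_field:
 assumes "smooth_family zeta"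
 obtains e where "e > 0" "!!t. \<bar>t\<bar> < e ==> smooth_field (zeta t)"
proof -
 let ?P = "%t q. \<exists>c V A. represents (zeta t) c V A & q : cdom c & cmap c q : V"
 have "\<exists>e>0. \<exists>U. openin (mtop M) U & p : U & (\<forall>t q. \<bar>t\<bar> < e --> q : U --> ?P t q)" if p: "p : points M" for p
 proof -
  obtain c W A where R: "fam_rep zeta c W A" and q: "p : cdom c" "(0, cmap c p) : W"
   using assms p unfolding smooth_family_def by blast
  have c: "c : atlas M" "open W" using R unfolding fam_rep_def by (blast, blast intro: Cinf_on_open)
  have "?P t q" if "q : cdom c" "(t, cmap c q) : W" for t q using fam_rep_slice[OF R] that by blast
  then show ?thesis using chart_nbhd[OF c q] by meson
 qed
 then obtain e where "e > 0" "!!t q. \<bar>t\<bar> < e ==> q : points M ==> ?P t q"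
  by (rule compactin_uniform[OF compact_points[unfolded compact_space_def], of ?P]) blast+
 then show ?thesis using that unfolding smooth_field_def by blast
qed

lemma fam_rep_contact:
 assumes R: "fam_rep zeta c W A"
 obtains kp :: "real \<times> (real^3) => real" where "continuous_on W kp" "!!t x. (t, x) : W ==> contact_at M (zeta t) (cinv c x) \<longleftrightarrow> kp (t, x) > 0"
proof -
 have A: "Cinf_on W A" using R unfolding fam_rep_def by blast
 define D where "D i tx = fd A tx (0, axis i 1)" for i :: 3 and tx
 have cD: "continuous_on W (D i)" for i unfolding D_def by (rule Cinf_on_continuous[OF Cinf_on_derivative[OF A]])
 define kp where "kp tx = A tx \<bullet> vec3 (D 2 tx $ 3 - D 3 tx $ 2) (D 3 tx $ 1 - D 1 tx $ 3) (D 1 tx $ 2 - D 2 tx $ 1)" for tx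
 show ?thesis
 proof (rule that[of kp])
  show "continuous_on W kp" unfolding kp_def
   by (intro continuous_intros continuous_on_vec3 cD Cinf_on_continuous[OF A])
  fix t x assume tx: "(t, x) : W"
  have xc: "x : cimage c" using R tx unfolding fam_rep_def by blast
  have "contact_coeff_vec (%x. A (t, x)) x = kp (t, x)"
   unfolding kp_def D_def by (rule contact_coeff_vec_eq[OF frechet_slice[OF A tx]])
  then show "contact_at M (zeta t) (cinv c x) \<longleftrightarrow> kp (t, x) > 0"
   using contact_at_represents[OF fam_rep_slice[OF R, of t] cinv_cdom[OF xc]] tx cmap_cinv[OF xc] by simp
 qed
qed

lemma contact_persists:
 assumes zeta: "smooth_family zeta" and K: "compactin (mtop M) K" "!!p. p : K ==> contact_at M (zeta 0) p"
 obtains e where "e > 0" "!!t p. \<bar>t\<bar> < e ==> p : K ==> contact_at M (zeta t) p"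
proof (rule compactin_uniform[OF K(1), of "%t p. contact_at M (zeta t) p"])
 fix p assume p: "p : K"
 have "p : points M" using compactin_subset_topspace[OF K(1)] p by blast
 then obtain c W A where R: "fam_rep zeta c W A" and q: "p : cdom c" "(0, cmap c p) : W"
  using zeta unfolding smooth_family_def by blast
 have c: "c : atlas M" "open W" using R unfolding fam_rep_def by (blast, blast intro: Cinf_on_open)
 obtain kp :: "real \<times> (real^3) => real" where kp: "continuous_on W kp" "!!t x. (t, x) : W ==> contact_at M (zeta t) (cinv c x) \<longleftrightarrow> kp (t, x) > 0"
  by (rule fam_rep_contact[OF R]; (assumption | rule that))
 have o: "open (W Int kp -` {0<..})" by (rule continuous_open_preimage[OF kp(1) c(2) open_greaterThan])
 have i: "(0, cmap c p) : W Int kp -` {0<..}" using kp(2)[OF q(2)] K(2)[OF p] q cinv_cmap[OF c(1) q(1)] by simp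
 have "contact_at M (zeta t) q" if "q : cdom c" "(t, cmap c q) : W Int kp -` {0<..}" for t q
  using kp(2)[of t "cmap c q"] that cinv_cmap[OF c(1) that(1)] by simp
 then show "\<exists>e>0. \<exists>U. openin (mtop M) U & p : U & (\<forall>t q. \<bar>t\<bar> < e --> q : U --> contact_at M (zeta t) q)"
  using chart_nbhd[OF c(1) o q(1) i] by meson
qed (use that in blast)

lemma fam_rep_transport:
 assumes zeta: "smooth_family zeta" and d: "d : atlas M" and p: "p : cdom d"
 obtains W A where "fam_rep zeta d W A" "(0, cmap d p) : W"
proof -
 have "p : points M" using cdom_subset[OF d] p by blast
 then obtain c W A where R: "fam_rep zeta c W A" and q: "p : cdom c" "(0, cmap c p) : W"
  using zeta unfolding smooth_family_def by blast
 have c: "c : atlas M" and A: "Cinf_on W A" using R unfolding fam_rep_def by blast+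
 let ?T = "transition d c" and ?O = "cmap d ` (cdom d Int cdom c)"
 have T: "Cinf_on ?O ?T" by (rule Cinf_on_transition[OF d c])
 have oO: "open ?O" by (rule Cinf_on_open[OF T])
 let ?U = "UNIV \<times> ?O :: (real \<times> (real^3)) set"
 have oU: "open ?U" by (intro open_Times oO open_UNIV)
 have T2: "Cinf_on ?U (%tx. ?T (snd tx))" by (rule Cinf_on_compose[OF _ T]) (auto intro!: smooth_intros oU)
 define g where "g tx = (fst tx, ?T (snd tx))" for tx :: "real \<times> (real^3)"
 have g: "Cinf_on ?U g" unfolding g_def by (intro smooth_intros T2 oU)
 define V where "V = ?U Int g -` W"
 have oV: "open V" unfolding V_def by (rule continuous_open_preimage[OF Cinf_on_continuous[OF g] oU Cinf_on_open[OF A]])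
 define B where "B tx = vec3 (A (g tx) \<bullet> fd ?T (snd tx) (axis 1 1))
  (A (g tx) \<bullet> fd ?T (snd tx) (axis 2 1)) (A (g tx) \<bullet> fd ?T (snd tx) (axis 3 1))" for tx
 have gV: "Cinf_on V g" by (rule Cinf_on_subset[OF g oV]) (simp add: V_def)
 have Ag: "Cinf_on V (%tx. A (g tx))" by (rule Cinf_on_compose[OF gV A]) (auto simp: V_def)
 have DT: "Cinf_on V (%tx. fd ?T (snd tx) w)" for w
  by (rule Cinf_on_compose[OF Cinf_on_snd[OF Cinf_on_ident[OF oV]] Cinf_on_derivative[OF T, of w]]) (auto simp: V_def)
 show ?thesis
 proof (rule that[of V B])
  show "(0, cmap d p) : V" unfolding V_def g_def using p q transition_cmap[OF d p] by auto
  show "fam_rep zeta d V B" unfolding fam_rep_def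
  proof (intro conjI allI impI)
   show "d : atlas M" by (rule d)
   show "Cinf_on V B" unfolding B_def by (intro smooth_intros Ag DT oV)
   fix t y assume ty: "(t, y) : V"
   then obtain r where r: "r : cdom d" "r : cdom c" "y = cmap d r" "(t, ?T y) : W" unfolding V_def g_def by auto
   have Ty: "?T y = cmap c r" using r(3) transition_cmap[OF d r(1)] by simp
   have "r : cinv c ` {x. (t, x) : W}" using r(4) cinv_cmap[OF c r(2)] unfolding Ty by force
   then have y: "y : cmap d ` (cdom d Int cinv c ` {x. (t, x) : W})" using r(1,3) by blast
   have "B (t, y) = cov_pull ?T (%x. A (t, x)) y" by (simp add: B_def cov_pull_def g_def)
   then show "y : cimage d" "B (t, y) ~= 0" "zeta t (cinv d y) = ker_at (cinv d y) d (B (t, y))"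
    using representsD(2,5,6)[OF represents_transport[OF fam_rep_slice[OF R, of t] d]] y by auto
  qed
 qed
qed


section \<open>Families close to a coordinate plane\<close>

lemma same_kernel_proportional:
 assumes c: "c : charts_at M p" and a: "a ~= 0"
  and eq: "ker_at p c a = ker_at p c b"
 obtains r where "b = r *\<^sub>R a"
proof -
 have "a \<bullet> w = 0 \<longleftrightarrow> b \<bullet> w = 0" for w
 proof -
  have "tvec p c w : ker_at p c a \<longleftrightarrow> tvec p c w : ker_at p c b"
   unfolding eq ..
  then show ?thesis using tvec_tangent[OF c] tvec_chart[OF c] by simp
 qed
 from covector_proportional(1)[OF this a] show ?thesis by (rule that)
qed

text \<open>In the coordinates of \<open>c\<close> the plane is transverse to the third axis and almost contains the first one.\<close>

definition cone :: "'a plane_field => 'a chart => real^3 => bool" where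
 "cone ksi c x \<longleftrightarrow> x : cimage c & (\<exists>a. \<bar>a $ 1\<bar> < \<bar>a $ 3\<bar> / 8 &
  ksi (cinv c x) = ker_at (cinv c x) c a)"

lemma cone_represents:
 assumes R: "represents ksi c V A" and x: "x : V"
 shows "cone ksi c x \<longleftrightarrow> \<bar>A x $ 1\<bar> < \<bar>A x $ 3\<bar> / 8"
proof
 note D = representsD[OF R]
 show "cone ksi c x" if "\<bar>A x $ 1\<bar> < \<bar>A x $ 3\<bar> / 8" using that D(2,6) x unfolding cone_def by blast
 assume "cone ksi c x"
 then obtain a where a: "\<bar>a $ 1\<bar> < \<bar>a $ 3\<bar> / 8" "ksi (cinv c x) = ker_at (cinv c x) c a"
  unfolding cone_def by blast
 obtain r where r: "a = r *\<^sub>R A x"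
  by (rule same_kernel_proportional[OF D(7)[OF x] D(5)[OF x], of a]) (use a(2) D(6)[OF x] that in auto)
 then have "\<bar>r\<bar> * \<bar>A x $ 1\<bar> < \<bar>r\<bar> * (\<bar>A x $ 3\<bar> / 8)" using a(1) by (simp add: abs_mult)
 then show "\<bar>A x $ 1\<bar> < \<bar>A x $ 3\<bar> / 8" by (rule mult_left_less_imp_less) simp
qed

text \<open>A plane transverse to the third axis has a unique covector with third component 1. Local
  defining covectors, divided by their third components, therefore agree where they overlap and give
  coefficients \<open>h\<close> and \<open>k\<close> on one open set around the whole of
  \<open>K\<close>.\<close>

lemma cone_family:
 assumes zeta: "smooth_family zeta" and c: "c : atlas M" and K: "compact K" "!!x. x : K ==> cone (zeta 0) c x"
 obtains e W h k where "e > 0" "!!t x. \<bar>t\<bar> < e ==> x : K ==> (t, x) : W" "Cinf_on W h" "Cinf_on W k"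
  "fam_rep zeta c W (%tx. vec3 (k tx) (h tx) 1)" "!!tx. tx : W ==> \<bar>k tx\<bar> < 1 / 8"
proof -
 define Q where "Q t x n \<longleftrightarrow> n $ 3 = 1 & zeta t (cinv c x) = ker_at (cinv c x) c n" for t x and n :: "real^3"
 define N where "N tx = (SOME n. Q (fst tx) (snd tx) n)" for tx
 have uniq: "n = m" if Qn: "x : cimage c" "Q t x n" "Q t x m" for t x n m
 proof -
  have n0: "n ~= 0" using Qn(2) by (auto simp: Q_def)
  note k = conjunct2[OF Qn(2)[unfolded Q_def]] conjunct2[OF Qn(3)[unfolded Q_def]]
  obtain r where "m = r *\<^sub>R n"
   by (rule same_kernel_proportional[OF cinv_charts_at[OF c Qn(1)] n0 trans[OF k(1)[symmetric] k(2)]], rule that)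
  then show ?thesis using conjunct1[OF Qn(2)[unfolded Q_def]] conjunct1[OF Qn(3)[unfolded Q_def]] by simp
 qed
 define P where "P V A \<longleftrightarrow> fam_rep zeta c V A & (\<forall>tx\<in>V. \<bar>A tx $ 1\<bar> < \<bar>A tx $ 3\<bar> / 8)" for V A
 define W where "W = \<Union>{V. \<exists>A. P V A}"
 have patch: "Q t x ((1 / A (t, x) $ 3) *\<^sub>R A (t, x))" "x : cimage c" "\<bar>((1 / A (t, x) $ 3) *\<^sub>R A (t, x)) $ 1\<bar> < 1 / 8"
  "A (t, x) $ 3 ~= 0" if "P V A" "(t, x) : V" for V A t x
 proof -
  have a: "\<bar>A (t, x) $ 1\<bar> < \<bar>A (t, x) $ 3\<bar> / 8" "x : cimage c"
   "zeta t (cinv c x) = ker_at (cinv c x) c (A (t, x))"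
   using that unfolding P_def fam_rep_def by blast+
  then show "A (t, x) $ 3 ~= 0" "x : cimage c" by auto
  then show "Q t x ((1 / A (t, x) $ 3) *\<^sub>R A (t, x))" using a(3) by (simp add: Q_def)
  show "\<bar>((1 / A (t, x) $ 3) *\<^sub>R A (t, x)) $ 1\<bar> < 1 / 8" using a(1) \<open>A (t, x) $ 3 ~= 0\<close>
   by (simp add: abs_mult field_simps)
 qed
 have N: "N (t, x) = (1 / A (t, x) $ 3) *\<^sub>R A (t, x)" if "P V A" "(t, x) : V" for V A t x
 proof -
  have "Q t x (N (t, x))" unfolding N_def using someI[of "Q t x", OF patch(1)[OF that]] by simp
  then show ?thesis using uniq[OF patch(2)[OF that]] patch(1)[OF that] by blast
 qed
 have oP: "open V" if "P V A" for V A using that unfolding P_def fam_rep_def by (blast intro: Cinf_on_open)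
 have oW: "open W" unfolding W_def using oP by blast
 have smN: "Cinf_on W N"
 proof (rule Cinf_on_local[OF oW])
  fix tx assume "tx : W"
  then obtain V A where V: "P V A" "tx : V" unfolding W_def by blast
  have A: "Cinf_on V A" using V(1) unfolding P_def fam_rep_def by blast
  have "Cinf_on V (%tx. (1 / A tx $ 3) *\<^sub>R A tx)"
   by (intro smooth_intros A oP[OF V(1)]) (use patch(4)[OF V(1)] in auto)
  then have "Cinf_on V N" by (rule Cinf_on_cong) (use N[OF V(1)] in auto)
  then show "\<exists>U. tx : U & Cinf_on U N" using V(2) by blast
 qed
 have onW: "Q t x (N (t, x))" "x : cimage c" "\<bar>N (t, x) $ 1\<bar> < 1 / 8" if "(t, x) : W" for t x
 proof -
  obtain V A where V: "P V A" "(t, x) : V" using \<open>(t, x) : W\<close> unfolding W_def by blast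
  show "Q t x (N (t, x))" "x : cimage c" "\<bar>N (t, x) $ 1\<bar> < 1 / 8"
   unfolding N[OF V] using patch[OF V] by simp_all
 qed
 have "(0, x) : W" if x: "x : K" for x
 proof -
  have xc: "x : cimage c" using K(2)[OF x] unfolding cone_def by blast
  obtain V A where R: "fam_rep zeta c V A" "(0, cmap c (cinv c x)) : V"
   by (rule fam_rep_transport[OF zeta c cinv_cdom[OF xc]])
  then have xV: "(0, x) : V" using cmap_cinv[OF xc] by simp
  have A: "Cinf_on V A" using R(1) unfolding fam_rep_def by blast
  let ?V = "V Int (%tx. \<bar>A tx $ 3\<bar> / 8 - \<bar>A tx $ 1\<bar>) -` {0<..}"
  have "open ?V" by (intro continuous_open_preimage Cinf_on_open[OF A] open_greaterThan continuous_intros Cinf_on_continuous[OF A]) simp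
  then have "fam_rep zeta c ?V A" by (rule fam_rep_restrict[OF R(1)]) blast
  then have "P ?V A" unfolding P_def by auto
  moreover have "(0, x) : ?V" using cone_represents[OF fam_rep_slice[OF R(1), of 0]] K(2)[OF x] xV by simp
  ultimately show ?thesis unfolding W_def by blast
 qed
 from tube_uniform[OF K(1) oW this]
 obtain e where e: "e > 0" "!!t x. dist t 0 < e ==> x : K ==> (t, x) : W" by blast
 have vN: "vec3 (N tx $ 1) (N tx $ 2) 1 = N tx" if "tx : W" for tx
  using onW(1)[of "fst tx" "snd tx"] that by (simp add: Q_def vec_eq_iff forall_3)
 show ?thesis
 proof (rule that[OF e(1), of W "%tx. N tx $ 2" "%tx. N tx $ 1"])
  show "(t, x) : W" if "\<bar>t\<bar> < e" "x : K" for t x using e(2) that by simp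
  show sm: "Cinf_on W (%tx. N tx $ 2)" "Cinf_on W (%tx. N tx $ 1)" by (intro smooth_intros smN)+
  show "\<bar>N tx $ 1\<bar> < 1 / 8" if "tx : W" for tx using onW(3)[of "fst tx" "snd tx"] that by simp
  have "Cinf_on W (%tx. vec3 (N tx $ 1) (N tx $ 2) 1)" by (rule Cinf_on_cong[OF smN]) (simp add: vN)
  then show "fam_rep zeta c W (%tx. vec3 (N tx $ 1) (N tx $ 2) 1)"
   unfolding fam_rep_def
  proof (intro conjI allI impI)
   fix t x assume tx: "(t, x) : W"
   show "x : cimage c" by (rule onW(2)[OF tx])
   show "vec3 (N (t, x) $ 1) (N (t, x) $ 2) 1 ~= 0" by (simp add: vec_eq_iff forall_3)
   show "zeta t (cinv c x) = ker_at (cinv c x) c (vec3 (N (t, x) $ 1) (N (t, x) $ 2) 1)"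
    unfolding vN[OF tx] by (rule conjunct2[OF onW(1)[OF tx, unfolded Q_def]])
  qed (use c in simp)
 qed
qed

lemma cone_persists:
 assumes "smooth_family zeta" "c : atlas M" "compact K" "!!x. x : K ==> cone (zeta 0) c x"
 obtains e where "e > 0" "!!t x. \<bar>t\<bar> < e ==> x : K ==> cone (zeta t) c x"
proof -
 obtain e W h k where W: "e > 0" "!!t x. \<bar>t\<bar> < e ==> x : K ==> (t, x) : W" "Cinf_on W h" "Cinf_on W k"
  "fam_rep zeta c W (%tx. vec3 (k tx) (h tx) 1)" "!!tx. tx : W ==> \<bar>k tx\<bar> < 1 / 8"
  by (rule cone_family[OF assms]; (assumption | rule that))
 have "cone (zeta t) c x" if "(t, x) : W" for t x
  using cone_represents[OF fam_rep_slice[OF W(5), of t]] that W(6)[OF that] by simp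
 then show ?thesis using that W(1,2) by blast
qed

lemma fam_rep_const:
 assumes R: "fam_rep zeta c W A"
 shows "fam_rep (%_. zeta 0) c (UNIV \<times> {x. (0, x) : W}) (%tx. A (0, snd tx))"
proof -
 note S = fam_rep_slice[OF R, of 0]
 have o: "open (UNIV \<times> {x. (0, x) : W} :: (real \<times> (real^3)) set)"
  by (intro open_Times open_UNIV representsD(4)[OF S])
 have "Cinf_on (UNIV \<times> {x. (0, x) : W}) (%tx. A (0, snd (tx :: real \<times> (real^3))))"
  by (rule Cinf_on_compose[OF Cinf_on_snd[OF Cinf_on_ident[OF o]] representsD(3)[OF S]]) auto
 then show ?thesis using R unfolding fam_rep_def by auto
qed

lemma smooth_family_const:
 assumes "smooth_family zeta"
 shows "smooth_family (%_. zeta 0)"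
 unfolding smooth_family_def
proof
 fix p assume "p : points M"
 then obtain c W A where R: "fam_rep zeta c W A" and q: "p : cdom c" "(0, cmap c p) : W"
  using assms unfolding smooth_family_def by blast
 show "\<exists>c W A. fam_rep (%_. zeta 0) c W A & p : cdom c & (0, cmap c p) : W"
  using fam_rep_const[OF R] q by blast
qed

definition perturb :: "'a chart => (real^3) set => (real \<times> (real^3) => real^3) => (real => 'a plane_field) => real => 'a plane_field" where
 "perturb c C B zeta t p = (if p : cinv c ` C then ker_at p c (B (t, cmap c p)) else zeta t p)"

text \<open>Off \<open>C\<close> the covectors \<open>B\<close> and \<open>A\<close> agree, so
  \<open>B\<close> describes the new family on the whole chart region \<open>W\<close>; away from
  the closed set carried by \<open>C\<close> the old descriptions remain valid. The two open regions
  cover \<open>M\<close>.\<close>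

lemma perturb_family:
 assumes zeta: "smooth_family zeta" and R: "fam_rep zeta c W A" and C: "compact C" "C <= cimage c" "!!x. x : C ==> (0, x) : W"
  and B: "Cinf_on W B" "!!tx. tx : W ==> B tx ~= 0" "!!t x. (t, x) : W ==> x ~: C ==> B (t, x) = A (t, x)"
 shows "fam_rep (perturb c C B zeta) c W B" "smooth_family (perturb c C B zeta)"
proof -
 let ?zeta = "perturb c C B zeta"
 have c: "c : atlas M" using R unfolding fam_rep_def by blast
 have inC: "cinv c x : cinv c ` C \<longleftrightarrow> x : C" if x: "x : cimage c" for x
 proof
  assume "cinv c x : cinv c ` C"
  then obtain y where y: "y : C" "cinv c x = cinv c y" by blast
  have "y : cimage c" using y(1) C(2) by (rule subsetD[rotated])
  then have "y = x" using arg_cong[OF y(2), of "cmap c"] cmap_cinv[OF x] cmap_cinv[of y c] by simp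
  then show "x : C" using y(1) by simp
 qed (rule imageI)
 show R': "fam_rep ?zeta c W B" unfolding fam_rep_def
 proof (intro conjI allI impI)
  fix t x assume tx: "(t, x) : W"
  then have x: "x : cimage c" "zeta t (cinv c x) = ker_at (cinv c x) c (A (t, x))"
   using R unfolding fam_rep_def by blast+
  show "x : cimage c" "B (t, x) ~= 0" using x(1) B(2)[OF tx] .
  show "?zeta t (cinv c x) = ker_at (cinv c x) c (B (t, x))"
   using B(3)[OF tx] x(2) cmap_cinv[OF x(1)] inC[OF x(1)] by (cases "x : C") (simp_all add: perturb_def)
 qed (rule c B(1))+
 show "smooth_family ?zeta" unfolding smooth_family_def
 proof
  fix p assume p: "p : points M"
  show "\<exists>d V A. fam_rep ?zeta d V A & p : cdom d & (0, cmap d p) : V"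
  proof (cases "p : cinv c ` C")
   case True
   then obtain x where x: "x : C" "p = cinv c x" by blast
   have xc: "x : cimage c" using x(1) C(2) by blast
   have "p : cdom c" "(0, cmap c p) : W" using C(3)[OF x(1)] cinv_cdom[OF xc] cmap_cinv[OF xc] x(2) by simp_all
   then show ?thesis using R' by blast
  next
   case False
   obtain d V D where D: "fam_rep zeta d V D" and q: "p : cdom d" "(0, cmap d p) : V"
    using zeta p unfolding smooth_family_def by blast
   have d: "d : atlas M" "open V" using D unfolding fam_rep_def by (blast, blast intro: Cinf_on_open)
   have oU: "openin (mtop M) (points M - cinv c ` C)"
    using compactin_imp_closedin[OF Hausdorff_points compactin_cinv[OF c C(1,2)]] by blast
   let ?Y = "cmap d ` (cdom d Int (points M - cinv c ` C))"
   let ?V = "V Int UNIV \<times> ?Y"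
   have "open ?V" using open_cmap_image[OF d(1) oU] d(2) by (intro open_Int open_Times) auto
   then have "fam_rep zeta d ?V D" by (rule fam_rep_restrict[OF D]) blast
   moreover have "?zeta t (cinv d x) = zeta t (cinv d x)" if "x : ?Y" for t x
   proof -
    obtain r where "r : cdom d" "r ~: cinv c ` C" "x = cmap d r" using \<open>x : ?Y\<close> by blast
    then show ?thesis using cinv_cmap[OF d(1)] by (simp add: perturb_def)
   qed
   ultimately have "fam_rep ?zeta d ?V D" unfolding fam_rep_def by auto
   moreover have "(0, cmap d p) : ?V" using q p False by blast
   ultimately show ?thesis using q(1) by blast
  qed
 qed
qed

section \<open>Comparison of families for small parameters\<close>

text \<open>The surfaces \<open>F t\<close> may depend on the parameter in an arbitrary way; they
  serve only to confine the degenerate points of the plane field with the same parameter.\<close>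

definition admissible :: "(real => 'a set) => (real => 'a plane_field) => bool" where
 "admissible F zeta \<longleftrightarrow> smooth_family zeta & (\<exists>e>0. \<forall>t. \<bar>t\<bar> < e --> integral_confoliation (F t) (zeta t))"

text \<open>The comparison is made parameter by parameter, so it relates two families without yet
  saying that overtwistedness is constant along either.\<close>

definition equivalent :: "(real => 'a plane_field) => (real => 'a plane_field) => bool" where
 "equivalent zeta zeta' \<longleftrightarrow> (\<exists>e>0. \<forall>t. \<bar>t\<bar> < e --> overtwisted (zeta t) \<longleftrightarrow> overtwisted (zeta' t))"

lemma equivalent_trans: "equivalent zeta zeta' ==> equivalent zeta' zeta'' ==> equivalent zeta zeta''"
 unfolding equivalent_def by (metis min_less_iff_conj)

abbreviation slice_contact :: "(real \<times> (real^3) => real) => (real \<times> (real^3) => real) => real => real^3 => real" where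
 "slice_contact h k t x == nf_contact (%x. h (t, x)) (%x. k (t, x)) x"

text \<open>One chart, one cube and one support \<open>C\<close> serve all small parameters, and for
  each of them \<open>overtwisted_cube_step\<close> compares the plane field with its own
  perturbation.\<close>

lemma family_cube_step:
 assumes ad: "admissible F zeta" and c: "c : atlas M" and e: "e > 0" "!!t x. \<bar>t\<bar> < e ==> x : ccube 2 ==> (t, x) : W"
  and hk: "Cinf_on W h" "Cinf_on W k" "fam_rep zeta c W (%tx. vec3 (k tx) (h tx) 1)" "!!tx. tx : W ==> \<bar>k tx\<bar> < 1 / 8"
  and g: "Cinf_on W g" and C: "compact C" "C <= ccube 1" "!!t x. (t, x) : W ==> x ~: C ==> g (t, x) = h (t, x)"
  and e1: "e1 > 0" and up: "!!t x. \<bar>t\<bar> < e1 ==> x : cube 2 ==>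
   slice_contact h k t x >= 0 ==>
   slice_contact g k t x >= 0 &
   (slice_contact h k t x > 0 \<or> h (t, x) ~= g (t, x) --> slice_contact g k t x > 0)"
 defines "zeta' == perturb c C (%tx. vec3 (k tx) (g tx) 1) zeta"
 shows "admissible F zeta'" "equivalent zeta zeta'" "\<exists>e>0. \<forall>t. \<bar>t\<bar> < e --> noncontact (zeta' t) <= noncontact (zeta t)"
proof -
 have oW: "open W" by (rule Cinf_on_open[OF hk(1)])
 have ccc: "ccube 1 <= ccube 2" "cube 2 <= ccube 2" unfolding subset_iff mem_ccube mem_cube by auto
 have Wc: "x : cimage c" if "(t, x) : W" for t x using hk(3) that unfolding fam_rep_def by blast
 have im: "ccube 2 <= cimage c" by (rule subsetI, rule Wc[of 0], rule e(2)) (simp_all add: e(1) del: mem_box)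
 have C2: "C <= ccube 2" using C(2) ccc(1) by (rule subset_trans)
 have Cc: "C <= cimage c" using C2 im by (rule subset_trans)
 have C0: "(0, x) : W" if "x : C" for x using e(2)[of 0 x] e(1) subsetD[OF C2 that] by simp
 have sf: "smooth_family zeta" using ad unfolding admissible_def by blast
 have n0: "vec3 a b 1 ~= 0" for a b :: real by (simp add: vec_eq_iff forall_3)
 note pf = perturb_family[OF sf hk(3) C(1) Cc C0, of "%tx. vec3 (k tx) (g tx) 1", folded zeta'_def]
 have smB: "Cinf_on W (%tx. vec3 (k tx) (g tx) 1)" by (intro smooth_intros hk(2) g oW)
 have pf: "fam_rep zeta' c W (%tx. vec3 (k tx) (g tx) 1)" "smooth_family zeta'"
  by (rule pf; use smB n0 C(3) in simp)+
 obtain e2 where e2: "e2 > 0" "!!t. \<bar>t\<bar> < e2 ==> smooth_field (zeta' t)" by (rule smooth_family_smooth_field[OF pf(2)]; (assumption | rule that))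
 obtain e3 where e3: "e3 > 0" "!!t. \<bar>t\<bar> < e3 ==> integral_confoliation (F t) (zeta t)" using ad unfolding admissible_def by blast
 define m where "m = Min {e, e1, e2, e3}"
 have m: "m > 0" "m <= e" "m <= e1" "m <= e2" "m <= e3" unfolding m_def using e(1) e1 e2(1) e3(1) by auto
 have step: "overtwisted (zeta t) \<longleftrightarrow> overtwisted (zeta' t)" "integral_confoliation (F t) (zeta' t)" "noncontact (zeta' t) <= noncontact (zeta t)"
  if t: "\<bar>t\<bar> < m" for t
 proof -
  have good: "integral_confoliation (F t) (zeta t)" and sm': "smooth_field (zeta' t)" using e2(2) e3(2) t m by auto
  have sl: "x : cube 2 ==> (t, x) : W" for x using e(2)[of t x] t m(2) ccc(2) by auto
  have ca: "cube 2 <= cimage c" using im ccc(2) by blast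
  have sub: "cube 2 <= {x. (t, x) : W}" using sl by blast
  have R1: "represents (zeta t) c (cube 2) (nf_covector (%x. h (t, x)) (%x. k (t, x)))"
   using represents_subset[OF fam_rep_slice[OF hk(3)] sub open_box] unfolding nf_covector_def[abs_def] .
  have R2: "represents (zeta' t) c (cube 2) (nf_covector (%x. g (t, x)) (%x. k (t, x)))"
   using represents_subset[OF fam_rep_slice[OF pf(1)] sub open_box] unfolding nf_covector_def[abs_def] .
  note smo = Cinf_on_slice[OF hk(1) open_box sl] Cinf_on_slice[OF g open_box sl] Cinf_on_slice[OF hk(2) open_box sl]
  have kap: "slice_contact h k t x >= 0" if x: "x : cube 2" for x
  proof -
   have xc: "x : cimage c" using x ca by blast
   have "cinv c x : points M" by (rule subsetD[OF cdom_subset[OF c] cinv_cdom[OF xc]])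
   then have "conf_at (zeta t) (cinv c x)" using good unfolding integral_confoliation_def by blast
   then show ?thesis using contact_at_nf(2)[OF R1 smo(1,3) cinv_cdom[OF xc]] cmap_cinv[OF xc] x by simp
  qed
  have up': "slice_contact g k t x >= 0 &
   (slice_contact h k t x > 0 \<or> h (t, x) ~= g (t, x) --> slice_contact g k t x > 0)"
   if x: "x : cube 2" for x using up[OF _ x kap[OF x]] t m(3) by simp
  have kb: "\<bar>k (t, x)\<bar> <= 1 / 8" if "x : cube 2" for x using hk(4)[OF sl[OF that]] by simp
  have hg: "h (t, x) = g (t, x)" if "x : cube 2 - C" for x using C(3)[of t x] sl that by simp
  have eq: "zeta' t p = zeta t p" if "p ~: cinv c ` C" for p using that unfolding zeta'_def perturb_def by simp
  have U: "slice_contact g k t x > 0"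
   if "x : cube 2" "slice_contact h k t x > 0 \<or> h (t, x) ~= g (t, x)" for x
   using conjunct2[OF up'[OF that(1)]] that(2) by (rule mp)
  have Nn: "slice_contact g k t x >= 0" if "x : cube 2" for x by (rule conjunct1[OF up'[OF that]])
  note cs = overtwisted_cube_step[OF good sm' c ca R1 R2 smo kb C(1,2) hg eq U Nn]
  show "overtwisted (zeta t) \<longleftrightarrow> overtwisted (zeta' t)" by (rule cs(1))
  show "integral_confoliation (F t) (zeta' t)" by (rule cs(2))
  show "noncontact (zeta' t) <= noncontact (zeta t)" by (rule cs(3))
 qed
 show "admissible F zeta'" "equivalent zeta zeta'" "\<exists>e>0. \<forall>t. \<bar>t\<bar> < e --> noncontact (zeta' t) <= noncontact (zeta t)"
  unfolding admissible_def equivalent_def using pf(2) m(1) step by blast+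
qed

end

section \<open>Pushing contactness along the integral surface\<close>

text \<open>The solid paraboloid \<open>x >= y^2 + z^2\<close>, cut at \<open>x = 1\<close>. An
  x-line that enters it leaves through the flat end only, so a bump can grow along the line until
  the exit.\<close>

definition nose_arg :: "real^3 => real" where "nose_arg x = x $ 1 - (x $ 2)\<^sup>2 - (x $ 3)\<^sup>2"
definition nose_exit :: "real => (real^3) set" where "nose_exit eta = {x. nose_arg x >= 0 & 1 - eta <= x $ 1 & x $ 1 <= 1}"
definition nose_core :: "real => (real^3) set" where "nose_core eta = {x. nose_arg x > 0 & x $ 1 < 1 - eta}"
definition nose_body :: "(real^3) set" where "nose_body = {x. nose_arg x >= 0 & x $ 1 <= 1}"

text \<open>The logarithmic derivative of \<open>flat (u / n)\<close> is \<open>n / u^2\<close>, at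
  least \<open>n\<close> for \<open>0 < u <= 1\<close>: a large \<open>n\<close> makes the bump
  steep in relation to its own size. The step function switches it off in the exit.\<close>

definition nose_bump :: "real => real => real^3 => real" where
 "nose_bump eta n x = flat (nose_arg x / n) * smooth_step ((1 - x $ 1) / eta)"

lemma nose_body_bounds:
 assumes "x : nose_body"
 shows "0 <= x $ 1" "x $ 1 <= 1" "\<bar>x $ 2\<bar> <= 1" "\<bar>x $ 3\<bar> <= 1"
proof -
 have "0 <= x $ 1 - (x $ 2)\<^sup>2 - (x $ 3)\<^sup>2" "x $ 1 <= 1" using assms unfolding nose_body_def nose_arg_def by auto
 then have "0 <= x $ 1" "x $ 1 <= 1" "(x $ 2)\<^sup>2 <= 1" "(x $ 3)\<^sup>2 <= 1"
  using zero_le_power2[of "x $ 2"] zero_le_power2[of "x $ 3"] by linarith+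
 then show "0 <= x $ 1" "x $ 1 <= 1" "\<bar>x $ 2\<bar> <= 1" "\<bar>x $ 3\<bar> <= 1" by (simp_all add: abs_square_le_1)
qed

lemma nose_body_ccube: "nose_body <= ccube 1"
 using nose_body_bounds unfolding subset_iff mem_ccube by auto

lemma continuous_nose_arg: "continuous_on S nose_arg"
 unfolding nose_arg_def by (intro continuous_intros)

lemma compact_nose_body: "compact nose_body" "compact (nose_exit eta)"
proof -
 have c: "closed {x. nose_arg x >= 0}" "closed {x :: real^3. x $ 1 <= 1}" "closed {x :: real^3. 1 - eta <= x $ 1}"
  by (intro closed_Collect_le continuous_intros continuous_nose_arg)+
 have "closed nose_body" "closed (nose_exit eta)"
  unfolding nose_body_def nose_exit_def using c by (auto intro!: closed_Collect_conj)
 moreover have "nose_exit eta <= nose_body" unfolding nose_body_def nose_exit_def by auto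
 then have "bounded nose_body" "bounded (nose_exit eta)"
  using bounded_subset[OF bounded_cbox nose_body_ccube] bounded_subset[OF bounded_cbox order_trans[OF _ nose_body_ccube]] by auto
 ultimately show "compact nose_body" "compact (nose_exit eta)" by (simp_all add: compact_eq_bounded_closed)
qed

lemma open_nose_core: "open (nose_core eta)"
 unfolding nose_core_def
 by (intro open_Collect_conj open_Collect_less continuous_nose_arg continuous_intros)

lemma nose_exit_subset: "nose_exit eta <= nose_body"
 unfolding nose_body_def nose_exit_def by auto

lemma Cinf_on_nose_bump: "eta > 0 ==> n > 0 ==> Cinf_on UNIV (nose_bump eta n)"
 unfolding nose_bump_def[abs_def] nose_arg_def by (intro smooth_intros) auto

lemma nose_bump_outside:
 assumes "n > 0" "eta > 0" "x ~: nose_body"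
 shows "nose_bump eta n x = 0"
proof (cases "nose_arg x >= 0")
 case True
 then have "(1 - x $ 1) / eta <= 0" using assms unfolding nose_body_def by (simp add: divide_nonpos_pos)
 then show ?thesis by (simp add: nose_bump_def smooth_step_0)
next
 case False
 then have "nose_arg x / n <= 0" using assms(1) by (simp add: divide_nonpos_pos)
 then show ?thesis by (simp add: nose_bump_def flat_0)
qed

text \<open>The flat function satisfies \<open>f' >= n f\<close> on the nose, which beats the zeroth order term \<open>b f\<close>.\<close>

lemma nose_bump_increase:
 fixes x :: "real^3"
 assumes eta: "eta > 0" and n: "n > 0" "n >= 2 * B + 1" and x: "x $ 1 < 1 - eta" and k: "\<bar>k\<bar> <= 1 / 8" and b: "\<bar>b\<bar> <= B"
 defines "L == pd 1 (nose_bump eta n) x - k * pd 3 (nose_bump eta n) x + b * nose_bump eta n x"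
 shows "L >= 0" "nose_arg x > 0 ==> L > 0" "nose_bump eta n x ~= 0 ==> nose_arg x > 0"
proof -
 let ?y = "nose_arg x / n" and ?H = "{x :: real^3. x $ 1 < 1 - eta}"
 define f' where "f' = (if ?y > 0 then flat ?y / ?y\<^sup>2 else 0)"
 have o: "open ?H" by (intro open_Collect_less continuous_intros)
 have eq: "nose_bump eta n x = flat (nose_arg x / n)" if "x $ 1 < 1 - eta" for x :: "real^3"
 proof -
  have "(1 - x $ 1) / eta >= 1" using that eta by simp
  then show ?thesis by (simp add: nose_bump_def smooth_step_1)
 qed
 have vn: "((%w. w $ i) has_derivative (%w. w $ i)) (at x)" for i :: 3
  by (rule bounded_linear_imp_has_derivative[OF bounded_linear_vec_nth])
 have "((%x. nose_arg x / n) has_derivative (%w. (w $ 1 - 2 * x $ 2 * w $ 2 - 2 * x $ 3 * w $ 3) / n)) (at x)"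
  unfolding nose_arg_def using n(1) by (auto intro!: derivative_eq_intros vn simp: power2_eq_square)
 from has_derivative_compose[OF this flat_has_derivative[of ?y, folded f'_def, unfolded has_field_derivative_def]]
 have "((%x. flat (nose_arg x / n)) has_derivative (%w. f' * ((w $ 1 - 2 * x $ 2 * w $ 2 - 2 * x $ 3 * w $ 3) / n))) (at x)" .
 then have "(nose_bump eta n has_derivative (%w. f' * ((w $ 1 - 2 * x $ 2 * w $ 2 - 2 * x $ 3 * w $ 3) / n))) (at x)"
  by (rule has_derivative_transform_within_open[OF _ o]) (use x eq in auto)
 note fd = fun_cong[OF frechet_derivative_at[OF this], symmetric]
 have "L = f' * (1 / n) - k * (f' * (- 2 * x $ 3 / n)) + b * flat ?y"
  unfolding L_def fd eq[OF x] by (simp add: axis_def)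
 then have L: "L = f' / n * (1 + 2 * k * x $ 3) + b * flat ?y" by (simp add: algebra_simps add_divide_distrib)
 show "nose_bump eta n x ~= 0 ==> nose_arg x > 0"
  using n(1) flat_0[of ?y] unfolding eq[OF x] by (metis divide_nonpos_pos not_less)
 show pos: "L > 0" if u: "nose_arg x > 0"
 proof -
  have "x : nose_body" using u x eta unfolding nose_body_def by auto
  note bd = nose_body_bounds[OF this]
  have u1: "nose_arg x <= 1" using bd(2) unfolding nose_arg_def by (smt (verit) zero_le_power2)
  have y0: "?y > 0" using u n(1) by simp
  have fp: "flat ?y > 0" by (rule flat_pos[OF y0])
  have fe: "f' / n = flat ?y * (n / (nose_arg x)\<^sup>2)" using y0 n(1) u by (simp add: f'_def power2_eq_square field_simps)
  have "n / (nose_arg x)\<^sup>2 >= n"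
  proof -
   have "(nose_arg x)\<^sup>2 <= 1" using u u1 by (simp add: power_le_one)
   then show ?thesis using u n(1) by (simp add: le_divide_eq)
  qed
  then have f1: "f' / n >= flat ?y * n" unfolding fe by (rule mult_left_mono) (rule less_imp_le[OF fp])
  have "\<bar>2 * k * x $ 3\<bar> <= 2 * (1 / 8) * 1" unfolding abs_mult using k bd(4) by (intro mult_mono) auto
  \<comment> \<open>The z-derivative of the paraboloid is at most 2 in size and meets
    \<open>|k| <= 1 / 8\<close>, so the term with \<open>k\<close> costs at most a quarter. Against
    the rest, \<open>n >= 2 * B + 1\<close> leaves \<open>n * (3 / 4) - B\<close> positive.\<close>
  then have k34: "3 / 4 <= 1 + 2 * k * x $ 3" by (simp add: abs_le_iff)
  have "0 <= f' / n" using f1 mult_pos_pos[OF fp n(1)] by linarith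
  then have "flat ?y * n * (3 / 4) <= f' / n * (1 + 2 * k * x $ 3)" by (intro mult_mono f1 k34) simp_all
  moreover have "b * flat ?y >= - B * flat ?y" using b fp by (intro mult_right_mono) (auto simp: abs_le_iff)
  ultimately have "L >= flat ?y * (n * (3 / 4) - B)" unfolding L by (simp add: algebra_simps)
  moreover have "B >= 0" using b by simp
  then have "n * (3 / 4) - B > 0" using n by simp
  ultimately show ?thesis using fp by (smt (verit) mult_pos_pos)
 qed
 show "L >= 0"
 proof (cases "nose_arg x > 0")
  case False
  then have "?y <= 0" using n(1) by (simp add: divide_nonpos_pos)
  then show ?thesis unfolding L by (simp add: f'_def flat_0)
 qed (use pos in simp)
qed

lemma nf_contact_add:
 assumes "h differentiable at x" "phi differentiable at x"
 shows "nf_contact (%x. h x + eps * phi x) k x = nf_contact h k x + eps * (pd 1 phi x - k x * pd 3 phi x + pd 3 k x * phi x)"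
proof -
 have "((%x. h x + eps * phi x) has_derivative (%w. fd h x w + eps * fd phi x w)) (at x)"
  using assms by (intro has_derivative_add has_derivative_mult_right) (simp_all add: frechet_derivative_works[symmetric])
 note fd = fun_cong[OF frechet_derivative_at[OF this], symmetric]
 show ?thesis unfolding nf_contact_def fd by (simp add: algebra_simps)
qed

context closed_manifold
begin

section \<open>Attaching one nose\<close>

text \<open>The second component is the length \<open>eta\<close> of the exit. The cone condition on
  a compact cube is open, so nose charts survive small changes of the plane field, which allows
  several noses to be treated one after the other.\<close>

definition nose_chart :: "'a plane_field => 'a chart \<times> real => bool" where
 "nose_chart ksi n \<longleftrightarrow> fst n : atlas M & 0 < snd n & snd n < 1 & (\<forall>x\<in>ccube 2. cone ksi (fst n) x)"

abbreviation exit_set :: "'a chart \<times> real => 'a set" where "exit_set n == cinv (fst n) ` nose_exit (snd n)"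
abbreviation core_set :: "'a chart \<times> real => 'a set" where "core_set n == cinv (fst n) ` nose_core (snd n)"

text \<open>The bump increases the contact coefficient up to the exit. In the exit it may decrease
  it, but there the planes are contact by hypothesis, and a small amplitude \<open>eps\<close> keeps
  them so. The amplitude is fixed at parameter 0; by compactness the conclusions extend to nearby
  parameters.\<close>

lemma nose_step:
 assumes ad: "admissible F zeta" and nose: "nose_chart (zeta 0) n" and L: "!!m. m : set L ==> nose_chart (zeta 0) m"
  and exit: "exit_set n Int noncontact (zeta 0) = {}"
 obtains zeta' where "admissible F zeta'" "equivalent zeta zeta'" "noncontact (zeta' 0) <= noncontact (zeta 0) - core_set n"
  "!!m. m : set L ==> nose_chart (zeta' 0) m"
proof -
 obtain c eta where n: "n = (c, eta)" by (cases n)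
 have c: "c : atlas M" and eta: "0 < eta" "eta < 1" and cone: "!!x. x : ccube 2 ==> cone (zeta 0) c x"
  using nose unfolding nose_chart_def n by simp_all
 have sf: "smooth_family zeta" using ad unfolding admissible_def by blast
 obtain e W h k where W: "e > 0" "!!t x. \<bar>t\<bar> < e ==> x : ccube 2 ==> (t, x) : W" "Cinf_on W h" "Cinf_on W k"
  "fam_rep zeta c W (%tx. vec3 (k tx) (h tx) 1)" "!!tx. tx : W ==> \<bar>k tx\<bar> < 1 / 8"
  by (rule cone_family[OF sf c compact_cbox cone]; (assumption | rule that))
 have oW: "open W" by (rule Cinf_on_open[OF W(3)])
 have bc: "nose_body <= ccube 2" using nose_body_ccube unfolding subset_iff mem_ccube by force
 have im: "ccube 2 <= cimage c" using cone unfolding cone_def by blast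
 have bi: "nose_body <= cimage c" using bc im by (rule subset_trans)
 have W0: "(0, x) : W" if "x : ccube 2" for x by (rule W(2)) (use W(1) that in simp_all)
 have b0: "(0, x) : W" if "x : nose_body" for x by (rule W0) (rule subsetD[OF bc that])
 let ?K = "cball 0 (e / 2) \<times> ccube 2 :: (real \<times> (real^3)) set"
 have K: "compact ?K" by (intro compact_Times compact_cball compact_cbox)
 have KW: "?K <= W" using W(1,2) by auto
 define k3 where "k3 tx = fd k tx (0, axis 3 1)" for tx
 obtain B where B: "B > 0" "!!tx. tx : ?K ==> \<bar>k3 tx\<bar> <= B"
  by (rule compact_continuous_bound[OF K, of k3])
   (use continuous_on_subset[OF Cinf_on_continuous[OF Cinf_on_derivative[OF W(4)]] KW] that in \<open>auto simp: k3_def\<close>)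
 define N where "N = 2 * B + 1"
 have N: "N > 0" "N >= 2 * B + 1" using B(1) unfolding N_def by auto
 let ?phi = "nose_bump eta N"
 have sphi: "Cinf_on UNIV ?phi" by (rule Cinf_on_nose_bump[OF eta(1) N(1)])
 have phi0: "?phi x = 0" if "x ~: nose_body" for x by (rule nose_bump_outside[OF N(1) eta(1) that])
 have v0: "vec3 a b 1 ~= 0" for a b :: real by (simp add: vec_eq_iff forall_3)
 \<comment> \<open>An auxiliary family whose parameter is the amplitude of the bump on the plane
   field at 0. The persistence lemmas, applied to it, tell how small \<open>eps\<close> has to be
   for the exit and for the remaining noses.\<close>
 define om where "om = perturb c nose_body (%tx. vec3 (k (0, snd tx)) (h (0, snd tx) + fst tx * ?phi (snd tx)) 1) (%_. zeta 0)"
 let ?W0 = "UNIV \<times> {x. (0, x) : W} :: (real \<times> (real^3)) set"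
 have o0: "open {x. (0, x) : W}" by (rule representsD(4)[OF fam_rep_slice[OF W(5)]])
 have oW0: "open ?W0" by (intro open_Times open_UNIV o0)
 have sn: "Cinf_on ?W0 snd" using Cinf_on_snd[OF Cinf_on_ident[OF oW0]] by simp
 have sl: "Cinf_on ?W0 (%tx. g (0, snd tx))" if g: "Cinf_on W g" for g :: "real \<times> (real^3) => real"
  by (rule Cinf_on_compose[OF sn Cinf_on_slice[OF g o0]]) auto
 have som: "smooth_family om" unfolding om_def
 proof (rule perturb_family(2)[OF smooth_family_const[OF sf] fam_rep_const[OF W(5)] compact_nose_body(1) bi])
  show "(0, x) : ?W0" if "x : nose_body" for x using b0[OF that] by simp
  show "Cinf_on ?W0 (%tx. vec3 (k (0, snd tx)) (h (0, snd tx) + fst tx * ?phi (snd tx)) 1)"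
   by (intro smooth_intros sl W(3,4) oW0 Cinf_on_compose_UNIV[OF sphi])
  show "vec3 (k (0, snd (t, x))) (h (0, snd (t, x)) + fst (t, x) * ?phi (snd (t, x))) 1 = vec3 (k (0, snd (t, x))) (h (0, snd (t, x))) 1"
   if "x ~: nose_body" for t x using phi0[OF that] by simp
 qed (rule v0)
 have om0: "om 0 = zeta 0"
 proof
  fix p
  show "om 0 p = zeta 0 p"
  proof (cases "p : cinv c ` nose_body")
   case True
   then obtain x where x: "x : nose_body" "p = cinv c x" by blast
   have xc: "cmap c p = x" using cmap_cinv[of x c] subsetD[OF bi x(1)] x(2) by simp
   have "zeta 0 (cinv c x) = ker_at (cinv c x) c (vec3 (k (0, x)) (h (0, x)) 1)"
    using W(5) b0[OF x(1)] unfolding fam_rep_def by blast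
   then show ?thesis using True by (simp add: om_def perturb_def xc x(2)[symmetric])
  qed (simp add: om_def perturb_def)
 qed
 let ?E = "cinv c ` nose_exit eta"
 have ei: "nose_exit eta <= cimage c" using nose_exit_subset bi by (rule subset_trans)
 have Ec: "compactin (mtop M) ?E" by (rule compactin_cinv[OF c compact_nose_body(2) ei])
 have "contact_at M (om 0) p" if "p : ?E" for p
  using exit that compactin_subset_topspace[OF Ec] unfolding n om0 noncontact_def by auto
 then obtain e1 where e1: "e1 > 0" "!!t p. \<bar>t\<bar> < e1 ==> p : ?E ==> contact_at M (om t) p"
  using contact_persists[OF som Ec] by metis
 have "\<exists>e>0. \<forall>t. \<bar>t\<bar> < e --> (\<forall>m\<in>set L'. nose_chart (om t) m)" if "set L' <= set L" for L'
  using that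
 proof (induction L')
  case (Cons m L')
  then obtain a where a: "a > 0" "!!t. \<bar>t\<bar> < a ==> \<forall>m\<in>set L'. nose_chart (om t) m" by auto
  have m: "nose_chart (om 0) m" using L[of m] Cons.prems unfolding om0 by simp
  then obtain b where b: "b > 0" "!!t x. \<bar>t\<bar> < b ==> x : ccube 2 ==> cone (om t) (fst m) x"
   using cone_persists[OF som _ compact_cbox, of "fst m"] unfolding nose_chart_def by metis
  have "nose_chart (om t) m" if "\<bar>t\<bar> < b" for t using m b(2)[OF that] unfolding nose_chart_def by blast
  then show ?case using a b(1) by (intro exI[of _ "min a b"]) simp
 qed (auto intro: exI[of _ 1])
 then obtain e2 where e2: "e2 > 0" "!!t m. \<bar>t\<bar> < e2 ==> m : set L ==> nose_chart (om t) m" by blast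
 define eps where "eps = min e1 e2 / 2"
 have eps: "eps > 0" "\<bar>eps\<bar> < e1" "\<bar>eps\<bar> < e2" using e1(1) e2(1) unfolding eps_def by auto
 define g where "g tx = h tx + eps * ?phi (snd tx)" for tx
 have snW: "Cinf_on W snd" using Cinf_on_snd[OF Cinf_on_ident[OF oW]] by simp
 have sg: "Cinf_on W g" unfolding g_def
  by (intro smooth_intros W(3) oW Cinf_on_compose_UNIV[OF sphi snW])
 define zeta' where "zeta' = perturb c nose_body (%tx. vec3 (k tx) (g tx) 1) zeta"
 \<comment> \<open>Deformation parameter 0 of the new family is amplitude \<open>eps\<close> of the
   auxiliary one, so its exit is contact; persistence then works in the deformation
   parameter.\<close>
 have zeta'0: "zeta' 0 = om eps" by (simp add: zeta'_def om_def perturb_def g_def fun_eq_iff)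
 note pf = perturb_family[OF sf W(5) compact_nose_body(1) bi b0, of "%tx. vec3 (k tx) (g tx) 1", folded zeta'_def]
 have smB: "Cinf_on W (%tx. vec3 (k tx) (g tx) 1)" by (intro smooth_intros W(4) sg oW)
 have g_out: "g (t, x) = h (t, x)" if "x ~: nose_body" for t x using phi0[OF that] by (simp add: g_def)
 have pf: "fam_rep zeta' c W (%tx. vec3 (k tx) (g tx) 1)" "smooth_family zeta'"
  by (rule pf; use smB v0 g_out in simp)+
 have "contact_at M (zeta' 0) p" if "p : ?E" for p unfolding zeta'0 by (rule e1(2)[OF eps(2) that])
 then obtain e3 where e3: "e3 > 0" "!!t p. \<bar>t\<bar> < e3 ==> p : ?E ==> contact_at M (zeta' t) p"
  using contact_persists[OF pf(2) Ec] by metis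
 define m where "m = Min {e / 2, e3}"
 have m: "m > 0" "m <= e / 2" "m <= e3" unfolding m_def using W(1) e3(1) by auto
 have cc: "cube 2 <= ccube 2" by (rule box_subset_cbox)
 have key: "slice_contact g k t x >= 0 &
   (slice_contact h k t x > 0 \<or> h (t, x) ~= g (t, x) \<or> x : nose_core eta -->
    slice_contact g k t x > 0)"
  if t: "\<bar>t\<bar> < m" and x: "x : cube 2" and nn: "slice_contact h k t x >= 0" for t x
 proof -
  have xc: "x : ccube 2" using x cc by blast
  have tx: "(t, x) : W" using W(2)[OF _ xc] t m(2) W(1) by auto
  have sl': "y : cube 2 ==> (t, y) : W" for y using W(2)[OF _ subsetD[OF cc]] t m(2) W(1) by auto
  have sub: "cube 2 <= {x. (t, x) : W}" using sl' by blast
  note slices = Cinf_on_slice[OF W(3) open_box sl'] Cinf_on_slice[OF W(4) open_box sl'] Cinf_on_slice[OF sg open_box sl']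
  have k3x: "pd 3 (%x. k (t, x)) x = k3 (t, x)"
   unfolding k3_def by (rule fun_cong[OF frechet_derivative_at[OF frechet_slice[OF W(4) tx], symmetric]])
  have "(t, x) : ?K" using t m(2) xc by auto
  then have k3b: "\<bar>pd 3 (%x. k (t, x)) x\<bar> <= B" using B(2) k3x by simp
  have add: "slice_contact g k t x = slice_contact h k t x +
   eps * (pd 1 ?phi x - k (t, x) * pd 3 ?phi x + pd 3 (%x. k (t, x)) x * ?phi x)"
   unfolding g_def snd_conv
   by (rule nf_contact_add[OF Cinf_on_differentiable[OF slices(1) x] Cinf_on_differentiable[OF sphi UNIV_I]])
  have kk: "\<bar>k (t, x)\<bar> <= 1 / 8" using W(6)[OF tx] by simp
  show ?thesis
  \<comment> \<open>Before the exit the growth estimate for the bump applies; in the exit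
    contactness was arranged; elsewhere nothing has changed.\<close>
  proof (cases "x $ 1 < 1 - eta")
   case True
   note inc = nose_bump_increase[OF eta(1) N True kk k3b]
   show ?thesis
   proof (intro conjI impI)
    show "slice_contact g k t x >= 0"
     unfolding add using nn mult_nonneg_nonneg[OF less_imp_le[OF eps(1)] inc(1)] by (rule add_nonneg_nonneg)
    assume or: "slice_contact h k t x > 0 \<or> h (t, x) ~= g (t, x) \<or> x : nose_core eta"
    show "slice_contact g k t x > 0"
    proof (cases "nose_arg x > 0")
     case u: True
     show ?thesis unfolding add using nn mult_pos_pos[OF eps(1) inc(2)[OF u]] by (rule add_nonneg_pos)
    next
     case False
     then have "?phi x = 0" "x ~: nose_core eta" using inc(3) unfolding nose_core_def by auto
     then have "slice_contact h k t x > 0" using or by (simp add: g_def)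
     then show ?thesis unfolding add using mult_nonneg_nonneg[OF less_imp_le[OF eps(1)] inc(1)] by (rule add_pos_nonneg)
    qed
   qed
  next
   case ge: False
   show ?thesis
   proof (cases "x : nose_body")
    case True
    then have "x : nose_exit eta" using ge unfolding nose_body_def nose_exit_def by simp
    then have ct: "contact_at M (zeta' t) (cinv c x)" using e3(2)[of t "cinv c x"] t m(3) by simp
    have xi: "x : cimage c" using subsetD[OF bi True] .
    have "represents (zeta' t) c (cube 2) (nf_covector (%x. g (t, x)) (%x. k (t, x)))"
     using represents_subset[OF fam_rep_slice[OF pf(1)] sub open_box] unfolding nf_covector_def[abs_def] .
    from contact_at_nf(1)[OF this slices(3,2) cinv_cdom[OF xi]] ct
    have "slice_contact g k t x > 0" using cmap_cinv[OF xi] x by simp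
    then show ?thesis by simp
   next
    case False
    have o: "open (- nose_body)" using compact_imp_closed[OF compact_nose_body(1)] by (simp add: open_Compl)
    have "((%x. 0 :: real) has_derivative (%w. 0)) (at x)" by simp
    then have "(?phi has_derivative (%w. 0)) (at x)"
     by (rule has_derivative_transform_within_open[OF _ o]) (use False phi0 in auto)
    from fun_cong[OF frechet_derivative_at[OF this], symmetric]
    have "slice_contact g k t x = slice_contact h k t x"
     unfolding add by (simp add: phi0[OF False])
    moreover have "x ~: nose_core eta" using ge unfolding nose_core_def by simp
    ultimately show ?thesis using nn phi0[OF False] by (simp add: g_def)
   qed
  qed
 qed
 note step = family_cube_step[OF ad c W(1,2,3,4,5,6) sg compact_nose_body(1) nose_body_ccube g_out m(1), folded zeta'_def]
 have res: "admissible F zeta'" "equivalent zeta zeta'" "\<exists>e>0. \<forall>t. \<bar>t\<bar> < e --> noncontact (zeta' t) <= noncontact (zeta t)"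
  by (rule step; use key in blast)+
 obtain e4 where e4: "e4 > 0" "!!t. \<bar>t\<bar> < e4 ==> noncontact (zeta' t) <= noncontact (zeta t)" using res(3) by blast
 obtain e5 where e5: "e5 > 0" "!!t. \<bar>t\<bar> < e5 ==> integral_confoliation (F t) (zeta t)" using ad unfolding admissible_def by blast
 have core: "contact_at M (zeta' 0) (cinv c x)" if xc: "x : nose_core eta" for x
 proof -
  have xb: "x : nose_body" using xc eta(1) unfolding nose_core_def nose_body_def by simp
  have "x : ccube 1" using xb nose_body_ccube by blast
  then have x: "x : cube 2" unfolding mem_ccube mem_cube by simp
  have xi: "x : cimage c" using subsetD[OF bi xb] .
  have sl0: "y : cube 2 ==> (0, y) : W" for y using W0 cc by blast
  have sub: "cube 2 <= {x. (0, x) : W}" using sl0 by blast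
  note slices = Cinf_on_slice[OF W(3) open_box sl0] Cinf_on_slice[OF W(4) open_box sl0] Cinf_on_slice[OF sg open_box sl0]
  have R: "represents (zeta 0) c (cube 2) (nf_covector (%x. h (0, x)) (%x. k (0, x)))"
   "represents (zeta' 0) c (cube 2) (nf_covector (%x. g (0, x)) (%x. k (0, x)))"
   using represents_subset[OF fam_rep_slice[OF W(5)] sub open_box] represents_subset[OF fam_rep_slice[OF pf(1)] sub open_box]
   unfolding nf_covector_def[abs_def] .
  have "cinv c x : points M" by (rule subsetD[OF cdom_subset[OF c] cinv_cdom[OF xi]])
  then have "conf_at (zeta 0) (cinv c x)" using e5(2)[of 0] e5(1) unfolding integral_confoliation_def by simp
  then have "slice_contact h k 0 x >= 0"
   using contact_at_nf(2)[OF R(1) slices(1,2) cinv_cdom[OF xi]] cmap_cinv[OF xi] x by simp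
  then have "slice_contact g k 0 x > 0" using key[of 0 x] m(1) x xc by simp
  then show ?thesis using contact_at_nf(1)[OF R(2) slices(3,2) cinv_cdom[OF xi]] cmap_cinv[OF xi] x by simp
 qed
 show ?thesis
 proof (rule that[OF res(1,2)])
  have "p ~: noncontact (zeta' 0)" if "p : core_set n" for p using that core unfolding n noncontact_def by auto
  then show "noncontact (zeta' 0) <= noncontact (zeta 0) - core_set n" using e4(2)[of 0] e4(1) by auto
  show "nose_chart (zeta' 0) m" if "m : set L" for m unfolding zeta'0 by (rule e2(2)[OF eps(3) that])
 qed
qed

section \<open>Sequences of noses\<close>

text \<open>\<open>N\<close> bounds the degenerate points still present. Each exit has to avoid what
  is left after the cores of the earlier noses are removed, so the order of the list
  matters.\<close>

primrec valid_noses :: "'a set => ('a chart \<times> real) list => bool" where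
 "valid_noses N [] = True"
| "valid_noses N (n # L) = (exit_set n Int N = {} & valid_noses (N - core_set n) L)"

definition covered :: "('a chart \<times> real) list => 'a set" where
 "covered L = (\<Union>n\<in>set L. core_set n)"

lemma valid_noses_mono: "valid_noses N L ==> N' <= N ==> valid_noses N' L"
 by (induction L arbitrary: N N') (auto, meson Diff_mono order_refl)

lemma valid_noses_append: "valid_noses N (L @ L') \<longleftrightarrow> valid_noses N L & valid_noses (N - covered L) L'"
 by (induction L arbitrary: N) (auto simp: covered_def Diff_Diff_Int set_diff_eq conj_ac)

lemma nose_sequence:
 assumes "admissible F zeta" "!!n. n : set L ==> nose_chart (zeta 0) n" "valid_noses N L" "noncontact (zeta 0) <= N"
 shows "\<exists>zeta'. admissible F zeta' & equivalent zeta zeta' & noncontact (zeta' 0) <= N - covered L"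
 using assms
proof (induction L arbitrary: N zeta)
 case Nil
 have "equivalent zeta zeta" unfolding equivalent_def by (intro exI[of _ 1]) simp
 then show ?case using Nil by (auto simp: covered_def)
next
 case (Cons n L)
 have n: "nose_chart (zeta 0) n" and L: "!!m. m : set L ==> nose_chart (zeta 0) m" using Cons.prems(2) by simp_all
 have ex: "exit_set n Int noncontact (zeta 0) = {}" and v: "valid_noses (N - core_set n) L" using Cons.prems(3,4) by auto
 obtain zeta1 where 1: "admissible F zeta1" "equivalent zeta zeta1" "noncontact (zeta1 0) <= noncontact (zeta 0) - core_set n"
  "!!m. m : set L ==> nose_chart (zeta1 0) m"
  by (rule nose_step[OF Cons.prems(1) n L ex]; (assumption | rule that))
 have "noncontact (zeta1 0) <= N - core_set n" using 1(3) Cons.prems(4) by blast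
 from Cons.IH[OF 1(1,4) v this]
 obtain zeta' where "admissible F zeta'" "equivalent zeta1 zeta'" "noncontact (zeta' 0) <= N - core_set n - covered L" by blast
 moreover have "covered (n # L) = core_set n Un covered L" by (simp add: covered_def)
 ultimately show ?case using equivalent_trans[OF 1(2)] by (metis Diff_Un Diff_Diff_Int Diff_eq Int_assoc Compl_Un)
qed

end

lemma homeomorphic_imp_homeomorphic_space:
 "S homeomorphic T ==> top_of_set S homeomorphic_space top_of_set T"
 unfolding homeomorphic_def homeomorphism_def homeomorphic_space_def homeomorphic_maps_def
 by (auto 0 4)

lemma plane_disc_homeomorphic:
 fixes x0 :: "real^3"
 assumes "s > 0"
 shows "{x : ball x0 s. x $ 3 = x0 $ 3} homeomorphic (UNIV :: (real^2) set)"
proof -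
 let ?f = "%x. vector [x $ 1 - x0 $ 1, x $ 2 - x0 $ 2] :: real^2" and ?g = "%u :: real^2. x0 + vec3 (u $ 1) (u $ 2) 0"
 have eqf: "?f = (%x. (x $ 1 - x0 $ 1) *\<^sub>R axis 1 1 + (x $ 2 - x0 $ 2) *\<^sub>R axis 2 1)"
  by (auto simp: fun_eq_iff vec_eq_iff forall_2 axis_def)
 have n: "norm (?f x) = dist x0 x" if "x $ 3 = x0 $ 3" for x
  using that by (simp add: dist_norm norm_vec_def L2_set_def sum_3 sum_2 power2_commute)
 have gn: "dist x0 (?g u) = norm u" for u
  by (simp add: dist_norm norm_vec_def L2_set_def sum_3 sum_2)
 have "{x : ball x0 s. x $ 3 = x0 $ 3} homeomorphic ball (0 :: real^2) s"
 proof (rule homeomorphicI[of ?f _ _ ?g])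
  have sub: "?f ` {x : ball x0 s. x $ 3 = x0 $ 3} <= ball 0 s" using n by auto
  show "continuous_on {x : ball x0 s. x $ 3 = x0 $ 3} ?f" unfolding eqf by (intro continuous_intros)
  show "continuous_on (ball 0 s) ?g" by (intro continuous_intros continuous_on_vec3)
  show gf: "?g (?f x) = x" if "x : {x : ball x0 s. x $ 3 = x0 $ 3}" for x
   using that by (simp add: vec_eq_iff forall_3)
  show fg: "?f (?g u) = u" for u by (simp add: vec_eq_iff forall_2)
  have gsub: "?g u : {x : ball x0 s. x $ 3 = x0 $ 3}" if "u : ball 0 s" for u using that gn[of u] by simp
  show "?f ` {x : ball x0 s. x $ 3 = x0 $ 3} = ball 0 s"
   using sub gsub fg by (metis (no_types, lifting) imageI subsetI subset_antisym)
  show "?g ` ball 0 s = {x : ball x0 s. x $ 3 = x0 $ 3}"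
   using gsub gf sub by (metis (no_types, lifting) image_subset_iff imageI subsetI subset_antisym)
 qed
 also have "ball (0 :: real^2) s homeomorphic (UNIV :: (real^2) set)" by (rule homeomorphic_ball_UNIV[OF assms])
 finally show ?thesis .
qed

text \<open>A one-sided ray is enough, so derivatives along a surface can be computed at its
  boundary points as well.\<close>

lemma derivative_zero_on_ray:
 fixes f :: "real^3 => real"
 assumes D: "(f has_derivative D) (at x)" and dl: "dl > 0" and z: "f x = 0" "!!s. 0 < s ==> s < dl ==> f (x + s *\<^sub>R e) = 0"
 shows "D e = 0"
proof -
 have "((%s. x + s *\<^sub>R e) has_derivative (%s. s *\<^sub>R e)) (at (0 :: real))" by (auto intro!: derivative_eq_intros)
 moreover have "(f has_derivative D) (at (x + 0 *\<^sub>R e))" using D by simp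
 ultimately have "((%s. f (x + s *\<^sub>R e)) has_derivative (%s. D (s *\<^sub>R e))) (at 0)" by (rule has_derivative_compose)
 then have "((%s. f (x + s *\<^sub>R e)) has_real_derivative D e) (at 0)"
  using linear_cmul[OF has_derivative_linear[OF D]] by (simp add: has_field_derivative_def mult_commute_abs)
 then have "((%s. (f (x + s *\<^sub>R e) - f x) / s) \<longlongrightarrow> D e) (at 0)" by (simp add: has_field_derivative_iff)
 then have "((%s. (f (x + s *\<^sub>R e) - f x) / s) \<longlongrightarrow> D e) (at_right 0)" by (rule tendsto_within_subset) simp
 moreover have "((%s. (f (x + s *\<^sub>R e) - f x) / s) \<longlongrightarrow> 0) (at_right 0)"
  by (rule tendsto_eventually) (use dl z in \<open>auto simp: eventually_at_right_field intro!: exI[of _ dl]\<close>)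
 ultimately show ?thesis using tendsto_unique[OF trivial_limit_at_right_real] by blast
qed

context closed_manifold
begin

lemma fam_rep_of_represents:
 assumes "represents ksi c V A"
 shows "fam_rep (%_. ksi) c (UNIV \<times> V) (%tx. A (snd tx))"
proof -
 note D = representsD[OF assms]
 have o: "open (UNIV \<times> V :: (real \<times> (real^3)) set)" by (intro open_Times open_UNIV D(4))
 have "Cinf_on (UNIV \<times> V) (%tx. A (snd (tx :: real \<times> (real^3))))"
  by (rule Cinf_on_compose[OF Cinf_on_snd[OF Cinf_on_ident[OF o]] D(3)]) auto
 then show ?thesis unfolding fam_rep_def using D(1,2,5,6) by auto
qed

lemma smooth_family_constant: "smooth_field ksi ==> smooth_family (%_. ksi)"
 unfolding smooth_field_def smooth_family_def using fam_rep_of_represents by fastforce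

lemma openin_contact:
 assumes "smooth_field ksi"
 shows "openin (mtop M) {p : points M. contact_at M ksi p}"
proof (subst openin_subopen, intro ballI)
 fix p assume p: "p : {p : points M. contact_at M ksi p}"
 then obtain c V A where R: "represents ksi c V A" and q: "p : cdom c" "cmap c p : V"
  using assms unfolding smooth_field_def by blast
 note D = representsD[OF R] and FR = fam_rep_of_represents[OF R]
 obtain kp :: "real \<times> (real^3) => real" where kp: "continuous_on (UNIV \<times> V) kp"
  "!!t x. (t, x) : UNIV \<times> V ==> contact_at M ksi (cinv c x) \<longleftrightarrow> kp (t, x) > 0"
  by (rule fam_rep_contact[OF FR]; (assumption | rule that))
 have o: "open ((UNIV \<times> V) Int kp -` {0<..})"
  by (rule continuous_open_preimage[OF kp(1) open_Times[OF open_UNIV D(4)] open_greaterThan])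
 have i: "(0, cmap c p) : (UNIV \<times> V) Int kp -` {0<..}"
  using kp(2)[of 0 "cmap c p"] p q cinv_cmap[OF D(1) q(1)] by simp
 obtain e U where U: "e > 0" "openin (mtop M) U" "p : U"
  "!!t q. \<bar>t\<bar> < e ==> q : U ==> q : cdom c & (t, cmap c q) : (UNIV \<times> V) Int kp -` {0<..}"
  using chart_nbhd[OF D(1) o q(1) i] by blast
 have "contact_at M ksi q" if "q : U" for q
  using kp(2)[of 0 "cmap c q"] U(4)[of 0 q] U(1) that cinv_cmap[OF D(1), of q] by auto
 then have "U <= {p : points M. contact_at M ksi p}" using openin_subset[OF U(2)] by blast
 then show "\<exists>U. openin (mtop M) U & p : U & U <= {p : points M. contact_at M ksi p}" using U(2,3) by blast
qed

section \<open>Reaching the whole surface from its boundary\<close>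

text \<open>All noses belong to one fixed plane field, so that different sequences can be
  concatenated; points off the degenerate set are reached by the empty list.\<close>

definition reach :: "'a plane_field => 'a => bool" where
 "reach ksi p \<longleftrightarrow> (\<exists>L. (\<forall>n\<in>set L. nose_chart ksi n) & valid_noses (noncontact ksi) L & p ~: noncontact ksi - covered L)"

lemma openin_reached:
 assumes ksi: "smooth_field ksi" and L: "\<forall>n\<in>set L. nose_chart ksi n"
 shows "openin (mtop M) (points M - (noncontact ksi - covered L))"
proof -
 have op: "openin (mtop M) (core_set n)" if "n : set L" for n
 proof -
  have n: "fst n : atlas M" "0 < snd n" "!!x. x : ccube 2 ==> cone ksi (fst n) x" using L that unfolding nose_chart_def by blast+
  have "nose_core (snd n) <= nose_body" using n(2) unfolding nose_core_def nose_body_def by auto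
  also have "nose_body <= ccube 2" using nose_body_ccube unfolding subset_iff mem_ccube by force
  also have "ccube 2 <= cimage (fst n)" using n(3) unfolding cone_def by blast
  finally show ?thesis by (rule openin_cinv_image[OF n(1) open_nose_core])
 qed
 then have "openin (mtop M) (covered L)" unfolding covered_def by blast
 moreover have "points M - (noncontact ksi - covered L) = {p : points M. contact_at M ksi p} Un covered L"
  using openin_subset[OF \<open>openin (mtop M) (covered L)\<close>] unfolding noncontact_def by auto
 ultimately show ?thesis using openin_contact[OF ksi] by auto
qed

text \<open>Inside a small flat piece one more nose is appended, with its exit at the reached point
  \<open>q\<close> and its core containing \<open>q'\<close>. Degenerate points occur at height
  \<open>x0 $ 3\<close> only, so the exit has to be narrow within the plane alone to stay in the
  region around \<open>q\<close> that is already free of them.\<close>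

lemma reach_disc:
 assumes ksi: "smooth_field ksi" and r: "r > 0" and R: "represents ksi c V A"
  and V: "!!x. (!!i. \<bar>x $ i - x0 $ i\<bar> < 64 * r) ==> x : V & \<bar>A x $ 1\<bar> + \<bar>A x $ 2\<bar> < \<bar>A x $ 3\<bar> / 8 &
   (cinv c x : noncontact ksi --> x $ 3 = x0 $ 3)"
  and q: "!!i. \<bar>q $ i - x0 $ i\<bar> < r" "q $ 3 = x0 $ 3" and q': "!!i. \<bar>q' $ i - x0 $ i\<bar> < r" "q' $ 3 = x0 $ 3"
  and reach: "reach ksi (cinv c q)"
 shows "reach ksi (cinv c q')"
proof (cases "q = q'")
 case False
 note D = representsD[OF R]
 obtain L where L: "\<forall>n\<in>set L. nose_chart ksi n" "valid_noses (noncontact ksi) L" "cinv c q ~: noncontact ksi - covered L"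
  using reach unfolding reach_def by blast
 have "\<bar>q $ i - x0 $ i\<bar> < 64 * r" for i using q(1)[of i] r by linarith
 then have qV: "q : V" using V by blast
 have qc: "q : cimage c" using qV D(2) by blast
 let ?O = "points M - (noncontact ksi - covered L)"
 have "open (cmap c ` (cdom c Int ?O))" by (rule open_cmap_image[OF D(1) openin_reached[OF ksi L(1)]])
 moreover have "q : cmap c ` (cdom c Int ?O)"
  using cinv_cdom[OF qc] cmap_cinv[OF qc] L(3) cdom_subset[OF D(1)] by (intro image_eqI[of _ _ "cinv c q"]) auto
 ultimately obtain rho where rho: "rho > 0" "ball q rho <= cmap c ` (cdom c Int ?O)" using openE by blast
 have free: "cinv c x ~: noncontact ksi - covered L" if "dist q x < rho" for x
 proof -
  have "x : cmap c ` (cdom c Int ?O)" using rho(2) that by (auto simp: subset_iff)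
  then obtain p where "p : cdom c" "p : ?O" "x = cmap c p" by blast
  then show ?thesis using cinv_cmap[OF D(1)] by simp
 qed
 define d1 d2 where "d1 = q $ 1 - q' $ 1" and "d2 = q $ 2 - q' $ 2"
 define l where "l = sqrt (d1\<^sup>2 + d2\<^sup>2)"
 have d12: "\<bar>d1\<bar> < 2 * r" "\<bar>d2\<bar> < 2 * r" using q(1)[of 1] q(1)[of 2] q'(1)[of 1] q'(1)[of 2] unfolding d1_def d2_def by arith+
 have "d1 ~= 0 \<or> d2 ~= 0" using False q(2) q'(2) unfolding d1_def d2_def by (auto simp: vec_eq_iff forall_3)
 then have "d1\<^sup>2 + d2\<^sup>2 > 0" by (auto simp: sum_power2_gt_zero_iff)
 then have l0: "l > 0" "l\<^sup>2 = d1\<^sup>2 + d2\<^sup>2" unfolding l_def by simp_all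
 have l4: "l <= 4 * r" using sqrt_sum_squares_le_sum_abs[of d1 d2] d12 unfolding l_def by linarith
 define e1 e2 where "e1 = d1 / l" and "e2 = d2 / l"
 have e: "e1\<^sup>2 + e2\<^sup>2 = 1" unfolding e1_def e2_def power_divide add_divide_distrib[symmetric] l0(2)[symmetric] using l0(1) by simp
 have "e1\<^sup>2 <= 1" "e2\<^sup>2 <= 1" using e zero_le_power2[of e1] zero_le_power2[of e2] by linarith+
 then have e_le: "\<bar>e1\<bar> <= 1" "\<bar>e2\<bar> <= 1" by (simp_all add: abs_square_le_1)
 have le: "l * e1 = d1" "l * e2 = d2" using l0(1) unfolding e1_def e2_def by simp_all
 \<comment> \<open>Exit points at the height of the surface lie within \<open>8 * l * eta\<close> of
   \<open>q\<close>, hence inside the free ball of radius \<open>rho\<close>;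
   \<open>eta <= 1 / 4\<close> keeps the abscissa 1/2 of \<open>q'\<close> ahead of the
   exit.\<close>
 define eta where "eta = min (1 / 4) (rho / (16 * l))"
 have eta: "0 < eta" "eta <= 1 / 4" "eta <= rho / (16 * l)" using rho(1) l0(1) unfolding eta_def by auto
 have etarho: "8 * l * eta < rho" using eta(3) l0(1) rho(1) by (simp add: pos_le_divide_eq mult.commute)
 \<comment> \<open>An affine chart with first axis along the segment and unit \<open>2 * l\<close>:
   its origin is the reflection of \<open>q\<close> in \<open>q'\<close>, so \<open>q'\<close> has
   abscissa 1/2 and \<open>q\<close> abscissa 1. The second axis is shrunk by \<open>eta\<close> to
   make the exit narrow. The cube of size 3 stays within \<open>64 * r\<close> of \<open>x0\<close>,
   since \<open>l <= 4 * r\<close>.\<close>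
 define T where "T y = vec3 (q' $ 1 - d1 + 2 * l * (y $ 1 * e1 - eta * y $ 2 * e2))
  (q' $ 2 - d2 + 2 * l * (y $ 1 * e2 + eta * y $ 2 * e1)) (x0 $ 3 + 2 * l * y $ 3)" for y :: "real^3"
 define DT where "DT w = vec3 (2 * l * (w $ 1 * e1 - eta * w $ 2 * e2)) (2 * l * (w $ 1 * e2 + eta * w $ 2 * e1)) (2 * l * w $ 3)" for w :: "real^3"
 have smT: "Cinf_on UNIV T" unfolding T_def[abs_def] by (intro smooth_intros) auto
 have linDT: "linear DT" unfolding DT_def by (rule linearI) (simp_all add: vec_eq_iff forall_3 algebra_simps)
 have Tadd: "T y = T 0 + DT y" for y by (simp add: T_def DT_def vec_eq_iff forall_3 algebra_simps)
 have "(T has_derivative DT) (at y)" for y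
 proof -
  have bl: "bounded_linear DT" using linDT by (simp add: linear_conv_bounded_linear)
  have "((%y. T 0 + DT y) has_derivative (%w. 0 + DT w)) (at y)"
   by (intro has_derivative_add has_derivative_const bounded_linear_imp_has_derivative[OF bl])
  moreover have "(%y. T 0 + DT y) = T" by (rule ext) (rule Tadd[symmetric])
  ultimately show ?thesis by simp
 qed
 then have fT: "fd T y = DT" for y by (rule frechet_derivative_at[symmetric])
 have "det (matrix DT) = (2 * l) * (2 * l) * (2 * l) * eta * (e1\<^sup>2 + e2\<^sup>2)"
  by (simp add: det_3 matrix_def axis_def DT_def power2_eq_square algebra_simps)
 then have det: "det (matrix DT) > 0" using l0(1) eta(1) e by simp
 have injT: "inj T"
 proof (rule injI)
  fix x y assume "T x = T y"
  then have "DT x = DT y" using Tadd[of x] Tadd[of y] by (metis add_left_cancel)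
  then have "DT (x - y) = 0" unfolding linear_diff[OF linDT] by simp
  moreover have "inj DT" using det det_nz_iff_inj[OF linDT] by simp
  ultimately show "x = y" using linear_0[OF linDT] by (metis eq_iff_diff_eq_0 injD)
 qed
 have inV: "T y : V & \<bar>A (T y) $ 1\<bar> + \<bar>A (T y) $ 2\<bar> < \<bar>A (T y) $ 3\<bar> / 8 &
   (cinv c (T y) : noncontact ksi --> T y $ 3 = x0 $ 3)" if y: "y : cube 3" for y
 proof (rule V)
  fix i
  have yb: "\<bar>y $ 1\<bar> < 3" "\<bar>y $ 2\<bar> < 3" "\<bar>y $ 3\<bar> < 3" using y unfolding mem_cube by simp_all
  have b: "\<bar>y $ 1 * a\<bar> <= 3" "\<bar>eta * y $ 2 * a\<bar> <= 3" if "\<bar>a\<bar> <= 1" for a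
  proof -
   have "\<bar>y $ 1\<bar> * \<bar>a\<bar> <= 3 * 1" using yb that by (intro mult_mono) auto
   then show "\<bar>y $ 1 * a\<bar> <= 3" by (simp add: abs_mult)
   have "\<bar>eta\<bar> * \<bar>y $ 2\<bar> * \<bar>a\<bar> <= 1 * 3 * 1" using yb eta(1,2) that by (intro mult_mono) auto
   then show "\<bar>eta * y $ 2 * a\<bar> <= 3" by (simp add: abs_mult)
  qed
  have sc: "\<bar>2 * l * a\<bar> <= 48 * r" if "\<bar>a\<bar> <= 6" for a
  proof -
   have "\<bar>2 * l\<bar> * \<bar>a\<bar> <= (8 * r) * 6" using l4 l0(1) that by (intro mult_mono) auto
   then show ?thesis by (simp add: abs_mult)
  qed
  have "\<bar>y $ 1 * e1 - eta * y $ 2 * e2\<bar> <= 6" "\<bar>y $ 1 * e2 + eta * y $ 2 * e1\<bar> <= 6" "\<bar>y $ 3\<bar> <= 6"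
   using b[OF e_le(1)] b[OF e_le(2)] yb by linarith+
  note s = sc[OF this(1)] sc[OF this(2)] sc[OF this(3)]
  have "\<bar>T y $ 1 - x0 $ 1\<bar> < 64 * r"
   using s(1) q'(1)[of 1] d12(1) r unfolding T_def vector_3 by linarith
  moreover have "\<bar>T y $ 2 - x0 $ 2\<bar> < 64 * r"
   using s(2) q'(1)[of 2] d12(2) r unfolding T_def vector_3 by linarith
  moreover have "\<bar>T y $ 3 - x0 $ 3\<bar> < 64 * r"
   using s(3) r unfolding T_def vector_3 by linarith
  ultimately show "\<bar>T y $ i - x0 $ i\<bar> < 64 * r" using exhaust_3[of i] by auto
 qed
 have TV: "T ` cube 3 <= V" using inV by blast
 have detT: "det (matrix (fd T x)) > 0" for x unfolding fT by (rule det)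
 obtain d where d: "d : atlas M" "cimage d = cube 3" "!!y. y : cube 3 ==> cinv d y = cinv c (T y)"
  "!!ksi V A. represents ksi c V A ==> T ` cube 3 <= V ==> represents ksi d (cube 3) (cov_pull T A)"
  by (rule chart_pullback[OF D(1) Cinf_on_subset[OF smT open_box subset_UNIV] inj_on_subset[OF injT subset_UNIV] order_trans[OF TV D(2)] detT], rule that)
 have Rd: "represents ksi d (cube 3) (cov_pull T A)" by (rule d(4)[OF R TV])
 have c23: "ccube 2 <= cube 3" unfolding subset_iff mem_cube mem_ccube by auto
 have body3: "nose_body <= cube 3" using nose_body_ccube unfolding subset_iff mem_cube mem_ccube by force
 have "cone ksi d y" if y: "y : cube 3" for y
 proof -
  let ?a = "A (T y)"
  have "cov_pull T A y $ 1 = ?a \<bullet> DT (axis 1 1)" "cov_pull T A y $ 3 = ?a \<bullet> DT (axis 3 1)"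
   by (simp_all add: cov_pull_def fT)
  then have c13: "cov_pull T A y $ 1 = 2 * l * (?a $ 1 * e1 + ?a $ 2 * e2)" "cov_pull T A y $ 3 = 2 * l * ?a $ 3"
   by (simp_all add: DT_def axis_def inner_vec_def sum_3 algebra_simps)
  have "\<bar>?a $ 1 * e1\<bar> <= \<bar>?a $ 1\<bar> * 1" "\<bar>?a $ 2 * e2\<bar> <= \<bar>?a $ 2\<bar> * 1"
   unfolding abs_mult using e_le by (intro mult_left_mono; simp)+
  then have "\<bar>?a $ 1 * e1 + ?a $ 2 * e2\<bar> < \<bar>?a $ 3\<bar> / 8" using inV[OF y] by linarith
  then have "\<bar>2 * l\<bar> * \<bar>?a $ 1 * e1 + ?a $ 2 * e2\<bar> < \<bar>2 * l\<bar> * (\<bar>?a $ 3\<bar> / 8)"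
   using l0(1) by (intro mult_strict_left_mono) auto
  then show ?thesis unfolding cone_represents[OF Rd y] c13 abs_mult by simp
 qed
 then have nose: "nose_chart ksi (d, eta)" unfolding nose_chart_def using d(1) eta(1,2) c23 by auto
 have exit: "exit_set (d, eta) Int (noncontact ksi - covered L) = {}"
 proof -
  have False if y: "y : nose_exit eta" and N: "cinv d y : noncontact ksi - covered L" for y
  proof -
   have yb: "y : nose_body" using y nose_exit_subset by blast
   have y3: "y : cube 3" using yb body3 by blast
   have N': "cinv c (T y) : noncontact ksi - covered L" using N d(3)[OF y3] by simp
   then have "T y $ 3 = x0 $ 3" using inV[OF y3] by blast
   then have "y $ 3 = 0" using l0(1) by (simp add: T_def)
   have yy: "\<bar>y $ 1 - 1\<bar> <= eta" "\<bar>y $ 2\<bar> <= 1" using y nose_body_bounds[OF yb] unfolding nose_exit_def by auto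
   have b: "\<bar>(y $ 1 - 1) * a\<bar> <= eta" "\<bar>eta * y $ 2 * a\<bar> <= eta" if "\<bar>a\<bar> <= 1" for a
   proof -
    have "\<bar>y $ 1 - 1\<bar> * \<bar>a\<bar> <= eta * 1" using yy that by (intro mult_mono) auto
    then show "\<bar>(y $ 1 - 1) * a\<bar> <= eta" by (simp add: abs_mult)
    have "\<bar>eta\<bar> * (\<bar>y $ 2\<bar> * \<bar>a\<bar>) <= eta * (1 * 1)" using yy eta(1) that by (intro mult_mono) auto
    then show "\<bar>eta * y $ 2 * a\<bar> <= eta" by (simp add: abs_mult)
   qed
   have sc: "\<bar>2 * l * a\<bar> <= 4 * l * eta" if "\<bar>a\<bar> <= 2 * eta" for a
   proof -
    have "\<bar>2 * l\<bar> * \<bar>a\<bar> <= (2 * l) * (2 * eta)" using l0(1) that by (intro mult_mono) auto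
    then show ?thesis by (simp add: abs_mult)
   qed
   have "\<bar>(y $ 1 - 1) * e1 - eta * y $ 2 * e2\<bar> <= 2 * eta" "\<bar>(y $ 1 - 1) * e2 + eta * y $ 2 * e1\<bar> <= 2 * eta"
    using b[OF e_le(1)] b[OF e_le(2)] by linarith+
   note s = sc[OF this(1)] sc[OF this(2)]
   have "T y $ 1 - q $ 1 = 2 * l * ((y $ 1 - 1) * e1 - eta * y $ 2 * e2)"
    "T y $ 2 - q $ 2 = 2 * l * ((y $ 1 - 1) * e2 + eta * y $ 2 * e1)" "T y $ 3 - q $ 3 = 0"
    using le \<open>y $ 3 = 0\<close> q(2) by (simp_all add: T_def d1_def d2_def algebra_simps)
   then have "\<bar>(T y - q) $ 1\<bar> <= 4 * l * eta" "\<bar>(T y - q) $ 2\<bar> <= 4 * l * eta" "(T y - q) $ 3 = 0" using s by simp_all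
   then have "norm (T y - q) <= 8 * l * eta" using norm_le_l1_cart[of "T y - q"] by (simp add: sum_3)
   then have "dist q (T y) < rho" using etarho by (simp add: dist_norm norm_minus_commute)
   then show False using free N' by blast
  qed
  then show ?thesis by auto
 qed
 let ?h = "vec3 (1 / 2) 0 0"
 have h3: "?h : cube 3" unfolding mem_cube by simp
 have "T ?h = q'" using le q'(2) by (simp add: T_def vec_eq_iff forall_3)
 then have hq: "cinv d ?h = cinv c q'" using d(3)[OF h3] by simp
 have "?h : nose_core eta" using eta(2) unfolding nose_core_def nose_arg_def by simp
 then have "cinv c q' : core_set (d, eta)" unfolding hq[symmetric] by simp
 then have "cinv c q' : covered (L @ [(d, eta)])" unfolding covered_def by auto
 moreover have "valid_noses (noncontact ksi) (L @ [(d, eta)])" using L(2) exit unfolding valid_noses_append by simp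
 ultimately show ?thesis unfolding reach_def using L(1) nose by (intro exI[of _ "L @ [(d, eta)]"]) auto
qed (use reach in simp)


lemma confoliation_smooth_field:
 assumes "confoliation M ksi"
 shows "smooth_field ksi"
 unfolding smooth_field_def
proof
 fix p assume "p : points M"
 then obtain c W al where W: "p : W" "local_form M ksi c W al"
  using assms unfolding confoliation_def smooth_plane_field_def by blast
 have "W <= cdom c" using W(2) unfolding local_form_def by blast
 then have "p : cdom c" "cmap c p : cmap c ` W" using W(1) by auto
 then show "\<exists>c V A. represents ksi c V A & p : cdom c & cmap c p : V"
  using local_form_imp_represents(1)[OF W(2)] by blast
qed

lemma represents_in_chart:
 assumes "smooth_field ksi" "d : charts_at M p"
 obtains V A where "represents ksi d V A" "cmap d p : V"
proof -
 obtain W A where W: "fam_rep (%_. ksi) d W A" "(0, cmap d p) : W"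
  using fam_rep_transport[OF smooth_family_constant[OF assms(1)], of d p] charts_atD[OF assms(2)] by metis
 show ?thesis by (rule that[OF fam_rep_slice[OF W(1), of 0]]) (use W(2) in simp)
qed

lemma flattensD:
 assumes e: "e : atlas M" "flattens e F"
 shows "!!q. q : F ==> q : cdom e ==> cmap e q $ 3 = 0"
  and "(\<forall>x\<in>cimage e. x $ 3 = 0 --> cinv e x : F) \<or>
   (\<forall>q\<in>F Int cdom e. cmap e q $ 1 >= 0) & (\<forall>x\<in>cimage e. x $ 3 = 0 & x $ 1 >= 0 --> cinv e x : F)"
proof -
 show "cmap e q $ 3 = 0" if "q : F" "q : cdom e" for q
 proof -
  have "cmap e q : cmap e ` (F Int cdom e)" using that by blast
  then show ?thesis using e(2) unfolding flattens_def by auto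
 qed
 have inF: "cinv e x : F" if "x : cmap e ` (F Int cdom e)" for x using that cinv_cmap[OF e(1)] by auto
 show "(\<forall>x\<in>cimage e. x $ 3 = 0 --> cinv e x : F) \<or>
   (\<forall>q\<in>F Int cdom e. cmap e q $ 1 >= 0) & (\<forall>x\<in>cimage e. x $ 3 = 0 & x $ 1 >= 0 --> cinv e x : F)"
  using e(2) unfolding flattens_def
 proof
  assume eq: "cmap e ` (F Int cdom e) = cimage e Int {x. x $ 3 = 0}"
  have "cinv e x : F" if "x : cimage e" "x $ 3 = 0" for x by (rule inF) (unfold eq, use that in simp)
  then show ?thesis by blast
 next
  assume eq: "cmap e ` (F Int cdom e) = cimage e Int {x. x $ 3 = 0 & x $ 1 >= 0}"
  have "cinv e x : F" if "x : cimage e" "x $ 3 = 0" "x $ 1 >= 0" for x by (rule inF) (unfold eq, use that in simp)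
  moreover have "cmap e q $ 1 >= 0" if "q : F Int cdom e" for q
  proof -
   have "cmap e q : cmap e ` (F Int cdom e)" using that by blast
   then show ?thesis unfolding eq by simp
  qed
  ultimately show ?thesis by blast
 qed
qed

lemma integral_covector:
 assumes F: "!!p. p : F ==> surface_tangent_plane M F p = ksi p" and p: "p : F" "e : charts_at M p" "flattens e F"
  and R: "represents ksi e V A" "cmap e p : V"
 shows "A (cmap e p) $ 1 = 0" "A (cmap e p) $ 2 = 0" "A (cmap e p) $ 3 ~= 0"
proof -
 have ce: "p : cdom e" using charts_atD[OF p(2)] by blast
 have "A (cmap e p) \<bullet> w = 0" if "w $ 3 = 0" for w
 proof -
  have "tvec p e w : surface_tangent_plane M F p"
   unfolding surface_tangent_plane_def using tvec_tangent[OF p(2)] tvec_chart[OF p(2)] p(2,3) that by auto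
  then show ?thesis using represents_tvec[OF R(1) ce R(2)] F[OF p(1)] by simp
 qed
 then have "A (cmap e p) \<bullet> axis i 1 = 0" if "i ~= 3" for i using that by (simp add: axis_def[of i] del: inner_axis)
 from this[of 1] this[of 2]
 show "A (cmap e p) $ 1 = 0" "A (cmap e p) $ 2 = 0" by (simp_all add: inner_axis)
 then show "A (cmap e p) $ 3 ~= 0" using representsD(5)[OF R] by (auto simp: vec_eq_iff forall_3)
qed

text \<open>In a flattening chart the first two components of the covector vanish on
  \<open>F\<close>, hence so do their derivatives along \<open>F\<close>. The product of
  \<open>A\<close> with its curl reduces to \<open>A3 (d1 A2 - d2 A1)\<close>, which is then 0. At
  the boundary of \<open>F\<close> the derivatives are taken along rays into
  \<open>F\<close>.\<close>

lemma surface_noncontact: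
 assumes ksi: "smooth_field ksi" and F: "compact_smooth_surface M F" "!!p. p : F ==> surface_tangent_plane M F p = ksi p"
  and p: "p : F"
 shows "p : noncontact ksi"
proof -
 have "\<exists>e. e : charts_at M p & flattens e F" using F(1) p unfolding compact_smooth_surface_def by blast
 then obtain e where ce: "e : charts_at M p" and fl: "flattens e F" by (elim exE conjE) (rule that)
 have e: "e : atlas M" "p : cdom e" using charts_atD[OF ce] by blast+
 obtain V A where R: "represents ksi e V A" "cmap e p : V" by (rule represents_in_chart[OF ksi ce])
 note D = representsD[OF R(1)] and fD = flattensD[OF e(1) fl]
 let ?x = "cmap e p"
 obtain rho where rho: "rho > 0" "ball ?x rho <= V" using openE[OF D(4) R(2)] by blast
 have Ap: "A ?x $ 1 = 0" "A ?x $ 2 = 0" using integral_covector[OF F(2) p ce fl R] by simp_all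
 have x3: "?x $ 3 = 0" by (rule fD(1)[OF p e(2)])
 have zero: "A (?x + s *\<^sub>R w) $ 1 = 0 & A (?x + s *\<^sub>R w) $ 2 = 0" if w: "norm w = 1" "w $ 3 = 0" "w $ 1 >= 0" and s: "0 < s" "s < rho" for s and w :: "real^3"
 proof -
  let ?y = "?x + s *\<^sub>R w"
  have "?y : ball ?x rho" using s w(1) by (simp add: dist_norm)
  then have yV: "?y : V" using rho(2) by blast
  then have yc: "?y : cimage e" using D(2) by blast
  have y3: "?y $ 3 = 0" using x3 w(2) by simp
  have "cinv e ?y : F" using fD(2)
  proof
   assume "\<forall>x\<in>cimage e. x $ 3 = 0 --> cinv e x : F"
   then show ?thesis using yc y3 by blast
  next
   assume h: "(\<forall>q\<in>F Int cdom e. cmap e q $ 1 >= 0) & (\<forall>x\<in>cimage e. x $ 3 = 0 & x $ 1 >= 0 --> cinv e x : F)"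
   then have "?x $ 1 >= 0" using p e(2) by blast
   then have "?y $ 1 >= 0" using w(3) s(1) by simp
   then show ?thesis using h yc y3 by blast
  qed
  moreover have "e : charts_at M (cinv e ?y)" by (rule cinv_charts_at[OF e(1) yc])
  moreover have "cmap e (cinv e ?y) = ?y" by (rule cmap_cinv[OF yc])
  ultimately show ?thesis using integral_covector(1,2)[OF F(2) _ _ fl R(1), of "cinv e ?y"] yV by simp
 qed
 have dA: "(A has_derivative fd A ?x) (at ?x)" by (rule Cinf_on_has_derivative[OF D(3) R(2)])
 let ?D = "fd A ?x"
 have ax: "axis 1 (1 :: real) $ (3 :: 3) = 0" "axis 2 (1 :: real) $ (3 :: 3) = 0" "axis 2 (1 :: real) $ (1 :: 3) = 0"
  by (simp_all add: axis_def)
 have d2: "?D (axis 1 1) $ 2 = 0"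
  by (rule derivative_zero_on_ray[OF bounded_linear.has_derivative[OF bounded_linear_vec_nth dA] rho(1) Ap(2)])
   (rule conjunct2[OF zero], simp_all add: ax)
 have d1: "?D (axis 2 1) $ 1 = 0"
  by (rule derivative_zero_on_ray[OF bounded_linear.has_derivative[OF bounded_linear_vec_nth dA] rho(1) Ap(1)])
   (rule conjunct1[OF zero], simp_all add: ax)
 have "contact_coeff_vec A ?x = 0"
  unfolding contact_coeff_vec_eq[OF dA] by (simp add: inner_vec_def sum_3 Ap(1,2) d1 d2)
 then have "\<not> contact_at M ksi p" using contact_at_represents[OF R(1) e(2) R(2)] by simp
 then show ?thesis using cdom_subset[OF e(1)] e(2) unfolding noncontact_def by blast
qed

lemma maximal_noncontact:
 assumes "maximal_integral_surface M ksi F" "smooth_field ksi"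
 shows "noncontact ksi = F"
proof
 show "noncontact ksi <= F" using assms(1) unfolding maximal_integral_surface_def noncontact_def by blast
 show "F <= noncontact ksi" using surface_noncontact[OF assms(2)] assms(1) unfolding maximal_integral_surface_def by blast
qed

lemma maximal_integral_confoliation:
 assumes "confoliation M ksi" "maximal_integral_surface M ksi F"
 shows "integral_confoliation F ksi"
 unfolding integral_confoliation_def maximal_noncontact[OF assms(2) confoliation_smooth_field[OF assms(1)]]
 using confoliation_smooth_field[OF assms(1)] confoliation_conf_at[OF assms(1)] assms(2)
 unfolding maximal_integral_surface_def by blast

text \<open>Reachability spreads over a flat piece \<open>D\<close> around \<open>p\<close>. Either
  \<open>p\<close> has a connected open disc neighbourhood in \<open>F\<close>, or \<open>D\<close>
  sticks out of \<open>F\<close> beyond its boundary and so contains a contact point, reached by the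
  empty list.\<close>

lemma reach_local:
 assumes ksi: "smooth_field ksi" and max: "maximal_integral_surface M ksi F" and p: "p : F"
 obtains U D where "openin (mtop M) U" "p : U" "F Int U <= D" "p : D"
  "!!q q'. q : D ==> q' : D ==> reach ksi q ==> reach ksi q'"
  "(\<exists>q\<in>D. reach ksi q) \<or> (\<exists>V W. openin (mtop M) W & V = F Int W & p : V & connectedin (mtop M) V &
   subtopology (mtop M) V homeomorphic_space (euclidean :: (real^2) topology))"
proof -
 have F: "compact_smooth_surface M F" "!!p. p : F ==> surface_tangent_plane M F p = ksi p"
  using max unfolding maximal_integral_surface_def by blast+
 have NF: "noncontact ksi = F" by (rule maximal_noncontact[OF max ksi])
 have "\<exists>e. e : charts_at M p & flattens e F" using F(1) p unfolding compact_smooth_surface_def by blast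
 then obtain e where ce: "e : charts_at M p" and fl: "flattens e F" by (elim exE conjE) (rule that)
 have e: "e : atlas M" "p : cdom e" using charts_atD[OF ce] by blast+
 obtain V A where R: "represents ksi e V A" "cmap e p : V" by (rule represents_in_chart[OF ksi ce])
 note D = representsD[OF R(1)] and fD = flattensD[OF e(1) fl]
 define x0 where "x0 = cmap e p"
 have x3: "x0 $ 3 = 0" unfolding x0_def by (rule fD(1)[OF p e(2)])
 have Ap: "A x0 $ 1 = 0" "A x0 $ 2 = 0" "A x0 $ 3 ~= 0"
  using integral_covector[OF F(2) p ce fl R] unfolding x0_def by simp_all
 have cA: "continuous_on V A" by (rule Cinf_on_continuous[OF D(3)])
 have "open (V Int (%x. \<bar>A x $ 3\<bar> / 8 - (\<bar>A x $ 1\<bar> + \<bar>A x $ 2\<bar>)) -` {0<..})"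
  by (intro continuous_open_preimage D(4) open_greaterThan continuous_intros cA) simp
 moreover have "x0 : V Int (%x. \<bar>A x $ 3\<bar> / 8 - (\<bar>A x $ 1\<bar> + \<bar>A x $ 2\<bar>)) -` {0<..}"
  using R(2) Ap unfolding x0_def by simp
 ultimately obtain rho where rho: "rho > 0" "ball x0 rho <= V Int (%x. \<bar>A x $ 3\<bar> / 8 - (\<bar>A x $ 1\<bar> + \<bar>A x $ 2\<bar>)) -` {0<..}"
  using openE by blast
 \<comment> \<open>Three coordinate differences below \<open>64 * r\<close> add up to less than
   \<open>rho\<close>.\<close>
 define r where "r = rho / 200"
 have r: "r > 0" using rho(1) unfolding r_def by simp
 have near: "x : ball x0 rho" if "!!i. \<bar>x $ i - x0 $ i\<bar> < 64 * r" for x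
 proof -
  have "norm (x - x0) <= \<bar>x $ 1 - x0 $ 1\<bar> + \<bar>x $ 2 - x0 $ 2\<bar> + \<bar>x $ 3 - x0 $ 3\<bar>"
   using norm_le_l1_cart[of "x - x0"] by (simp add: sum_3)
  then have "norm (x - x0) < rho" using that[of 1] that[of 2] that[of 3] unfolding r_def by linarith
  then show ?thesis by (simp add: dist_norm norm_minus_commute)
 qed
 have ballc: "ball x0 rho <= cimage e" using rho(2) D(2) by blast
 have V: "x : V & \<bar>A x $ 1\<bar> + \<bar>A x $ 2\<bar> < \<bar>A x $ 3\<bar> / 8 & (cinv e x : noncontact ksi --> x $ 3 = x0 $ 3)"
  if "!!i. \<bar>x $ i - x0 $ i\<bar> < 64 * r" for x
 proof -
  have xb: "x : ball x0 rho" by (rule near[OF that])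
  then have xc: "x : cimage e" by (rule subsetD[OF ballc])
  have "x $ 3 = x0 $ 3" if "cinv e x : noncontact ksi"
   using fD(1)[of "cinv e x"] that NF cinv_cdom[OF xc] cmap_cinv[OF xc] x3 by simp
  moreover have "x : V Int (%x. \<bar>A x $ 3\<bar> / 8 - (\<bar>A x $ 1\<bar> + \<bar>A x $ 2\<bar>)) -` {0<..}" using xb rho(2) by blast
  then have "x : V" "\<bar>A x $ 1\<bar> + \<bar>A x $ 2\<bar> < \<bar>A x $ 3\<bar> / 8" by auto
  ultimately show ?thesis by blast
 qed
 define B where "B = {x :: real^3. \<bar>x $ 1 - x0 $ 1\<bar> < r & \<bar>x $ 2 - x0 $ 2\<bar> < r & \<bar>x $ 3 - x0 $ 3\<bar> < r}"
 have B: "\<bar>x $ i - x0 $ i\<bar> < r" if "x : B" for x and i :: 3 using that exhaust_3[of i] unfolding B_def by auto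
 have oB: "open B" unfolding B_def by (intro open_Collect_conj open_Collect_less continuous_intros)
 have Bb: "B <= ball x0 rho"
 proof
  fix x assume x: "x : B"
  have "\<bar>x $ i - x0 $ i\<bar> < 64 * r" for i using B[OF x, of i] r by linarith
  then show "x : ball x0 rho" by (rule near)
 qed
 have x0B: "x0 : B" using r unfolding B_def by simp
 \<comment> \<open>The full flat piece, also beyond the boundary of \<open>F\<close>: this is where
   the first noses start.\<close>
 define Dd where "Dd = cinv e ` {x : B. x $ 3 = x0 $ 3}"
 have pe: "cinv e x0 = p" unfolding x0_def by (rule cinv_cmap[OF e])
 show ?thesis
 proof (rule that[of "cinv e ` B" Dd])
  have Bc: "B <= cimage e" using Bb ballc by (rule subset_trans)
  show "openin (mtop M) (cinv e ` B)" by (rule openin_cinv_image[OF e(1) oB Bc])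
  show "p : cinv e ` B" using x0B pe by (intro image_eqI[of _ _ x0]) simp_all
  show "p : Dd" unfolding Dd_def using x0B pe by (intro image_eqI[of _ _ x0]) simp_all
  show "F Int cinv e ` B <= Dd"
  proof
   fix q assume "q : F Int cinv e ` B"
   then obtain x where x: "x : B" "q = cinv e x" "q : F" by blast
   have xc: "x : cimage e" using Bc x(1) by blast
   have "x $ 3 = x0 $ 3" using fD(1)[OF x(3)] x(2) cinv_cdom[OF xc] cmap_cinv[OF xc] x3 by simp
   then show "q : Dd" unfolding Dd_def using x by blast
  qed
  show "reach ksi q'" if q: "q : Dd" "q' : Dd" and rq: "reach ksi q" for q q'
  proof -
   obtain x x' where x: "x : B" "x $ 3 = x0 $ 3" "q = cinv e x" "x' : B" "x' $ 3 = x0 $ 3" "q' = cinv e x'"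
    using q unfolding Dd_def by blast
   show ?thesis unfolding x(6)
    by (rule reach_disc[OF ksi r R(1) V B[OF x(1)] x(2) B[OF x(4)] x(5)]) (use rq x(3) in simp_all)
  qed
  have main: "\<exists>V W. openin (mtop M) W & V = F Int W & p : V & connectedin (mtop M) V &
   subtopology (mtop M) V homeomorphic_space (euclidean :: (real^2) topology)"
   if s: "0 < s" "s <= rho" and inF: "!!x. x : ball x0 s ==> x $ 3 = x0 $ 3 ==> cinv e x : F" for s
  proof -
   let ?P = "{x : ball x0 s. x $ 3 = x0 $ 3}" and ?W = "cinv e ` ball x0 s"
   have sub: "ball x0 s <= cimage e" using ballc subset_ball[OF s(2)] by blast
   have Pc: "?P <= cimage e" using sub by blast
   have oW: "openin (mtop M) ?W" by (rule openin_cinv_image[OF e(1) open_ball sub])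
   have VW: "cinv e ` ?P = F Int ?W"
   proof (intro equalityI subsetI)
    fix q assume "q : cinv e ` ?P" then show "q : F Int ?W" using inF by blast
   next
    fix q assume "q : F Int ?W"
    then obtain x where x: "x : ball x0 s" "q = cinv e x" "q : F" by blast
    have xc: "x : cimage e" using x(1) by (rule subsetD[OF sub])
    have "x $ 3 = x0 $ 3" using fD(1)[OF x(3)] x(2) cinv_cdom[OF xc] cmap_cinv[OF xc] x3 by simp
    then show "q : cinv e ` ?P" using x by blast
   qed
   have "convex (ball x0 s Int {x. axis 3 1 \<bullet> x = x0 $ 3})" by (intro convex_Int convex_ball convex_hyperplane)
   moreover have "?P = ball x0 s Int {x. axis 3 1 \<bullet> x = x0 $ 3}" by (auto simp: inner_axis')
   ultimately have "connected ?P" using convex_connected by simp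
   then have "connectedin (top_of_set (cimage e)) ?P" using Pc by (simp add: connectedin_subtopology)
   then have con: "connectedin (mtop M) (cinv e ` ?P)"
    by (rule connectedin_continuous_map_image[OF continuous_cinv[OF e(1)]])
   have Vd: "cinv e ` ?P <= cdom e" by (rule cinv_image_subset[OF Pc])
   have "cmap e ` cinv e ` ?P = ?P"
   proof -
    have "cmap e ` cinv e ` ?P = (%x. x) ` ?P" unfolding image_image
     by (rule image_cong[OF refl], rule cmap_cinv, rule subsetD[OF Pc])
    then show ?thesis by simp
   qed
   then have eq: "cmap e ` (topspace (subtopology (mtop M) (cdom e)) Int cinv e ` ?P) = topspace (top_of_set (cimage e)) Int ?P"
    using Vd cdom_subset[OF e(1)] Pc by (simp add: Int_absorb1 Int_absorb2 inf.absorb2)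
   have "homeomorphic_map (subtopology (subtopology (mtop M) (cdom e)) (cinv e ` ?P)) (subtopology (top_of_set (cimage e)) ?P) (cmap e)"
    by (rule homeomorphic_map_subtopologies[OF chart_homeo[OF e(1)] eq])
   then have "homeomorphic_map (subtopology (mtop M) (cinv e ` ?P)) (top_of_set ?P) (cmap e)"
    using Vd Pc by (simp add: subtopology_subtopology Int_absorb1 inf.absorb2)
   then have "subtopology (mtop M) (cinv e ` ?P) homeomorphic_space top_of_set ?P"
    using homeomorphic_space by blast
   moreover have "top_of_set ?P homeomorphic_space (euclidean :: (real^2) topology)"
    using homeomorphic_imp_homeomorphic_space[OF plane_disc_homeomorphic[OF s(1)]] by simp
   ultimately have "subtopology (mtop M) (cinv e ` ?P) homeomorphic_space (euclidean :: (real^2) topology)"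
    by (rule homeomorphic_space_trans)
   moreover have "p : cinv e ` ?P" using pe s(1) by (intro image_eqI[of _ _ x0]) simp_all
   ultimately show ?thesis using oW VW con by metis
  qed
  show "(\<exists>q\<in>Dd. reach ksi q) \<or> (\<exists>V W. openin (mtop M) W & V = F Int W & p : V & connectedin (mtop M) V &
   subtopology (mtop M) V homeomorphic_space (euclidean :: (real^2) topology))"
   using fD(2)
  proof
   assume pl: "\<forall>x\<in>cimage e. x $ 3 = 0 --> cinv e x : F"
   have "cinv e x : F" if "x : ball x0 rho" "x $ 3 = x0 $ 3" for x
    by (rule mp[OF bspec[OF pl subsetD[OF ballc that(1)]]]) (simp add: that(2) x3)
   then show ?thesis using main[OF rho(1) order_refl] by blast
  next
   assume half: "(\<forall>q\<in>F Int cdom e. cmap e q $ 1 >= 0) & (\<forall>x\<in>cimage e. x $ 3 = 0 & x $ 1 >= 0 --> cinv e x : F)"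
   have x1: "x0 $ 1 >= 0" using half p e(2) unfolding x0_def by blast
   show ?thesis
   proof (cases "x0 $ 1 = 0")
    case True
    \<comment> \<open>A point on the far side of the boundary line of the half-plane, hence off
      \<open>F\<close>.\<close>
    define y where "y = x0 + vec3 (- r / 2) 0 0"
    have yB: "y : B" using r unfolding B_def y_def by simp
    have yc: "y : cimage e" using Bc yB by blast
    have "cinv e y ~: F"
    proof
     assume "cinv e y : F"
     then have "cmap e (cinv e y) $ 1 >= 0" using half cinv_cdom[OF yc] by blast
     then show False using cmap_cinv[OF yc] True r by (simp add: y_def)
    qed
    then have "reach ksi (cinv e y)" unfolding reach_def NF by (intro exI[of _ "[]"]) simp
    moreover have "y $ 3 = x0 $ 3" by (simp add: y_def)
    ultimately show ?thesis using yB unfolding Dd_def by blast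
   next
    case False
    define s where "s = min rho (x0 $ 1)"
    have s: "0 < s" "s <= rho" "s <= x0 $ 1" using rho(1) x1 False unfolding s_def by auto
    have "cinv e x : F" if x: "x : ball x0 s" "x $ 3 = x0 $ 3" for x
    proof -
     have "x : ball x0 rho" using x(1) s(2) by simp
     then have xc: "x : cimage e" by (rule subsetD[OF ballc])
     have "\<bar>x0 $ 1 - x $ 1\<bar> <= dist x0 x" using component_le_norm_cart[of "x0 - x" 1] by (simp add: dist_norm)
     then have "x $ 1 >= 0" using x(1) s(3) by (simp add: abs_le_iff)
     then show ?thesis using mp[OF bspec[OF conjunct2[OF half] xc]] x(2) x3 by simp
    qed
    then show ?thesis using main[OF s(1,2)] by blast
   qed
  qed
 qed
qed

text \<open>The component of \<open>p\<close> has a boundary point \<open>b\<close>. A connected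
  disc neighbourhood of \<open>b\<close> in \<open>F\<close> would lie in the component and make
  \<open>b\<close> an interior point, so reachability starts near \<open>b\<close>. Reached and
  unreached points both form open subsets of the component, and connectedness leaves the first
  only.\<close>

lemma component_reach:
 assumes ksi: "smooth_field ksi" and max: "maximal_integral_surface M ksi F" and p: "p : F"
 shows "reach ksi p"
proof -
 have FM: "F <= points M" using max unfolding maximal_integral_surface_def compact_smooth_surface_def
  using compactin_subset_topspace by blast
 then have tF: "topspace (subtopology (mtop M) F) = F" by auto
 obtain C where C: "C : connected_components_of (subtopology (mtop M) F)" "p : C"
  using Union_connected_components_of[of "subtopology (mtop M) F"] p tF by blast
 have CF: "C <= F" using connected_components_of_subset[OF C(1)] tF by simp
 have con: "connectedin (mtop M) C" using connectedin_connected_components_of[OF C(1)] by (simp add: connectedin_subtopology)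
 define P where "P p U D \<longleftrightarrow> openin (mtop M) U & p : U & F Int U <= D & p : D &
  (\<forall>q q'. q : D --> q' : D --> reach ksi q --> reach ksi q') &
  ((\<exists>q\<in>D. reach ksi q) \<or> (\<exists>V W. openin (mtop M) W & V = F Int W & p : V & connectedin (mtop M) V &
   subtopology (mtop M) V homeomorphic_space (euclidean :: (real^2) topology)))" for p U D
 have "\<exists>U D. P p U D" if pF: "p : F" for p
 proof (rule reach_local[OF ksi max pF], intro exI)
  fix U D
  assume a: "openin (mtop M) U" "p : U" "F Int U <= D" "p : D"
   "!!q q'. q : D ==> q' : D ==> reach ksi q ==> reach ksi q'"
   "(\<exists>q\<in>D. reach ksi q) \<or> (\<exists>V W. openin (mtop M) W & V = F Int W & p : V & connectedin (mtop M) V &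
    subtopology (mtop M) V homeomorphic_space (euclidean :: (real^2) topology))"
  show "P p U D" unfolding P_def
   by (intro conjI allI impI, rule a(1), rule a(2), rule a(3), rule a(4), erule (2) a(5), rule a(6))
 qed
 then obtain U D where UD: "!!p. p : F ==> P p (U p) (D p)" by metis
 have oU: "openin (mtop M) (U q)" "q : U q" "F Int U q <= D q" "q : D q" if "q : F" for q
  using UD[OF that] unfolding P_def by blast+
 have spread: "reach ksi q''" if "q : F" "q' : D q" "q'' : D q" "reach ksi q'" for q q' q''
  using UD[OF that(1)] that unfolding P_def by blast
 have "surface_boundary (mtop M) C ~= {}" using max C(1) unfolding maximal_integral_surface_def by blast
 then obtain b where b: "b : C" "!!V. b : V ==> openin (subtopology (mtop M) C) V ==>
  \<not> subtopology (mtop M) V homeomorphic_space (euclidean :: (real^2) topology)"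
  unfolding surface_boundary_def by blast
 have bF: "b : F" using b(1) CF by blast
 have "\<exists>q\<in>D b. reach ksi q"
 proof (rule ccontr)
  assume "\<not> (\<exists>q\<in>D b. reach ksi q)"
  then obtain V W where V: "openin (mtop M) W" "V = F Int W" "b : V" "connectedin (mtop M) V"
   "subtopology (mtop M) V homeomorphic_space (euclidean :: (real^2) topology)"
   using UD[OF bF] unfolding P_def by blast
  have "connectedin (subtopology (mtop M) F) V" using V(2,4) by (simp add: connectedin_subtopology)
  moreover have "\<not> disjnt C V" using b(1) V(3) by (auto simp: disjnt_def)
  ultimately have "V <= C" using connected_components_of_maximal[OF C(1)] by blast
  then have "V = W Int C" using V(2) CF by blast
  then have "openin (subtopology (mtop M) C) V" unfolding openin_subtopology using V(1) by blast
  then show False using b(2) V(3,5) by blast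
 qed
 then have rb: "reach ksi b" using spread[OF bF] oU(4)[OF bF] by blast
 let ?E1 = "\<Union>q\<in>{q : C. reach ksi q}. U q" and ?E2 = "\<Union>q\<in>{q : C. \<not> reach ksi q}. U q"
 show ?thesis
 proof (rule ccontr)
  assume np: "\<not> reach ksi p"
  have "openin (mtop M) ?E1" "openin (mtop M) ?E2" using oU(1) CF by blast+
  moreover have "C <= ?E1 Un ?E2" using oU(2) CF by blast
  moreover have "?E1 Int C ~= {}" "?E2 Int C ~= {}" using b(1) rb oU(2)[OF bF] C(2) np oU(2)[OF p] by blast+
  moreover have "?E1 Int ?E2 Int C = {}"
  proof -
   have False if x: "x : C" "x : U q" "q : C" "reach ksi q" "x : U q'" "q' : C" "\<not> reach ksi q'" for x q q'
   proof -
    have F: "x : F" "q : F" "q' : F" using x CF by blast+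
    have "x : D q" "x : D q'" using oU(3)[OF F(2)] oU(3)[OF F(3)] F(1) x by blast+
    then have "reach ksi q'" using spread[OF F(2) oU(4)[OF F(2)] _ x(4)] spread[OF F(3) _ oU(4)[OF F(3)]] by blast
    then show False using x(7) by blast
   qed
   then show ?thesis by blast
  qed
  ultimately show False using con unfolding connectedin by blast
 qed
qed

text \<open>Finitely many sequences suffice by compactness. They can be put one after the other,
  since a sequence stays valid when fewer degenerate points are present.\<close>

lemma covering_noses:
 assumes ksi: "smooth_field ksi" and max: "maximal_integral_surface M ksi F"
 obtains L where "!!n. n : set L ==> nose_chart ksi n" "valid_noses (noncontact ksi) L" "noncontact ksi <= covered L"
proof -
 have NF: "noncontact ksi = F" by (rule maximal_noncontact[OF max ksi])
 have Fc: "compactin (mtop M) F" using max unfolding maximal_integral_surface_def compact_smooth_surface_def by blast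
 define G where "G L \<longleftrightarrow> (\<forall>n\<in>set L. nose_chart ksi n) & valid_noses (noncontact ksi) L" for L
 have "\<exists>L. G L & p ~: noncontact ksi - covered L" if "p : F" for p
  using component_reach[OF ksi max that] unfolding reach_def G_def by blast
 then obtain l where l: "!!p. p : F ==> G (l p)" "!!p. p : F ==> p ~: noncontact ksi - covered (l p)" by metis
 let ?O = "%p. points M - (noncontact ksi - covered (l p))"
 have FM: "F <= points M" using compactin_subset_topspace[OF Fc] .
 have "\<exists>\<F>. finite \<F> & \<F> <= ?O ` F & F <= \<Union>\<F>"
  by (rule compactinD[OF Fc]) (use openin_reached[OF ksi] l FM in \<open>auto simp: G_def\<close>)
 then obtain \<F> where \<F>: "finite \<F>" "\<F> <= ?O ` F" "F <= \<Union>\<F>" by blast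
 obtain P where P: "P <= F" "finite P" "\<F> = ?O ` P" using finite_subset_image[OF \<F>(1,2)] by blast
 have "\<exists>L. G L & (\<Union>p\<in>P. covered (l p)) <= covered L" using P(2,1)
 proof (induction P rule: finite_induct)
  case empty
  show ?case by (intro exI[of _ "[]"]) (simp add: G_def)
 next
  case (insert p P)
  then obtain L where L: "G L" "(\<Union>p\<in>P. covered (l p)) <= covered L" by auto
  have gp: "G (l p)" using l(1) insert.prems by blast
  have "valid_noses (noncontact ksi - covered L) (l p)"
   by (rule valid_noses_mono[of "noncontact ksi"]) (use gp G_def in auto)
  then have "G (L @ l p)" using L(1) gp unfolding G_def valid_noses_append by auto
  moreover have "covered (L @ l p) = covered L Un covered (l p)" unfolding covered_def by auto
  ultimately show ?case using L(2) by (intro exI[of _ "L @ l p"]) auto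
 qed
 then obtain L where L: "G L" "(\<Union>p\<in>P. covered (l p)) <= covered L" by blast
 show ?thesis
 proof (rule that[of L])
  show "noncontact ksi <= covered L"
  proof
   fix q assume q: "q : noncontact ksi"
   then obtain p where "p : P" "q : ?O p" using NF \<F>(3) P(3) by blast
   then show "q : covered L" using q L(2) by blast
  qed
 qed (use L(1) in \<open>auto simp: G_def\<close>)
qed

end

section \<open>Families of contact structures\<close>

definition rot :: "real^3 => real^3" where "rot y = vec3 (- (y $ 2)) (y $ 1) (y $ 3)"

lemma linear_rot: "linear rot"
 unfolding rot_def by (rule linearI) (simp_all add: vec_eq_iff forall_3)

lemma frechet_derivative_linear: "linear f ==> fd f x = f" for f :: "real^3 => real^3"
 by (rule frechet_derivative_at[symmetric]) (simp add: bounded_linear_imp_has_derivative linear_conv_bounded_linear)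

lemma Cinf_on_rot: "Cinf_on UNIV rot"
 unfolding rot_def[abs_def] by (intro smooth_intros) auto

lemma rot_cube: "rot ` cube r = cube r" "y : ccube r \<longleftrightarrow> rot y : ccube r"
proof -
 have "rot (vec3 (x $ 2) (- (x $ 1)) (x $ 3)) = x" for x by (simp add: rot_def vec_eq_iff forall_3)
 moreover have "vec3 (x $ 2) (- (x $ 1)) (x $ 3) : cube r" if "x : cube r" for x using that unfolding mem_cube by simp
 ultimately have "x : rot ` cube r" if "x : cube r" for x using that by (metis imageI)
 moreover have "rot x : cube r" if "x : cube r" for x using that unfolding mem_cube by (simp add: rot_def)
 ultimately show "rot ` cube r = cube r" by blast
 show "y : ccube r \<longleftrightarrow> rot y : ccube r" unfolding mem_ccube by (auto simp: rot_def)
qed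

lemma rot_inj: "inj rot" by (rule injI) (simp add: rot_def vec_eq_iff forall_3)

lemma rot_det: "det (matrix (fd rot x)) > 0"
 unfolding frechet_derivative_linear[OF linear_rot] by (simp add: det_3 matrix_def axis_def rot_def)

context closed_manifold
begin

lemma ker_at_eq:
 assumes "c : charts_at M p" "a $ 3 = 1" "b $ 3 = 1" "ker_at p c a = ker_at p c b"
 shows "a = b"
proof -
 have "a ~= 0" using assms(2) by auto
 then obtain r where "b = r *\<^sub>R a" by (rule same_kernel_proportional[OF assms(1) _ assms(4)])
 then show ?thesis using assms(2,3) by simp
qed

section \<open>Local constancy of contact families\<close>

definition contact_family :: "(real => 'a plane_field) => bool" where
 "contact_family zeta \<longleftrightarrow> smooth_family zeta & (\<forall>p\<in>points M. contact_at M (zeta 0) p)"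

lemma contact_family_admissible:
 assumes "contact_family zeta"
 shows "admissible (%_. {}) zeta"
proof -
 have zeta: "smooth_family zeta" "!!p. p : points M ==> contact_at M (zeta 0) p" using assms unfolding contact_family_def by blast+
 obtain e1 where e1: "e1 > 0" "!!t p. \<bar>t\<bar> < e1 ==> p : points M ==> contact_at M (zeta t) p"
  using contact_persists[OF zeta(1) compact_points[unfolded compact_space_def] zeta(2)] by metis
 obtain e2 where e2: "e2 > 0" "!!t. \<bar>t\<bar> < e2 ==> smooth_field (zeta t)"
  by (rule smooth_family_smooth_field[OF zeta(1)]; (assumption | rule that))
 have "integral_confoliation {} (zeta t)" if t: "\<bar>t\<bar> < min e1 e2" for t
 proof -
  have sf: "smooth_field (zeta t)" and ct: "!!p. p : points M ==> contact_at M (zeta t) p" using e1 e2 t by auto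
  have "conf_at (zeta t) p" if p: "p : points M" for p
  proof -
   obtain c V A where R: "represents (zeta t) c V A" "p : cdom c" "cmap c p : V"
    using sf p unfolding smooth_field_def by blast
   show ?thesis using contact_at_represents[OF R] conf_at_represents[OF R] ct[OF p] by simp
  qed
  moreover have "noncontact (zeta t) = {}" using ct unfolding noncontact_def by blast
  ultimately show ?thesis unfolding integral_confoliation_def compact_smooth_surface_def using sf by simp
 qed
 then show ?thesis unfolding admissible_def using zeta(1) e1(1) e2(1) by (intro conjI exI[of _ "min e1 e2"]) auto
qed

text \<open>The coefficient \<open>h\<close> is replaced near the centre of the chart by its value
  at parameter 0, while \<open>k\<close> is kept, as changes in one chart require. At parameter 0
  nothing changes, so the new planes are contact for small parameters by persistence.\<close>

lemma homotopy_step: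
 assumes cf: "contact_family zeta" and c: "c : atlas M" and cone: "!!x. x : ccube 2 ==> cone (zeta 0) c x"
 obtains zeta' e where "contact_family zeta'" "equivalent zeta zeta'" "zeta' 0 = zeta 0" "e > 0"
  "!!t p. \<bar>t\<bar> < e ==> zeta t p = zeta 0 p ==> zeta' t p = zeta 0 p"
  "!!t x. \<bar>t\<bar> < e ==> x : ccube (1 / 2) ==> \<exists>k h k0 h0. zeta t (cinv c x) = ker_at (cinv c x) c (vec3 k h 1) &
   zeta 0 (cinv c x) = ker_at (cinv c x) c (vec3 k0 h0 1) & zeta' t (cinv c x) = ker_at (cinv c x) c (vec3 k h0 1)"
proof -
 have sf: "smooth_family zeta" and ct: "!!p. p : points M ==> contact_at M (zeta 0) p" using cf unfolding contact_family_def by blast+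
 obtain e W1 h k where W1: "e > 0" "!!t x. \<bar>t\<bar> < e ==> x : ccube 2 ==> (t, x) : W1" "Cinf_on W1 h" "Cinf_on W1 k"
  "fam_rep zeta c W1 (%tx. vec3 (k tx) (h tx) 1)" "!!tx. tx : W1 ==> \<bar>k tx\<bar> < 1 / 8"
  by (rule cone_family[OF sf c compact_cbox cone]; (assumption | rule that))
 have o0: "open {x. (0, x) : W1}" by (rule representsD(4)[OF fam_rep_slice[OF W1(5)]])
 define W where "W = W1 Int UNIV \<times> {x. (0, x) : W1}"
 have oW: "open W" unfolding W_def by (intro open_Int open_Times open_UNIV o0 Cinf_on_open[OF W1(3)])
 have WW: "W <= W1" unfolding W_def by blast
 have inW: "(t, x) : W" if "\<bar>t\<bar> < e" "x : ccube 2" for t x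
  unfolding W_def using W1(2)[OF that] W1(2)[of 0 x] W1(1) that(2) by simp
 have hk: "Cinf_on W h" "Cinf_on W k" by (rule Cinf_on_subset[OF _ oW WW], rule W1)+
 have fr: "fam_rep zeta c W (%tx. vec3 (k tx) (h tx) 1)" by (rule fam_rep_restrict[OF W1(5) oW WW])
 have kb: "\<bar>k tx\<bar> < 1 / 8" if "tx : W" for tx by (rule W1(6)[OF subsetD[OF WW that]])
 have sub: "ccube (1 / 2) <= cube 1" "ccube 1 <= ccube 2" "cube 2 <= ccube 2" "cube 1 <= ccube 1" "cube 1 <= ccube 2"
  unfolding subset_iff mem_cube mem_ccube by auto
 obtain rho :: "real^3 => real" and U C where rho: "Cinf_on UNIV rho" "!!x. 0 <= rho x" "!!x. rho x <= 1"
  "open U" "ccube (1 / 2) <= U" "!!x. x : U ==> rho x = 1" and C: "compact C" "C <= cube 1" "!!x. x ~: C ==> rho x = 0"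
  by (rule smooth_bump[OF compact_cbox open_box sub(1)], rule that)
 define g where "g tx = h tx + rho (snd tx) * (h (0, snd tx) - h tx)" for tx
 have sn: "Cinf_on W snd" using Cinf_on_snd[OF Cinf_on_ident[OF oW]] by simp
 have h0: "Cinf_on W (%tx. h (0, snd tx))"
  by (rule Cinf_on_compose[OF sn Cinf_on_slice[OF W1(3) o0]]) (auto simp: W_def)
 have sg: "Cinf_on W g" unfolding g_def by (intro smooth_intros hk h0 Cinf_on_compose_UNIV[OF rho(1) sn])
 have v0: "vec3 a b 1 ~= 0" for a b :: real by (simp add: vec_eq_iff forall_3)
 have im: "ccube 2 <= cimage c" using cone unfolding cone_def by blast
 have Cc: "C <= ccube 1" "C <= ccube 2" using C(2) sub by blast+
 have Ci: "C <= cimage c" using Cc(2) im by (rule subset_trans)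
 have C0: "(0, x) : W" if "x : C" for x by (rule inW) (use W1(1) subsetD[OF Cc(2) that] in simp_all)
 define zeta' where "zeta' = perturb c C (%tx. vec3 (k tx) (g tx) 1) zeta"
 have g_out: "g (t, x) = h (t, x)" if "x ~: C" for t x using C(3)[OF that] by (simp add: g_def)
 note pf = perturb_family[OF sf fr C(1) Ci C0, of "%tx. vec3 (k tx) (g tx) 1", folded zeta'_def]
 have smB: "Cinf_on W (%tx. vec3 (k tx) (g tx) 1)" by (intro smooth_intros hk sg oW)
 have pf: "fam_rep zeta' c W (%tx. vec3 (k tx) (g tx) 1)" "smooth_family zeta'"
  by (rule pf; use smB v0 g_out in simp)+
 have krn: "zeta t (cinv c x) = ker_at (cinv c x) c (vec3 (k (t, x)) (h (t, x)) 1)"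
  "zeta' t (cinv c x) = ker_at (cinv c x) c (vec3 (k (t, x)) (g (t, x)) 1)" if "(t, x) : W" for t x
  using fr pf(1) that unfolding fam_rep_def by blast+
 \<comment> \<open>Planes that already agree with those at parameter 0 are not disturbed, so
   progress made in other charts is not lost.\<close>
 have keep: "zeta' t p = zeta 0 p" if t: "\<bar>t\<bar> < e" and eq: "zeta t p = zeta 0 p" for t p
 proof (cases "p : cinv c ` C")
  case True
  then obtain x where x: "x : C" "p = cinv c x" by blast
  have w: "(t, x) : W" "(0, x) : W" using inW[OF t subsetD[OF Cc(2) x(1)]] C0[OF x(1)] .
  have cx: "c : charts_at M (cinv c x)" by (rule cinv_charts_at[OF c subsetD[OF Ci x(1)]])
  have "ker_at (cinv c x) c (vec3 (k (t, x)) (h (t, x)) 1) = ker_at (cinv c x) c (vec3 (k (0, x)) (h (0, x)) 1)"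
   using krn(1)[OF w(1)] krn(1)[OF w(2)] eq unfolding x(2) by (metis (no_types))
  then have "vec3 (k (t, x)) (h (t, x)) 1 = vec3 (k (0, x)) (h (0, x)) 1" by (rule ker_at_eq[OF cx vector_3(3) vector_3(3)])
  then have "k (t, x) = k (0, x)" "h (t, x) = h (0, x)" by (auto simp: vec_eq_iff forall_3)
  then show ?thesis unfolding x(2) krn(2)[OF w(1)] krn(1)[OF w(2)] by (simp add: g_def)
 qed (simp add: zeta'_def perturb_def eq)
 have z0: "zeta' 0 = zeta 0" by (rule ext, rule keep) (use W1(1) in simp_all)
 obtain e1 where e1: "e1 > 0" "!!t p. \<bar>t\<bar> < e1 ==> p : points M ==> contact_at M (zeta' t) p"
  using contact_persists[OF pf(2) compact_points[unfolded compact_space_def]] ct unfolding z0 by metis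
 have m: "min e e1 > 0" using W1(1) e1(1) by simp
 have key: "slice_contact g k t x > 0" if t: "\<bar>t\<bar> < min e e1" and x: "x : cube 2" for t x
 proof -
  have sl: "y : cube 2 ==> (t, y) : W" for y using inW[OF _ subsetD[OF sub(3)]] t by simp
  have sub': "cube 2 <= {x. (t, x) : W}" using sl by blast
  have xi: "x : cimage c" using x sub(3) im by blast
  have R: "represents (zeta' t) c (cube 2) (nf_covector (%x. g (t, x)) (%x. k (t, x)))"
   using represents_subset[OF fam_rep_slice[OF pf(1)] sub' open_box] unfolding nf_covector_def[abs_def] .
  have "contact_at M (zeta' t) (cinv c x)" using e1(2) t subsetD[OF cdom_subset[OF c] cinv_cdom[OF xi]] by simp
  then show ?thesis
   using contact_at_nf(1)[OF R Cinf_on_slice[OF sg open_box sl] Cinf_on_slice[OF hk(2) open_box sl] cinv_cdom[OF xi]]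
    cmap_cinv[OF xi] x by simp
 qed
 note step = family_cube_step[OF contact_family_admissible[OF cf] c W1(1) inW hk fr kb sg C(1) Cc(1) g_out m, folded zeta'_def]
 have eqv: "equivalent zeta zeta'" by (rule step(2)) (use key in \<open>auto intro: less_imp_le\<close>)
 show ?thesis
 proof (rule that[OF _ eqv z0 W1(1) keep])
  show "contact_family zeta'" unfolding contact_family_def z0 using pf(2) ct by blast
  fix t x assume t: "\<bar>t\<bar> < e" and x: "x : ccube (1 / 2)"
  have x2: "x : ccube 2" using x sub(1,5) by blast
  have w: "(t, x) : W" "(0, x) : W" using inW[OF t x2] inW[of 0, OF _ x2] W1(1) by simp_all
  have gh: "g (t, x) = h (0, x)" using rho(6)[OF subsetD[OF rho(5) x]] by (simp add: g_def)
  show "\<exists>k h k0 h0. zeta t (cinv c x) = ker_at (cinv c x) c (vec3 k h 1) &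
   zeta 0 (cinv c x) = ker_at (cinv c x) c (vec3 k0 h0 1) & zeta' t (cinv c x) = ker_at (cinv c x) c (vec3 k h0 1)"
   by (intro exI conjI, rule krn(1)[OF w(1)], rule krn(1)[OF w(2)], unfold krn(2)[OF w(1)] gh, rule refl)
 qed
qed

text \<open>A plane near the horizontal one has two coefficients. The first step freezes
  \<open>h\<close>; after a quarter turn of the x- and y-axes the coefficient \<open>k\<close>
  takes, up to sign, the place of \<open>h\<close>, and the second step freezes it.\<close>

lemma homotopy_chart_step:
 assumes cf: "contact_family zeta" and R: "represents (zeta 0) c (cube 3) A"
  and A: "!!x. x : cube 3 ==> \<bar>A x $ 1\<bar> + \<bar>A x $ 2\<bar> < \<bar>A x $ 3\<bar> / 8"
 obtains zeta' e where "contact_family zeta'" "equivalent zeta zeta'" "zeta' 0 = zeta 0" "e > 0"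
  "!!t p. \<bar>t\<bar> < e ==> zeta t p = zeta 0 p ==> zeta' t p = zeta 0 p"
  "!!t p. \<bar>t\<bar> < e ==> p : cinv c ` ccube (1 / 2) ==> zeta' t p = zeta 0 p"
proof -
 note D = representsD[OF R]
 have sub: "ccube 2 <= cube 3" "ccube (1 / 2) <= cube 3" unfolding subset_iff mem_cube mem_ccube by auto
 have cone1: "cone (zeta 0) c x" if "x : ccube 2" for x
  using cone_represents[OF R subsetD[OF sub(1) that]] A[OF subsetD[OF sub(1) that]] by simp
 have rs: "rot ` cube 3 <= cube 3" using rot_cube(1) by blast
 obtain d where d: "d : atlas M" "cimage d = cube 3" "!!y. y : cube 3 ==> cinv d y = cinv c (rot y)"
  "!!ksi V A. represents ksi c V A ==> rot ` cube 3 <= V ==> represents ksi d (cube 3) (cov_pull rot A)"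
  by (rule chart_pullback[OF D(1) Cinf_on_subset[OF Cinf_on_rot open_box subset_UNIV] inj_on_subset[OF rot_inj subset_UNIV] order_trans[OF rs D(2)] rot_det], rule that)
 have Rd: "represents (zeta 0) d (cube 3) (cov_pull rot A)" by (rule d(4)[OF R rs])
 have cone2: "cone (zeta 0) d y" if y: "y : ccube 2" for y
 proof -
  have y3: "y : cube 3" "rot y : cube 3" using subsetD[OF sub(1) y] rs by blast+
  have "cov_pull rot A y $ 1 = A (rot y) $ 2" "cov_pull rot A y $ 3 = A (rot y) $ 3"
   by (simp_all add: cov_pull_def frechet_derivative_linear[OF linear_rot] rot_def axis_def inner_vec_def sum_3)
  then show ?thesis using cone_represents[OF Rd y3(1)] A[OF y3(2)] by simp
 qed
 obtain zeta1 e1 where 1: "contact_family zeta1" "equivalent zeta zeta1" "zeta1 0 = zeta 0" "e1 > 0"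
  "!!t p. \<bar>t\<bar> < e1 ==> zeta t p = zeta 0 p ==> zeta1 t p = zeta 0 p"
  "!!t x. \<bar>t\<bar> < e1 ==> x : ccube (1 / 2) ==> \<exists>k h k0 h0. zeta t (cinv c x) = ker_at (cinv c x) c (vec3 k h 1) &
   zeta 0 (cinv c x) = ker_at (cinv c x) c (vec3 k0 h0 1) & zeta1 t (cinv c x) = ker_at (cinv c x) c (vec3 k h0 1)"
  by (rule homotopy_step[OF cf D(1) cone1]; (assumption | rule that))
 have cone2': "cone (zeta1 0) d y" if "y : ccube 2" for y unfolding 1(3) by (rule cone2[OF that])
 obtain zeta2 e2 where 2: "contact_family zeta2" "equivalent zeta1 zeta2" "zeta2 0 = zeta1 0" "e2 > 0"
  "!!t p. \<bar>t\<bar> < e2 ==> zeta1 t p = zeta1 0 p ==> zeta2 t p = zeta1 0 p"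
  "!!t x. \<bar>t\<bar> < e2 ==> x : ccube (1 / 2) ==> \<exists>k h k0 h0. zeta1 t (cinv d x) = ker_at (cinv d x) d (vec3 k h 1) &
   zeta1 0 (cinv d x) = ker_at (cinv d x) d (vec3 k0 h0 1) & zeta2 t (cinv d x) = ker_at (cinv d x) d (vec3 k h0 1)"
  by (rule homotopy_step[OF 1(1) d(1) cone2']; (assumption | rule that))
 show ?thesis
 proof (rule that[of zeta2 "min e1 e2"])
  show "contact_family zeta2" "equivalent zeta zeta2" "zeta2 0 = zeta 0" "min e1 e2 > 0"
   using 2(1,3,4) 1(3,4) equivalent_trans[OF 1(2) 2(2)] by simp_all
  show "zeta2 t p = zeta 0 p" if "\<bar>t\<bar> < min e1 e2" "zeta t p = zeta 0 p" for t p
   using 2(5)[of t p] 1(5)[of t p] 1(3) that by simp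
  fix t p assume t: "\<bar>t\<bar> < min e1 e2" and "p : cinv c ` ccube (1 / 2)"
  then obtain x where x: "x : ccube (1 / 2)" "p = cinv c x" by blast
  have t1: "\<bar>t\<bar> < e1" and t2: "\<bar>t\<bar> < e2" using t by simp_all
  define y where "y = vec3 (x $ 2) (- (x $ 1)) (x $ 3)"
  have ry: "rot y = x" unfolding y_def rot_def by (simp add: vec_eq_iff forall_3)
  have y: "y : ccube (1 / 2)" using x(1) rot_cube(2)[of y] ry by simp
  have y3: "y : cube 3" by (rule subsetD[OF sub(2) y])
  have py: "p = cinv d y" using d(3)[OF y3] ry x(2) by simp
  have xc: "x : cimage c" using subsetD[OF sub(2) x(1)] D(2) by blast
  have yd: "y : cimage d" using y3 d(2) by simp
  have ch: "c : charts_at M p" "d : charts_at M p"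
   using cinv_charts_at[OF D(1) xc] cinv_charts_at[OF d(1) yd] x(2) py by simp_all
  have mp: "cmap d p = y" unfolding py by (rule cmap_cinv[OF yd])
  have "(transition d c has_derivative rot) (at y)"
  proof (rule has_derivative_transform_within_open[of rot rot y UNIV "cube 3"])
   show "(rot has_derivative rot) (at y)"
    by (simp add: bounded_linear_imp_has_derivative linear_conv_bounded_linear[symmetric] linear_rot)
   show "rot z = transition d c z" if z: "z : cube 3" for z
   proof -
    have "rot z : cimage c" using z rs D(2) by blast
    then show ?thesis using d(3)[OF z] cmap_cinv[of "rot z" c] by simp
   qed
  qed (use y3 open_box in auto)
  then have fd: "fd (transition d c) (cmap d p) = rot" unfolding mp by (rule frechet_derivative_at[symmetric])
  have turn: "ker_at p c (vec3 k h 1) = ker_at p d (vec3 h (- k) 1)" for k h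
  proof -
   have "vec3 k h 1 \<bullet> v c = vec3 h (- k) 1 \<bullet> v d" if "v : tangent_space M p" for v
    using tangent_change[OF ch(2,1) that] unfolding fd by (simp add: rot_def inner_vec_def sum_3)
   then show ?thesis by auto
  qed
  obtain k h k0 h0 where a: "zeta 0 p = ker_at p c (vec3 k0 h0 1)" "zeta1 t p = ker_at p c (vec3 k h0 1)"
   using 1(6)[OF t1 x(1), folded x(2)] by (elim exE conjE) (rule that)
  obtain k' h' k0' h0' where b: "zeta1 t p = ker_at p d (vec3 k' h' 1)" "zeta 0 p = ker_at p d (vec3 k0' h0' 1)"
   "zeta2 t p = ker_at p d (vec3 k' h0' 1)"
   using 2(6)[OF t2 y, folded py, unfolded 1(3)] by (elim exE conjE) (rule that)
  have "vec3 h0 (- k) 1 = vec3 k' h' 1"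
   by (rule ker_at_eq[OF ch(2) vector_3(3) vector_3(3) trans[OF trans[OF turn[symmetric] a(2)[symmetric]] b(1)]])
  moreover have "vec3 h0 (- k0) 1 = vec3 k0' h0' 1"
   by (rule ker_at_eq[OF ch(2) vector_3(3) vector_3(3) trans[OF trans[OF turn[symmetric] a(1)[symmetric]] b(2)]])
  ultimately have "k' = k0'" by (auto simp: vec_eq_iff forall_3)
  then show "zeta2 t p = zeta 0 p" unfolding b(2,3) by simp
 qed
qed

text \<open>An affine change of coordinates places the first two axes in the plane at
  \<open>p\<close> and the third along its covector; continuity gives the inequality on a small
  cube, which is rescaled to \<open>cube 3\<close>.\<close>

lemma adapted_chart:
 assumes ksi: "smooth_field ksi" and p: "p : points M"
 obtains c A where "represents ksi c (cube 3) A" "!!x. x : cube 3 ==> \<bar>A x $ 1\<bar> + \<bar>A x $ 2\<bar> < \<bar>A x $ 3\<bar> / 8" "p : cinv c ` cube (1 / 2)"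
proof -
 obtain d V A where R: "represents ksi d V A" and q: "p : cdom d" "cmap d p : V" using ksi p unfolding smooth_field_def by blast
 note D = representsD[OF R]
 define x0 a where "x0 = cmap d p" and "a = A (cmap d p)"
 have Ax: "A x0 = a" by (simp add: x0_def a_def)
 have a0: "a ~= 0" unfolding a_def by (rule D(5)[OF q(2)])
 \<comment> \<open>Some nonzero vector orthogonal to \<open>a\<close>; the alternative covers an
   \<open>a\<close> on the third axis, where the first formula gives 0.\<close>
 define f1 where "f1 = (if a $ 1 ~= 0 \<or> a $ 2 ~= 0 then vec3 (- (a $ 2)) (a $ 1) 0 else axis 1 1)"
 have f1: "f1 ~= 0" "a \<bullet> f1 = 0"
  unfolding f1_def by (auto simp: vec_eq_iff forall_3 axis_def inner_vec_def sum_3)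
 define f2 where "f2 = cross3 a f1"
 have f2: "a \<bullet> f2 = 0" unfolding f2_def by (rule dot_cross_self)
 have cA: "continuous_on V A" by (rule Cinf_on_continuous[OF D(3)])
 let ?S = "V Int (%x. \<bar>A x \<bullet> a\<bar> / 8 - (\<bar>A x \<bullet> f1\<bar> + \<bar>A x \<bullet> f2\<bar>)) -` {0<..}"
 have "open ?S" by (intro continuous_open_preimage D(4) open_greaterThan continuous_intros cA) simp
 moreover have "x0 : ?S" using q(2)[folded x0_def] f1(2) f2 a0 by (simp add: Ax)
 ultimately obtain rho where rho: "rho > 0" "ball x0 rho <= ?S" using openE by blast
 define n where "n = norm f1 + norm f2 + norm a"
 have n: "n > 0" unfolding n_def using a0 by (simp add: add_nonneg_pos)
 define s where "s = rho / (4 * n)"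
 have s: "s > 0" "3 * s * n < rho" unfolding s_def using rho(1) n by simp_all
 define DT where "DT y = s *\<^sub>R (y $ 1 *\<^sub>R f1 + y $ 2 *\<^sub>R f2 + y $ 3 *\<^sub>R a)" for y :: "real^3"
 define T where "T y = x0 + DT y" for y
 have linDT: "linear DT" unfolding DT_def by (rule linearI) (simp_all add: algebra_simps)
 have smT: "Cinf_on UNIV T" unfolding T_def[abs_def] DT_def by (intro smooth_intros) auto
 have bl: "bounded_linear DT" using linDT by (simp add: linear_conv_bounded_linear)
 have "(T has_derivative DT) (at y)" for y
 proof -
  have "(T has_derivative (%w. 0 + DT w)) (at y)" unfolding T_def[abs_def]
   by (intro has_derivative_add has_derivative_const bounded_linear_imp_has_derivative[OF bl])
  then show ?thesis by simp
 qed
 then have fT: "fd T y = DT" for y by (rule frechet_derivative_at[symmetric])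
 have DTa: "DT (axis 1 1) = s *\<^sub>R f1" "DT (axis 2 1) = s *\<^sub>R f2" "DT (axis 3 1) = s *\<^sub>R a" by (simp_all add: DT_def axis_def)
 have "det (matrix DT) = s * s * s * (f1 \<bullet> cross3 f2 a)"
  unfolding linear_inverse_real3(1)[OF linDT] DTa by (simp add: cross_mult_left cross_mult_right)
 also have "f1 \<bullet> cross3 f2 a = (a \<bullet> a) * (f1 \<bullet> f1) - (a \<bullet> f1)\<^sup>2"
  unfolding f2_def by (simp add: cross3_def inner_vec_def sum_3 power2_eq_square algebra_simps)
 finally have det: "det (matrix DT) > 0" using f1 a0 s(1) by simp
 have injT: "inj T" using det det_nz_iff_inj[OF linDT] unfolding T_def inj_def by simp
 have inS: "T y : ?S" if y: "y : cube 3" for y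
 proof -
  have yb: "\<bar>y $ 1\<bar> <= 3" "\<bar>y $ 2\<bar> <= 3" "\<bar>y $ 3\<bar> <= 3" using y unfolding mem_cube by simp_all
  have nb: "norm (y $ 1 *\<^sub>R f1 + y $ 2 *\<^sub>R f2 + y $ 3 *\<^sub>R a) <= 3 * norm f1 + 3 * norm f2 + 3 * norm a"
   by (intro norm_triangle_le add_mono; simp add: yb mult_right_mono)
  have "norm (DT y) = s * norm (y $ 1 *\<^sub>R f1 + y $ 2 *\<^sub>R f2 + y $ 3 *\<^sub>R a)" unfolding DT_def norm_scaleR using s(1) by simp
  also have "... <= s * (3 * n)" using nb s(1) unfolding n_def by (intro mult_left_mono) simp_all
  finally have "norm (DT y) <= s * (3 * n)" .
  then have "T y : ball x0 rho" using s(2) by (simp add: T_def dist_norm mult.assoc mult.left_commute)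
  then show ?thesis using rho(2) by blast
 qed
 have TV: "T ` cube 3 <= V" using inS by blast
 have detT: "det (matrix (fd T x)) > 0" for x unfolding fT by (rule det)
 obtain c where c: "c : atlas M" "cimage c = cube 3" "!!y. y : cube 3 ==> cinv c y = cinv d (T y)"
  "!!ksi V A. represents ksi d V A ==> T ` cube 3 <= V ==> represents ksi c (cube 3) (cov_pull T A)"
  by (rule chart_pullback[OF D(1) Cinf_on_subset[OF smT open_box subset_UNIV] inj_on_subset[OF injT subset_UNIV] order_trans[OF TV D(2)] detT], rule that)
 show ?thesis
 proof (rule that[OF c(4)[OF R TV]])
  fix x assume x: "x : cube 3"
  have S: "\<bar>A (T x) \<bullet> f1\<bar> + \<bar>A (T x) \<bullet> f2\<bar> < \<bar>A (T x) \<bullet> a\<bar> / 8" using inS[OF x] by simp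
  have "s * (\<bar>A (T x) \<bullet> f1\<bar> + \<bar>A (T x) \<bullet> f2\<bar>) < s * (\<bar>A (T x) \<bullet> a\<bar> / 8)" by (rule mult_strict_left_mono[OF S s(1)])
  then show "\<bar>cov_pull T A x $ 1\<bar> + \<bar>cov_pull T A x $ 2\<bar> < \<bar>cov_pull T A x $ 3\<bar> / 8"
   using s(1) by (simp add: cov_pull_def fT DTa abs_mult algebra_simps)
 next
  have "cinv c 0 = p" using c(3)[of 0] cinv_cmap[OF D(1) q(1)] by (simp add: mem_cube T_def x0_def linear_0[OF linDT])
  moreover have "0 : cube (1 / 2)" unfolding mem_cube by simp
  ultimately show "p : cinv c ` cube (1 / 2)" by (metis imageI)
 qed
qed

lemma overtwisted_cong:
 assumes "smooth_field ksi" "!!p. p : points M ==> ksi' p = ksi p"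
 shows "overtwisted ksi' \<longleftrightarrow> overtwisted ksi"
proof -
 have "contact_at M ksi' p \<longleftrightarrow> contact_at M ksi p" if "p : points M" for p
  by (rule contact_at_local(1)[OF assms(1) openin_topspace that assms(2)])
 then have N: "noncontact ksi' = noncontact ksi" unfolding noncontact_def by auto
 have "overtwisted_disc M ksi' F f \<longleftrightarrow> overtwisted_disc M ksi F f" for F f
 proof (cases "smooth_into M unit_disc f")
  case True
  then have "f x : points M" if "x : sphere 0 1" for x using that unfolding smooth_into_def by fastforce
  then have "ksi' (f x) = ksi (f x)" if "x : sphere 0 1" for x using assms(2) that by blast
  then show ?thesis unfolding overtwisted_disc_def by (auto simp del: mem_sphere_0)
 qed (simp add: overtwisted_disc_def)
 then show ?thesis unfolding overtwisted_def N by blast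
qed

text \<open>The consequence of Gray stability that matters here. Finitely many small cubes cover
  \<open>M\<close>; the family is made constant on them one after another, each step preserving
  overtwistedness for every small parameter and respecting the cubes already treated. The final
  family is constant on all of \<open>M\<close>.\<close>

lemma contact_family_constant:
 assumes cf: "contact_family zeta"
 shows "equivalent zeta (%_. zeta 0)"
proof -
 have sf0: "smooth_field (zeta 0)"
  using smooth_family_smooth_field[of zeta] cf unfolding contact_family_def by (metis abs_zero)
 define G where "G c \<longleftrightarrow> (\<exists>A. represents (zeta 0) c (cube 3) A & (\<forall>x\<in>cube 3. \<bar>A x $ 1\<bar> + \<bar>A x $ 2\<bar> < \<bar>A x $ 3\<bar> / 8))" for c
 have "\<exists>c. G c & p : cinv c ` cube (1 / 2)" if p: "p : points M" for p
  by (rule adapted_chart[OF sf0 p]) (unfold G_def, blast)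
 then obtain c where c: "!!p. p : points M ==> G (c p)" "!!p. p : points M ==> p : cinv (c p) ` cube (1 / 2)" by metis
 have op: "openin (mtop M) (cinv (c p) ` cube (1 / 2))" if p: "p : points M" for p
 proof -
  obtain A where "represents (zeta 0) (c p) (cube 3) A" using c(1)[OF p] unfolding G_def by blast
  note D = representsD[OF this]
  have "cube (1 / 2) <= cube 3" unfolding subset_iff mem_cube by auto
  then have "cube (1 / 2) <= cimage (c p)" using D(2) by (rule subset_trans)
  then show ?thesis by (rule openin_cinv_image[OF D(1) open_box])
 qed
 let ?O = "%p. cinv (c p) ` cube (1 / 2)"
 have "\<exists>\<F>. finite \<F> & \<F> <= ?O ` points M & points M <= \<Union>\<F>"
  by (rule compactinD[OF compact_points[unfolded compact_space_def]]) (use op c(2) in auto)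
 then obtain \<F> where \<F>: "finite \<F>" "\<F> <= ?O ` points M" "points M <= \<Union>\<F>" by blast
 obtain P where P: "P <= points M" "finite P" "\<F> = ?O ` P" using finite_subset_image[OF \<F>(1,2)] by blast
 have "\<exists>zeta' e. contact_family zeta' & equivalent zeta zeta' & zeta' 0 = zeta 0 & e > 0 &
  (\<forall>t p. \<bar>t\<bar> < e --> p : (\<Union>p\<in>P. ?O p) --> zeta' t p = zeta 0 p)" using P(2,1)
 proof (induction P rule: finite_induct)
  case empty
  have "equivalent zeta zeta" unfolding equivalent_def by (intro exI[of _ 1]) simp
  then show ?case using cf by (intro exI[of _ zeta] exI[of _ 1]) simp
 next
  case (insert p P)
  then obtain zeta' e where IH: "contact_family zeta'" "equivalent zeta zeta'" "zeta' 0 = zeta 0" "e > 0"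
   "!!t q. \<bar>t\<bar> < e ==> q : (\<Union>p\<in>P. ?O p) ==> zeta' t q = zeta 0 q" by auto
  obtain A where A: "represents (zeta' 0) (c p) (cube 3) A" "!!x. x : cube 3 ==> \<bar>A x $ 1\<bar> + \<bar>A x $ 2\<bar> < \<bar>A x $ 3\<bar> / 8"
   using c(1)[of p] insert.prems unfolding G_def IH(3) by blast
  obtain zeta'' e' where S: "contact_family zeta''" "equivalent zeta' zeta''" "zeta'' 0 = zeta' 0" "e' > 0"
   "!!t p. \<bar>t\<bar> < e' ==> zeta' t p = zeta' 0 p ==> zeta'' t p = zeta' 0 p"
   "!!t q. \<bar>t\<bar> < e' ==> q : cinv (c p) ` ccube (1 / 2) ==> zeta'' t q = zeta' 0 q"
   by (rule homotopy_chart_step[OF IH(1) A]; (assumption | rule that))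
  have sub: "?O p <= cinv (c p) ` ccube (1 / 2)" by (rule image_mono[OF box_subset_cbox])
  have new: "zeta'' t q = zeta 0 q" if t: "\<bar>t\<bar> < min e e'" and q: "q : (\<Union>p\<in>insert p P. ?O p)" for t q
  proof -
   have t': "\<bar>t\<bar> < e" "\<bar>t\<bar> < e'" using t by simp_all
   have "q : ?O p \<or> q : (\<Union>p\<in>P. ?O p)" using q by blast
   then show ?thesis
   proof
    assume "q : ?O p"
    from S(6)[OF t'(2) subsetD[OF sub this]] show ?thesis unfolding IH(3) .
   next
    assume "q : (\<Union>p\<in>P. ?O p)"
    from IH(5)[OF t'(1) this] have "zeta' t q = zeta' 0 q" unfolding IH(3) .
    from S(5)[OF t'(2) this] show ?thesis unfolding IH(3) .
   qed
  qed
  show ?case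
  proof (intro exI conjI allI impI)
   show "contact_family zeta''" by (rule S(1))
   show "equivalent zeta zeta''" by (rule equivalent_trans[OF IH(2) S(2)])
   show "zeta'' 0 = zeta 0" using S(3) IH(3) by (rule trans)
   show "min e e' > 0" using IH(4) S(4) by simp
  qed (rule new)
 qed
 then obtain zeta' e where Z: "equivalent zeta zeta'" "e > 0" and Z':
  "\<forall>t p. \<bar>t\<bar> < e --> p : (\<Union>p\<in>P. ?O p) --> zeta' t p = zeta 0 p" by (elim exE conjE) (rule that)
 have cov: "points M <= (\<Union>p\<in>P. ?O p)" using \<F>(3) unfolding P(3) .
 have "overtwisted (zeta' t) \<longleftrightarrow> overtwisted (zeta 0)" if t: "\<bar>t\<bar> < e" for t
  by (rule overtwisted_cong[OF sf0], rule Z'[rule_format, OF t], erule subsetD[OF cov])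
 then have "equivalent zeta' (%_. zeta 0)" unfolding equivalent_def by (intro exI[of _ e]) (simp add: Z(2))
 then show ?thesis by (rule equivalent_trans[OF Z(1)])
qed

section \<open>Local constancy along a deformation\<close>

text \<open>On the closed interval the defining forms are smooth through local extensions. Composing
  with a smooth \<open>tau\<close> that maps a neighbourhood of 0 into \<open>[a, b]\<close> gives a
  family smooth in an open sense, and its values are planes of the deformation itself, not of an
  extension.\<close>

lemma smooth_family_of_deformation:
 assumes fam: "smooth_plane_field_family M a b ksi" and s: "s : {a..b}"
  and tau: "Cinf_on UNIV tau" "tau 0 = s" "e0 > 0" "!!t. \<bar>t\<bar> < e0 ==> tau t : {a..b}"
 shows "smooth_family (%t. ksi (tau t))"
 unfolding smooth_family_def
proof
 fix p assume p: "p : points M"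
 have "\<exists>c W al dl. p : W & dl > 0 & (\<forall>t\<in>{a..b} Int ball s dl. local_form M (ksi t) c W (al t)) &
   (\<forall>v. smooth_on (({a..b} Int ball s dl) \<times> cmap c ` W) (%(t, x). al t x v))"
  by (rule bspec[OF bspec[OF fam[unfolded smooth_plane_field_family_def] s] p])
 then obtain c W al dl where W: "p : W" "dl > 0" and lf: "\<forall>t\<in>{a..b} Int ball s dl. local_form M (ksi t) c W (al t)"
  and so: "\<forall>v. smooth_on (({a..b} Int ball s dl) \<times> cmap c ` W) (%(t, x). al t x v)"
  by (elim exE conjE) (rule that)
 have sdl: "s : {a..b} Int ball s dl" using s W(2) by simp
 let ?S = "({a..b} Int ball s dl) \<times> cmap c ` W"
 have x0: "(s, cmap c p) : ?S" using sdl W(1) by blast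
 define Q where "Q v T g \<longleftrightarrow> (s, cmap c p) : T & Cinf_on T g & (\<forall>y\<in>?S Int T. g y = (%(t, x). al t x v) y)" for v T and g :: "real \<times> (real^3) => real"
 have "\<exists>T g. Q v T g" for v
 proof -
  obtain T g where "(s, cmap c p) : T" "Cinf_on T g" "!!y. y : ?S Int T ==> g y = (%(t, x). al t x v) y"
   by (rule smooth_on_extension[OF spec[OF so, of v] x0], rule that)
  then have "Q v T g" unfolding Q_def by (intro conjI ballI)
  then show ?thesis by blast
 qed
 then obtain T g where TQ: "!!v. Q v (T v) (g v)" by metis
 have Tg: "(s, cmap c p) : T v" "Cinf_on (T v) (g v)" for v using TQ[of v] unfolding Q_def by blast+
 have Tg3: "g v (t, x) = al t x v" if "(t, x) : ?S" "(t, x) : T v" for v t x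
  using bspec[OF conjunct2[OF conjunct2[OF TQ[of v, unfolded Q_def]]], of "(t, x)"] that by simp
 note R0 = representsD[OF local_form_imp_represents(1)[OF bspec[OF lf sdl]]]
 let ?a = "%i. axis i (1 :: real) :: real^3"
 define Phi where "Phi tx = (tau (fst tx), snd tx)" for tx :: "real \<times> (real^3)"
 have sPhi: "Cinf_on UNIV Phi" unfolding Phi_def by (intro smooth_intros Cinf_on_compose_UNIV[OF tau(1)] open_UNIV)
 define Y where "Y = (T (?a 1) Int T (?a 2) Int T (?a 3)) Int ball s dl \<times> cmap c ` W"
 have oY: "open Y" unfolding Y_def by (intro open_Int open_Times open_ball R0(4) Cinf_on_open[OF Tg(2)])
 define V where "V = Phi -` Y Int ball 0 e0 \<times> UNIV"
 have oV: "open V" unfolding V_def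
  by (intro open_Int open_Times open_UNIV open_ball open_vimage oY Cinf_on_continuous[OF sPhi])
 define A where "A tx = vec3 (g (?a 1) (Phi tx)) (g (?a 2) (Phi tx)) (g (?a 3) (Phi tx))" for tx
 have VT: "Phi ` V <= T (?a 1)" "Phi ` V <= T (?a 2)" "Phi ` V <= T (?a 3)" unfolding V_def Y_def by auto
 have "fam_rep (%t. ksi (tau t)) c V A" unfolding fam_rep_def
 proof (intro conjI allI impI)
  show "c : atlas M" by (rule R0(1))
  show "Cinf_on V A" unfolding A_def
   by (intro smooth_intros oV Cinf_on_compose[OF Cinf_on_subset[OF sPhi oV subset_UNIV] Tg(2)] VT)
  fix t x assume tx: "(t, x) : V"
  have t: "tau t : {a..b}" "tau t : ball s dl" "x : cmap c ` W" using tx tau(4)[of t] unfolding V_def Y_def Phi_def by auto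
  have tS: "(tau t, x) : ?S" using t by blast
  have tT: "(tau t, x) : T (?a 1)" "(tau t, x) : T (?a 2)" "(tau t, x) : T (?a 3)" using tx unfolding V_def Y_def Phi_def by auto
  have "A (t, x) = vec3 (al (tau t) x (?a 1)) (al (tau t) x (?a 2)) (al (tau t) x (?a 3))"
   unfolding A_def Phi_def fst_conv snd_conv using Tg3[OF tS tT(1)] Tg3[OF tS tT(2)] Tg3[OF tS tT(3)] by simp
  moreover have I: "tau t : {a..b} Int ball s dl" using t by blast
  moreover note Rt = representsD(2,5,6)[OF local_form_imp_represents(1)[OF bspec[OF lf I]]]
  ultimately show "x : cimage c" "A (t, x) ~= 0" "ksi (tau t) (cinv c x) = ker_at (cinv c x) c (A (t, x))"
   using Rt(1) Rt(2,3)[OF t(3)] t(3) by auto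
 qed
 moreover have "W <= cdom c" using bspec[OF lf sdl] unfolding local_form_def by blast
 then have "p : cdom c" using W(1) by blast
 moreover have "(0, cmap c p) : V" using Tg(1) W(1,2) tau(2,3) unfolding V_def Y_def Phi_def by auto
 ultimately show "\<exists>c W A. fam_rep (%t. ksi (tau t)) c W A & p : cdom c & (0, cmap c p) : W" by blast
qed

text \<open>Noses chosen for the single plane field at \<open>s\<close> are applied to the whole
  family. The result is contact at parameter 0, so it is equivalent to a constant family, and
  overtwistedness of the original one is constant near 0.\<close>

lemma overtwisted_locally_constant:
 fixes tau :: "real => real"
 assumes fam: "smooth_plane_field_family M a b ksi" and sig: "!!t. t : {a..b} ==> sigma_confoliation M (ksi t)" and s: "s : {a..b}"
  and tau: "Cinf_on UNIV tau" "tau 0 = s" "e0 > 0" "!!t. \<bar>t\<bar> < e0 ==> tau t : {a..b}"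
 obtains e where "e > 0" "!!t. \<bar>t\<bar> < e ==> overtwisted (ksi (tau t)) \<longleftrightarrow> overtwisted (ksi s)"
proof -
 let ?zeta = "%t. ksi (tau t)"
 have sf: "smooth_family ?zeta" by (rule smooth_family_of_deformation[OF fam s tau])
 have "\<forall>t\<in>{a..b}. \<exists>F. maximal_integral_surface M (ksi t) F" using sig unfolding sigma_confoliation_def by blast
 then obtain F where F: "!!t. t : {a..b} ==> maximal_integral_surface M (ksi t) (F t)" by metis
 have conf: "confoliation M (ksi t)" if "t : {a..b}" for t using sig[OF that] unfolding sigma_confoliation_def by blast
 have ad: "admissible (%t. F (tau t)) ?zeta" unfolding admissible_def
  using sf tau(3) maximal_integral_confoliation[OF conf F] tau(4) by blast
 obtain L where L: "!!n. n : set L ==> nose_chart (ksi s) n" "valid_noses (noncontact (ksi s)) L" "noncontact (ksi s) <= covered L"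
  by (rule covering_noses[OF confoliation_smooth_field[OF conf[OF s]] F[OF s]]; (assumption | rule that))
 have L': "nose_chart (ksi (tau 0)) n" if "n : set L" for n unfolding tau(2) by (rule L(1)[OF that])
 have N0: "noncontact (ksi (tau 0)) <= noncontact (ksi s)" unfolding tau(2) by simp
 obtain zeta' where Z: "admissible (%t. F (tau t)) zeta'" "equivalent ?zeta zeta'" "noncontact (zeta' 0) <= noncontact (ksi s) - covered L"
  using nose_sequence[OF ad L' L(2) N0] by blast
 have "noncontact (zeta' 0) = {}" using Z(3) L(3) by blast
 then have "contact_family zeta'" unfolding contact_family_def noncontact_def using Z(1) unfolding admissible_def by blast
 then have "equivalent ?zeta (%_. zeta' 0)" by (rule equivalent_trans[OF Z(2) contact_family_constant])
 then obtain e where e: "e > 0" "!!t. \<bar>t\<bar> < e ==> overtwisted (ksi (tau t)) \<longleftrightarrow> overtwisted (zeta' 0)"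
  unfolding equivalent_def by blast
 show ?thesis by (rule that[OF e(1)]) (use e(2) e(2)[of 0] e(1) tau(2) in simp)
qed

text \<open>The maximal integral surface is exactly the set of degenerate points, so both notions
  ask the boundary of the disc to avoid the same set.\<close>

lemma tight_iff_not_overtwisted:
 assumes "sigma_confoliation M ksi"
 shows "tight M ksi \<longleftrightarrow> \<not> overtwisted ksi"
proof -
 have c: "confoliation M ksi" and F: "\<exists>F. maximal_integral_surface M ksi F" using assms unfolding sigma_confoliation_def by blast+
 have N: "F = noncontact ksi" if "maximal_integral_surface M ksi F" for F
  by (rule maximal_noncontact[OF that confoliation_smooth_field[OF c], symmetric])
 have "maximal_integral_surface M ksi F \<longleftrightarrow> F = noncontact ksi" for F using F N by metis
 then show ?thesis unfolding tight_def overtwisted_def using assms by simp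
qed

lemma overtwisted_deformation:
 assumes ab: "a < b" and fam: "smooth_plane_field_family M a b ksi" and sig: "!!t. t : {a..b} ==> sigma_confoliation M (ksi t)"
 shows "overtwisted (ksi a) \<longleftrightarrow> overtwisted (ksi b)"
proof (rule connected_local_const[of "{a..b}" a b "%t. overtwisted (ksi t)"])
 show "\<forall>s\<in>{a..b}. \<forall>\<^sub>F t in at s within {a..b}. overtwisted (ksi s) = overtwisted (ksi t)"
 proof
  fix s assume s: "s : {a..b}"
  \<comment> \<open>At an end of the interval, \<open>a + t^2\<close> or \<open>b - t^2\<close>
    folds both sides of 0 into \<open>[a, b]\<close>. Its section \<open>theta\<close> is a square
    root, of which only continuity at the end point is used; at inner points a translation
    does.\<close>
  have "\<exists>tau theta e0. Cinf_on UNIV tau & tau (0 :: real) = s & e0 > 0 & (\<forall>t. \<bar>t\<bar> < e0 --> tau t : {a..b}) &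
   (theta \<longlongrightarrow> (0 :: real)) (at s within {a..b}) & (\<forall>u\<in>{a..b}. tau (theta u) = u)"
  proof -
   have small: "t\<^sup>2 <= b - a" if "\<bar>t\<bar> < min 1 (b - a)" for t
   proof -
    have "\<bar>t\<bar> * \<bar>t\<bar> <= 1 * \<bar>t\<bar>" using that by (intro mult_right_mono) auto
    then show ?thesis using that by (simp add: power2_eq_square)
   qed
   consider "s = a" | "s = b" | "a < s" "s < b" using s by fastforce
   then show ?thesis
   proof cases
    case 1
    have "((%u. sqrt (u - a)) \<longlongrightarrow> sqrt (a - a)) (at a within {a..b})" by (intro tendsto_intros)
    then show ?thesis using 1 small ab
     by (intro exI[of _ "%t. a + t\<^sup>2"] exI[of _ "%u. sqrt (u - a)"] exI[of _ "min 1 (b - a)"])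
      (force intro!: smooth_intros simp: power2_eq_square[symmetric] add.commute[of a] le_diff_eq[symmetric])
   next
    case 2
    have "((%u. sqrt (b - u)) \<longlongrightarrow> sqrt (b - b)) (at b within {a..b})" by (intro tendsto_intros)
    then show ?thesis using 2 small ab
     by (intro exI[of _ "%t. b - t\<^sup>2"] exI[of _ "%u. sqrt (b - u)"] exI[of _ "min 1 (b - a)"])
      (force intro!: smooth_intros simp: power2_eq_square[symmetric])
   next
    case 3
    have "((%u. u - s) \<longlongrightarrow> s - s) (at s within {a..b})" by (intro tendsto_intros)
    then show ?thesis using 3
     by (intro exI[of _ "%t. s + t"] exI[of _ "%u. u - s"] exI[of _ "min (s - a) (b - s)"])
      (auto intro!: smooth_intros simp: abs_less_iff)
   qed
  qed
  then obtain tau theta :: "real => real" and e0 where tau: "Cinf_on UNIV tau" "tau 0 = s" "e0 > 0" "!!t. \<bar>t\<bar> < e0 ==> tau t : {a..b}"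
   and theta: "(theta \<longlongrightarrow> (0 :: real)) (at s within {a..b})" "!!u. u : {a..b} ==> tau (theta u) = u" by blast
  obtain e where e: "e > 0" "!!t. \<bar>t\<bar> < e ==> overtwisted (ksi (tau t)) \<longleftrightarrow> overtwisted (ksi s)"
   by (rule overtwisted_locally_constant[OF fam sig s tau]; (assumption | rule that))
  have "\<forall>\<^sub>F u in at s within {a..b}. dist (theta u) 0 < e" by (rule tendstoD[OF theta(1) e(1)])
  moreover have "\<forall>\<^sub>F u in at s within {a..b}. u : {a..b}" by (simp add: eventually_at_filter)
  ultimately show "\<forall>\<^sub>F t in at s within {a..b}. overtwisted (ksi s) = overtwisted (ksi t)"
  proof eventually_elim
   case (elim u)
   then show ?case using e(2)[of "theta u"] theta(2)[of u] by simp
  qed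
 qed
qed (use ab in auto)

end

theorem theorem1p6:
 fixes M :: "'a manifold3" and \<xi> :: "real => 'a plane_field" and a b :: real
 assumes "closed_oriented_3manifold M"
  and "a < b"
  and "sigma_deformation M a b \<xi>"
 shows "tight M (\<xi> a) \<longleftrightarrow> tight M (\<xi> b)"
proof -
 interpret closed_manifold M by unfold_locales (rule assms(1))
 have fam: "smooth_plane_field_family M a b \<xi>" and \<sigma>: "!!t. t : {a..b} ==> sigma_confoliation M (\<xi> t)"
  using assms(3) unfolding sigma_deformation_def by blast+
 have ab: "a : {a..b}" "b : {a..b}" using assms(2) by simp_all
 show ?thesis
  unfolding tight_iff_not_overtwisted[OF \<sigma>[OF ab(1)]] tight_iff_not_overtwisted[OF \<sigma>[OF ab(2)]]
  using overtwisted_deformation[OF assms(2) fam \<sigma>] by simp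
qed

end
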